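(* Let $s>1$ and let $\Phi(x)=\phi(|x|)$ be an interaction potential with singularity of order $s$, satisfying the assumption on the potential stated in the context. For $\varepsilon>0$ let $\mathcal{L}_\varepsilon$ be the linearized Boltzmann operator associated with $\Phi_\varepsilon=\varepsilon\Phi$. Then for $\psi\in C^3_b(\mathbb{R}^3)$ we have $$\lim_{\varepsilon\to0}\frac{1}{\varepsilon^{2/s}}\,\mathcal{L}_\varepsilon\psi=\mathcal{L}_\infty\psi,$$ where $\mathcal{L}_\infty$ is the (linearized) non-cutoff Boltzmann operator given by $$\mathcal{L}_\infty\psi(v_1)=\int_{\mathbb{R}^3}\int_{S^2}\big(\psi(v_1')+\psi(v_2')-\psi(v_1)-\psi(v_2)\big)M(v_2)\,\tilde B_s(v_1-v_2,\cos\theta)\,d\sigma\,dv_2$$ and $\tilde B_s(v_1-v_2,\cos\theta)$ is the collision kernel of the homogeneous potential $$\Phi_s(x)=\frac{1}{|x|^s}.$$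
   Context: Assumption on the potential (with order $s\ge 0$): $\Phi\in C(\mathbb{R}^3\setminus\{0\})$ is radially symmetric, $\Phi(x)=\phi(|x|)$, with $\phi$ decreasing, and $\phi(r)=f(r)/r^s$ for $0<r\le1$, $\phi(r)=0$ otherwise, where $f\in C^\infty_b(0,1)$ is a decreasing function (smooth on $(0,1)$ with all derivatives bounded) with $f(0)>0$ and $f(1)=0$. Notation: $M(v)=(2\pi)^{-3/2}e^{-|v|^2/2}$. $C^3_b(\mathbb{R}^3)$ is the space of three times continuously differentiable functions with bounded derivatives up to order 3. Linearized Boltzmann operator: $$\mathcal{L}_\varepsilon\psi(v_1)=\int_{\mathbb{R}^3}\int_{S^2_+}\big(\psi(v'_{1,\varepsilon})+\psi(v'_{2,\varepsilon})-\psi(v_1)-\psi(v_2)\big)M(v_2)\,(v_1-v_2)\cdot\nu\,d\nu\,dv_2,$$ with $S^2_+=\{\nu\in S^2:\nu\cdot(v_1-v_2)\ge0\}$. The outgoing velocities $v'_{i,\varepsilon}=\lim_{t\to\infty}V_i(t)$ (whenever the limit exists) come from the scattering problem $$\dot X_i=V_i,\quad \dot V_1=-\nabla\Phi_\varepsilon(X_1-X_2),\quad \dot V_2=-\nabla\Phi_\varepsilon(X_2-X_1),\quad V_i(0)=v_i,\quad X_2(0)-X_1(0)=\nu .$$ In the limit operator, for $\sigma\in S^2$, $v_1'=\frac{v_1+v_2}{2}+\frac{|v_1-v_2|}{2}\sigma$, $v_2'=\frac{v_1+v_2}{2}-\frac{|v_1-v_2|}{2}\sigma$, and $\theta$ is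 the deviation angle, $\cos\theta=\eta\cdot\sigma$ with $\eta=\frac{v_1-v_2}{|v_1-v_2|}$. The collision kernel $\tilde B_s$ of $\Phi_s$ is the rate of collisions with parameter $\sigma$: it is determined by $\tilde B_s(v_1-v_2,\cos\theta)\sin\theta\,|d\theta|=|v_1-v_2|\,\rho\,d\rho$, where $\rho>0$ is the impact parameter and $\theta=\theta(\rho)$ is the scattering angle of $\Phi_s$, $$\theta(\rho)=\pi-2\int_{r_0}^\infty\frac{\rho}{r^2\sqrt{1-\frac{\rho^2}{r^2}-\frac{4}{|v_1-v_2|^2r^s}}}\,dr,$$ with $r_0>0$ the unique zero of the expression under the square root.
   Formalization: The limit is f(0)^{2/s} L_∞ψ instead of L_∞ψ, which is correct only if f(0)=1 (scaling Φ by 2 refutes it otherwise); convergence is pointwise in v_1, and the integral over S^2 in L_∞ is the limit δ→0 of integrals over θ≥δ, as it need not converge absolutely for s≤2. *)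

theory Defs
  imports "HOL-Analysis.Analysis"
begin

text \<open>
  The function \<open>f\<close> is identified with its continuous extension to \<open>[0,1]\<close>, so that \<open>f 0\<close> and
  \<open>f 1\<close> are its boundary values. The value of \<open>\<Phi>\<close> at the origin is irrelevant.
\<close>

definition smooth_bounded_01 :: "(real \<Rightarrow> real) \<Rightarrow> bool" where
  "smooth_bounded_01 f \<longleftrightarrow>
     (\<forall>k. (\<forall>r\<in>{0<..<1}. (deriv ^^ k) f differentiable (at r)) \<and>
          bounded ((deriv ^^ k) f ` {0<..<1}))"

definition singular_potential ::
    "real \<Rightarrow> (real ^ 3 \<Rightarrow> real) \<Rightarrow> (real \<Rightarrow> real) \<Rightarrow> (real \<Rightarrow> real) \<Rightarrow> bool" where
  "singular_potential s \<Phi> \<phi> f \<longleftrightarrow>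
     0 \<le> s \<and>
     continuous_on (- {0}) \<Phi> \<and>
     (\<forall>x. x \<noteq> 0 \<longrightarrow> \<Phi> x = \<phi> (norm x)) \<and>
     antimono_on {0<..} \<phi> \<and>
     (\<forall>r. 0 < r \<and> r \<le> 1 \<longrightarrow> \<phi> r = f r / r powr s) \<and>
     (\<forall>r. 1 < r \<longrightarrow> \<phi> r = 0) \<and>
     smooth_bounded_01 f \<and> continuous_on {0..1} f \<and> antimono_on {0..1} f \<and>
     0 < f 0 \<and> f 1 = 0"

definition C3_bounded :: "(real ^ 3 \<Rightarrow> real) \<Rightarrow> bool" where
  "C3_bounded \<psi> \<longleftrightarrow>
     bounded (range \<psi>) \<and>
     (\<exists>(D1 :: real ^ 3 \<Rightarrow> ((real ^ 3) \<Rightarrow>\<^sub>L real))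
       (D2 :: real ^ 3 \<Rightarrow> ((real ^ 3) \<Rightarrow>\<^sub>L ((real ^ 3) \<Rightarrow>\<^sub>L real)))
       (D3 :: real ^ 3 \<Rightarrow> ((real ^ 3) \<Rightarrow>\<^sub>L ((real ^ 3) \<Rightarrow>\<^sub>L ((real ^ 3) \<Rightarrow>\<^sub>L real)))).
        (\<forall>x. (\<psi> has_derivative blinfun_apply (D1 x)) (at x)) \<and>
        (\<forall>x. (D1 has_derivative blinfun_apply (D2 x)) (at x)) \<and>
        (\<forall>x. (D2 has_derivative blinfun_apply (D3 x)) (at x)) \<and>
        continuous_on UNIV D3 \<and>
        bounded (range D1) \<and> bounded (range D2) \<and> bounded (range D3))"

definition maxwellian :: "real ^ 3 \<Rightarrow> real" where
  "maxwellian v = (2 * pi) powr (- 3 / 2) * exp (- (norm v)\<^sup>2 / 2)"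

text \<open>
  Surface measure on the unit sphere: the measure of a set \<open>A\<close> of unit vectors is three times
  the volume of the cone \<open>{r x. 0 < r < 1, x \<in> A}\<close>. For \<open>x \<noteq> 0\<close>, \<open>sgn x\<close> is \<open>x / |x|\<close>.
\<close>

definition sphere_measure :: "(real ^ 3) measure" where
  "sphere_measure = distr (density lborel (\<lambda>x. 3 * indicator (ball 0 1) x)) borel sgn"

lemma emeasure_sphere_measure_sphere:
  "emeasure sphere_measure (sphere 0 1) = ennreal (4 * pi)"
proof -
  let ?B = "ball (0 :: real ^ 3) 1"
  have vim: "sgn -` sphere (0 :: real ^ 3) 1 = - {0}"
    by (auto simp: norm_sgn)
  have "emeasure sphere_measure (sphere 0 1) =
      emeasure (density lborel (\<lambda>x. 3 * indicator ?B x)) (- {0})"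
    unfolding sphere_measure_def by (subst emeasure_distr) (auto simp: vim)
  also have "\<dots> = (\<integral>\<^sup>+x. 3 * indicator ?B x * indicator (- {0}) x \<partial>lborel)"
    by (rule emeasure_density) (auto intro!: borel_measurable_times_ennreal borel_measurable_indicator)
  also have "\<dots> = (\<integral>\<^sup>+x. 3 * indicator (?B - {0}) x \<partial>lborel)"
    by (intro nn_integral_cong) (auto split: split_indicator)
  also have "\<dots> = 3 * emeasure lborel (?B - {0})"
    by (subst nn_integral_cmult_indicator) auto
  also have "emeasure lborel (?B - {0}) = emeasure lborel ?B"
    by (subst emeasure_Diff) auto
  also have "\<dots> = ennreal (4 / 3 * pi)"
    using emeasure_ball[of 1 "0 :: real ^ 3"] by (simp add: unit_ball_vol_3)
  also have "3 * ennreal (4 / 3 * pi) = ennreal (4 * pi)"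
    by (simp flip: ennreal_numeral ennreal_mult)
  finally show ?thesis .
qed

text \<open>
  The gradient of \<open>\<Phi>\<close> may jump across the sphere \<open>|x| = 1\<close>, on which the scattering trajectories
  start and which they cross on exit. Velocities are therefore continuous, and Newton's equations
  are required at all but finitely many times.
\<close>

definition scattering_solution ::
    "(real ^ 3 \<Rightarrow> real) \<Rightarrow> real ^ 3 \<Rightarrow> real ^ 3 \<Rightarrow> real ^ 3 \<Rightarrow>
     (real \<Rightarrow> real ^ 3) \<Rightarrow> (real \<Rightarrow> real ^ 3) \<Rightarrow> (real \<Rightarrow> real ^ 3) \<Rightarrow> (real \<Rightarrow> real ^ 3) \<Rightarrow> bool" where
  "scattering_solution \<Phi> v1 v2 \<nu> X1 X2 V1 V2 \<longleftrightarrow>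
     V1 0 = v1 \<and> V2 0 = v2 \<and> X2 0 - X1 0 = \<nu> \<and>
     continuous_on {0..} V1 \<and> continuous_on {0..} V2 \<and>
     (\<forall>t\<ge>0. X1 t \<noteq> X2 t \<and>
        (X1 has_vector_derivative V1 t) (at t within {0..}) \<and>
        (X2 has_vector_derivative V2 t) (at t within {0..})) \<and>
     (\<exists>T. finite T \<and> (\<forall>t\<in>{0<..} - T. \<exists>g1 g2.
        GDERIV \<Phi> (X1 t - X2 t) :> g1 \<and> (V1 has_vector_derivative - g1) (at t) \<and>
        GDERIV \<Phi> (X2 t - X1 t) :> g2 \<and> (V2 has_vector_derivative - g2) (at t)))"

definition outgoing_velocities ::
    "(real ^ 3 \<Rightarrow> real) \<Rightarrow> real ^ 3 \<Rightarrow> real ^ 3 \<Rightarrow> real ^ 3 \<Rightarrow> (real ^ 3) \<times> (real ^ 3)" where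
  "outgoing_velocities \<Phi> v1 v2 \<nu> =
     (THE u. \<exists>X1 X2 V1 V2. scattering_solution \<Phi> v1 v2 \<nu> X1 X2 V1 V2 \<and>
        (V1 \<longlongrightarrow> fst u) at_top \<and> (V2 \<longlongrightarrow> snd u) at_top)"

definition linearized_boltzmann ::
    "(real ^ 3 \<Rightarrow> real) \<Rightarrow> (real ^ 3 \<Rightarrow> real) \<Rightarrow> real ^ 3 \<Rightarrow> real" where
  "linearized_boltzmann \<Phi> \<psi> v1 =
     (LINT v2|lborel. (LINT \<nu>:{\<nu> \<in> sphere 0 1. 0 \<le> \<nu> \<bullet> (v1 - v2)}|sphere_measure.
        (\<psi> (fst (outgoing_velocities \<Phi> v1 v2 \<nu>)) + \<psi> (snd (outgoing_velocities \<Phi> v1 v2 \<nu>))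
           - \<psi> v1 - \<psi> v2) * maxwellian v2 * ((v1 - v2) \<bullet> \<nu>)))"

text \<open>
  Scattering by \<open>1 / |x| powr s\<close>, for relative velocity of modulus \<open>w\<close> and impact parameter \<open>\<rho>\<close>.
\<close>

definition radial_expr :: "real \<Rightarrow> real \<Rightarrow> real \<Rightarrow> real \<Rightarrow> real" where
  "radial_expr s w \<rho> r = 1 - \<rho>\<^sup>2 / r\<^sup>2 - 4 / (w\<^sup>2 * r powr s)"

definition closest_distance :: "real \<Rightarrow> real \<Rightarrow> real \<Rightarrow> real" where
  "closest_distance s w \<rho> = (THE r. 0 < r \<and> radial_expr s w \<rho> r = 0)"

definition scattering_angle :: "real \<Rightarrow> real \<Rightarrow> real \<Rightarrow> real" where
  "scattering_angle s w \<rho> =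
     pi - 2 * (LBINT r:{closest_distance s w \<rho>..}. \<rho> / (r\<^sup>2 * sqrt (radial_expr s w \<rho> r)))"

text \<open>
  For \<open>w > 0\<close>, \<open>scattering_angle s w\<close> is a strictly decreasing bijection from \<open>(0, \<infinity>)\<close> onto
  \<open>(0, pi)\<close>; \<open>impact_parameter s w\<close> is its inverse. The kernel solves
  \<open>B(z, cos \<theta>) sin \<theta> |d\<theta>| = |z| \<rho> d\<rho>\<close> for \<open>B\<close>.
\<close>

definition impact_parameter :: "real \<Rightarrow> real \<Rightarrow> real \<Rightarrow> real" where
  "impact_parameter s w \<theta> = (THE \<rho>. 0 < \<rho> \<and> scattering_angle s w \<rho> = \<theta>)"

definition collision_kernel :: "real \<Rightarrow> real ^ 3 \<Rightarrow> real \<Rightarrow> real" where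
  "collision_kernel s z c =
     (let \<theta> = arccos c; \<rho> = impact_parameter s (norm z)
      in norm z * \<rho> \<theta> * \<bar>deriv \<rho> \<theta>\<bar> / sin \<theta>)"

text \<open>
  The kernel has a non-integrable singularity at \<open>\<theta> = 0\<close>, and for \<open>s \<le> 2\<close> the integrand below is
  in general not absolutely integrable over the sphere: the first-order term in \<open>\<theta>\<close> cancels only
  after integration over the azimuth. The integral over the sphere is therefore the limit, as
  \<open>\<delta>\<close> tends to 0, of the integrals over the deviation angles \<open>\<theta> \<ge> \<delta>\<close>; it agrees with the
  Lebesgue integral whenever the latter exists.
\<close>

definition noncutoff_boltzmann ::
    "real \<Rightarrow> (real ^ 3 \<Rightarrow> real) \<Rightarrow> real ^ 3 \<Rightarrow> real" where
  "noncutoff_boltzmann s \<psi> v1 =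
     (LINT v2|lborel.
        (let \<eta> = (v1 - v2) /\<^sub>R norm (v1 - v2);
             v1' = (\<lambda>\<sigma>. (v1 + v2) /\<^sub>R 2 + (norm (v1 - v2) / 2) *\<^sub>R \<sigma>);
             v2' = (\<lambda>\<sigma>. (v1 + v2) /\<^sub>R 2 - (norm (v1 - v2) / 2) *\<^sub>R \<sigma>)
         in Lim (at_right 0) (\<lambda>\<delta>. LINT \<sigma>:{\<sigma> \<in> sphere 0 1. \<eta> \<bullet> \<sigma> \<le> cos \<delta>}|sphere_measure.
              (\<psi> (v1' \<sigma>) + \<psi> (v2' \<sigma>) - \<psi> v1 - \<psi> v2) * maxwellian v2
                * collision_kernel s (v1 - v2) (\<eta> \<bullet> \<sigma>))))"

end

theory Submission imports Defs begin

text \<open>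
  The relative velocity moves in a central repulsive potential. Conservation of energy and of angular
  momentum show that a trajectory leaves the unit ball, with its relative velocity turned by the
  deflection angle \<open>\<theta>\<close> of the effective potential \<open>4 \<epsilon> \<phi> / w\<^sup>2\<close>, where \<open>w\<close> is the relative speed and \<open>\<rho>\<close>
  the impact parameter. Both operators thus become integrals over \<open>v2\<close> and \<open>\<rho>\<close>, with respect to
  \<open>\<rho> d\<rho>\<close>, of one function of the deflection angle: the average of the gain over the azimuth. For
  the non-cutoff operator this uses the change of variables \<open>\<theta> \<leftrightarrow> \<rho>\<close>.

  Rescaling \<open>\<rho>\<close> by \<open>\<epsilon> powr (1 / s)\<close> produces the factor \<open>\<epsilon> powr (2 / s)\<close>, and the rescaled potentials
  \<open>\<epsilon> \<phi> (\<epsilon> powr (1 / s) r)\<close> converge to \<open>f 0 / r powr s\<close>; the deflection angles converge with them.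
  The limit is taken by dominated convergence: the azimuthal average is bounded, and bounded by a
  multiple of \<open>(w + w\<^sup>2) \<theta>\<^sup>2\<close> since its first order terms cancel, while \<open>\<theta>\<close> is at most of order
  \<open>\<rho> powr - s / w\<^sup>2\<close>. So the integrand is dominated by a multiple of \<open>\<rho> powr (1 - 2 s)\<close> for large \<open>\<rho>\<close>, which is
  integrable because \<open>s > 1\<close>, and the remaining singularity \<open>1 / w\<^sup>2\<close> is integrable in \<open>v2\<close>.
\<close>

text \<open>\<open>outgoing_velocities\<close> is a definite description over all solutions, so
  existence and uniqueness of trajectories are both needed, for a force that may jump on the very
  sphere where they start. Both rest on conserved quantities instead of a general theory of
  differential equations: a solution inside the ball is compared with an explicit orbit, and the
  difference of the directions has constant norm. The explicit formula also supplies the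
  measurability that the description does not give by itself.

  The bound on \<theta> has to be uniform in \<epsilon>. A bound on the size of \<phi> is not enough
  for it: the half angle depends on differences of potential values near the apsis, so these are
  compared with differences of \<open>r powr - s\<close>, at the price of a bound on the derivative
  of \<open>f\<close>.

  The azimuth is integrated while the truncation \<delta> is still positive, where Fubini's theorem
  applies; only then does \<delta> tend to 0.

  The 4 in \<open>4 * \<phi> / w\<^sup>2\<close>: both particles are accelerated, so the relative
  acceleration is twice the force and the conserved energy is
  \<open>V \<bullet> V + 4 * \<phi>\<close>.\<close>

lemma constant_if_derivative_zero:
  fixes f :: "real \<Rightarrow> 'a::banach"
  assumes "finite T" "continuous_on {a..b} f"
    and "\<And>t. t \<in> {a<..<b} - T \<Longrightarrow> (f has_vector_derivative 0) (at t)"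
    and "x \<in> {a..b}"
  shows "f x = f a"
proof -
  have "continuous_on {a..x} f"
    by (rule continuous_on_subset[OF assms(2)]) (use assms in auto)
  then have "((\<lambda>_. 0) has_integral (f x - f a)) {a..x}"
    by (intro fundamental_theorem_of_calculus_interior_strong[OF assms(1)])
      (use assms in auto)
  then show ?thesis
    using has_integral_0 has_integral_unique by fastforce
qed

text \<open>A mean value inequality that tolerates finitely many times without a derivative. It
  makes the radial velocity of a solution grow at a fixed rate, and it also yields the Lipschitz
  bound for \<open>f\<close>.\<close>

lemma increase_ge:
  fixes f f' :: "real \<Rightarrow> real"
  assumes "finite T" "continuous_on {a..b} f" "a \<le> b"
    and "\<And>t. t \<in> {a<..<b} - T \<Longrightarrow> (f has_real_derivative f' t) (at t)"
    and "\<And>t. t \<in> {a<..<b} - T \<Longrightarrow> m \<le> f' t"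
  shows "m * (b - a) \<le> f b - f a"
proof -
  define g where "g t = (if t \<in> {a<..<b} - T then f' t else m)" for t
  have "(g has_integral (f b - f a)) {a..b}"
    by (rule fundamental_theorem_of_calculus_interior_strong[OF assms(1)])
      (use assms in \<open>auto simp: g_def has_real_derivative_iff_has_vector_derivative\<close>)
  moreover have "((\<lambda>_. m) has_integral (b - a) *\<^sub>R m) {a..b}"
    using has_integral_const[of m a b] assms(3) by simp
  ultimately have "(b - a) *\<^sub>R m \<le> f b - f a"
    using assms(5) by (auto intro: has_integral_le simp: g_def)
  then show ?thesis by (simp add: mult.commute)
qed

text \<open>As \<open>f'\<close> is continuous, \<open>f\<close> is its integral, which recovers the
  derivative at the exceptional times and, one-sidedly, at 0. The constructed motion needs this at
  its exit time, where the acceleration may jump.\<close>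

lemma has_vector_derivative_half_line:
  fixes f f' :: "real \<Rightarrow> 'a::euclidean_space"
  assumes "finite T" "continuous_on {0..} f" "continuous_on {0..} f'"
    and der: "\<And>t. t \<in> {0<..} - T \<Longrightarrow> (f has_vector_derivative f' t) (at t)"
    and "0 \<le> t"
  shows "(f has_vector_derivative f' t) (at t within {0..})"
proof -
  have int: "f u = f 0 + integral {0..u} f'" if "0 \<le> u" for u
  proof -
    have "continuous_on {0..u} f"
      by (rule continuous_on_subset[OF assms(2)]) (use that in auto)
    then have "(f' has_integral (f u - f 0)) {0..u}"
      by (intro fundamental_theorem_of_calculus_interior_strong[OF assms(1)])
        (use assms that in auto)
    then show ?thesis by (simp add: integral_unique)
  qed
  have "continuous_on {0..t+1} f'"
    using assms(3) by (rule continuous_on_subset) auto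
  from integral_has_vector_derivative[OF this, of t] \<open>0 \<le> t\<close>
  have "((\<lambda>u. integral {0..u} f') has_vector_derivative f' t) (at t within {0..t+1})"
    by auto
  from has_vector_derivative_add[OF has_vector_derivative_const this, of "f 0"]
  have "((\<lambda>u. f 0 + integral {0..u} f') has_vector_derivative f' t) (at t within {0..t+1})"
    by simp
  then have "(f has_vector_derivative f' t) (at t within {0..t+1})"
    by (rule has_vector_derivative_transform_within[where d=1]) (use \<open>0 \<le> t\<close> in \<open>auto simp: int[symmetric]\<close>)
  moreover have "at t within {0..t+1} = at t within {0..}"
  proof (rule at_within_nhd[of _ "{..<t+1}"])
    show "{0..t + 1} \<inter> {..<t + 1} - {t} = {0..} \<inter> {..<t + 1} - {t}"
      using \<open>0 \<le> t\<close> by auto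
  qed auto
  ultimately show ?thesis by simp
qed

section \<open>The deflection angle\<close>

\<comment> \<open>The relative motion in a potential \<open>\<phi>\<close> depends on \<open>\<phi>\<close> and on the speed \<open>w\<close> only through \<open>\<kappa> = 4 \<phi> / w\<^sup>2\<close>.\<close>
definition repulsive :: "(real \<Rightarrow> real) \<Rightarrow> bool" where
  "repulsive \<kappa> \<longleftrightarrow> continuous_on {0<..} \<kappa> \<and> antimono_on {0<..} \<kappa> \<and> (\<kappa> \<longlongrightarrow> 0) at_top"

definition apsis :: "(real \<Rightarrow> real) \<Rightarrow> real \<Rightarrow> real" where
  "apsis \<kappa> \<rho> = (THE r. 0 < r \<and> \<rho>\<^sup>2 / r\<^sup>2 + \<kappa> r = 1)"

\<comment> \<open>In the variable \<open>x = apsis / r\<close> and after eliminating the constant \<open>1\<close> by the equation of the apsis.\<close>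
definition half_angle_integrand :: "(real \<Rightarrow> real) \<Rightarrow> real \<Rightarrow> real \<Rightarrow> real" where
  "half_angle_integrand \<kappa> \<rho> x =
     1 / sqrt (1 - x\<^sup>2 + (\<kappa> (apsis \<kappa> \<rho>) - \<kappa> (apsis \<kappa> \<rho> / x)) * (apsis \<kappa> \<rho>)\<^sup>2 / \<rho>\<^sup>2)"

definition half_angle :: "(real \<Rightarrow> real) \<Rightarrow> real \<Rightarrow> real" where
  "half_angle \<kappa> \<rho> = (LBINT x:{0<..<1}. half_angle_integrand \<kappa> \<rho> x)"

definition deflection :: "(real \<Rightarrow> real) \<Rightarrow> real \<Rightarrow> real" where
  "deflection \<kappa> \<rho> = pi - 2 * half_angle \<kappa> \<rho>"

lemma repulsive_antimono: "repulsive \<kappa> \<Longrightarrow> 0 < r \<Longrightarrow> r \<le> r' \<Longrightarrow> \<kappa> r' \<le> \<kappa> r"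
  by (auto simp: repulsive_def monotone_on_def)

lemma repulsive_nonneg:
  assumes "repulsive \<kappa>" "0 < r"
  shows "0 \<le> \<kappa> r"
proof (rule tendsto_upperbound[of \<kappa> 0 at_top])
  show "\<forall>\<^sub>F x in at_top. \<kappa> x \<le> \<kappa> r"
    using eventually_ge_at_top[of r] by eventually_elim (use assms repulsive_antimono in auto)
qed (use assms in \<open>auto simp: repulsive_def\<close>)

lemma effective_potential_strict_antimono:
  assumes "repulsive \<kappa>" "0 < \<rho>" "0 < r" "r < r'"
  shows "\<rho>\<^sup>2 / r'\<^sup>2 + \<kappa> r' < \<rho>\<^sup>2 / r\<^sup>2 + \<kappa> r"
proof -
  have "\<rho>\<^sup>2 / r'\<^sup>2 < \<rho>\<^sup>2 / r\<^sup>2"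
    using assms by (intro divide_strict_left_mono) (auto simp: power_strict_mono)
  with repulsive_antimono[of \<kappa> r r'] assms show ?thesis by auto
qed

text \<open>At \<open>r = \<rho>\<close> the centrifugal term alone equals 1 and
  \<open>\<kappa>\<close> is non-negative; at infinity both terms vanish. Strict decrease gives
  uniqueness.\<close>

lemma apsis_ex1:
  assumes "repulsive \<kappa>" "0 < \<rho>"
  shows "\<exists>!r. 0 < r \<and> \<rho>\<^sup>2 / r\<^sup>2 + \<kappa> r = 1"
proof -
  let ?U = "\<lambda>r. \<rho>\<^sup>2 / r\<^sup>2 + \<kappa> r"
  have "((\<lambda>r. \<rho>\<^sup>2 / r\<^sup>2 + \<kappa> r) \<longlongrightarrow> 0 + 0) at_top"
    using assms(1) by (intro tendsto_add tendsto_divide_0[where c="\<rho>\<^sup>2"] filterlim_at_top_imp_at_infinity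
        filterlim_pow_at_top filterlim_ident tendsto_const) (auto simp: repulsive_def)
  then have "\<forall>\<^sub>F r in at_top. ?U r < 1"
    by (intro order_tendstoD) auto
  then have "\<forall>\<^sub>F r in at_top. ?U r < 1 \<and> \<rho> \<le> r"
    by (intro eventually_conj eventually_ge_at_top)
  then obtain b where b: "?U b < 1" "\<rho> \<le> b"
    by (auto simp: eventually_at_top_linorder)
  have "\<exists>r\<ge>\<rho>. r \<le> b \<and> ?U r = 1"
  proof (rule IVT2')
    show "?U b \<le> 1" "\<rho> \<le> b" using b by auto
    show "1 \<le> ?U \<rho>" using repulsive_nonneg[OF assms] assms by simp
    show "continuous_on {\<rho>..b} ?U"
    proof (intro continuous_intros)
      show "continuous_on {\<rho>..b} \<kappa>"
        by (rule continuous_on_subset[of "{0<..}"]) (use assms in \<open>auto simp: repulsive_def\<close>)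
    qed (use assms in auto)
  qed
  then obtain r where "0 < r" "?U r = 1" using assms by (metis order_less_le_trans)
  then show ?thesis
    using effective_potential_strict_antimono[OF assms]
    by (metis less_irrefl not_less_iff_gr_or_eq)
qed

lemma
  assumes "repulsive \<kappa>" "0 < \<rho>"
  shows apsis_pos: "0 < apsis \<kappa> \<rho>"
    and apsis_eq: "\<rho>\<^sup>2 / (apsis \<kappa> \<rho>)\<^sup>2 + \<kappa> (apsis \<kappa> \<rho>) = 1"
  using theI'[OF apsis_ex1[OF assms]] by (auto simp: apsis_def)

lemma apsis_eqI:
  assumes "repulsive \<kappa>" "0 < \<rho>" "0 < r" "\<rho>\<^sup>2 / r\<^sup>2 + \<kappa> r = 1"
  shows "apsis \<kappa> \<rho> = r"
  using apsis_ex1[OF assms(1,2)] apsis_pos[OF assms(1,2)] apsis_eq[OF assms(1,2)] assms by blast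

lemma less_apsis_iff:
  assumes "repulsive \<kappa>" "0 < \<rho>" "0 < r"
  shows "r < apsis \<kappa> \<rho> \<longleftrightarrow> 1 < \<rho>\<^sup>2 / r\<^sup>2 + \<kappa> r"
    and "apsis \<kappa> \<rho> < r \<longleftrightarrow> \<rho>\<^sup>2 / r\<^sup>2 + \<kappa> r < 1"
proof -
  note p = apsis_pos[OF assms(1,2)] apsis_eq[OF assms(1,2)]
  note m = effective_potential_strict_antimono[OF assms(1,2)]
  have "r < apsis \<kappa> \<rho> \<Longrightarrow> 1 < \<rho>\<^sup>2 / r\<^sup>2 + \<kappa> r" "apsis \<kappa> \<rho> < r \<Longrightarrow> \<rho>\<^sup>2 / r\<^sup>2 + \<kappa> r < 1"
    using m[of r "apsis \<kappa> \<rho>"] m[of "apsis \<kappa> \<rho>" r] p assms by auto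
  then show "r < apsis \<kappa> \<rho> \<longleftrightarrow> 1 < \<rho>\<^sup>2 / r\<^sup>2 + \<kappa> r"
    "apsis \<kappa> \<rho> < r \<longleftrightarrow> \<rho>\<^sup>2 / r\<^sup>2 + \<kappa> r < 1"
    using p by (cases r "apsis \<kappa> \<rho>" rule: linorder_cases; fastforce)+
qed

lemma apsis_ge: assumes "repulsive \<kappa>" "0 < \<rho>" shows "\<rho> \<le> apsis \<kappa> \<rho>"
proof -
  have "\<not> apsis \<kappa> \<rho> < \<rho>"
    using less_apsis_iff(2)[OF assms assms(2)] repulsive_nonneg[OF assms] assms by simp
  then show ?thesis by simp
qed

lemma has_integral_arcsin:
  assumes "0 \<le> u" "u \<le> 1"
  shows "((\<lambda>x::real. 1 / sqrt (1 - x\<^sup>2)) has_integral arcsin u) {0..u}"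
proof -
  have "((\<lambda>x. 1 / sqrt (1 - x\<^sup>2)) has_integral (arcsin u - arcsin 0)) {0..u}"
  proof (rule fundamental_theorem_of_calculus_interior)
    show "continuous_on {0..u} arcsin"
      by (rule continuous_on_subset[OF continuous_on_arcsin']) (use assms in auto)
    fix x assume "x \<in> {0<..<u}"
    then have "(arcsin has_real_derivative inverse (sqrt (1 - x\<^sup>2))) (at x)"
      using assms by (intro DERIV_arcsin) auto
    then show "(arcsin has_vector_derivative 1 / sqrt (1 - x\<^sup>2)) (at x)"
      by (simp add: has_real_derivative_iff_has_vector_derivative inverse_eq_divide)
  qed (use assms in auto)
  then show ?thesis by simp
qed

text \<open>This is the half angle of free motion. Its integrand dominates all others, because
  repulsion only adds a non-negative term under the root; so one majorant serves for every potential
  and every impact parameter.\<close>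

lemma
  shows set_integrable_arcsin: "set_integrable lborel {0<..<1} (\<lambda>x::real. 1 / sqrt (1 - x\<^sup>2))"
    and set_integral_arcsin: "(LBINT x:{0<..<1}. 1 / sqrt (1 - x\<^sup>2)) = pi / 2"
proof -
  have h: "((\<lambda>x::real. 1 / sqrt (1 - x\<^sup>2)) has_integral pi/2) {0<..<1}"
    using has_integral_arcsin[of 1] by (simp add: has_integral_Icc_iff_Ioo)
  then have "(\<lambda>x::real. 1 / sqrt (1 - x\<^sup>2)) absolutely_integrable_on {0<..<1}"
    by (intro nonnegative_absolutely_integrable_1) (auto simp: abs_square_le_1 power_le_one has_integral_integrable)
  then show i: "set_integrable lborel {0<..<1} (\<lambda>x::real. 1 / sqrt (1 - x\<^sup>2))"
    unfolding set_integrable_def by (subst (asm) integrable_completion) auto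
  from set_borel_integral_eq_integral(2)[OF this] h
  show "(LBINT x:{0<..<1}. 1 / sqrt (1 - x\<^sup>2)) = pi / 2"
    by (simp add: integral_unique)
qed

text \<open>The potential drop of a power law contains \<open>1 - x powr s\<close>. The upper bounds
  make it comparable with the free radicand \<open>1 - x\<^sup>2\<close> up to the singular end
  \<open>x = 1\<close>; the lower bound is used for strong deflection.\<close>

lemma one_minus_powr_bounds:
  fixes x s :: real
  assumes "1 \<le> s" "x \<in> {0<..<1}"
  shows "1 - x \<le> 1 - x powr s" "1 - x powr s \<le> s * (1 - x)" "1 - x powr s \<le> s * (1 - x\<^sup>2)"
proof -
  have "x powr s \<le> x powr 1" using assms by (intro powr_mono') auto
  then show "1 - x \<le> 1 - x powr s" using assms by simp
  \<comment> \<open>Young's inequality with weights \<open>1 / s\<close> and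
    \<open>1 - 1 / s\<close>, applied to \<open>x powr s\<close> and 1, is Bernoulli's inequality
    for the exponent \<open>s\<close>.\<close>
  have "(x powr s) powr (1 / s) * 1 powr (1 - 1 / s) \<le> 1 / s * x powr s + (1 - 1 / s) * 1"
    using assms by (intro Youngs_inequality_0) auto
  then have "x \<le> x powr s / s + 1 - 1 / s"
    using assms by (simp add: powr_powr)
  then have "s * x \<le> s * (x powr s / s + 1 - 1 / s)"
    using assms(1) by (intro mult_left_mono) auto
  also have "\<dots> = x powr s + s - 1"
    using assms(1) by (simp add: distrib_left right_diff_distrib)
  finally show *: "1 - x powr s \<le> s * (1 - x)" by (simp add: algebra_simps)
  also have "s * (1 - x) \<le> s * (1 - x\<^sup>2)"
    using assms by (intro mult_left_mono) (auto simp: power2_eq_square mult_left_le_one_le)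
  finally show "1 - x powr s \<le> s * (1 - x\<^sup>2)" .
qed

section \<open>Bounds for the half angle and the deflection\<close>

context
  fixes \<kappa> :: "real \<Rightarrow> real" and \<rho> :: real
  assumes rep: "repulsive \<kappa>" and \<rho>: "0 < \<rho>"
begin

lemma potential_drop_nonneg:
  assumes "x \<in> {0<..<1}"
  shows "0 \<le> (\<kappa> (apsis \<kappa> \<rho>) - \<kappa> (apsis \<kappa> \<rho> / x)) * (apsis \<kappa> \<rho>)\<^sup>2 / \<rho>\<^sup>2"
proof -
  have "apsis \<kappa> \<rho> \<le> apsis \<kappa> \<rho> / x"
    using assms apsis_pos[OF rep \<rho>] by (simp add: field_simps mult_left_le_one_le)
  then have "\<kappa> (apsis \<kappa> \<rho> / x) \<le> \<kappa> (apsis \<kappa> \<rho>)"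
    by (intro repulsive_antimono[OF rep] apsis_pos[OF rep \<rho>])
  then show ?thesis by simp
qed

lemma half_angle_integrand_bounds:
  assumes "x \<in> {0<..<1}"
  shows "0 \<le> half_angle_integrand \<kappa> \<rho> x" "half_angle_integrand \<kappa> \<rho> x \<le> 1 / sqrt (1 - x\<^sup>2)"
proof -
  have x: "0 < 1 - x\<^sup>2" using assms by (simp add: power_less_one_iff abs_square_less_1)
  note d = potential_drop_nonneg[OF assms]
  show "0 \<le> half_angle_integrand \<kappa> \<rho> x"
    using x d by (simp add: half_angle_integrand_def)
  show "half_angle_integrand \<kappa> \<rho> x \<le> 1 / sqrt (1 - x\<^sup>2)"
    unfolding half_angle_integrand_def using x d
    by (intro divide_left_mono real_sqrt_le_mono mult_pos_pos real_sqrt_gt_zero) auto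
qed

lemma half_angle_integrand_measurable:
  "(\<lambda>x. indicator {0<..<1} x *\<^sub>R half_angle_integrand \<kappa> \<rho> x) \<in> borel_measurable lborel"
proof -
  have "continuous_on {0<..<1} (\<lambda>x. \<kappa> (apsis \<kappa> \<rho> / x))"
    by (rule continuous_on_compose2[of "{0<..}" \<kappa>])
      (use rep apsis_pos[OF rep \<rho>] in \<open>auto simp: repulsive_def intro!: continuous_intros\<close>)
  moreover have "0 < 1 - x\<^sup>2 + (\<kappa> (apsis \<kappa> \<rho>) - \<kappa> (apsis \<kappa> \<rho> / x)) * (apsis \<kappa> \<rho>)\<^sup>2 / \<rho>\<^sup>2"
    if "x \<in> {0<..<1}" for x
    using potential_drop_nonneg[OF that] that
    by (intro add_pos_nonneg) (simp add: power_less_one_iff abs_square_less_1)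
  ultimately have "continuous_on {0<..<1} (half_angle_integrand \<kappa> \<rho>)"
    unfolding half_angle_integrand_def
    using \<rho> by (intro continuous_intros) (auto simp: less_le)
  then show ?thesis
    using borel_measurable_continuous_on_indicator[of "{0<..<1}" "half_angle_integrand \<kappa> \<rho>"] by simp
qed

lemma set_integrable_half_angle:
  "set_integrable lborel {0<..<1} (half_angle_integrand \<kappa> \<rho>)"
  unfolding set_integrable_def
proof (rule Bochner_Integration.integrable_bound)
  show "integrable lborel (\<lambda>x::real. indicator {0<..<1} x *\<^sub>R (1 / sqrt (1 - x\<^sup>2)))"
    using set_integrable_arcsin by (simp add: set_integrable_def)
  show "AE x in lborel. norm (indicator {0<..<1} x *\<^sub>R half_angle_integrand \<kappa> \<rho> x)
      \<le> norm (indicator {0<..<1} x *\<^sub>R (1 / sqrt (1 - x\<^sup>2)))"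
    using order_trans[OF half_angle_integrand_bounds] half_angle_integrand_bounds(1)
    by (intro AE_I2) (auto simp: indicator_def half_angle_integrand_bounds)
qed (rule half_angle_integrand_measurable)

lemma half_angle_nonneg: "0 \<le> half_angle \<kappa> \<rho>"
  unfolding half_angle_def set_lebesgue_integral_def
  by (intro Bochner_Integration.integral_nonneg) (auto simp: indicator_def half_angle_integrand_bounds)

lemma half_angle_le: "half_angle \<kappa> \<rho> \<le> pi / 2"
  unfolding half_angle_def set_integral_arcsin[symmetric]
  by (intro set_integral_mono set_integrable_half_angle set_integrable_arcsin)
    (auto intro!: half_angle_integrand_bounds)

lemma deflection_bounds: "0 \<le> deflection \<kappa> \<rho>" "deflection \<kappa> \<rho> \<le> pi"
  using half_angle_le half_angle_nonneg by (auto simp: deflection_def)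

text \<open>The bound on drops enlarges the free radicand by at most a constant factor
  \<open>1 + \<gamma>\<close>, so the half angle is at least
  \<open>pi / 2 / sqrt (1 + \<gamma>)\<close> and the deflection at most
  \<open>pi * \<gamma> / 2\<close>. It remains to replace the apsis in \<open>\<gamma>\<close> by
  the impact parameter.\<close>

lemma deflection_le:
  assumes "1 \<le> s" "\<And>r. 0 < r \<Longrightarrow> \<kappa> r \<le> B * r powr - s"
    and drop: "\<And>r r'. 0 < r \<Longrightarrow> r \<le> r' \<Longrightarrow> \<kappa> r - \<kappa> r' \<le> B * (r powr - s - r' powr - s)"
  shows "deflection \<kappa> \<rho> \<le> 2 * pi * s * B * \<rho> powr - s"
proof -
  define r where "r = apsis \<kappa> \<rho>"
  have r: "0 < r" "\<rho> \<le> r" and req: "\<rho>\<^sup>2 / r\<^sup>2 + \<kappa> r = 1"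
    using apsis_pos[OF rep \<rho>] apsis_ge[OF rep \<rho>] apsis_eq[OF rep \<rho>] by (auto simp: r_def)
  have B: "0 \<le> B"
    using assms(2)[of 1] repulsive_nonneg[OF rep, of 1] by simp
  \<comment> \<open>The drop up to \<open>r / x\<close> is at most
    \<open>B * r powr - s * s * (1 - x\<^sup>2)\<close>; the factor
    \<open>r\<^sup>2 / \<rho>\<^sup>2\<close> is the one in the integrand.\<close>
  define \<gamma> where "\<gamma> = s * B * r powr - s * r\<^sup>2 / \<rho>\<^sup>2"
  have \<gamma>: "0 \<le> \<gamma>" using B assms(1) by (simp add: \<gamma>_def)
  have "1 / sqrt (1 + \<gamma>) * (1 / sqrt (1 - x\<^sup>2)) \<le> half_angle_integrand \<kappa> \<rho> x" if x: "x \<in> {0<..<1}" for x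
  proof -
    have x2: "0 < 1 - x\<^sup>2" using x by (simp add: power_less_one_iff abs_square_less_1)
    have "r \<le> r / x" using x r by (simp add: field_simps mult_left_le_one_le)
    from drop[OF r(1) this]
    have "\<kappa> r - \<kappa> (r / x) \<le> B * r powr - s * (1 - x powr s)"
      using x r by (simp add: powr_divide powr_minus field_simps)
    also have "1 - x powr s \<le> s * (1 - x\<^sup>2)" by (rule one_minus_powr_bounds(3)[OF assms(1) x])
    finally have "\<kappa> r - \<kappa> (r / x) \<le> B * r powr - s * (s * (1 - x\<^sup>2))"
      using B by (simp add: mult_left_mono)
    then have "(\<kappa> r - \<kappa> (r / x)) * r\<^sup>2 / \<rho>\<^sup>2 \<le> B * r powr - s * (s * (1 - x\<^sup>2)) * r\<^sup>2 / \<rho>\<^sup>2"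
      by (intro divide_right_mono mult_right_mono) auto
    also have "\<dots> = \<gamma> * (1 - x\<^sup>2)" by (simp add: \<gamma>_def)
    finally have "1 - x\<^sup>2 + (\<kappa> r - \<kappa> (r / x)) * r\<^sup>2 / \<rho>\<^sup>2 \<le> (1 + \<gamma>) * (1 - x\<^sup>2)"
      by (simp add: algebra_simps)
    moreover have "0 < 1 - x\<^sup>2 + (\<kappa> r - \<kappa> (r / x)) * r\<^sup>2 / \<rho>\<^sup>2"
      using potential_drop_nonneg[OF x] x2 by (simp add: r_def add_pos_nonneg)
    ultimately show ?thesis
      unfolding half_angle_integrand_def r_def[symmetric] using \<gamma> x2
      by (simp add: real_sqrt_mult[symmetric] frac_le)
  qed
  then have "(LBINT x:{0<..<1}. 1 / sqrt (1 + \<gamma>) * (1 / sqrt (1 - x\<^sup>2))) \<le> half_angle \<kappa> \<rho>"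
    unfolding half_angle_def
    by (intro set_integral_mono set_integrable_half_angle set_integrable_mult_right set_integrable_arcsin) auto
  then have "1 / sqrt (1 + \<gamma>) * (pi / 2) \<le> half_angle \<kappa> \<rho>"
    unfolding set_integral_mult_right set_integral_arcsin .
  moreover have "1 - 1 / sqrt (1 + \<gamma>) \<le> \<gamma> / 2"
  proof -
    have "sqrt (1 + \<gamma>) \<le> 1 + \<gamma> / 2"
      using \<gamma> by (intro real_le_lsqrt) (auto simp: power2_eq_square algebra_simps)
    then have "1 / (1 + \<gamma> / 2) \<le> 1 / sqrt (1 + \<gamma>)"
      using \<gamma> by (intro divide_left_mono) auto
    moreover have "1 - \<gamma> / 2 \<le> 1 / (1 + \<gamma> / 2)"
      using \<gamma> by (simp add: field_simps)
    ultimately show ?thesis by linarith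
  qed
  then have "pi * (1 - 1 / sqrt (1 + \<gamma>)) \<le> pi * (\<gamma> / 2)" by (intro mult_left_mono) auto
  moreover have "pi * (1 - 1 / sqrt (1 + \<gamma>)) = pi - 2 * (1 / sqrt (1 + \<gamma>) * (pi / 2))"
    by (simp add: algebra_simps)
  ultimately have d: "deflection \<kappa> \<rho> \<le> pi * \<gamma> / 2"
    unfolding deflection_def by linarith
  have rs: "r powr - s \<le> \<rho> powr - s"
    using r \<rho> assms(1) by (intro powr_mono2') auto
  show ?thesis
  \<comment> \<open>If the centrifugal term at the apsis is at least one half, \<open>r\<close> and
    \<open>\<rho>\<close> are comparable. Otherwise the potential exceeds one half there, so the
    claimed bound is at least \<open>pi\<close> and holds trivially.\<close>
  proof (cases "1 / 2 \<le> \<rho>\<^sup>2 / r\<^sup>2")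
    case True
    then have "r\<^sup>2 / \<rho>\<^sup>2 \<le> 2" using r \<rho> by (simp add: field_simps)
    then have "\<gamma> \<le> s * B * \<rho> powr - s * 2"
      unfolding \<gamma>_def times_divide_eq_right[symmetric] using rs B assms(1)
      by (intro mult_mono mult_left_mono) auto
    then have "pi * \<gamma> \<le> pi * (s * B * \<rho> powr - s * 2)"
      by (intro mult_left_mono) auto
    moreover have "0 \<le> pi * (s * B * \<rho> powr - s)" using B assms(1) by simp
    moreover have "pi * (s * B * \<rho> powr - s * 2) = 2 * (pi * (s * B * \<rho> powr - s))"
      "2 * pi * s * B * \<rho> powr - s = 2 * (pi * (s * B * \<rho> powr - s))" by simp_all
    ultimately show ?thesis using d by linarith
  next
    case False
    then have "1 / 2 \<le> \<kappa> r" using req by linarith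
    also have "\<dots> \<le> B * \<rho> powr - s"
      using assms(2)[OF r(1)] mult_left_mono[OF rs B] by linarith
    also have "\<dots> \<le> s * (B * \<rho> powr - s)"
      using mult_right_mono[OF assms(1), of "B * \<rho> powr - s"] B by simp
    finally have "2 * pi * (1 / 2) \<le> 2 * pi * (s * (B * \<rho> powr - s))"
      by (intro mult_left_mono) auto
    moreover have "2 * pi * (s * (B * \<rho> powr - s)) = 2 * pi * s * B * \<rho> powr - s" by simp
    ultimately show ?thesis using deflection_bounds(2) by linarith
  qed
qed

text \<open>If the potential vanishes at the distance \<open>\<rho>\<close>, then this distance is
  the apsis and the whole path is free. It applies to the impact parameters that miss the
  ball.\<close>

lemma deflection_eq_0:
  assumes "\<kappa> \<rho> = 0"
  shows "deflection \<kappa> \<rho> = 0"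
proof -
  have a: "apsis \<kappa> \<rho> = \<rho>"
    by (rule apsis_eqI) (use rep \<rho> assms in auto)
  have "half_angle_integrand \<kappa> \<rho> x = 1 / sqrt (1 - x\<^sup>2)" if "x \<in> {0<..<1}" for x
  proof -
    have "\<kappa> (\<rho> / x) \<le> 0"
      using repulsive_antimono[OF rep, of \<rho> "\<rho> / x"] that \<rho> assms
      by (simp add: field_simps mult_left_le_one_le)
    moreover have "0 \<le> \<kappa> (\<rho> / x)" by (rule repulsive_nonneg[OF rep]) (use that \<rho> in auto)
    ultimately show ?thesis by (simp add: half_angle_integrand_def a assms)
  qed
  then have "half_angle \<kappa> \<rho> = (LBINT x:{0<..<1}. 1 / sqrt (1 - x\<^sup>2))"
    unfolding half_angle_def by (intro set_lebesgue_integral_cong) auto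
  then show ?thesis by (simp add: deflection_def set_integral_arcsin)
qed

end

text \<open>Whether the apsis lies below or above a fixed radius is decided by comparing the
  effective potential at that radius with 1, so pointwise convergence of the potentials suffices.
  The half angles follow by dominated convergence with the free integrand as majorant.\<close>

lemma
  fixes \<kappa> :: "nat \<Rightarrow> real \<Rightarrow> real"
  assumes rep: "\<And>n. repulsive (\<kappa> n)" "repulsive \<kappa>'" and pos: "\<And>n. 0 < \<rho> n" "0 < \<rho>'"
    and \<rho>: "\<rho> \<longlonglongrightarrow> \<rho>'" and \<kappa>: "\<And>r. 0 < r \<Longrightarrow> (\<lambda>n. \<kappa> n r) \<longlonglongrightarrow> \<kappa>' r"
  shows apsis_tendsto: "(\<lambda>n. apsis (\<kappa> n) (\<rho> n)) \<longlonglongrightarrow> apsis \<kappa>' \<rho>'"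
    and half_angle_tendsto: "(\<lambda>n. half_angle (\<kappa> n) (\<rho> n)) \<longlonglongrightarrow> half_angle \<kappa>' \<rho>'"
proof -
  let ?r = "\<lambda>n. apsis (\<kappa> n) (\<rho> n)" and ?r' = "apsis \<kappa>' \<rho>'"
  have rpos: "0 < ?r n" "0 < ?r'" for n
    using apsis_pos[OF rep(1) pos(1)] apsis_pos[OF rep(2) pos(2)] by auto
  have U: "(\<lambda>n. (\<rho> n)\<^sup>2 / a\<^sup>2 + \<kappa> n a) \<longlonglongrightarrow> \<rho>'\<^sup>2 / a\<^sup>2 + \<kappa>' a" if "0 < a" for a
    using that by (intro tendsto_intros \<rho> \<kappa>) auto
  show r: "?r \<longlonglongrightarrow> ?r'"
  proof (rule order_tendstoI)
    fix a assume a: "a < ?r'"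
    show "\<forall>\<^sub>F n in sequentially. a < ?r n"
    proof (cases "0 < a")
      case True
      then have "1 < \<rho>'\<^sup>2 / a\<^sup>2 + \<kappa>' a" using less_apsis_iff(1)[OF rep(2) pos(2) True] a by simp
      from order_tendstoD(1)[OF U[OF True] this] show ?thesis
        by eventually_elim (use less_apsis_iff(1)[OF rep(1) pos(1) True] in auto)
    next
      case False
      then show ?thesis using rpos(1) by (intro always_eventually) (meson le_less_trans not_less)
    qed
  next
    fix a assume a: "?r' < a"
    then have 0: "0 < a" using rpos by linarith
    then have "\<rho>'\<^sup>2 / a\<^sup>2 + \<kappa>' a < 1" using less_apsis_iff(2)[OF rep(2) pos(2) 0] a by simp
    from order_tendstoD(2)[OF U[OF 0] this] show "\<forall>\<^sub>F n in sequentially. ?r n < a"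
      by eventually_elim (use less_apsis_iff(2)[OF rep(1) pos(1) 0] in auto)
  qed
  \<comment> \<open>The value of the potential at the moving apsis is read off from the apsis
    equation, without any uniformity in \<open>r\<close>.\<close>
  have kr: "(\<lambda>n. \<kappa> n (?r n)) \<longlonglongrightarrow> \<kappa>' ?r'"
  proof -
    have "(\<lambda>n. 1 - (\<rho> n)\<^sup>2 / (?r n)\<^sup>2) \<longlonglongrightarrow> 1 - \<rho>'\<^sup>2 / ?r'\<^sup>2"
      using rpos(2) by (intro tendsto_intros \<rho> r) auto
    moreover have "1 - (\<rho> n)\<^sup>2 / (?r n)\<^sup>2 = \<kappa> n (?r n)" for n
      using apsis_eq[OF rep(1) pos(1), of n n] by simp
    moreover have "1 - \<rho>'\<^sup>2 / ?r'\<^sup>2 = \<kappa>' ?r'"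
      using apsis_eq[OF rep(2) pos(2)] by simp
    ultimately show ?thesis by simp
  qed
  \<comment> \<open>Pointwise convergence of monotone functions to a continuous limit is locally uniform.\<close>
  have krx: "(\<lambda>n. \<kappa> n (?r n / x)) \<longlonglongrightarrow> \<kappa>' (?r' / x)" if x: "x \<in> {0<..<1}" for x
  proof -
    let ?y = "?r' / x"
    have y: "0 < ?y" using rpos x by simp
    have ry: "(\<lambda>n. ?r n / x) \<longlonglongrightarrow> ?y" using x by (intro tendsto_intros r) auto
    have c: "isCont \<kappa>' ?y"
      using rep(2) y by (auto simp: repulsive_def continuous_on_eq_continuous_at)
    show ?thesis
    proof (rule order_tendstoI)
      fix l assume "l < \<kappa>' ?y"
      then have "\<forall>\<^sub>F b in at_right ?y. l < \<kappa>' b"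
        using c by (intro order_tendstoD(1)) (auto simp: isCont_def filterlim_at_split)
      then have "\<forall>\<^sub>F b in at_right ?y. l < \<kappa>' b \<and> ?y < b"
        by (intro eventually_conj eventually_at_right_less)
      from eventually_happens[OF this] obtain b where b: "l < \<kappa>' b" "?y < b" by auto
      then have "0 < b" using y by linarith
      from order_tendstoD(1)[OF \<kappa>[OF this] b(1)] order_tendstoD(2)[OF ry b(2)]
      show "\<forall>\<^sub>F n in sequentially. l < \<kappa> n (?r n / x)"
      proof eventually_elim
        case (elim n)
        have "\<kappa> n b \<le> \<kappa> n (?r n / x)"
          by (rule repulsive_antimono[OF rep(1)]) (use elim rpos(1) x in auto)
        then show ?case using elim by simp
      qed
    next
      fix l assume "\<kappa>' ?y < l"
      then have "\<forall>\<^sub>F b in at_left ?y. \<kappa>' b < l"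
        using c by (intro order_tendstoD(2)) (auto simp: isCont_def filterlim_at_split)
      moreover have "\<forall>\<^sub>F b in at_left ?y. b \<in> {0<..<?y}"
        using y by (rule eventually_at_leftI[rotated]) auto
      ultimately have "\<forall>\<^sub>F b in at_left ?y. \<kappa>' b < l \<and> b \<in> {0<..<?y}"
        by (intro eventually_conj)
      from eventually_happens[OF this] obtain b where b: "\<kappa>' b < l" "b < ?y" "0 < b" by auto
      from order_tendstoD(2)[OF \<kappa>[OF b(3)] b(1)] order_tendstoD(1)[OF ry b(2)]
      show "\<forall>\<^sub>F n in sequentially. \<kappa> n (?r n / x) < l"
      proof eventually_elim
        case (elim n)
        have "\<kappa> n (?r n / x) \<le> \<kappa> n b"
          by (rule repulsive_antimono[OF rep(1)]) (use elim b in auto)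
        then show ?case using elim by simp
      qed
    qed
  qed
  show "(\<lambda>n. half_angle (\<kappa> n) (\<rho> n)) \<longlonglongrightarrow> half_angle \<kappa>' \<rho>'"
    unfolding half_angle_def set_lebesgue_integral_def
  proof (rule integral_dominated_convergence)
    show "integrable lborel (\<lambda>x::real. indicator {0<..<1} x *\<^sub>R (1 / sqrt (1 - x\<^sup>2)))"
      using set_integrable_arcsin by (simp add: set_integrable_def)
    show "AE x in lborel. (\<lambda>n. indicator {0<..<1} x *\<^sub>R half_angle_integrand (\<kappa> n) (\<rho> n) x)
        \<longlonglongrightarrow> indicator {0<..<1} x *\<^sub>R half_angle_integrand \<kappa>' \<rho>' x"
    proof (intro AE_I2)
      fix x :: real
      show "(\<lambda>n. indicator {0<..<1} x *\<^sub>R half_angle_integrand (\<kappa> n) (\<rho> n) x)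
        \<longlonglongrightarrow> indicator {0<..<1} x *\<^sub>R half_angle_integrand \<kappa>' \<rho>' x"
      proof (cases "x \<in> {0<..<1}")
        case True
        have "0 < 1 - x\<^sup>2 + (\<kappa>' ?r' - \<kappa>' (?r' / x)) * ?r'\<^sup>2 / \<rho>'\<^sup>2"
          using potential_drop_nonneg[OF rep(2) pos(2) True] True
          by (intro add_pos_nonneg) (simp add: power_less_one_iff abs_square_less_1)
        then show ?thesis
          unfolding half_angle_integrand_def using pos(2)
          by (intro tendsto_intros kr krx r \<rho> True) auto
      qed simp
    qed
    show "AE x in lborel. norm (indicator {0<..<1} x *\<^sub>R half_angle_integrand (\<kappa> n) (\<rho> n) x)
      \<le> indicator {0<..<1} x *\<^sub>R (1 / sqrt (1 - x\<^sup>2))" for n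
      by (intro AE_I2) (auto simp: indicator_def half_angle_integrand_bounds[OF rep(1) pos(1)])
  qed (use half_angle_integrand_measurable rep pos in auto)
qed

text \<open>With a constant sequence of potentials this is continuity in \<open>\<rho>\<close>; with
  \<open>w\<close> varying, joint measurability follows; with the rescaled potentials it is the
  limit of small \<epsilon>.\<close>

lemma deflection_tendsto:
  fixes \<kappa> :: "nat \<Rightarrow> real \<Rightarrow> real"
  assumes "\<And>n. repulsive (\<kappa> n)" "repulsive \<kappa>'" "\<And>n. 0 < \<rho> n" "0 < \<rho>'"
    and "\<rho> \<longlonglongrightarrow> \<rho>'" "\<And>r. 0 < r \<Longrightarrow> (\<lambda>n. \<kappa> n r) \<longlonglongrightarrow> \<kappa>' r"
  shows "(\<lambda>n. deflection (\<kappa> n) (\<rho> n)) \<longlonglongrightarrow> deflection \<kappa>' \<rho>'"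
  unfolding deflection_def by (intro tendsto_intros half_angle_tendsto assms)

lemma apsis_scale:
  assumes "repulsive \<kappa>" "0 < \<rho>" "0 < l" "repulsive (\<lambda>r. \<kappa> (l * r))"
  shows "apsis \<kappa> (l * \<rho>) = l * apsis (\<lambda>r. \<kappa> (l * r)) \<rho>"
  using apsis_pos[OF assms(4,2)] apsis_eq[OF assms(4,2)] assms
  by (intro apsis_eqI) (auto simp: power_mult_distrib)

text \<open>After the substitution \<open>x = apsis / r\<close> the integrand contains lengths only
  through ratios and through the arguments of \<open>\<kappa>\<close>.\<close>

lemma deflection_scale:
  assumes "repulsive \<kappa>" "0 < \<rho>" "0 < l" "repulsive (\<lambda>r. \<kappa> (l * r))"
  shows "deflection \<kappa> (l * \<rho>) = deflection (\<lambda>r. \<kappa> (l * r)) \<rho>"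
  using assms(3) by (simp add: deflection_def half_angle_def half_angle_integrand_def apsis_scale[OF assms] power_mult_distrib mult.assoc)

section \<open>Motion in the unit ball\<close>

lemma cross_cross_self: "cross3 (cross3 x v) x = (x \<bullet> x) *\<^sub>R v - (x \<bullet> v) *\<^sub>R x"
  unfolding vec_eq_iff forall_3 by (simp add: cross3_simps)

lemma cross_cross_orthogonal: "l \<bullet> x = 0 \<Longrightarrow> cross3 l (cross3 l x) = - (l \<bullet> l) *\<^sub>R x"
proof -
  have "cross3 l (cross3 l x) = (l \<bullet> x) *\<^sub>R l - (l \<bullet> l) *\<^sub>R x"
    unfolding vec_eq_iff forall_3 by (simp add: cross3_simps)
  then show "l \<bullet> x = 0 \<Longrightarrow> ?thesis" by simp
qed

lemma bounded_bilinear_cross3: "bounded_bilinear cross3"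
  using bilinear_cross by (simp add: bilinear_conv_bounded_bilinear)

lemma has_real_derivative_norm:
  fixes X :: "real \<Rightarrow> 'a::real_inner"
  assumes "(X has_vector_derivative V) (at t)" "X t \<noteq> 0"
  shows "((\<lambda>t. norm (X t)) has_real_derivative (X t \<bullet> V) / norm (X t)) (at t)"
proof -
  have "(norm has_derivative (\<lambda>h. h \<bullet> sgn (X t))) (at (X t))"
    using GDERIV_norm[OF assms(2)] by (simp add: gderiv_def)
  from has_derivative_compose[OF assms(1)[unfolded has_vector_derivative_def] this]
  have "((\<lambda>t. norm (X t)) has_derivative (\<lambda>h. (h *\<^sub>R V) \<bullet> sgn (X t))) (at t)" .
  moreover have "(\<lambda>h. (h *\<^sub>R V) \<bullet> sgn (X t)) = (*) ((X t \<bullet> V) / norm (X t))"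
    by (auto simp: sgn_div_norm inner_commute divide_inverse mult_ac)
  ultimately show ?thesis by (simp add: has_field_derivative_def)
qed

lemma has_real_derivative_inner:
  assumes "(X has_vector_derivative X') (at t)" "(Y has_vector_derivative Y') (at t)"
  shows "((\<lambda>t. X t \<bullet> Y t) has_real_derivative X t \<bullet> Y' + X' \<bullet> Y t) (at t)"
  using bounded_bilinear.has_vector_derivative[OF bounded_bilinear_inner assms]
  by (simp add: has_real_derivative_iff_has_vector_derivative)

text \<open>\<open>d\<phi>\<close> is the derivative inside the ball, continued up to
  \<open>r = 1\<close>, where the potential may have a kink. The strict bounds on
  \<open>\<rho>\<close> exclude head-on and grazing collisions: the former have no angular momentum,
  the latter no inward velocity on entry.\<close>

locale scattering =
  fixes \<phi> d\<phi> :: "real \<Rightarrow> real" and w \<rho> :: real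
  assumes continuous: "continuous_on {0<..} \<phi>"
    and deriv: "\<And>r. 0 < r \<Longrightarrow> r < 1 \<Longrightarrow> (\<phi> has_real_derivative d\<phi> r) (at r)"
    and continuous_deriv: "continuous_on {0<..1} d\<phi>"
    and deriv_nonpos: "\<And>r. 0 < r \<Longrightarrow> r \<le> 1 \<Longrightarrow> d\<phi> r \<le> 0"
    and vanish: "\<And>r. 1 \<le> r \<Longrightarrow> \<phi> r = 0"
    and antimono: "antimono_on {0<..} \<phi>"
    and w: "0 < w" and \<rho>: "0 < \<rho>" "\<rho> < 1"
begin

text \<open>
  The orbit is parametrized by the radial velocity \<open>q = X \<bullet> V / (w |X|)\<close>, which increases from
  \<open>- qmax\<close> on entry to \<open>qmax\<close> on exit and, unlike the radius, is regular at the point of closest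
  approach. By conservation of energy the radius is \<open>rad q\<close>, with \<open>U (rad q) + q\<^sup>2 = 1\<close>; further
  \<open>acc q\<close> is the time derivative of \<open>q\<close>, and \<open>ang q\<close> and \<open>tim q\<close> are the polar angle and the time.
\<close>

definition \<kappa> where "\<kappa> r = 4 * \<phi> r / w\<^sup>2"
definition U where "U r = \<rho>\<^sup>2 / r\<^sup>2 + \<kappa> r"
definition dU where "dU r = 4 * d\<phi> r / w\<^sup>2 - 2 * \<rho>\<^sup>2 / r ^ 3"
definition qmax where "qmax = sqrt (1 - \<rho>\<^sup>2)"
definition Uinv where "Uinv y = (THE r. 0 < r \<and> r \<le> 1 \<and> U r = y)"
definition rad where "rad q = Uinv (1 - q\<^sup>2)"
definition acc where "acc q = - (w / 2) * dU (rad q)"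
definition ang where "ang q = integral {-qmax..q} (\<lambda>p. w * \<rho> / (rad p)\<^sup>2 / acc p)"
definition tim where "tim q = integral {-qmax..q} (\<lambda>p. 1 / acc p)"

lemma repulsive: "repulsive \<kappa>"
proof -
  have "(\<kappa> \<longlongrightarrow> 0) at_top"
    by (rule tendsto_eventually, rule eventually_mono[OF eventually_ge_at_top[of 1]])
      (simp add: \<kappa>_def vanish)
  then show ?thesis
    using continuous antimono w unfolding repulsive_def \<kappa>_def
    by (auto simp: monotone_on_def divide_right_mono intro!: continuous_intros)
qed

lemma U_strict_antimono: "0 < r \<Longrightarrow> r < r' \<Longrightarrow> U r' < U r"
  using effective_potential_strict_antimono[OF repulsive \<rho>(1)] by (simp add: U_def)

lemma U_inj: "0 < r \<Longrightarrow> 0 < r' \<Longrightarrow> U r = U r' \<Longrightarrow> r = r'"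
  using U_strict_antimono by (metis less_irrefl not_less_iff_gr_or_eq)

lemma U_1 [simp]: "U 1 = \<rho>\<^sup>2"
  by (simp add: U_def \<kappa>_def vanish)

lemma U_deriv: "0 < r \<Longrightarrow> r < 1 \<Longrightarrow> (U has_real_derivative dU r) (at r)"
  unfolding U_def \<kappa>_def dU_def using w
  by (auto intro!: derivative_eq_intros deriv simp: field_simps power2_eq_square power3_eq_cube)

text \<open>The slope of the potential is non-positive, so the centrifugal term alone gives the
  bound. It keeps \<open>acc\<close> away from 0, also at the turning point.\<close>

lemma dU_le: assumes "0 < r" "r \<le> 1" shows "dU r \<le> - 2 * \<rho>\<^sup>2"
proof -
  have "r ^ 3 \<le> 1" using assms by (simp add: power_le_one)
  then have "2 * \<rho>\<^sup>2 \<le> 2 * \<rho>\<^sup>2 / r ^ 3"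
    using assms by (simp add: le_divide_eq mult_left_le)
  moreover have "4 * d\<phi> r / w\<^sup>2 \<le> 0"
    using deriv_nonpos[OF assms] by (simp add: divide_nonpos_nonneg)
  ultimately show ?thesis by (simp add: dU_def)
qed

lemma continuous_on_U: "continuous_on {0<..} U"
  unfolding U_def \<kappa>_def using continuous w by (intro continuous_intros) auto

text \<open>The number 4 is the centrifugal term at \<open>\<rho> / 2\<close>. Only values up to 1
  occur on the orbit; an upper end above 1 puts the value 1 of the turning point into the interior,
  where the inverse can be differentiated.\<close>

lemma Uinv_ex1:
  assumes "\<rho>\<^sup>2 \<le> y" "y \<le> 4"
  shows "\<exists>!r. 0 < r \<and> r \<le> 1 \<and> U r = y"
proof -
  have "\<exists>r\<ge>\<rho>/2. r \<le> 1 \<and> U r = y"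
  proof (rule IVT2')
    show "continuous_on {\<rho>/2..1} U"
      by (rule continuous_on_subset[OF continuous_on_U]) (use \<rho> in auto)
    show "y \<le> U (\<rho> / 2)"
      using repulsive_nonneg[OF repulsive, of "\<rho>/2"] \<rho> assms by (simp add: U_def power_divide)
  qed (use assms \<rho> in auto)
  then obtain r where r: "0 < r" "r \<le> 1" "U r = y"
    using \<rho> by (metis half_gt_zero order_less_le_trans)
  then show ?thesis using U_inj by blast
qed

lemma Uinv:
  assumes "\<rho>\<^sup>2 \<le> y" "y \<le> 4"
  shows "0 < Uinv y" "Uinv y \<le> 1" "U (Uinv y) = y"
  using theI'[OF Uinv_ex1[OF assms]] by (auto simp: Uinv_def)

lemma Uinv_U: "\<rho>\<^sup>2 \<le> y \<Longrightarrow> y \<le> 4 \<Longrightarrow> 0 < r \<Longrightarrow> U r = y \<Longrightarrow> Uinv y = r"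
  using Uinv U_inj by metis

text \<open>The inverse of a continuous injection on a compact set is continuous. Values of
  \<open>U\<close> up to 4 are taken only at radii \<open>r \<ge> \<rho> / 2\<close>, which supplies
  the compact set.\<close>

lemma continuous_on_Uinv: "continuous_on {\<rho>\<^sup>2..4} Uinv"
proof -
  have U_range: "\<rho>\<^sup>2 \<le> U r" if "0 < r" "r \<le> 1" for r
    using U_strict_antimono[of r 1] that by (cases "r = 1") auto
  let ?S = "{r \<in> {\<rho>/2..1}. U r \<in> {..4}}"
  have c: "continuous_on {\<rho>/2..1} U"
    by (rule continuous_on_subset[OF continuous_on_U]) (use \<rho> in auto)
  have "closed ({\<rho>/2..1} \<inter> U -` {..4})"
    using c by (intro continuous_closed_preimage) auto
  then have "compact ({\<rho>/2..1} \<inter> U -` {..4})"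
    using compact_Int_closed[of "{\<rho>/2..1}" "{\<rho>/2..1} \<inter> U -` {..4}"] by (simp add: Int_absorb1)
  then have "continuous_on (U ` ({\<rho>/2..1} \<inter> U -` {..4})) Uinv"
    by (intro continuous_on_inv continuous_on_subset[OF c]) (use Uinv_U U_range \<rho> in auto)
  moreover have "{\<rho>\<^sup>2..4} \<subseteq> U ` ({\<rho>/2..1} \<inter> U -` {..4})"
  proof
    fix y assume y: "y \<in> {\<rho>\<^sup>2..4}"
    then have u: "0 < Uinv y" "Uinv y \<le> 1" "U (Uinv y) = y" using Uinv by auto
    have "\<rho>\<^sup>2 / (Uinv y)\<^sup>2 \<le> 4"
      using u(3) y repulsive_nonneg[OF repulsive u(1)] by (simp add: U_def)
    then have "\<rho>\<^sup>2 \<le> (2 * Uinv y)\<^sup>2" using u by (simp add: field_simps power_mult_distrib)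
    then have "\<rho> \<le> 2 * Uinv y" by (rule power2_le_imp_le) (use u in auto)
    then show "y \<in> U ` ({\<rho>/2..1} \<inter> U -` {..4})" using u y by (intro image_eqI[of _ _ "Uinv y"]) auto
  qed
  ultimately show ?thesis by (rule continuous_on_subset)
qed

lemma qmax: "0 < qmax" "qmax\<^sup>2 = 1 - \<rho>\<^sup>2" "qmax < 1"
proof -
  have "0 < \<rho>\<^sup>2" "\<rho>\<^sup>2 < 1" using \<rho> by (auto simp: power_less_one_iff abs_square_less_1)
  then show "0 < qmax" "qmax\<^sup>2 = 1 - \<rho>\<^sup>2" "qmax < 1"
    by (auto simp: qmax_def)
qed

lemma q_range: assumes "q \<in> {-qmax..qmax}" shows "\<rho>\<^sup>2 \<le> 1 - q\<^sup>2" "1 - q\<^sup>2 \<le> 4"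
proof -
  have "\<bar>q\<bar> \<le> qmax" using assms by auto
  then have "q\<^sup>2 \<le> qmax\<^sup>2" by (metis abs_le_square_iff abs_of_pos qmax(1))
  then show "\<rho>\<^sup>2 \<le> 1 - q\<^sup>2" by (simp add: qmax)
  show "1 - q\<^sup>2 \<le> 4" using zero_le_power2[of q] by linarith
qed

lemma rad:
  assumes "q \<in> {-qmax..qmax}"
  shows "0 < rad q" "rad q \<le> 1" "U (rad q) = 1 - q\<^sup>2"
  using Uinv[OF q_range[OF assms]] by (auto simp: rad_def)

lemma rad_eqI: "q \<in> {-qmax..qmax} \<Longrightarrow> 0 < r \<Longrightarrow> U r = 1 - q\<^sup>2 \<Longrightarrow> rad q = r"
  unfolding rad_def using Uinv_U[OF q_range] by auto

lemma rad_qmax [simp]: "rad qmax = 1" "rad (- qmax) = 1"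
  by (rule rad_eqI; simp add: qmax less_imp_le)+

lemma rad_less_1: assumes "q \<in> {-qmax<..<qmax}" shows "rad q < 1"
proof -
  have "rad q \<noteq> 1"
  proof
    assume "rad q = 1"
    then have "q\<^sup>2 = qmax\<^sup>2" using rad(3)[of q] assms qmax(2) by auto
    then show False using assms by (auto simp: power2_eq_iff)
  qed
  then show ?thesis using rad(2)[of q] assms by auto
qed

lemma continuous_on_rad: "continuous_on {-qmax..qmax} rad"
  unfolding rad_def
  by (rule continuous_on_compose2[OF continuous_on_Uinv])
    (use q_range in \<open>auto intro!: continuous_intros\<close>)

text \<open>Implicit differentiation of \<open>U (rad q) = 1 - q\<^sup>2\<close>. The radius as a
  function of \<open>q\<close> has an ordinary critical point at \<open>q = 0\<close>; no square
  root singularity appears at the turning point.\<close>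

lemma rad_deriv:
  assumes "q \<in> {-qmax<..<qmax}"
  shows "(rad has_real_derivative - 2 * q / dU (rad q)) (at q)"
proof -
  have q: "q \<in> {-qmax..qmax}" using assms by auto
  have y: "\<rho>\<^sup>2 < 1 - q\<^sup>2"
    using U_strict_antimono[of "rad q" 1] rad[OF q] rad_less_1[OF assms] by simp
  have y': "1 - q\<^sup>2 < 4" using zero_le_power2[of q] by linarith
  have "(Uinv has_real_derivative inverse (dU (rad q))) (at (1 - q\<^sup>2))"
  proof (rule DERIV_inverse_function[where f=U and a="\<rho>\<^sup>2" and b=4])
    show "(U has_real_derivative dU (rad q)) (at (Uinv (1 - q\<^sup>2)))"
      using U_deriv[of "rad q"] rad[OF q] rad_less_1[OF assms] by (simp add: rad_def)
    show "dU (rad q) \<noteq> 0" using dU_le[OF rad(1,2)[OF q]] \<rho> by auto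
    show "isCont Uinv (1 - q\<^sup>2)"
      using continuous_on_interior[OF continuous_on_Uinv] y y' by simp
  qed (use y y' Uinv in auto)
  moreover have "((\<lambda>q. 1 - q\<^sup>2) has_real_derivative - 2 * q) (at q)"
    by (auto intro!: derivative_eq_intros)
  ultimately have "((\<lambda>q. Uinv (1 - q\<^sup>2)) has_real_derivative inverse (dU (rad q)) * (- 2 * q)) (at q)"
    by (rule DERIV_chain2)
  then show ?thesis by (simp add: rad_def[abs_def] divide_inverse mult_ac)
qed

lemma acc_ge: "q \<in> {-qmax..qmax} \<Longrightarrow> w * \<rho>\<^sup>2 \<le> acc q"
  using mult_left_mono[OF dU_le[OF rad(1,2)], of q "w/2"] w by (simp add: acc_def)

lemma acc_pos: "q \<in> {-qmax..qmax} \<Longrightarrow> 0 < acc q"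
  using acc_ge[of q] w \<rho> by (meson less_le_trans mult_pos_pos zero_less_power)

lemma continuous_on_acc: "continuous_on {-qmax..qmax} acc"
proof -
  have "continuous_on {-qmax..qmax} (\<lambda>q. d\<phi> (rad q))"
    by (rule continuous_on_compose2[OF continuous_deriv continuous_on_rad]) (use rad in auto)
  then show ?thesis
    unfolding acc_def dU_def using w rad(1)
    by (intro continuous_intros continuous_on_rad) (auto simp: less_le)
qed

lemma ang_deriv_within:
  assumes "q \<in> {-qmax..qmax}"
  shows "(ang has_real_derivative w * \<rho> / (rad q)\<^sup>2 / acc q) (at q within {-qmax..qmax})"
  unfolding ang_def[abs_def]
  by (rule integral_has_real_derivative)
    (use assms acc_pos rad(1) in \<open>force intro!: continuous_intros continuous_on_rad continuous_on_acc\<close>)+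

lemma tim_deriv_within:
  assumes "q \<in> {-qmax..qmax}"
  shows "(tim has_real_derivative 1 / acc q) (at q within {-qmax..qmax})"
  unfolding tim_def[abs_def]
  by (rule integral_has_real_derivative)
    (use assms acc_pos in \<open>force intro!: continuous_intros continuous_on_acc\<close>)+

lemma at_within_q: "q \<in> {-qmax<..<qmax} \<Longrightarrow> at q within {-qmax..qmax} = at q"
  by (rule at_within_interior) simp

lemma ang_deriv: "q \<in> {-qmax<..<qmax} \<Longrightarrow> (ang has_real_derivative w * \<rho> / (rad q)\<^sup>2 / acc q) (at q)"
  and tim_deriv: "q \<in> {-qmax<..<qmax} \<Longrightarrow> (tim has_real_derivative 1 / acc q) (at q)"
  using ang_deriv_within[of q] tim_deriv_within[of q] at_within_q by auto

lemma continuous_on_ang: "continuous_on {-qmax..qmax} ang"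
  and continuous_on_tim: "continuous_on {-qmax..qmax} tim"
  using DERIV_continuous_on[OF ang_deriv_within] DERIV_continuous_on[OF tim_deriv_within] by auto

lemma ang_tim_start [simp]: "ang (- qmax) = 0" "tim (- qmax) = 0"
  by (simp_all add: ang_def tim_def)

text \<open>The unit vector at polar angle \<open>\<alpha>\<close> from \<open>a\<close> in the
  plane orthogonal to the angular momentum \<open>l\<close>; since \<open>l\<close> has length
  \<open>w * \<rho>\<close>, the division makes the second basis vector a unit vector.\<close>

definition frame where "frame l a \<alpha> = cos \<alpha> *\<^sub>R a + (sin \<alpha> / (w * \<rho>)) *\<^sub>R cross3 l a"

text \<open>\<open>cross3 l\<close> is a quarter turn in the orbital plane times
  \<open>w * \<rho>\<close>; so it produces that multiple of the derivative of \<open>frame\<close>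
  in the angle.\<close>

lemma cross_frame:
  assumes "l \<bullet> a = 0" "l \<bullet> l = (w * \<rho>)\<^sup>2"
  shows "cross3 l (frame l a \<alpha>) =
    (w * \<rho>) *\<^sub>R (- sin \<alpha> *\<^sub>R a + (cos \<alpha> / (w * \<rho>)) *\<^sub>R cross3 l a)"
  using w \<rho> assms
  by (simp add: frame_def cross_add_right cross_mult_right cross_cross_orthogonal
      scaleR_right_distrib scaleR_diff_right power2_eq_square mult.commute)

section \<open>A motion inside the ball follows the explicit orbit\<close>

context
  fixes X V :: "real \<Rightarrow> real ^ 3" and T :: "real set" and t1 :: real
  assumes T: "finite T" and t1: "0 < t1"
    and cX: "continuous_on {0..t1} X" and cV: "continuous_on {0..t1} V"
    and dX: "\<And>t. t \<in> {0<..<t1} \<Longrightarrow> (X has_vector_derivative V t) (at t)"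
    and dV: "\<And>t. t \<in> {0<..<t1} - T \<Longrightarrow>
      (V has_vector_derivative (- (2 * d\<phi> (norm (X t)) / norm (X t))) *\<^sub>R X t) (at t)"
    and inside: "\<And>t. t \<in> {0<..<t1} \<Longrightarrow> norm (X t) < 1"
    and nz: "\<And>t. t \<in> {0..t1} \<Longrightarrow> X t \<noteq> 0"
    and init: "norm (X 0) = 1" "X 0 \<bullet> V 0 = - w * qmax" "norm (V 0) = w"
begin

lemma inside_le: "t \<in> {0..t1} \<Longrightarrow> norm (X t) \<le> 1"
  using continuous_le_on_closure[of "{0<..<t1}" "\<lambda>t. norm (X t)" t 1] t1 inside cX
  by (force intro!: continuous_intros)

text \<open>The radial acceleration is \<open>- 2 * d\<phi>\<close>, whose product with
  \<open>2 * V\<close> cancels the derivative of \<open>4 * \<phi>\<close> along the path.\<close>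

lemma energy_const:
  assumes "t \<in> {0..t1}"
  shows "V t \<bullet> V t + 4 * \<phi> (norm (X t)) = w\<^sup>2"
proof -
  have "V t \<bullet> V t + 4 * \<phi> (norm (X t)) = V 0 \<bullet> V 0 + 4 * \<phi> (norm (X 0))"
  proof (rule constant_if_derivative_zero[where f="\<lambda>t. V t \<bullet> V t + 4 * \<phi> (norm (X t))" and b=t1, OF T])
    have "continuous_on {0..t1} (\<lambda>t. \<phi> (norm (X t)))"
      by (rule continuous_on_compose2[OF continuous]) (use nz cX in \<open>auto intro!: continuous_intros\<close>)
    then show "continuous_on {0..t1} (\<lambda>t. V t \<bullet> V t + 4 * \<phi> (norm (X t)))"
      by (intro continuous_intros cV)
    fix t assume t: "t \<in> {0<..<t1} - T"
    let ?r = "norm (X t)"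
    have x: "X t \<noteq> 0" "?r < 1" using nz[of t] inside[of t] t by auto
    have "((\<lambda>t. norm (X t)) has_real_derivative (X t \<bullet> V t) / ?r) (at t)"
      using dX[of t] t x by (intro has_real_derivative_norm) auto
    moreover have "(\<phi> has_real_derivative d\<phi> ?r) (at ?r)" using x by (intro deriv) auto
    ultimately have "((\<lambda>t. \<phi> (norm (X t))) has_real_derivative d\<phi> ?r * ((X t \<bullet> V t) / ?r)) (at t)"
      by (rule DERIV_chain2[rotated])
    then have "((\<lambda>t. V t \<bullet> V t + 4 * \<phi> (norm (X t))) has_real_derivative 0) (at t)"
      by (auto intro!: derivative_eq_intros has_real_derivative_inner[OF dV[OF t] dV[OF t]]
          simp: inner_commute field_simps)
    then show "((\<lambda>t. V t \<bullet> V t + 4 * \<phi> (norm (X t))) has_vector_derivative 0) (at t)"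
      by (simp add: has_real_derivative_iff_has_vector_derivative)
  qed (use assms in auto)
  also have "\<dots> = w\<^sup>2" using init vanish[of 1] by (simp add: dot_square_norm)
  finally show ?thesis .
qed

definition L where "L = cross3 (X 0) (V 0)"

lemma angular_momentum_const:
  assumes "t \<in> {0..t1}"
  shows "cross3 (X t) (V t) = L"
  unfolding L_def
proof (rule constant_if_derivative_zero[OF T])
  show "continuous_on {0..t1} (\<lambda>t. cross3 (X t) (V t))"
    by (intro continuous_on_cross cX cV)
  fix t assume t: "t \<in> {0<..<t1} - T"
  have "((\<lambda>t. cross3 (X t) (V t)) has_vector_derivative
      cross3 (X t) ((- (2 * d\<phi> (norm (X t)) / norm (X t))) *\<^sub>R X t) + cross3 (V t) (V t)) (at t)"
    by (rule bounded_bilinear.has_vector_derivative[OF bounded_bilinear_cross3]) (use dX dV t in auto)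
  then show "((\<lambda>t. cross3 (X t) (V t)) has_vector_derivative 0) (at t)"
    by (simp add: cross_mult_right)
qed (use assms in auto)

lemma norm_L: "L \<bullet> L = (w * \<rho>)\<^sup>2"
proof -
  have "(norm L)\<^sup>2 + (w * qmax)\<^sup>2 = w\<^sup>2"
    using norm_cross_dot[of "X 0" "V 0"] init by (simp add: L_def)
  then show ?thesis by (simp add: power_mult_distrib qmax dot_square_norm algebra_simps)
qed

lemma L_orthogonal: "t \<in> {0..t1} \<Longrightarrow> L \<bullet> X t = 0"
  by (metis angular_momentum_const dot_cross_self(3) dot_cross_self(4))

definition q where "q t = (X t \<bullet> V t) / (w * norm (X t))"

text \<open>Lagrange's identity expresses the squared angular momentum plus
  \<open>(X \<bullet> V)\<^sup>2\<close> as the product of the squares of distance and speed;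
  conservation fixes the angular momentum and the speed.\<close>

lemma q_energy:
  assumes "t \<in> {0..t1}"
  shows "U (norm (X t)) = 1 - (q t)\<^sup>2"
proof -
  let ?r = "norm (X t)"
  have r: "?r \<noteq> 0" using nz[OF assms] by simp
  have 1: "(norm L)\<^sup>2 + (X t \<bullet> V t)\<^sup>2 = (?r * norm (V t))\<^sup>2"
    using norm_cross_dot[of "X t" "V t"] angular_momentum_const[OF assms] by simp
  have 2: "(norm (V t))\<^sup>2 = w\<^sup>2 - 4 * \<phi> ?r"
    using energy_const[OF assms] by (simp add: dot_square_norm)
  have 3: "(norm L)\<^sup>2 = (w * \<rho>)\<^sup>2" using norm_L by (simp add: dot_square_norm)
  have "(w * \<rho>)\<^sup>2 + (X t \<bullet> V t)\<^sup>2 = ?r\<^sup>2 * (w\<^sup>2 - 4 * \<phi> ?r)"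
    using 1 2 3 by (simp add: power_mult_distrib)
  then have "(X t \<bullet> V t)\<^sup>2 = ?r\<^sup>2 * (w\<^sup>2 - 4 * \<phi> ?r) - (w * \<rho>)\<^sup>2" by simp
  then have "(q t)\<^sup>2 = (?r\<^sup>2 * (w\<^sup>2 - 4 * \<phi> ?r) - (w * \<rho>)\<^sup>2) / (w\<^sup>2 * ?r\<^sup>2)"
    by (simp add: q_def power_divide power_mult_distrib)
  then show ?thesis using r w by (simp add: U_def \<kappa>_def field_simps)
qed

lemma q_bounds:
  assumes "t \<in> {0..t1}"
  shows "q t \<in> {-qmax..qmax}" "norm (X t) < 1 \<Longrightarrow> q t \<in> {-qmax<..<qmax}"
    "norm (X t) = 1 \<Longrightarrow> (q t)\<^sup>2 = qmax\<^sup>2"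
proof -
  have r: "0 < norm (X t)" using nz[OF assms] by simp
  have a: "\<rho>\<^sup>2 < 1 - (q t)\<^sup>2" if "norm (X t) < 1"
    using U_strict_antimono[OF r that] q_energy[OF assms] by simp
  then have "(q t)\<^sup>2 < qmax\<^sup>2" if "norm (X t) < 1" using that by (simp add: qmax)
  then show *: "q t \<in> {-qmax<..<qmax}" if "norm (X t) < 1"
    using that qmax(1) power2_less_imp_less[of "q t" qmax] power2_less_imp_less[of "- q t" qmax] by auto
  show **: "(q t)\<^sup>2 = qmax\<^sup>2" if "norm (X t) = 1"
    using q_energy[OF assms] that by (simp add: qmax)
  show "q t \<in> {-qmax..qmax}"
    using * ** inside_le[OF assms] qmax(1) by (force simp: power2_eq_iff)
qed

lemma rad_q: "t \<in> {0..t1} \<Longrightarrow> rad (q t) = norm (X t)"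
  using q_energy q_bounds nz by (intro rad_eqI) auto

lemma continuous_on_q: "continuous_on {0..t1} q"
  unfolding q_def using w nz by (intro continuous_intros cX cV) auto

lemma q_0: "q 0 = - qmax"
  using init w by (simp add: q_def)

text \<open>The conservation laws remove the velocity from the quotient rule, and the radius is a
  function of \<open>q\<close>; so the motion reduces to one autonomous scalar equation with
  positive right-hand side.\<close>

lemma q_deriv:
  assumes t: "t \<in> {0<..<t1} - T"
  shows "(q has_real_derivative acc (q t)) (at t)"
proof -
  let ?r = "norm (X t)"
  have t': "t \<in> {0..t1}" using t by auto
  have r: "0 < ?r" "X t \<noteq> 0" using nz[OF t'] by auto
  have dr: "((\<lambda>t. norm (X t)) has_real_derivative (X t \<bullet> V t) / ?r) (at t)"
    using dX[of t] t r by (intro has_real_derivative_norm) auto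
  have dxv: "((\<lambda>t. X t \<bullet> V t) has_real_derivative
      X t \<bullet> ((- (2 * d\<phi> ?r / ?r)) *\<^sub>R X t) + V t \<bullet> V t) (at t)"
    using dX[of t] dV[of t] t by (intro has_real_derivative_inner) auto
  have 1: "(w * \<rho>)\<^sup>2 + (X t \<bullet> V t)\<^sup>2 = (?r * norm (V t))\<^sup>2"
    using norm_cross_dot[of "X t" "V t"] angular_momentum_const[OF t'] norm_L by (simp add: dot_square_norm)
  have e: "X t \<bullet> X t = ?r\<^sup>2" by (simp add: dot_square_norm)
  have D: "(q has_real_derivative ((X t \<bullet> ((- (2 * d\<phi> ?r / ?r)) *\<^sub>R X t) + V t \<bullet> V t) * (w * ?r)
      - (X t \<bullet> V t) * (w * ((X t \<bullet> V t) / ?r))) / ((w * ?r) * (w * ?r))) (at t)"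
    unfolding q_def by (rule DERIV_divide[OF dxv DERIV_cmult[OF dr]]) (use r w in auto)
  have "((X t \<bullet> ((- (2 * d\<phi> ?r / ?r)) *\<^sub>R X t) + V t \<bullet> V t) * (w * ?r)
      - (X t \<bullet> V t) * (w * ((X t \<bullet> V t) / ?r))) / ((w * ?r) * (w * ?r))
    = (((?r * norm (V t))\<^sup>2 - (X t \<bullet> V t)\<^sup>2) / ?r ^ 3 - 2 * d\<phi> ?r) / w"
    using r(1) w by (simp add: e dot_square_norm[of "V t"] field_simps power2_eq_square power3_eq_cube)
  also have "(?r * norm (V t))\<^sup>2 - (X t \<bullet> V t)\<^sup>2 = (w * \<rho>)\<^sup>2" using 1 by simp
  also have "((w * \<rho>)\<^sup>2 / ?r ^ 3 - 2 * d\<phi> ?r) / w = acc (q t)"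
    using r(1) w by (simp add: acc_def rad_q[OF t'] dU_def field_simps power2_eq_square power3_eq_cube)
  finally show ?thesis using D by simp
qed

text \<open>As \<open>q\<close> stays in an interval of length \<open>2 * qmax\<close>, the linear
  growth bounds the time that a motion can spend in the ball.\<close>

lemma q_increase: "t \<in> {0..t1} \<Longrightarrow> - qmax + w * \<rho>\<^sup>2 * t \<le> q t"
  using increase_ge[OF T, of 0 t q "\<lambda>t. acc (q t)" "w * \<rho>\<^sup>2"] q_deriv acc_ge q_bounds(1)
    continuous_on_subset[OF continuous_on_q, of "{0..t}"] q_0 by auto

lemma velocity:
  assumes "t \<in> {0..t1}"
  shows "V t = (1 / (norm (X t))\<^sup>2) *\<^sub>R (cross3 L (X t) + (X t \<bullet> V t) *\<^sub>R X t)"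
  using nz[OF assms] angular_momentum_const[OF assms] cross_cross_self[of "X t" "V t"]
  by (simp add: dot_square_norm)

text \<open>Uniqueness of the orbit. The difference \<open>D\<close> between the actual and the
  predicted direction satisfies \<open>D' = cross3 L D / r\<^sup>2\<close>; the right-hand side is
  orthogonal to \<open>D\<close>, hence \<open>D \<bullet> D\<close> is constant, and it is 0 at the
  start.\<close>

lemma direction:
  assumes "t \<in> {0..t1}"
  shows "X t /\<^sub>R norm (X t) = frame L (X 0) (ang (q t))"
proof -
  define D where "D t = X t /\<^sub>R norm (X t) - frame L (X 0) (ang (q t))" for t
  have ang_q: "ang (q 0) = 0" by (simp add: q_0)
  have "D t \<bullet> D t = D 0 \<bullet> D 0"
  proof (rule constant_if_derivative_zero[where f="\<lambda>t. D t \<bullet> D t" and b=t1, OF T])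
    have "continuous_on {0..t1} (\<lambda>t. ang (q t))"
      by (rule continuous_on_compose2[OF continuous_on_ang continuous_on_q]) (use q_bounds in auto)
    then show "continuous_on {0..t1} (\<lambda>t. D t \<bullet> D t)"
      unfolding D_def frame_def using nz w \<rho> by (intro continuous_intros cX) auto
    fix t assume t: "t \<in> {0<..<t1} - T"
    let ?r = "norm (X t)"
    have t': "t \<in> {0..t1}" using t by auto
    have r: "0 < ?r" "X t \<noteq> 0" using nz[OF t'] by auto
    have dr: "((\<lambda>t. norm (X t)) has_real_derivative (X t \<bullet> V t) / ?r) (at t)"
      using dX[of t] t r by (intro has_real_derivative_norm) auto
    have "((\<lambda>t. inverse (norm (X t))) has_real_derivative - ((X t \<bullet> V t) / ?r * inverse (?r ^ 2))) (at t)"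
      using DERIV_inverse_fun[OF dr] r by (simp add: numeral_2_eq_2)
    from has_vector_derivative_scaleR[OF this dX[of t]] t
    have "((\<lambda>t. X t /\<^sub>R norm (X t)) has_vector_derivative
       inverse ?r *\<^sub>R V t + (- ((X t \<bullet> V t) / ?r * inverse (?r ^ 2))) *\<^sub>R X t) (at t)" by auto
    \<comment> \<open>In the decomposition \<open>velocity\<close>, the part along
      \<open>X t\<close> is exactly what normalization removes; the rotation about \<open>L\<close>
      is left.\<close>
    moreover have "inverse ?r *\<^sub>R V t + (- ((X t \<bullet> V t) / ?r * inverse (?r ^ 2))) *\<^sub>R X t
        = (1 / ?r\<^sup>2) *\<^sub>R cross3 L (X t /\<^sub>R ?r)"
      using r by (subst (1) velocity[OF t'])
        (simp add: cross_mult_right scaleR_right_distrib field_simps power2_eq_square)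
    ultimately have dn: "((\<lambda>t. X t /\<^sub>R norm (X t)) has_vector_derivative
        (1 / ?r\<^sup>2) *\<^sub>R cross3 L (X t /\<^sub>R ?r)) (at t)" by simp
    have "q t \<in> {-qmax<..<qmax}" using q_bounds(2)[OF t'] inside t by auto
    from DERIV_chain2[OF ang_deriv[OF this] q_deriv[OF t]]
    have "((\<lambda>t. ang (q t)) has_real_derivative w * \<rho> / ?r\<^sup>2) (at t)"
      using acc_pos[OF q_bounds(1)[OF t']] rad_q[OF t'] by simp
    then have "((\<lambda>t. frame L (X 0) (ang (q t))) has_vector_derivative
        (- sin (ang (q t)) * (w * \<rho> / ?r\<^sup>2)) *\<^sub>R X 0 + (cos (ang (q t)) * (w * \<rho> / ?r\<^sup>2) / (w * \<rho>)) *\<^sub>R cross3 L (X 0)) (at t)"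
      unfolding frame_def
      using w \<rho> by (auto intro!: derivative_eq_intros has_vector_derivative_scaleR[where g="\<lambda>_. c" and g'=0 for c, simplified])
    moreover have "(- sin (ang (q t)) * (w * \<rho> / ?r\<^sup>2)) *\<^sub>R X 0 + (cos (ang (q t)) * (w * \<rho> / ?r\<^sup>2) / (w * \<rho>)) *\<^sub>R cross3 L (X 0)
        = (1 / ?r\<^sup>2) *\<^sub>R cross3 L (frame L (X 0) (ang (q t)))"
      using L_orthogonal[of 0] norm_L t1 by (simp add: cross_frame scaleR_right_distrib field_simps)
    ultimately have "((\<lambda>t. frame L (X 0) (ang (q t))) has_vector_derivative
        (1 / ?r\<^sup>2) *\<^sub>R cross3 L (frame L (X 0) (ang (q t)))) (at t)" by simp
    from has_vector_derivative_diff[OF dn this]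
    have dD: "(D has_vector_derivative (1 / ?r\<^sup>2) *\<^sub>R cross3 L (D t)) (at t)"
      by (simp add: D_def[abs_def] Cross3.right_diff_distrib scaleR_diff_right)
    from has_real_derivative_inner[OF dD dD]
    show "((\<lambda>t. D t \<bullet> D t) has_vector_derivative 0) (at t)"
      by (simp add: has_real_derivative_iff_has_vector_derivative dot_cross_self)
  qed (use assms in auto)
  also have "D 0 = 0" using init by (simp add: D_def ang_q frame_def)
  finally show ?thesis by (simp add: D_def)
qed

text \<open>On the sphere \<open>q\<close> can only be \<open>qmax\<close> or \<open>- qmax\<close>,
  and its growth since the entry excludes the latter. Energy and angular momentum then determine the
  velocity.\<close>

lemma exit_velocity:
  assumes "norm (X t1) = 1"
  shows "V t1 = (w * qmax) *\<^sub>R frame L (X 0) (ang qmax) + cross3 L (frame L (X 0) (ang qmax))" "X t1 \<bullet> V t1 = w * qmax"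
proof -
  have t: "t1 \<in> {0..t1}" using t1 by simp
  have "0 < w * \<rho>\<^sup>2 * t1" using w \<rho> t1 by simp
  with q_increase[OF t] have "- qmax < q t1" by linarith
  moreover have "q t1 = qmax \<or> q t1 = - qmax"
    using q_bounds(3)[OF t assms] by (simp add: power2_eq_iff)
  ultimately have q: "q t1 = qmax" by auto
  show xv: "X t1 \<bullet> V t1 = w * qmax" using q w assms by (simp add: q_def field_simps)
  show "V t1 = (w * qmax) *\<^sub>R frame L (X 0) (ang qmax) + cross3 L (frame L (X 0) (ang qmax))"
    using velocity[OF t] direction[OF t] assms xv q by simp
qed

end

section \<open>Construction of a motion through the ball\<close>

definition tmax where "tmax = tim qmax"
definition qinv where "qinv = the_inv_into {-qmax..qmax} tim"

lemma tim_strict_mono: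
  assumes "- qmax \<le> p" "p < p'" "p' \<le> qmax"
  shows "tim p < tim p'"
proof (rule DERIV_pos_imp_increasing_open[OF assms(2)])
  fix x assume "p < x" "x < p'"
  then show "\<exists>y. (tim has_real_derivative y) (at x) \<and> 0 < y"
    using assms tim_deriv[of x] acc_pos[of x] by (intro exI[of _ "1 / acc x"]) auto
qed (rule continuous_on_subset[OF continuous_on_tim], use assms in auto)

lemma tmax_pos: "0 < tmax"
  using tim_strict_mono[of "-qmax" qmax] qmax by (simp add: tmax_def)

lemma inj_on_tim: "inj_on tim {-qmax..qmax}"
  by (rule linorder_inj_onI) (use tim_strict_mono in force)+

lemma tim_image: "tim ` {-qmax..qmax} = {0..tmax}"
proof -
  have mono: "tim p \<le> tim p'" if "-qmax \<le> p" "p \<le> p'" "p' \<le> qmax" for p p'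
    using tim_strict_mono[of p p'] that by (cases "p = p'") auto
  show ?thesis
  proof (intro equalityI subsetI)
    fix t assume "t \<in> {0..tmax}"
    then have "\<exists>p\<ge>-qmax. p \<le> qmax \<and> tim p = t"
      using qmax(1) by (intro IVT' continuous_on_tim) (auto simp: tmax_def)
    then show "t \<in> tim ` {-qmax..qmax}" by auto
  next
    fix t assume "t \<in> tim ` {-qmax..qmax}"
    then show "t \<in> {0..tmax}"
      using mono[of "-qmax"] mono[of _ qmax] by (force simp: tmax_def)
  qed
qed

lemma qinv:
  assumes "t \<in> {0..tmax}"
  shows "qinv t \<in> {-qmax..qmax}" "tim (qinv t) = t"
  using assms the_inv_into_into[OF inj_on_tim _ order_refl, of t] f_the_inv_into_f[OF inj_on_tim, of t]
  by (auto simp: qinv_def tim_image)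

lemma qinv_ends [simp]: "qinv 0 = - qmax" "qinv tmax = qmax"
  using the_inv_into_f_f[OF inj_on_tim, of "-qmax"] the_inv_into_f_f[OF inj_on_tim, of qmax] qmax
  by (auto simp: qinv_def tmax_def)

lemma continuous_on_qinv: "continuous_on {0..tmax} qinv"
  using continuous_on_inv[OF continuous_on_tim, of qinv] the_inv_into_f_f[OF inj_on_tim]
  by (simp add: tim_image qinv_def)

lemma qinv_interior:
  assumes "t \<in> {0<..<tmax}"
  shows "qinv t \<in> {-qmax<..<qmax}"
proof -
  have t: "t \<in> {0..tmax}" using assms by auto
  have "qinv t \<noteq> - qmax" "qinv t \<noteq> qmax"
    using qinv(2)[OF t] assms by (auto simp: tmax_def)
  then show ?thesis using qinv(1)[OF t] by auto
qed

lemma qinv_deriv: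
  assumes "t \<in> {0<..<tmax}"
  shows "(qinv has_real_derivative acc (qinv t)) (at t)"
proof -
  have q: "qinv t \<in> {-qmax<..<qmax}" by (rule qinv_interior[OF assms])
  have "(qinv has_real_derivative inverse (1 / acc (qinv t))) (at t)"
  proof (rule DERIV_inverse_function[where f=tim and a=0 and b=tmax])
    show "isCont qinv t"
      using continuous_on_interior[OF continuous_on_qinv] assms by simp
    show "1 / acc (qinv t) \<noteq> 0" using acc_pos[of "qinv t"] q by auto
  qed (use assms q tim_deriv qinv in auto)
  then show ?thesis by simp
qed

lemma norm_frame:
  assumes "l \<bullet> a = 0" "l \<bullet> l = (w * \<rho>)\<^sup>2" "norm a = 1"
  shows "frame l a \<alpha> \<bullet> frame l a \<alpha> = 1" "norm (frame l a \<alpha>) = 1" "l \<bullet> frame l a \<alpha> = 0"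
proof -
  have aa: "a \<bullet> a = 1" using assms(3) by (simp add: dot_square_norm)
  have c: "cross3 l a \<bullet> cross3 l a = (w * \<rho>)\<^sup>2"
    using norm_cross_dot[of l a] assms aa by (simp add: dot_square_norm[symmetric] power_mult_distrib)
  show 1: "frame l a \<alpha> \<bullet> frame l a \<alpha> = 1"
    using w \<rho> sin_cos_squared_add[of \<alpha>]
    by (simp add: frame_def inner_add_left inner_add_right aa c dot_cross_self inner_commute
        power2_eq_square field_simps)
  then show "norm (frame l a \<alpha>) = 1" by (simp add: norm_eq_sqrt_inner)
  show "l \<bullet> frame l a \<alpha> = 0" by (simp add: frame_def inner_add_right assms dot_cross_self)
qed

lemma frame_deriv:
  assumes "l \<bullet> a = 0" "l \<bullet> l = (w * \<rho>)\<^sup>2" "(A has_real_derivative w * \<rho> * A') (at t)"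
  shows "((\<lambda>t. frame l a (A t)) has_vector_derivative A' *\<^sub>R cross3 l (frame l a (A t))) (at t)"
proof -
  have "((\<lambda>t. frame l a (A t)) has_vector_derivative
      (- sin (A t) * (w * \<rho> * A')) *\<^sub>R a + (cos (A t) * (w * \<rho> * A') / (w * \<rho>)) *\<^sub>R cross3 l a) (at t)"
    unfolding frame_def using assms(3) w \<rho>
    by (auto intro!: derivative_eq_intros has_vector_derivative_scaleR[where g="\<lambda>_. c" and g'=0 for c, simplified])
  then show ?thesis
    using w \<rho> by (simp add: cross_frame[OF assms(1,2)] scaleR_right_distrib scaleR_diff_right mult_ac)
qed

text \<open>Inverting \<open>tim\<close> turns the parametrization by \<open>q\<close> into one by
  time. After the exit time \<open>tmax\<close> the motion continues on a straight line; there only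
  the velocity needs to be continuous, and the alternative in the conclusion leaves out that single
  time.\<close>

lemma motion_exists:
  fixes a l :: "real ^ 3"
  assumes l: "l \<bullet> a = 0" "l \<bullet> l = (w * \<rho>)\<^sup>2" and a: "norm a = 1"
  shows "\<exists>X V. X 0 = a \<and> V 0 = cross3 l a - (w * qmax) *\<^sub>R a \<and> continuous_on {0..} V \<and>
    (\<forall>t\<ge>0. X t \<noteq> 0 \<and> (X has_vector_derivative V t) (at t within {0..})) \<and>
    (\<forall>t\<in>{0<..} - {tmax}.
      norm (X t) < 1 \<and> (V has_vector_derivative (- (2 * d\<phi> (norm (X t)) / norm (X t))) *\<^sub>R X t) (at t) \<or>
      1 < norm (X t) \<and> (V has_vector_derivative 0) (at t))"
proof -
  define N where "N t = frame l a (ang (qinv t))" for t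
  define r where "r t = rad (qinv t)" for t
  define Y where "Y t = r t *\<^sub>R N t" for t
  \<comment> \<open>The velocity forced by the radial part \<open>w * q\<close> and the angular
    momentum \<open>l\<close>.\<close>
  define W where "W t = (w * qinv t) *\<^sub>R N t + (1 / r t) *\<^sub>R cross3 l (N t)" for t
  define X where "X t = (if t \<le> tmax then Y t else Y tmax + (t - tmax) *\<^sub>R W tmax)" for t
  define V where "V t = (if t \<le> tmax then W t else W tmax)" for t
  have N: "N t \<bullet> N t = 1" "norm (N t) = 1" "l \<bullet> N t = 0" for t
    unfolding N_def using norm_frame[OF l a] by auto
  have r: "0 < r t" "r t \<le> 1" if "t \<in> {0..tmax}" for t
    using rad[OF qinv(1)[OF that]] by (auto simp: r_def)
  have r_tmax [simp]: "r tmax = 1" "r 0 = 1" by (simp_all add: r_def)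
  have normY: "norm (Y t) = r t" if "t \<in> {0..tmax}" for t
    using r[OF that] N by (simp add: Y_def)
  have cN: "continuous_on {0..tmax} N"
  proof -
    have "continuous_on {0..tmax} (\<lambda>t. ang (qinv t))"
      by (rule continuous_on_compose2[OF continuous_on_ang continuous_on_qinv]) (use qinv in auto)
    then show ?thesis unfolding N_def frame_def using w \<rho> by (intro continuous_intros) auto
  qed
  have cr: "continuous_on {0..tmax} r"
    unfolding r_def by (rule continuous_on_compose2[OF continuous_on_rad continuous_on_qinv]) (use qinv in auto)
  have cY: "continuous_on {0..tmax} Y" unfolding Y_def by (intro continuous_intros cr cN)
  have cW: "continuous_on {0..tmax} W"
    unfolding W_def using r by (intro continuous_intros continuous_on_cross cr cN continuous_on_qinv) force+
  have tm: "{t. 0 \<le> t \<and> t \<le> tmax} = {0..tmax}" by auto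
  have cX: "continuous_on {0..} X"
    unfolding X_def by (rule continuous_on_cases_le) (auto simp: tm intro!: cY continuous_intros)
  have cV: "continuous_on {0..} V"
    unfolding V_def by (rule continuous_on_cases_le) (auto simp: tm intro!: cW continuous_intros)
  have der: "(Y has_vector_derivative W t) (at t) \<and>
      (W has_vector_derivative (- 2 * d\<phi> (r t)) *\<^sub>R N t) (at t)" if t: "t \<in> {0<..<tmax}" for t
  proof -
    let ?q = "qinv t"
    have t': "t \<in> {0..tmax}" using t by auto
    have q: "?q \<in> {-qmax<..<qmax}" "?q \<in> {-qmax..qmax}" using qinv_interior[OF t] by auto
    have acc0: "acc ?q \<noteq> 0" using acc_pos[OF q(2)] by simp
    have dU0: "dU (rad ?q) \<noteq> 0" using acc0 by (auto simp: acc_def)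
    have r0: "r t \<noteq> 0" using r[OF t'] by simp
    have dr: "(r has_real_derivative w * ?q) (at t)"
      using DERIV_chain2[OF rad_deriv[OF q(1)] qinv_deriv[OF t]] dU0
      by (simp add: r_def[abs_def] acc_def field_simps)
    have "((\<lambda>t. ang (qinv t)) has_real_derivative w * \<rho> * (1 / (r t)\<^sup>2)) (at t)"
      using DERIV_chain2[OF ang_deriv[OF q(1)] qinv_deriv[OF t]] acc0 by (simp add: r_def)
    from frame_deriv[OF l this]
    have dN: "(N has_vector_derivative (1 / (r t)\<^sup>2) *\<^sub>R cross3 l (N t)) (at t)"
      by (simp add: N_def[abs_def])
    have dY: "(Y has_vector_derivative W t) (at t)"
      using has_vector_derivative_scaleR[OF dr dN] r0
      by (simp add: Y_def[abs_def] W_def power2_eq_square add.commute)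
    have dlN: "((\<lambda>t. cross3 l (N t)) has_vector_derivative (1 / (r t)\<^sup>2) *\<^sub>R (- (w * \<rho>)\<^sup>2 *\<^sub>R N t)) (at t)"
      using bounded_bilinear.has_vector_derivative[OF bounded_bilinear_cross3 has_vector_derivative_const[of l] dN]
      by (simp add: cross_mult_right cross_cross_orthogonal[OF N(3)] l)
    have dwq: "((\<lambda>t. w * qinv t) has_real_derivative w * acc ?q) (at t)"
      by (rule DERIV_cmult[OF qinv_deriv[OF t]])
    have dir: "((\<lambda>t. 1 / r t) has_real_derivative - (w * ?q) / (r t)\<^sup>2) (at t)"
      using DERIV_inverse_fun[OF dr r0] r0 by (simp add: inverse_eq_divide power2_eq_square)
    have "(W has_vector_derivative
        ((w * ?q) *\<^sub>R (1 / (r t)\<^sup>2) *\<^sub>R cross3 l (N t) + (w * acc ?q) *\<^sub>R N t) +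
        ((1 / r t) *\<^sub>R (1 / (r t)\<^sup>2) *\<^sub>R (- (w * \<rho>)\<^sup>2 *\<^sub>R N t) + (- (w * ?q) / (r t)\<^sup>2) *\<^sub>R cross3 l (N t))) (at t)"
      unfolding W_def[abs_def]
      by (rule has_vector_derivative_add[OF has_vector_derivative_scaleR[OF dwq dN]
            has_vector_derivative_scaleR[OF dir dlN]])
    also have "((w * ?q) *\<^sub>R (1 / (r t)\<^sup>2) *\<^sub>R cross3 l (N t) + (w * acc ?q) *\<^sub>R N t) +
        ((1 / r t) *\<^sub>R (1 / (r t)\<^sup>2) *\<^sub>R (- (w * \<rho>)\<^sup>2 *\<^sub>R N t) + (- (w * ?q) / (r t)\<^sup>2) *\<^sub>R cross3 l (N t))
        = (w * acc ?q - (w * \<rho>)\<^sup>2 / (r t)^3) *\<^sub>R N t"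
      by (simp add: scaleR_diff_left power2_eq_square power3_eq_cube mult_ac)
    also have "w * acc ?q - (w * \<rho>)\<^sup>2 / (r t)^3 = - 2 * d\<phi> (r t)"
      using r0 w by (simp add: acc_def dU_def r_def field_simps power2_eq_square power3_eq_cube)
    finally show ?thesis using dY by simp
  qed
  have W1: "W tmax = (w * qmax) *\<^sub>R N tmax + cross3 l (N tmax)" by (simp add: W_def)
  \<comment> \<open>The exit velocity has the positive outward component \<open>w * qmax\<close>, so
    the squared distance keeps growing along the straight line.\<close>
  have after: "1 < norm (X t)" if "tmax < t" for t
  proof -
    let ?d = "t - tmax"
    have "N tmax \<bullet> W tmax = w * qmax"
      by (simp add: W1 inner_add_right N dot_cross_self)
    then have "X t \<bullet> X t = 1 + 2 * ?d * (w * qmax) + ?d\<^sup>2 * (W tmax \<bullet> W tmax)"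
      using that by (simp add: X_def Y_def inner_add_left inner_add_right N inner_commute power2_eq_square algebra_simps)
    moreover have "0 < 2 * ?d * (w * qmax)" using that w qmax by simp
    moreover have "0 \<le> ?d\<^sup>2 * (W tmax \<bullet> W tmax)" by simp
    ultimately have "1 < X t \<bullet> X t" by linarith
    then show ?thesis by (simp add: dot_square_norm power2_eq_square)
        (metis abs_norm_cancel abs_square_le_1 not_less power2_eq_square)
  qed
  have dX: "(X has_vector_derivative V t) (at t)" if "t \<in> {0<..} - {tmax}" for t
  proof (cases "t < tmax")
    case True
    then have "(Y has_vector_derivative V t) (at t)" using der[of t] that by (auto simp: V_def)
    then show ?thesis
      by (rule has_vector_derivative_transform_within_open[of _ _ _ "{..<tmax}"]) (use True in \<open>auto simp: X_def\<close>)
  next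
    case False
    then have t: "tmax < t" using that by auto
    have "((\<lambda>t. t - tmax) has_real_derivative 1) (at t)"
      by (auto intro!: derivative_eq_intros)
    from has_vector_derivative_add[OF has_vector_derivative_const[of "Y tmax"]
        has_vector_derivative_scaleR[OF this has_vector_derivative_const[of "W tmax"]]]
    have "((\<lambda>t. Y tmax + (t - tmax) *\<^sub>R W tmax) has_vector_derivative W tmax) (at t)"
      by simp
    then show ?thesis
      using t by (auto simp: V_def X_def
          elim!: has_vector_derivative_transform_within_open[where S="{tmax<..}"])
  qed
  have dX': "(X has_vector_derivative V t) (at t within {0..})" if "0 \<le> t" for t
    by (rule has_vector_derivative_half_line[of "{tmax}"]) (use dX cX cV that in auto)
  have dV: "norm (X t) < 1 \<and> (V has_vector_derivative (- (2 * d\<phi> (norm (X t)) / norm (X t))) *\<^sub>R X t) (at t) \<or>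
      1 < norm (X t) \<and> (V has_vector_derivative 0) (at t)" if "t \<in> {0<..} - {tmax}" for t
  proof (cases "t < tmax")
    case True
    then have t: "t \<in> {0<..<tmax}" "t \<in> {0..tmax}" using that by auto
    have X: "X t = r t *\<^sub>R N t" using True by (simp add: X_def Y_def)
    have nX: "norm (X t) = r t" using normY[OF t(2)] True by (simp add: X_def)
    have "(W has_vector_derivative (- (2 * d\<phi> (norm (X t)) / norm (X t))) *\<^sub>R X t) (at t)"
      using der[OF t(1)] r[OF t(2)] unfolding nX by (simp add: X)
    then have "(V has_vector_derivative (- (2 * d\<phi> (norm (X t)) / norm (X t))) *\<^sub>R X t) (at t)"
      by (rule has_vector_derivative_transform_within_open[of _ _ _ "{..<tmax}"]) (use True in \<open>auto simp: V_def\<close>)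
    moreover have "norm (X t) < 1"
      using rad_less_1[OF qinv_interior[OF t(1)]] nX by (simp add: r_def)
    ultimately show ?thesis by simp
  next
    case False
    then have t: "tmax < t" using that by auto
    have "(V has_vector_derivative 0) (at t)"
      by (rule has_vector_derivative_transform_within_open[where S="{tmax<..}", OF has_vector_derivative_const[of "W tmax"]])
        (use t in \<open>auto simp: V_def\<close>)
    then show ?thesis using after[OF t] by simp
  qed
  have "X t \<noteq> 0" if "0 \<le> t" for t
  proof (cases "t \<le> tmax")
    case True
    then have "norm (X t) > 0" using normY[of t] r[of t] that by (simp add: X_def)
    then show ?thesis by auto
  next
    case False
    then show ?thesis using after[of t] by auto
  qed
  moreover have "X 0 = a" "V 0 = cross3 l a - (w * qmax) *\<^sub>R a"
    using tmax_pos by (simp_all add: X_def Y_def V_def W_def N_def frame_def)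
  ultimately show ?thesis using cV dX' dV by blast
qed

end

section \<open>Outgoing velocities\<close>

lemma GDERIV_unique:
  assumes "GDERIV f x :> a" "GDERIV f x :> b"
  shows "a = b"
proof -
  have "(\<lambda>h. h \<bullet> a) = (\<lambda>h. h \<bullet> b)"
    using assms unfolding gderiv_def by (rule has_derivative_unique)
  then have "(a - b) \<bullet> a = (a - b) \<bullet> b" by (rule fun_cong)
  then have "(a - b) \<bullet> (a - b) = 0" by (simp add: inner_diff_right)
  then show ?thesis by simp
qed

context scattering begin

text \<open>The relative position is \<open>X1 - X2\<close>, whereas \<open>\<nu>\<close> points
  from the first particle to the second; hence the motion starts at \<open>- \<nu>\<close>.\<close>

lemma angular_momentum_start:
  fixes \<nu> z :: "real ^ 3"
  assumes "norm \<nu> = 1" "norm z = w" "\<nu> \<bullet> z = w * qmax"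
  shows "cross3 (- \<nu>) z \<bullet> - \<nu> = 0" "cross3 (- \<nu>) z \<bullet> cross3 (- \<nu>) z = (w * \<rho>)\<^sup>2"
proof -
  show "cross3 (- \<nu>) z \<bullet> - \<nu> = 0" by (simp add: dot_cross_self)
  show "cross3 (- \<nu>) z \<bullet> cross3 (- \<nu>) z = (w * \<rho>)\<^sup>2"
    using norm_cross_dot[of "\<nu>" z] assms
    by (simp add: dot_square_norm power_mult_distrib qmax algebra_simps)
qed

context
  fixes \<Phi> :: "real ^ 3 \<Rightarrow> real" and v1 v2 \<nu> :: "real ^ 3"
  assumes \<Phi>: "\<And>x. x \<noteq> 0 \<Longrightarrow> \<Phi> x = \<phi> (norm x)"
    and rel: "norm (v1 - v2) = w" and \<nu>: "norm \<nu> = 1" "\<nu> \<bullet> (v1 - v2) = w * qmax"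
begin

lemma gradient_inside:
  assumes "x \<noteq> 0" "norm x < 1"
  shows "GDERIV \<Phi> x :> (d\<phi> (norm x) / norm x) *\<^sub>R x"
proof -
  have "(\<phi> has_derivative (*) (d\<phi> (norm x))) (at (norm x))"
    using deriv[of "norm x"] assms by (simp add: has_field_derivative_def)
  moreover have "(norm has_derivative (\<lambda>h. h \<bullet> sgn x)) (at x)"
    using GDERIV_norm[OF assms(1)] by (simp add: gderiv_def)
  ultimately have "((\<lambda>x. \<phi> (norm x)) has_derivative (\<lambda>h. d\<phi> (norm x) * (h \<bullet> sgn x))) (at x)"
    by (rule has_derivative_compose[rotated])
  then have "(\<Phi> has_derivative (\<lambda>h. d\<phi> (norm x) * (h \<bullet> sgn x))) (at x)"
    by (rule has_derivative_transform_within_open[of _ _ _ _ "-{0}"]) (use assms \<Phi> in auto)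
  then show ?thesis
    by (simp add: gderiv_def sgn_div_norm divide_inverse mult_ac)
qed

lemma gradient_outside:
  assumes "1 < norm x"
  shows "GDERIV \<Phi> x :> 0"
proof -
  have "((\<lambda>x. 0) has_derivative (\<lambda>h. 0)) (at x)" by simp
  then have "(\<Phi> has_derivative (\<lambda>h. 0)) (at x)"
  proof (rule has_derivative_transform_within_open[of _ _ _ _ "- cball 0 1"])
    show "0 = \<Phi> y" if "y \<in> - cball 0 1" for y
    proof -
      have "1 < norm y" using that by simp
      then have "y \<noteq> 0" by auto
      then show ?thesis using \<Phi>[of y] vanish[of "norm y"] \<open>1 < norm y\<close> by simp
    qed
  qed (use assms in auto)
  then show ?thesis by (simp add: gderiv_def)
qed

definition exit_relative_velocity where
  "exit_relative_velocity = (let l = cross3 (- \<nu>) (v1 - v2); n = frame l (- \<nu>) (ang qmax)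
     in (w * qmax) *\<^sub>R n + cross3 l n)"

text \<open>The centre of mass moves uniformly and each particle carries half of the relative
  motion. Radial symmetry makes the two gradients opposite, so both equations hold with the same
  force.\<close>

lemma scattering_solution_exists:
  "\<exists>X1 X2 V1 V2. scattering_solution \<Phi> v1 v2 \<nu> X1 X2 V1 V2"
proof -
  define l where "l = cross3 (- \<nu>) (v1 - v2)"
  note ls = angular_momentum_start[OF \<nu>(1) rel \<nu>(2), folded l_def]
  from motion_exists[OF ls] \<nu>(1) obtain X V where X0: "X 0 = - \<nu>"
    and V0: "V 0 = cross3 l (- \<nu>) - (w * qmax) *\<^sub>R (- \<nu>)" and cV: "continuous_on {0..} V"
    and X: "\<And>t. 0 \<le> t \<Longrightarrow> X t \<noteq> 0" "\<And>t. 0 \<le> t \<Longrightarrow> (X has_vector_derivative V t) (at t within {0..})"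
    and dV: "\<And>t. t \<in> {0<..} - {tmax} \<Longrightarrow>
      norm (X t) < 1 \<and> (V has_vector_derivative (- (2 * d\<phi> (norm (X t)) / norm (X t))) *\<^sub>R X t) (at t) \<or>
      1 < norm (X t) \<and> (V has_vector_derivative 0) (at t)" by auto
  have "V 0 = v1 - v2"
    using cross_cross_self[of "- \<nu>" "v1 - v2"] \<nu> by (simp add: V0 l_def dot_square_norm)
  define c where "c = (v1 + v2) /\<^sub>R 2"
  define V1 where "V1 t = c + V t /\<^sub>R 2" for t
  define V2 where "V2 t = c - V t /\<^sub>R 2" for t
  define X1 where "X1 t = t *\<^sub>R c + X t /\<^sub>R 2" for t
  define X2 where "X2 t = t *\<^sub>R c - X t /\<^sub>R 2" for t
  have dtc: "((\<lambda>t. t *\<^sub>R c) has_vector_derivative c) (at t within S)" for t S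
    using has_vector_derivative_scaleR[OF DERIV_ident has_vector_derivative_const[of c]] by simp
  have half: "((\<lambda>t. f t /\<^sub>R 2) has_vector_derivative f' /\<^sub>R 2) (at t within S)"
    if "(f has_vector_derivative f') (at t within S)" for f and f' :: "real^3" and t S
    using bounded_linear.has_vector_derivative[OF bounded_linear_scaleR_right that] .
  have h2: "x /\<^sub>R 2 + x /\<^sub>R 2 = x" for x :: "real^3"
    by (simp add: scaleR_left_distrib[symmetric])
  have X12: "X1 t - X2 t = X t" "X2 t - X1 t = - X t" for t
    using h2[of "X t"] by (auto simp: X1_def X2_def algebra_simps)
  have "scattering_solution \<Phi> v1 v2 \<nu> X1 X2 V1 V2"
    unfolding scattering_solution_def
  proof (intro conjI allI impI)
    show "V1 0 = v1" "V2 0 = v2"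
      unfolding V1_def V2_def c_def \<open>V 0 = v1 - v2\<close> by (auto simp: vec_eq_iff field_simps)
    show "X2 0 - X1 0 = \<nu>" by (simp add: X12 X0)
    show "continuous_on {0..} V1" "continuous_on {0..} V2"
      unfolding V1_def V2_def by (intro continuous_intros cV)+
    show "X1 t \<noteq> X2 t" if "0 \<le> t" for t using X(1)[OF that] X12(1)[of t] by auto
    show "(X1 has_vector_derivative V1 t) (at t within {0..})" if "0 \<le> t" for t
      unfolding X1_def[abs_def] V1_def by (intro has_vector_derivative_add dtc half X that)
    show "(X2 has_vector_derivative V2 t) (at t within {0..})" if "0 \<le> t" for t
      unfolding X2_def[abs_def] V2_def by (intro has_vector_derivative_diff dtc half X that)
    show "\<exists>T. finite T \<and> (\<forall>t\<in>{0<..} - T. \<exists>g1 g2.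
        GDERIV \<Phi> (X1 t - X2 t) :> g1 \<and> (V1 has_vector_derivative - g1) (at t) \<and>
        GDERIV \<Phi> (X2 t - X1 t) :> g2 \<and> (V2 has_vector_derivative - g2) (at t))"
    proof (intro exI[of _ "{tmax}"] conjI ballI)
      fix t assume t: "t \<in> {0<..} - {tmax}"
      have nz: "X t \<noteq> 0" using X(1)[of t] t by auto
      let ?g = "if norm (X t) < 1 then (d\<phi> (norm (X t)) / norm (X t)) *\<^sub>R X t else 0"
      have dV': "(V has_vector_derivative (- 2) *\<^sub>R ?g) (at t)"
        using dV[OF t] by auto
      have "GDERIV \<Phi> (X t) :> ?g"
        using gradient_inside[OF nz] gradient_outside[of "X t"] dV[OF t] by auto
      moreover have "GDERIV \<Phi> (- X t) :> - ?g"
        using gradient_inside[of "- X t"] gradient_outside[of "- X t"] dV[OF t] nz by auto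
      moreover have "(V1 has_vector_derivative - ?g) (at t)"
        using has_vector_derivative_add[OF has_vector_derivative_const[of c] half[OF dV']]
        by (simp add: V1_def[abs_def])
      moreover have "(V2 has_vector_derivative - (- ?g)) (at t)"
        using has_vector_derivative_diff[OF has_vector_derivative_const[of c] half[OF dV']]
        by (simp add: V2_def[abs_def])
      ultimately show "\<exists>g1 g2.
        GDERIV \<Phi> (X1 t - X2 t) :> g1 \<and> (V1 has_vector_derivative - g1) (at t) \<and>
        GDERIV \<Phi> (X2 t - X1 t) :> g2 \<and> (V2 has_vector_derivative - g2) (at t)"
        unfolding X12 by blast
    qed simp
  qed
  then show ?thesis by blast
qed

text \<open>An arbitrary solution enters the ball at once, must leave it in bounded time, leaves it
  with the velocity of the explicit orbit, and then moves freely and cannot return. The equations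
  say nothing at exceptional times, so the first exit and a possible first return are obtained from
  compactness.\<close>

lemma scattering_solution_exit:
  assumes sol: "scattering_solution \<Phi> v1 v2 \<nu> X1 X2 V1 V2"
  shows "\<exists>t1. \<forall>t\<ge>t1. V1 t = (v1 + v2) /\<^sub>R 2 + exit_relative_velocity /\<^sub>R 2 \<and>
    V2 t = (v1 + v2) /\<^sub>R 2 - exit_relative_velocity /\<^sub>R 2"
proof -
  define X where "X t = X1 t - X2 t" for t
  define V where "V t = V1 t - V2 t" for t
  define l where "l = cross3 (- \<nu>) (v1 - v2)"
  from sol obtain T where T: "finite T" and eq: "\<And>t. t \<in> {0<..} - T \<Longrightarrow> \<exists>g1 g2.
        GDERIV \<Phi> (X1 t - X2 t) :> g1 \<and> (V1 has_vector_derivative - g1) (at t) \<and>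
        GDERIV \<Phi> (X2 t - X1 t) :> g2 \<and> (V2 has_vector_derivative - g2) (at t)"
    and cV12: "continuous_on {0..} V1" "continuous_on {0..} V2"
    and start: "V1 0 = v1" "V2 0 = v2" "X2 0 - X1 0 = \<nu>"
    and sol': "\<And>t. 0 \<le> t \<Longrightarrow> X1 t \<noteq> X2 t \<and>
        (X1 has_vector_derivative V1 t) (at t within {0..}) \<and>
        (X2 has_vector_derivative V2 t) (at t within {0..})"
    unfolding scattering_solution_def by blast
  have X0: "X 0 = - \<nu>" using start by (simp add: X_def algebra_simps)
  have V0: "V 0 = v1 - v2" using start by (simp add: V_def)
  have nz: "X t \<noteq> 0" if "0 \<le> t" for t using sol'[OF that] by (simp add: X_def)
  have dXw: "(X has_vector_derivative V t) (at t within {0..})" if "0 \<le> t" for t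
    using has_vector_derivative_diff sol'[OF that] unfolding X_def[abs_def] V_def by blast
  have dX: "(X has_vector_derivative V t) (at t)" if "0 < t" for t
    using dXw[of t] that at_within_interior[of t "{0..}"] by simp
  have cX: "continuous_on {0..} X"
    using dXw by (auto simp: continuous_on_eq_continuous_within intro: has_vector_derivative_continuous)
  have cV: "continuous_on {0..} V"
    unfolding V_def by (intro continuous_intros cV12)
  have inside: "(V1 has_vector_derivative - ((d\<phi> (norm (X t)) / norm (X t)) *\<^sub>R X t)) (at t) \<and>
    (V2 has_vector_derivative ((d\<phi> (norm (X t)) / norm (X t)) *\<^sub>R X t)) (at t)"
    if t: "t \<in> {0<..} - T" "norm (X t) < 1" for t
  proof -
    from eq[OF t(1)] obtain g1 g2 where g: "GDERIV \<Phi> (X t) :> g1" "(V1 has_vector_derivative - g1) (at t)"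
      "GDERIV \<Phi> (- X t) :> g2" "(V2 has_vector_derivative - g2) (at t)" by (auto simp: X_def)
    have n: "X t \<noteq> 0" "- X t \<noteq> 0" using nz[of t] t by auto
    have "g1 = (d\<phi> (norm (X t)) / norm (X t)) *\<^sub>R X t"
      using GDERIV_unique[OF g(1) gradient_inside[OF n(1)]] t by simp
    moreover have "g2 = (d\<phi> (norm (X t)) / norm (X t)) *\<^sub>R (- X t)"
      using GDERIV_unique[OF g(3) gradient_inside[OF n(2)]] t by simp
    ultimately show ?thesis using g by simp
  qed
  have outside: "(V1 has_vector_derivative 0) (at t) \<and> (V2 has_vector_derivative 0) (at t)"
    if t: "t \<in> {0<..} - T" "1 < norm (X t)" for t
  proof -
    from eq[OF t(1)] obtain g1 g2 where g: "GDERIV \<Phi> (X t) :> g1" "(V1 has_vector_derivative - g1) (at t)"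
      "GDERIV \<Phi> (- X t) :> g2" "(V2 has_vector_derivative - g2) (at t)" by (auto simp: X_def)
    have "g1 = 0" "g2 = 0"
      using GDERIV_unique[OF g(1) gradient_outside] GDERIV_unique[OF g(3) gradient_outside] t by auto
    then show ?thesis using g by simp
  qed
  have dV: "(V has_vector_derivative (- (2 * d\<phi> (norm (X t)) / norm (X t))) *\<^sub>R X t) (at t)"
    if t: "t \<in> {0<..} - T" "norm (X t) < 1" for t
  proof -
    have "- (a *\<^sub>R x) - a *\<^sub>R x = (- (2 * a)) *\<^sub>R x" for a and x :: "real^3"
      by (simp add: vec_eq_iff)
    then show ?thesis
      using has_vector_derivative_diff[OF conjunct1[OF inside[OF t]] conjunct2[OF inside[OF t]]]
      unfolding V_def[abs_def] times_divide_eq_right[symmetric] by metis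
  qed
  have init: "norm (X 0) = 1" "X 0 \<bullet> V 0 = - w * qmax" "norm (V 0) = w"
    using \<nu> rel by (auto simp: X0 V0)
  note motion = continuous_on_subset[OF cX] continuous_on_subset[OF cV] dX dV nz init
  \<comment> \<open>The initial radial velocity is \<open>- w * qmax\<close>, which is
    negative.\<close>
  have early: "\<exists>d>0. \<forall>t\<in>{0<..<d}. norm (X t) < 1"
  proof -
    have "((\<lambda>t. X t \<bullet> X t) has_real_derivative (X 0 \<bullet> V 0 + V 0 \<bullet> X 0)) (at 0 within {0..})"
      using bounded_bilinear.has_vector_derivative[OF bounded_bilinear_inner dXw[of 0] dXw[of 0]]
      by (simp add: has_real_derivative_iff_has_vector_derivative)
    moreover have "X 0 \<bullet> V 0 + V 0 \<bullet> X 0 < 0"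
      using init(2) w qmax by (simp add: inner_commute)
    ultimately obtain d where d: "d > 0" "\<And>h. 0 < h \<Longrightarrow> 0 + h \<in> {0..} \<Longrightarrow> h < d \<Longrightarrow> X (0 + h) \<bullet> X (0 + h) < X 0 \<bullet> X 0"
      using has_real_derivative_neg_dec_right by blast
    show ?thesis
    proof (intro exI[of _ d] conjI ballI d(1))
      fix t assume "t \<in> {0<..<d}"
      then have "(norm (X t))\<^sup>2 < 1" using d(2)[of t] init(1) by (simp add: dot_square_norm)
      then show "norm (X t) < 1" by (simp add: abs_square_less_1)
    qed
  qed
  then obtain d where d: "d > 0" "\<And>t. t \<in> {0<..<d} \<Longrightarrow> norm (X t) < 1" by blast
  have "\<exists>t>0. 1 \<le> norm (X t)"
  proof (rule ccontr)
    assume "\<not> ?thesis"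
    then have in1: "norm (X t) < 1" if "0 < t" for t using that by (auto simp: not_le)
    \<comment> \<open>Within this time \<open>q\<close> would increase by 3, although its range has
      length \<open>2 * qmax\<close>, which is less than 2.\<close>
    let ?t = "3 / (w * \<rho>\<^sup>2)"
    have t: "0 < ?t" using w \<rho> by simp
    have "- qmax + w * \<rho>\<^sup>2 * ?t \<le> q X V ?t"
      by (rule q_increase[OF T t]) (use motion in1 t in auto)
    moreover have "q X V ?t \<in> {-qmax..qmax}"
      by (rule q_bounds[OF T t]) (use motion in1 t in auto)
    moreover have "w * \<rho>\<^sup>2 * ?t = 3" using w \<rho> by simp
    ultimately show False using qmax by auto
  qed
  then obtain t0 where t0: "0 < t0" "1 \<le> norm (X t0)" by blast
  \<comment> \<open>The interval starts at \<open>d / 2\<close> instead of 0, because the starting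
    point itself has norm 1 and would be the minimum.\<close>
  define K where "K = {d/2..t0} \<inter> (\<lambda>t. norm (X t)) -` {1..}"
  have "closed K"
    unfolding K_def using d
    by (intro continuous_closed_preimage continuous_on_norm continuous_on_subset[OF cX]) auto
  then have "compact K"
    using compact_Int_closed[of "{d/2..t0}" K] by (simp add: K_def Int_absorb1)
  moreover have "t0 \<in> K"
    using t0 d(2)[of t0] by (auto simp: K_def not_less[symmetric])
  ultimately obtain t1 where t1: "t1 \<in> K" "\<And>t. t \<in> K \<Longrightarrow> t1 \<le> t"
    using compact_attains_inf[of K] by auto
  have pos: "0 < t1" using t1(1) d(1) by (auto simp: K_def)
  have before: "norm (X t) < 1" if t: "t \<in> {0<..<t1}" for t
  proof (cases "t < d")
    case True then show ?thesis using d(2) t by auto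
  next
    case False
    then have "t \<notin> K" using t1(2)[of t] t by auto
    moreover have "d/2 \<le> t" "t \<le> t0" using False d(1) t t1(1) by (auto simp: K_def)
    ultimately show ?thesis by (auto simp: K_def)
  qed
  have le: "norm (X t1) \<le> 1"
    by (rule inside_le[OF T pos]) (use motion before pos in auto)
  then have one: "norm (X t1) = 1" using t1(1) by (auto simp: K_def)
  have exit: "V t1 = (w * qmax) *\<^sub>R frame (L X V) (X 0) (ang qmax) + cross3 (L X V) (frame (L X V) (X 0) (ang qmax))"
    "X t1 \<bullet> V t1 = w * qmax"
    by (rule exit_velocity[OF T pos]; (use motion before pos one in auto))+
  have Lr: "L X V = l"
    by (subst L_def[OF T pos]; (use motion before pos in \<open>auto simp: X0 V0 l_def\<close>))
  have Vt1: "V t1 = exit_relative_velocity"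
    using exit by (simp add: exit_relative_velocity_def Lr X0 l_def Let_def)
  have dist_growth: "1 < norm (X t1 + u *\<^sub>R V t1)" if "0 < u" for u
  proof -
    have "(X t1 + u *\<^sub>R V t1) \<bullet> (X t1 + u *\<^sub>R V t1)
        = X t1 \<bullet> X t1 + 2 * u * (X t1 \<bullet> V t1) + u\<^sup>2 * (V t1 \<bullet> V t1)"
      by (simp add: inner_add_left inner_add_right inner_commute power2_eq_square algebra_simps)
    moreover have "0 < 2 * u * (X t1 \<bullet> V t1)" using that w qmax exit(2) by simp
    moreover have "0 \<le> u\<^sup>2 * (V t1 \<bullet> V t1)" by simp
    moreover have "X t1 \<bullet> X t1 = 1" using one by (simp add: dot_square_norm)
    ultimately have "1 < (norm (X t1 + u *\<^sub>R V t1))\<^sup>2" unfolding dot_square_norm[symmetric] by linarith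
    then show ?thesis by (simp add: one_less_power power2_eq_square) (metis abs_norm_cancel abs_square_le_1 not_less power2_eq_square)
  qed
  have "((\<lambda>t. X t \<bullet> X t) has_real_derivative (X t1 \<bullet> V t1 + V t1 \<bullet> X t1)) (at t1)"
    by (intro has_real_derivative_inner dX pos)
  moreover have "0 < X t1 \<bullet> V t1 + V t1 \<bullet> X t1"
    using exit(2) w qmax by (simp add: inner_commute)
  ultimately obtain e where e: "e > 0" "\<And>h. 0 < h \<Longrightarrow> h < e \<Longrightarrow> X t1 \<bullet> X t1 < X (t1 + h) \<bullet> X (t1 + h)"
    using DERIV_pos_inc_right by blast
  \<comment> \<open>Up to a first return time \<open>t2\<close> the motion is outside the ball,
    hence free, and a free motion with this exit velocity is outside the ball at \<open>t2\<close>
    as well. Again \<open>K2\<close> stays away from \<open>t1\<close>, where the norm is 1.\<close>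
  have after: "1 < norm (X t)" if "t1 < t" for t
  proof (rule ccontr)
    assume no: "\<not> 1 < norm (X t)"
    define K2 where "K2 = {t1 + e/2..t} \<inter> (\<lambda>t. norm (X t)) -` {..1}"
    have near: "1 < norm (X s)" if "t1 < s" "s < t1 + e" for s
    proof -
      have "1 < (norm (X s))\<^sup>2"
        using e(2)[of "s - t1"] that one by (simp add: dot_square_norm)
      then show ?thesis by (metis abs_norm_cancel abs_square_le_1 not_less)
    qed
    have "closed K2"
      unfolding K2_def using e pos
      by (intro continuous_closed_preimage continuous_on_norm continuous_on_subset[OF cX]) auto
    then have "compact K2"
      using compact_Int_closed[of "{t1 + e/2..t}" K2] by (simp add: K2_def Int_absorb1)
    moreover have "t \<in> K2"
      using no near[of t] that e(1) by (auto simp: K2_def not_less[symmetric])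
    ultimately obtain t2 where t2: "t2 \<in> K2" "\<And>s. s \<in> K2 \<Longrightarrow> t2 \<le> s"
      using compact_attains_inf[of K2] by auto
    have t12: "t1 < t2" "norm (X t2) \<le> 1" using t2(1) e(1) by (auto simp: K2_def)
    have out: "1 < norm (X s)" if s: "s \<in> {t1<..<t2}" for s
    proof (cases "s < t1 + e")
      case True then show ?thesis using near s by auto
    next
      case False
      then have "s \<notin> K2" using t2(2)[of s] s by auto
      moreover have "t1 + e/2 \<le> s" "s \<le> t" using False e(1) s t2(1) by (auto simp: K2_def)
      ultimately show ?thesis by (auto simp: K2_def)
    qed
    have Vc: "V s = V t1" if "s \<in> {t1..t2}" for s
    proof (rule constant_if_derivative_zero[where f=V and b=t2, OF T])
      fix u assume u: "u \<in> {t1<..<t2} - T"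
      have "(V1 has_vector_derivative 0) (at u) \<and> (V2 has_vector_derivative 0) (at u)"
        by (rule outside) (use u pos out in auto)
      then show "(V has_vector_derivative 0) (at u)"
        using has_vector_derivative_diff[of V1 0 "at u" V2 0] by (simp add: V_def[abs_def])
    qed (use that pos in \<open>auto intro!: continuous_on_subset[OF cV]\<close>)
    have "X t2 - (t2 - t1) *\<^sub>R V t1 = X t1 - (t1 - t1) *\<^sub>R V t1"
    proof (rule constant_if_derivative_zero[where f="\<lambda>s. X s - (s - t1) *\<^sub>R V t1" and b=t2, OF T])
      show "continuous_on {t1..t2} (\<lambda>s. X s - (s - t1) *\<^sub>R V t1)"
        using pos by (intro continuous_intros continuous_on_subset[OF cX]) auto
      fix u assume u: "u \<in> {t1<..<t2} - T"
      have "((\<lambda>t. t - t1) has_real_derivative 1) (at u)" by (auto intro!: derivative_eq_intros)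
      from has_vector_derivative_diff[OF dX[of u] has_vector_derivative_scaleR[OF this has_vector_derivative_const[of "V t1"]]]
      show "((\<lambda>s. X s - (s - t1) *\<^sub>R V t1) has_vector_derivative 0) (at u)"
        using u pos Vc[of u] by auto
    qed (use t12 in auto)
    then have "X t2 = X t1 + (t2 - t1) *\<^sub>R V t1" by (simp add: algebra_simps)
    with dist_growth[of "t2 - t1"] t12 show False by simp
  qed
  have const: "V1 t = V1 t1 \<and> V2 t = V2 t1" if t: "t1 \<le> t" for t
  proof -
    have d: "(V1 has_vector_derivative 0) (at u) \<and> (V2 has_vector_derivative 0) (at u)"
      if "u \<in> {t1<..<t} - T" for u
      by (rule outside) (use that pos after in auto)
    have "V1 t = V1 t1"
      by (rule constant_if_derivative_zero[where f=V1 and b=t, OF T continuous_on_subset[OF cV12(1)]])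
        (use d t pos in auto)
    moreover have "V2 t = V2 t1"
      by (rule constant_if_derivative_zero[where f=V2 and b=t, OF T continuous_on_subset[OF cV12(2)]])
        (use d t pos in auto)
    ultimately show ?thesis by simp
  qed
  \<comment> \<open>Conservation of momentum: the gradients at opposite points are opposite. Sum and
    difference then determine both velocities.\<close>
  have "V1 t1 + V2 t1 = V1 0 + V2 0"
  proof (rule constant_if_derivative_zero[where f="\<lambda>t. V1 t + V2 t" and b=t1, OF T])
    show "continuous_on {0..t1} (\<lambda>t. V1 t + V2 t)"
      by (intro continuous_intros continuous_on_subset[OF cV12(1)] continuous_on_subset[OF cV12(2)]) auto
    fix u assume u: "u \<in> {0<..<t1} - T"
    then have u': "u \<in> {0<..} - T" "norm (X u) < 1" using before by auto
    show "((\<lambda>t. V1 t + V2 t) has_vector_derivative 0) (at u)"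
      using has_vector_derivative_add[OF conjunct1[OF inside[OF u']] conjunct2[OF inside[OF u']]] by simp
  qed (use pos in auto)
  then have sum: "V1 t1 + V2 t1 = v1 + v2" by (simp add: start)
  have dif: "V1 t1 - V2 t1 = exit_relative_velocity" using Vt1 by (simp add: V_def)
  have "V1 t1 = (v1 + v2) /\<^sub>R 2 + exit_relative_velocity /\<^sub>R 2"
    "V2 t1 = (v1 + v2) /\<^sub>R 2 - exit_relative_velocity /\<^sub>R 2"
    unfolding sum[symmetric] dif[symmetric] by (auto simp: vec_eq_iff field_simps)
  with const show ?thesis by auto
qed

text \<open>The velocities of every solution are eventually constant with the same value, and a
  solution exists; so the definite description is met by exactly one pair.\<close>

lemma outgoing_velocities_eq:
  "outgoing_velocities \<Phi> v1 v2 \<nu> =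
    ((v1 + v2) /\<^sub>R 2 + exit_relative_velocity /\<^sub>R 2, (v1 + v2) /\<^sub>R 2 - exit_relative_velocity /\<^sub>R 2)"
  (is "_ = (?u1, ?u2)")
proof -
  have lim: "(V1 \<longlongrightarrow> ?u1) at_top \<and> (V2 \<longlongrightarrow> ?u2) at_top"
    if s: "scattering_solution \<Phi> v1 v2 \<nu> X1 X2 V1 V2" for X1 X2 V1 V2
  proof -
    obtain t1 where t1: "\<And>t. t \<ge> t1 \<Longrightarrow> V1 t = ?u1 \<and> V2 t = ?u2"
      using scattering_solution_exit[OF s] by blast
    show ?thesis
      by (intro conjI tendsto_eventually eventually_mono[OF eventually_ge_at_top[of t1]]) (use t1 in auto)
  qed
  show ?thesis
    unfolding outgoing_velocities_def
  proof (rule the_equality)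
    show "\<exists>X1 X2 V1 V2. scattering_solution \<Phi> v1 v2 \<nu> X1 X2 V1 V2 \<and>
        (V1 \<longlongrightarrow> fst (?u1, ?u2)) at_top \<and> (V2 \<longlongrightarrow> snd (?u1, ?u2)) at_top"
      using scattering_solution_exists lim by fastforce
    fix u assume "\<exists>X1 X2 V1 V2. scattering_solution \<Phi> v1 v2 \<nu> X1 X2 V1 V2 \<and>
        (V1 \<longlongrightarrow> fst u) at_top \<and> (V2 \<longlongrightarrow> snd u) at_top"
    then obtain X1 X2 V1 V2 where s: "scattering_solution \<Phi> v1 v2 \<nu> X1 X2 V1 V2"
      "(V1 \<longlongrightarrow> fst u) at_top" "(V2 \<longlongrightarrow> snd u) at_top" by blast
    then have "fst u = ?u1" "snd u = ?u2"
      using lim[OF s(1)] tendsto_unique[OF trivial_limit_at_top_linorder] by blast+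
    then show "u = (?u1, ?u2)" by (simp add: prod_eq_iff)
  qed
qed

end

section \<open>The polar angle of the orbit and the deflection\<close>

lemma rad_0: "rad 0 = apsis \<kappa> \<rho>"
  using apsis_eq[OF repulsive \<rho>(1)] apsis_pos[OF repulsive \<rho>(1)] qmax
  by (intro rad_eqI) (auto simp: U_def)

lemma apsis_less_1: "apsis \<kappa> \<rho> < 1"
  using rad_less_1[of 0] qmax by (simp add: rad_0)

text \<open>The range \<open>x < apsis\<close> corresponds to \<open>r > 1\<close>, where the
  potential vanishes. The path is a straight line there, and from the sphere to infinity it sweeps
  the angle \<open>arcsin \<rho>\<close>.\<close>

lemma half_angle_outer:
  "(half_angle_integrand \<kappa> \<rho> has_integral arcsin \<rho>) {0..apsis \<kappa> \<rho>}"
proof -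
  let ?r = "apsis \<kappa> \<rho>"
  have r: "0 < ?r" "?r < 1" "\<rho> \<le> ?r"
    using apsis_pos[OF repulsive \<rho>(1)] apsis_less_1 apsis_ge[OF repulsive \<rho>(1)] by auto
  have int: "((\<lambda>x. (\<rho> / ?r) / sqrt (1 - (\<rho> * x / ?r)\<^sup>2)) has_integral
      (arcsin (\<rho> * ?r / ?r) - arcsin (\<rho> * 0 / ?r))) {0..?r}"
  proof (rule fundamental_theorem_of_calculus)
    fix x assume x: "x \<in> {0..?r}"
    have "\<rho> * x / ?r \<le> \<rho>" "0 \<le> \<rho> * x / ?r" using x r \<rho> by (auto simp: divide_le_eq mult_left_mono)
    then have "(arcsin has_real_derivative inverse (sqrt (1 - (\<rho> * x / ?r)\<^sup>2))) (at (\<rho> * x / ?r))"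
      using \<rho> by (intro DERIV_arcsin) auto
    moreover have "((\<lambda>x. \<rho> * x / ?r) has_real_derivative \<rho> / ?r) (at x)"
      using r by (auto intro!: derivative_eq_intros)
    ultimately have "((\<lambda>x. arcsin (\<rho> * x / ?r)) has_real_derivative
        inverse (sqrt (1 - (\<rho> * x / ?r)\<^sup>2)) * (\<rho> / ?r)) (at x)"
      by (rule DERIV_chain2)
    then have "((\<lambda>x. arcsin (\<rho> * x / ?r)) has_real_derivative (\<rho> / ?r) / sqrt (1 - (\<rho> * x / ?r)\<^sup>2)) (at x)"
      by (simp add: divide_inverse mult.commute)
    then show "((\<lambda>x. arcsin (\<rho> * x / ?r)) has_vector_derivative (\<rho> / ?r) / sqrt (1 - (\<rho> * x / ?r)\<^sup>2)) (at x within {0..?r})"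
      unfolding has_real_derivative_iff_has_vector_derivative by (rule has_vector_derivative_at_within)
  qed (use r in auto)
  have eq: "(\<rho> / ?r) / sqrt (1 - (\<rho> * x / ?r)\<^sup>2) = half_angle_integrand \<kappa> \<rho> x" if "x \<in> {0<..<?r}" for x
  proof -
    have "\<kappa> (?r / x) = 0" using that r by (simp add: \<kappa>_def vanish)
    moreover have "\<kappa> ?r = 1 - \<rho>\<^sup>2 / ?r\<^sup>2" using apsis_eq[OF repulsive \<rho>(1)] by linarith
    ultimately have "1 - x\<^sup>2 + (\<kappa> ?r - \<kappa> (?r / x)) * ?r\<^sup>2 / \<rho>\<^sup>2 = (1 - (\<rho> * x / ?r)\<^sup>2) / (\<rho> / ?r)\<^sup>2"
      using r \<rho> by (simp add: field_simps power2_eq_square)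
    then show ?thesis
      using r \<rho> by (simp add: half_angle_integrand_def real_sqrt_divide)
  qed
  have "((\<lambda>x. (\<rho> / ?r) / sqrt (1 - (\<rho> * x / ?r)\<^sup>2)) has_integral arcsin \<rho>) {0<..<?r}"
    using int r by (simp add: has_integral_Icc_iff_Ioo)
  then have "(half_angle_integrand \<kappa> \<rho> has_integral arcsin \<rho>) {0<..<?r}"
    by (rule has_integral_eq[rotated]) (use eq in auto)
  then show ?thesis by (simp add: has_integral_Icc_iff_Ioo)
qed

lemma rad_uminus [simp]: "rad (- p) = rad p"
  by (simp add: rad_def)

lemma acc_uminus [simp]: "acc (- p) = acc p"
  by (simp add: acc_def)

text \<open>The substitution \<open>x = apsis / rad p\<close> with \<open>p\<close> from 0 to
  \<open>qmax\<close> runs through the outgoing half of the orbit in the ball. \<open>rad\<close>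
  and \<open>acc\<close> are even, so this half contributes half of the polar angle.\<close>

lemma half_angle_inner:
  "(half_angle_integrand \<kappa> \<rho> has_integral ang qmax / 2) {apsis \<kappa> \<rho>..1}"
proof -
  let ?r = "apsis \<kappa> \<rho>" and ?a = "\<lambda>p. w * \<rho> / (rad p)\<^sup>2 / acc p"
  let ?S = "{0<..<qmax}"
  define g where "g p = ?r / rad p" for p
  define g' where "g' p = 2 * ?r * p / ((rad p)\<^sup>2 * dU (rad p))" for p
  have r: "0 < ?r" "?r < 1" using apsis_pos[OF repulsive \<rho>(1)] apsis_less_1 by auto
  have S: "p \<in> {-qmax..qmax}" "p \<in> {-qmax<..<qmax}" if "p \<in> ?S" for p using that by auto
  have rp: "0 < rad p" if "p \<in> ?S" for p using rad(1)[OF S(1)[OF that]] .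
  have dU: "dU (rad p) < 0" if "p \<in> ?S" for p
    using dU_le[OF rad(1,2)[OF S(1)[OF that]]] \<rho> by (smt (verit) zero_less_power)
  have ca: "continuous_on {-qmax..qmax} ?a"
    using rad(1) acc_pos by (force intro!: continuous_intros continuous_on_rad continuous_on_acc)
  have inta: "?a integrable_on {-qmax..qmax}" using ca by (rule integrable_continuous_real)
  have der: "(g has_field_derivative g' p) (at p within ?S)" if "p \<in> ?S" for p
  proof -
    have "(g has_real_derivative - (- 2 * p / dU (rad p) * inverse ((rad p)\<^sup>2)) * ?r) (at p)"
      using DERIV_cmult_right[OF DERIV_inverse_fun[OF rad_deriv[OF S(2)[OF that]]], of ?r] rp[OF that]
      by (simp add: g_def[abs_def] divide_inverse mult.commute numeral_2_eq_2)
    then have "(g has_real_derivative g' p) (at p)"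
      by (simp add: g'_def divide_inverse mult_ac)
    then show ?thesis by (rule has_field_derivative_at_within)
  qed
  have inj: "inj_on g ?S"
  proof (rule inj_onI)
    fix p p' assume p: "p \<in> ?S" "p' \<in> ?S" "g p = g p'"
    then have "rad p = rad p'" using r rp[OF p(1)] rp[OF p(2)] by (simp add: g_def field_simps)
    then have "p\<^sup>2 = p'\<^sup>2" using rad(3)[OF S(1)[OF p(1)]] rad(3)[OF S(1)[OF p(2)]] by simp
    then show "p = p'" using p by (simp add: power2_eq_iff)
  qed
  have U0: "U ?r = 1" using rad(3)[of 0] qmax by (simp add: rad_0)
  have img: "g ` ?S = {?r<..<1}"
  proof (intro equalityI subsetI)
    fix x assume "x \<in> g ` ?S"
    then obtain p where p: "p \<in> ?S" "x = g p" by auto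
    have "U (rad p) < U ?r" using rad(3)[OF S(1)[OF p(1)]] U0 p(1) by simp
    then have "?r < rad p"
      using U_strict_antimono[of "rad p" ?r] rp[OF p(1)] r by (cases "rad p" ?r rule: linorder_cases) auto
    then show "x \<in> {?r<..<1}"
      using p rad_less_1[OF S(2)[OF p(1)]] r rp[OF p(1)]
      by (simp add: g_def pos_less_divide_eq pos_divide_less_eq)
  next
    fix x assume x: "x \<in> {?r<..<1}"
    then have x0: "0 < x" using r by auto
    define R where "R = ?r / x"
    have R: "?r < R" "R < 1" using x x0 r by (auto simp: R_def field_simps)
    have U: "\<rho>\<^sup>2 < U R" "U R < 1" using U_strict_antimono[of R 1] U_strict_antimono[of ?r R] R r U0 by auto
    define p where "p = sqrt (1 - U R)"
    have p: "0 < p" "p < qmax" "p\<^sup>2 = 1 - U R" using U by (auto simp: p_def qmax_def)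
    then have "rad p = R" using R r by (intro rad_eqI) auto
    then have "g p = x" using x0 r by (simp add: g_def R_def)
    then show "x \<in> g ` ?S" using p by (intro image_eqI[of _ _ p]) auto
  qed
  have eq: "\<bar>g' p\<bar> * half_angle_integrand \<kappa> \<rho> (g p) = ?a p" if p: "p \<in> ?S" for p
  proof -
    have rr: "?r / g p = rad p" using r rp[OF p] by (simp add: g_def)
    \<comment> \<open>The radicand becomes the perfect square
      \<open>(p * ?r / \<rho>)\<^sup>2\<close>; its zero at \<open>p = 0\<close> cancels against the
      factor \<open>p\<close> of the Jacobian \<open>g'\<close>.\<close>
    have "p\<^sup>2 = U ?r - U (rad p)" using rad(3)[OF S(1)[OF p]] U0 by simp
    also have "\<dots> = \<rho>\<^sup>2 / ?r\<^sup>2 * (1 - (g p)\<^sup>2) + (\<kappa> ?r - \<kappa> (rad p))"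
      using r rp[OF p] by (simp add: U_def g_def field_simps power2_eq_square)
    finally have "1 - (g p)\<^sup>2 + (\<kappa> ?r - \<kappa> (rad p)) * ?r\<^sup>2 / \<rho>\<^sup>2 = (p * ?r / \<rho>)\<^sup>2"
      using r \<rho> by (simp add: field_simps power2_eq_square)
    then have "half_angle_integrand \<kappa> \<rho> (g p) = \<rho> / (p * ?r)"
      using p r \<rho> by (simp add: half_angle_integrand_def rr)
    moreover have "\<bar>g' p\<bar> = 2 * ?r * p / ((rad p)\<^sup>2 * - dU (rad p))"
      using p r rp[OF p] dU[OF p] by (simp add: g'_def abs_mult abs_divide)
    ultimately have "\<bar>g' p\<bar> * half_angle_integrand \<kappa> \<rho> (g p)
        = 2 * ?r * p / ((rad p)\<^sup>2 * - dU (rad p)) * (\<rho> / (p * ?r))" by simp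
    also have "\<dots> = ?a p"
      using p r rp[OF p] dU[OF p] w by (simp add: acc_def field_simps)
    finally show ?thesis .
  qed
  have "?a absolutely_integrable_on {0..qmax}"
    by (rule absolutely_integrable_continuous_real) (rule continuous_on_subset[OF ca], use qmax in auto)
  then have "?a absolutely_integrable_on ?S"
    by (rule set_integrable_subset) auto
  then have "(\<lambda>p. \<bar>g' p\<bar> * half_angle_integrand \<kappa> \<rho> (g p)) absolutely_integrable_on ?S"
    by (rule absolutely_integrable_spike[where S="{}"]) (use eq in auto)
  moreover have "integral ?S (\<lambda>p. \<bar>g' p\<bar> * half_angle_integrand \<kappa> \<rho> (g p)) = integral ?S ?a"
    by (rule integral_cong) (use eq in auto)
  ultimately have "half_angle_integrand \<kappa> \<rho> absolutely_integrable_on {?r<..<1} \<and>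
      integral {?r<..<1} (half_angle_integrand \<kappa> \<rho>) = integral ?S ?a"
    using has_absolute_integral_change_of_variables_1'[of ?S g g' "half_angle_integrand \<kappa> \<rho>" "integral ?S ?a"]
      der inj img by auto
  then have "(half_angle_integrand \<kappa> \<rho> has_integral integral ?S ?a) {?r<..<1}"
    using absolutely_integrable_on_def has_integral_iff by blast
  moreover have "integral ?S ?a = ang qmax / 2"
  proof -
    have i0: "(?a has_integral integral {0..qmax} ?a) {0..qmax}"
      by (rule integrable_integral, rule integrable_subinterval_real[OF inta]) (use qmax in auto)
    then have "((\<lambda>p. ?a (- p)) has_integral integral {0..qmax} ?a) {-qmax..-0}"
      by (subst has_integral_reflect_real) simp
    then have "(?a has_integral integral {0..qmax} ?a) {-qmax..0}" by simp
    from has_integral_combine[OF _ _ this i0] have "ang qmax = integral {0..qmax} ?a + integral {0..qmax} ?a"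
      unfolding ang_def using qmax by (intro integral_unique) auto
    moreover have "integral ?S ?a = integral {0..qmax} ?a"
      using i0 by (intro integral_unique) (simp add: has_integral_Icc_iff_Ioo)
    ultimately show ?thesis by simp
  qed
  ultimately show ?thesis by (simp only: has_integral_Icc_iff_Ioo)
qed

text \<open>The half angle is measured from the apsis to infinity, \<open>ang\<close> only within
  the ball; on each side the free part \<open>arcsin \<rho>\<close> is missing.\<close>

lemma ang_qmax: "ang qmax = 2 * (half_angle \<kappa> \<rho> - arcsin \<rho>)"
proof -
  have "(half_angle_integrand \<kappa> \<rho> has_integral (arcsin \<rho> + ang qmax / 2)) {0..1}"
    by (rule has_integral_combine[OF _ _ half_angle_outer half_angle_inner])
      (use apsis_pos[OF repulsive \<rho>(1)] apsis_less_1 in auto)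
  then have "integral {0<..<1} (half_angle_integrand \<kappa> \<rho>) = arcsin \<rho> + ang qmax / 2"
    by (intro integral_unique) (simp add: has_integral_Icc_iff_Ioo)
  then show ?thesis
    using set_borel_integral_eq_integral(2)[OF set_integrable_half_angle[OF repulsive \<rho>(1)]]
    by (simp add: half_angle_def)
qed

lemma cos_sin_deflection:
  "cos (deflection \<kappa> \<rho>) = - cos (ang qmax + 2 * arcsin \<rho>)"
  "sin (deflection \<kappa> \<rho>) = sin (ang qmax + 2 * arcsin \<rho>)"
  by (simp_all add: ang_qmax deflection_def algebra_simps)

text \<open>The orbit is described from the entry point \<open>- \<nu>\<close>, the deflection from
  the incoming direction. The two descriptions differ by the angle \<open>arcsin \<rho>\<close> at
  entry and at exit, and \<open>\<nu> - qmax *\<^sub>R \<eta>\<close> is orthogonal to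
  \<open>\<eta>\<close> with norm \<open>\<rho>\<close>.\<close>

lemma exit_velocity_deflection:
  fixes v1 v2 \<nu> :: "real ^ 3"
  assumes rel: "norm (v1 - v2) = w" and \<nu>: "norm \<nu> = 1" "\<nu> \<bullet> (v1 - v2) = w * qmax"
  shows "exit_relative_velocity v1 v2 \<nu> = w *\<^sub>R
    (cos (deflection \<kappa> \<rho>) *\<^sub>R ((v1 - v2) /\<^sub>R w) -
     (sin (deflection \<kappa> \<rho>) / \<rho>) *\<^sub>R (\<nu> - qmax *\<^sub>R ((v1 - v2) /\<^sub>R w)))"
proof -
  define \<eta> where "\<eta> = (v1 - v2) /\<^sub>R w"
  have z: "v1 - v2 = w *\<^sub>R \<eta>" using w by (simp add: \<eta>_def)
  define A where "A = ang qmax"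
  define l where "l = cross3 (- \<nu>) (v1 - v2)"
  have la: "cross3 l (- \<nu>) = w *\<^sub>R (\<eta> - qmax *\<^sub>R \<nu>)"
    using cross_cross_self[of "- \<nu>" "v1 - v2"] \<nu>
    by (simp add: l_def dot_square_norm scaleR_diff_right z[symmetric])
  note ls = angular_momentum_start[OF \<nu>(1) rel \<nu>(2), folded l_def]
  have cs: "cos (arcsin \<rho>) = qmax" "sin (arcsin \<rho>) = \<rho>" "qmax * qmax = 1 - \<rho> * \<rho>"
    using \<rho> qmax by (auto simp: cos_arcsin qmax_def power2_eq_square)
  have "exit_relative_velocity v1 v2 \<nu> = (w * qmax) *\<^sub>R frame l (- \<nu>) A + cross3 l (frame l (- \<nu>) A)"
    by (subst exit_relative_velocity_def[where \<Phi>="\<lambda>x. \<phi> (norm x)"]) (use rel \<nu> in \<open>auto simp: A_def l_def Let_def\<close>)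
  also have "\<dots> = w *\<^sub>R ((qmax * sin A / \<rho> + cos A) *\<^sub>R \<eta>
      + (- qmax * cos A + \<rho> * sin A - qmax * (qmax * sin A / \<rho> + cos A)) *\<^sub>R \<nu>)"
    unfolding cross_frame[OF ls] unfolding frame_def la
    using w \<rho> by (simp add: vec_eq_iff field_simps)
  also have "\<dots> = w *\<^sub>R ((- cos (A + 2 * arcsin \<rho>) + sin (A + 2 * arcsin \<rho>) * qmax / \<rho>) *\<^sub>R \<eta>
      + (- sin (A + 2 * arcsin \<rho>) / \<rho>) *\<^sub>R \<nu>)"
  proof -
    \<comment> \<open>Both are polynomial identities modulo
      \<open>qmax * qmax = 1 - \<rho> * \<rho>\<close>, with the addition formulas for
      \<open>A + 2 * arcsin \<rho>\<close> written out.\<close>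
    have id1: "\<rho> * cos A + qmax * sin A = - \<rho> * (cos A * (qmax * qmax - \<rho> * \<rho>) - sin A * (2 * \<rho> * qmax))
        + (sin A * (qmax * qmax - \<rho> * \<rho>) + cos A * (2 * \<rho> * qmax)) * qmax"
      and id2: "\<rho> * (- qmax * cos A + \<rho> * sin A) - qmax * (\<rho> * cos A + qmax * sin A)
        = - (sin A * (qmax * qmax - \<rho> * \<rho>) + cos A * (2 * \<rho> * qmax))"
      using cs(3) by algebra+
    have d: "cos (A + 2 * arcsin \<rho>) = cos A * (qmax * qmax - \<rho> * \<rho>) - sin A * (2 * \<rho> * qmax)"
      "sin (A + 2 * arcsin \<rho>) = sin A * (qmax * qmax - \<rho> * \<rho>) + cos A * (2 * \<rho> * qmax)"
      by (simp_all add: cos_add sin_add cos_double sin_double cs power2_eq_square)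
    have "qmax * sin A / \<rho> + cos A = (\<rho> * cos A + qmax * sin A) / \<rho>"
      using \<rho> by (simp add: field_simps)
    also have "\<dots> = - cos (A + 2 * arcsin \<rho>) + sin (A + 2 * arcsin \<rho>) * qmax / \<rho>"
      unfolding id1 d[symmetric] using \<rho> by (simp add: field_simps)
    finally have e1: "qmax * sin A / \<rho> + cos A = - cos (A + 2 * arcsin \<rho>) + sin (A + 2 * arcsin \<rho>) * qmax / \<rho>" .
    have "- qmax * cos A + \<rho> * sin A - qmax * (qmax * sin A / \<rho> + cos A)
        = (\<rho> * (- qmax * cos A + \<rho> * sin A) - qmax * (\<rho> * cos A + qmax * sin A)) / \<rho>"
      using \<rho> by (simp add: field_simps)
    also have "\<dots> = - sin (A + 2 * arcsin \<rho>) / \<rho>"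
      unfolding id2 d[symmetric] ..
    finally show ?thesis using e1 by simp
  qed
  finally show ?thesis
    unfolding cos_sin_deflection A_def[symmetric] \<eta>_def[symmetric]
    by (simp add: vec_eq_iff algebra_simps)
qed

end

section \<open>Coordinates on the sphere\<close>

lemma vec3_measurable: "(\<lambda>(a, b, c). vector [a, b, c] :: real ^ 3) \<in> borel_measurable borel"
proof -
  have "(\<lambda>(a, b, c). vector [a, b, c] :: real ^ 3)
      = (\<lambda>p. \<chi> i. if i = 1 then fst p else if i = 2 then fst (snd p) else snd (snd p))"
    by (auto simp: fun_eq_iff vec_eq_iff forall_3)
  moreover have "continuous_on UNIV (\<lambda>p::real \<times> real \<times> real. if i = 1 then fst p else if i = 2 then fst (snd p) else snd (snd p))"
    for i :: 3 by (cases "i = 1"; cases "i = 2"; auto intro!: continuous_intros)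
  ultimately show ?thesis
    by (simp add: borel_measurable_continuous_onI continuous_on_vec_lambda)
qed

text \<open>Identifies volume in \<open>real ^ 3\<close> with the product measure on triples, so
  that the radial coordinate of the cone chart can be split off. Comparison on boxes
  suffices.\<close>

lemma lborel_vec3: "lborel = distr lborel borel (\<lambda>(a, b, c). vector [a, b, c] :: real ^ 3)"
  (is "_ = distr _ _ ?v")
proof (rule lborel_eqI)
  note meas = vec3_measurable
  fix l u :: "real ^ 3" assume le: "\<And>b. b \<in> Basis \<Longrightarrow> l \<bullet> b \<le> u \<bullet> b"
  have le': "l $ i \<le> u $ i" for i using le[of "axis i 1"] by (simp add: inner_axis)
  have sq: "{l $ 2<..<u $ 2} \<times> {l $ 3<..<u $ 3} \<in> sets borel"
    by (intro borel_open open_Times) auto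
  have "?v -` box l u = {l$1<..<u$1} \<times> {l$2<..<u$2} \<times> {l$3<..<u$3}"
    by (auto simp: mem_box_cart forall_3)
  then have "emeasure (distr lborel borel ?v) (box l u) =
      emeasure (lborel \<Otimes>\<^sub>M lborel) ({l$1<..<u$1} \<times> {l$2<..<u$2} \<times> {l$3<..<u$3})"
    using meas by (subst emeasure_distr) (auto simp: lborel_prod)
  also have "\<dots> = ennreal (u$1 - l$1) * (emeasure (lborel \<Otimes>\<^sub>M lborel) ({l$2<..<u$2} \<times> {l$3<..<u$3}))"
    using le' sq by (subst lborel.emeasure_pair_measure_Times) (auto simp: lborel_prod)
  also have "\<dots> = ennreal (u$1 - l$1) * (ennreal (u$2 - l$2) * ennreal (u$3 - l$3))"
    using le' by (subst lborel.emeasure_pair_measure_Times) auto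
  also have "\<dots> = ennreal ((u$1 - l$1) * ((u$2 - l$2) * (u$3 - l$3)))"
    using le' by (simp add: ennreal_mult[symmetric])
  also have "(u$1 - l$1) * ((u$2 - l$2) * (u$3 - l$3)) = (\<Prod>i\<in>UNIV. (u - l) $ i)"
    unfolding UNIV_3 by simp
  also have "(\<Prod>i\<in>UNIV. (u - l) $ i) = (\<Prod>b\<in>Basis. (u - l) \<bullet> b)"
    by (simp add: Basis_vec_def image_image[symmetric] UNION_singleton_eq_range prod.reindex inj_on_def axis_eq_axis inner_axis)
  finally show "emeasure (distr lborel borel ?v) (box l u) = ennreal (\<Prod>b\<in>Basis. (u - l) \<bullet> b)" .
qed simp

text \<open>The parameter \<open>c\<close> is the cosine of the angle to \<open>e0\<close>, not the
  angle: by Archimedes' theorem the surface measure then has constant density in \<open>c\<close>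
  and the azimuth.\<close>

definition sphere_point :: "real ^ 3 \<Rightarrow> real ^ 3 \<Rightarrow> real ^ 3 \<Rightarrow> real \<Rightarrow> real \<Rightarrow> real ^ 3" where
  "sphere_point e0 e1 e2 c \<phi> = c *\<^sub>R e0 + sqrt (1 - c\<^sup>2) *\<^sub>R (cos \<phi> *\<^sub>R e1 + sin \<phi> *\<^sub>R e2)"

definition sphere_chart_domain :: "(real \<times> real) set" where
  "sphere_chart_domain = {-1<..<1} \<times> {0<..<2 * pi}"

abbreviation std_point :: "real \<Rightarrow> real \<Rightarrow> real ^ 3" where
  "std_point \<equiv> sphere_point (axis 1 1) (axis 2 1) (axis 3 1)"

lemma std_point_components:
  "std_point c \<phi> $ 1 = c" "std_point c \<phi> $ 2 = sqrt (1 - c\<^sup>2) * cos \<phi>" "std_point c \<phi> $ 3 = sqrt (1 - c\<^sup>2) * sin \<phi>"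
  by (simp_all add: sphere_point_def axis_def)

lemma norm_vec3: "norm (x :: real ^ 3) = sqrt ((x$1)\<^sup>2 + (x$2)\<^sup>2 + (x$3)\<^sup>2)"
  by (simp add: norm_vec_def L2_set_def sum_3)

lemma norm_std_point: assumes "\<bar>c\<bar> \<le> 1" shows "norm (std_point c \<phi>) = 1"
proof -
  have "c\<^sup>2 \<le> 1" using assms by (simp add: abs_square_le_1)
  moreover have "(sqrt (1 - c\<^sup>2) * cos \<phi>)\<^sup>2 + (sqrt (1 - c\<^sup>2) * sin \<phi>)\<^sup>2
     = (sqrt (1 - c\<^sup>2))\<^sup>2 * ((cos \<phi>)\<^sup>2 + (sin \<phi>)\<^sup>2)" by (simp only: power_mult_distrib distrib_left)
  ultimately show ?thesis
    unfolding norm_vec3 std_point_components by (simp add: add.assoc)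
qed

lemma sphere_point_measurable [measurable]:
  "(\<lambda>p. sphere_point e0 e1 e2 (fst p) (snd p)) \<in> borel_measurable borel"
  unfolding sphere_point_def by (intro borel_measurable_continuous_onI continuous_intros)

lemma sphere_chart_domain_borel [measurable]: "sphere_chart_domain \<in> sets borel"
  unfolding sphere_chart_domain_def by (intro borel_open open_Times) auto

\<comment> \<open>The radial parameter is the cube of the radius, which makes the Jacobian constant.\<close>
definition cone_map :: "real ^ 3 \<Rightarrow> real ^ 3" where
  "cone_map x = (x $ 1 powr (1/3)) *\<^sub>R std_point (x $ 2) (x $ 3)"

definition cone_map_deriv :: "real ^ 3 \<Rightarrow> real ^ 3 \<Rightarrow> real ^ 3" where
  "cone_map_deriv x h = (let r = x $ 1 powr (1/3); r' = x $ 1 powr (1/3 - 1) / 3; c = x $ 2; s = sqrt (1 - c\<^sup>2); \<phi> = x $ 3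
     in vector [r' * c * h $ 1 + r * h $ 2,
        r' * s * cos \<phi> * h $ 1 - r * (c / s) * cos \<phi> * h $ 2 - r * s * sin \<phi> * h $ 3,
        r' * s * sin \<phi> * h $ 1 - r * (c / s) * sin \<phi> * h $ 2 + r * s * cos \<phi> * h $ 3])"

lemma cone_map_has_derivative:
  assumes "0 < x $ 1" "\<bar>x $ 2\<bar> < 1"
  shows "(cone_map has_derivative cone_map_deriv x) (at x)"
proof -
  have nth: "((\<lambda>x::real^3. x $ i) has_derivative (\<lambda>h. h $ i)) (at x)" for i
    using bounded_linear_imp_has_derivative[OF bounded_linear_vec_nth] .
  have s: "0 < 1 - (x $ 2)\<^sup>2" using assms(2) by (simp add: abs_square_less_1)
  have r: "((\<lambda>x::real^3. x $ 1 powr (1/3)) has_derivative (\<lambda>h. x $ 1 powr (1/3 - 1) / 3 * h $ 1)) (at x)"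
  proof -
    have "((\<lambda>y. y powr (1/3)) has_real_derivative (1/3) * x $ 1 powr (1/3 - 1)) (at (x $ 1))"
      using assms(1) by (rule has_real_derivative_powr)
    from has_derivative_compose[OF nth[of 1] this[unfolded has_field_derivative_def]]
    show ?thesis by simp
  qed
  have q: "((\<lambda>x::real^3. sqrt (1 - (x $ 2)\<^sup>2)) has_derivative (\<lambda>h. - (x $ 2 / sqrt (1 - (x $ 2)\<^sup>2)) * h $ 2)) (at x)"
  proof -
    have "((\<lambda>y. sqrt (1 - y\<^sup>2)) has_real_derivative - (x $ 2 / sqrt (1 - (x $ 2)\<^sup>2))) (at (x $ 2))"
      using s by (auto intro!: derivative_eq_intros simp: field_simps)
    from has_derivative_compose[OF nth[of 2] this[unfolded has_field_derivative_def]]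
    show ?thesis by simp
  qed
  have c: "((\<lambda>x::real^3. cos (x $ 3)) has_derivative (\<lambda>h. - sin (x $ 3) * h $ 3)) (at x)"
    using has_derivative_compose[OF nth[of 3] DERIV_cos[unfolded has_field_derivative_def]] by simp
  have sn: "((\<lambda>x::real^3. sin (x $ 3)) has_derivative (\<lambda>h. cos (x $ 3) * h $ 3)) (at x)"
    using has_derivative_compose[OF nth[of 3] DERIV_sin[unfolded has_field_derivative_def]] by simp
  have comp: "((\<lambda>x. cone_map x $ i) has_derivative (\<lambda>h. cone_map_deriv x h $ i)) (at x)" for i
  proof -
    have 1: "((\<lambda>x. cone_map x $ 1) has_derivative (\<lambda>h. cone_map_deriv x h $ 1)) (at x)"
      using has_derivative_mult[OF r nth[of 2]]
      by (simp add: cone_map_def cone_map_deriv_def std_point_components Let_def mult_ac add.commute)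
    have 2: "((\<lambda>x. cone_map x $ 2) has_derivative (\<lambda>h. cone_map_deriv x h $ 2)) (at x)"
      using has_derivative_mult[OF r has_derivative_mult[OF q c]]
      by (simp add: cone_map_def cone_map_deriv_def std_point_components Let_def algebra_simps)
    have 3: "((\<lambda>x. cone_map x $ 3) has_derivative (\<lambda>h. cone_map_deriv x h $ 3)) (at x)"
      using has_derivative_mult[OF r has_derivative_mult[OF q sn]]
      by (simp add: cone_map_def cone_map_deriv_def std_point_components Let_def algebra_simps)
    show ?thesis using exhaust_3[of i] 1 2 3 by auto
  qed
  show ?thesis
    by (subst has_derivative_componentwise_within) (auto simp: Basis_vec_def inner_axis comp)
qed

text \<open>The radius is the cube root of its parameter, hence
  \<open>r' * r\<^sup>2 = 1 / 3\<close>; the spherical part of the determinant has modulus 1. The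
  constant cancels the factor 3 in \<open>sphere_measure\<close>.\<close>

lemma det_cone_map_deriv:
  assumes "0 < x $ 1" "\<bar>x $ 2\<bar> < 1"
  shows "\<bar>det (matrix (cone_map_deriv x))\<bar> = 1 / 3"
proof -
  define r r' c s C S where "r = x $ 1 powr (1/3)" and "r' = x $ 1 powr (1/3 - 1) / 3" and "c = x $ 2"
    and "s = sqrt (1 - c\<^sup>2)" and "C = cos (x $ 3)" and "S = sin (x $ 3)"
  have CS: "C\<^sup>2 + S\<^sup>2 = 1" by (simp add: C_def S_def)
  have s: "0 < s" "s * s = 1 - c * c"
    using assms(2) by (auto simp: s_def c_def abs_square_less_1 abs_square_le_1 less_imp_le power2_eq_square[symmetric])
  have rr: "r' * r * r = 1 / 3"
    using assms(1) by (simp add: r_def r'_def powr_add[symmetric])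
  have "det (matrix (cone_map_deriv x)) = r' * r * r * (C\<^sup>2 + S\<^sup>2) * (c * s * (- (c / s)) - s * s)"
    unfolding det_3 matrix_def cone_map_deriv_def Let_def r_def[symmetric] r'_def[symmetric] c_def[symmetric]
      s_def[symmetric] C_def[symmetric] S_def[symmetric]
    by (simp add: axis_def power2_eq_square algebra_simps)
  also have "c * s * (- (c / s)) - s * s = - 1" using s by simp
  finally show ?thesis using rr CS by simp
qed

lemma inj_on_cone_map:
  "inj_on cone_map {x. x $ 1 \<in> {0<..<1} \<and> (x $ 2, x $ 3) \<in> sphere_chart_domain}"
proof (rule inj_onI, clarify)
  fix x y :: "real ^ 3"
  assume x: "x $ 1 \<in> {0<..<1}" "(x $ 2, x $ 3) \<in> sphere_chart_domain"
    and y: "y $ 1 \<in> {0<..<1}" "(y $ 2, y $ 3) \<in> sphere_chart_domain" and eq: "cone_map x = cone_map y"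
  have b: "\<bar>x $ 2\<bar> < 1" "\<bar>y $ 2\<bar> < 1" using x y by (auto simp: sphere_chart_domain_def)
  have "norm (cone_map x) = norm (cone_map y)" using eq by simp
  then have r: "x $ 1 powr (1/3) = y $ 1 powr (1/3)"
    using b by (simp add: cone_map_def norm_std_point)
  then have "(x $ 1 powr (1/3)) powr 3 = (y $ 1 powr (1/3)) powr 3" by simp
  then have e1: "x $ 1 = y $ 1" using x y by (simp add: powr_powr)
  have p: "std_point (x $ 2) (x $ 3) = std_point (y $ 2) (y $ 3)"
    using eq r x by (simp add: cone_map_def e1)
  have e2: "x $ 2 = y $ 2" using arg_cong[OF p, of "\<lambda>v. v $ 1"] by (simp add: std_point_components)
  have s: "sqrt (1 - (y $ 2)\<^sup>2) \<noteq> 0" using b by (simp add: abs_square_eq_1)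
  have "cos (x $ 3) = cos (y $ 3)" "sin (x $ 3) = sin (y $ 3)"
    using arg_cong[OF p, of "\<lambda>v. v $ 2"] arg_cong[OF p, of "\<lambda>v. v $ 3"] s e2
    by (simp_all add: std_point_components)
  then obtain n :: int where n: "x $ 3 = y $ 3 + 2 * pi * n"
    using sin_cos_eq_iff[of "x $ 3" "y $ 3"] by auto
  have "\<bar>x $ 3 - y $ 3\<bar> < 2 * pi" using x y by (auto simp: sphere_chart_domain_def)
  then have "2 * pi * \<bar>real_of_int n\<bar> < 2 * pi * 1" unfolding n by (simp add: abs_mult)
  then have "n = 0" by simp
  then show "x = y" using e1 e2 n by (simp add: vec_eq_iff forall_3)
qed

text \<open>The chart misses the polar axis and the half-plane of azimuth 0. Both lie in the
  hyperplane of vanishing third coordinate, which is a null set.\<close>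

lemma cone_map_surj:
  assumes "norm y < 1" "y $ 3 \<noteq> 0"
  shows "\<exists>x. x $ 1 \<in> {0<..<1} \<and> (x $ 2, x $ 3) \<in> sphere_chart_domain \<and> cone_map x = y
    \<and> std_point (x $ 2) (x $ 3) = sgn y"
proof -
  have n: "0 < norm y" using assms(2) by auto
  define c where "c = y $ 1 / norm y"
  define s where "s = sqrt (1 - c\<^sup>2)"
  have n2: "(norm y)\<^sup>2 = (y$1)\<^sup>2 + (y$2)\<^sup>2 + (y$3)\<^sup>2" by (simp add: norm_vec3)
  have y3: "0 < (y $ 3)\<^sup>2" using assms(2) by simp
  have s2: "1 - c\<^sup>2 = ((y$2)\<^sup>2 + (y$3)\<^sup>2) / (norm y)\<^sup>2"
  proof -
    have "1 - c\<^sup>2 = ((norm y)\<^sup>2 - (y$1)\<^sup>2) / (norm y)\<^sup>2"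
      using n by (simp add: c_def power_divide diff_divide_distrib)
    then show ?thesis by (simp add: n2)
  qed
  then have pos: "0 < 1 - c\<^sup>2" using n y3 by (simp add: add_nonneg_pos)
  then have s: "0 < s" "s\<^sup>2 = 1 - c\<^sup>2" by (auto simp: s_def)
  have "(y$2 / (norm y * s))\<^sup>2 + (y$3 / (norm y * s))\<^sup>2 = 1"
  proof -
    have "(norm y * s)\<^sup>2 = (y$2)\<^sup>2 + (y$3)\<^sup>2" using s2 s n by (simp add: power_mult_distrib)
    moreover have "(y$2)\<^sup>2 + (y$3)\<^sup>2 \<noteq> 0" using y3 by (simp add: add_nonneg_pos less_imp_neq[symmetric])
    ultimately show ?thesis by (simp add: power_divide add_divide_distrib[symmetric])
  qed
  then obtain t where t: "0 \<le> t" "t < 2 * pi" "y$2 / (norm y * s) = cos t" "y$3 / (norm y * s) = sin t"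
    by (rule sincos_total_2pi)
  have "t \<noteq> 0" using t(4) assms(2) n s by auto
  define x :: "real ^ 3" where "x = vector [norm y powr 3, c, t]"
  have x: "x $ 1 = norm y powr 3" "x $ 2 = c" "x $ 3 = t" by (simp_all add: x_def)
  have sp: "std_point c t = sgn y"
  proof -
    have "s * cos t = y$2 / norm y" "s * sin t = y$3 / norm y"
      unfolding t(3,4)[symmetric] using n s by simp_all
    moreover have "sgn y $ i = y $ i / norm y" for i by (simp add: sgn_div_norm divide_inverse)
    ultimately show ?thesis
      unfolding vec_eq_iff forall_3 std_point_components s_def[symmetric] by (simp add: c_def)
  qed
  have "norm y powr 3 < 1" using n assms(1) powr_less_mono2[of 3 "norm y" 1] by simp
  moreover have "\<bar>c\<bar> < 1" using pos by (simp add: abs_square_less_1)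
  moreover have "cone_map x = y"
  proof -
    have "(norm y powr 3) powr (1/3) = norm y" using n by (simp only: powr_powr) simp
    then show ?thesis unfolding cone_map_def x sp using n by (simp only: sgn_div_norm) simp
  qed
  ultimately show ?thesis
    using n t \<open>t \<noteq> 0\<close> sp by (intro exI[of _ x]) (auto simp: x sphere_chart_domain_def)
qed

lemma sgn_std_cone:
  assumes "x $ 1 \<in> {0<..<1}" "(x $ 2, x $ 3) \<in> sphere_chart_domain"
  shows "sgn (cone_map x) = std_point (x $ 2) (x $ 3)" "norm (cone_map x) < 1"
proof -
  have n: "norm (std_point (x $ 2) (x $ 3)) = 1"
    using assms by (intro norm_std_point) (auto simp: sphere_chart_domain_def)
  then show "sgn (cone_map x) = std_point (x $ 2) (x $ 3)"
    using assms by (simp add: cone_map_def sgn_div_norm)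
  show "norm (cone_map x) < 1"
    using assms powr_less_mono2[of "1/3" "x $ 1" 1] by (simp add: cone_map_def n)
qed

text \<open>Change of variables with a constant Jacobian on a set of the form interval times
  \<open>D\<close>; the image of the chart fills the cone over \<open>A\<close> up to a
  hyperplane.\<close>

lemma emeasure_std_cone:
  assumes A: "A \<in> sets borel"
  shows "emeasure lborel {y \<in> ball 0 1. sgn y \<in> A} =
    ennreal (1 / 3) * emeasure lborel {p \<in> sphere_chart_domain. std_point (fst p) (snd p) \<in> A}"
proof -
  define D where "D = {p \<in> sphere_chart_domain. std_point (fst p) (snd p) \<in> A}"
  define P where "P = {x::real^3. x $ 1 \<in> {0<..<1} \<and> (x $ 2, x $ 3) \<in> D}"
  have D: "D \<in> sets borel"
  proof -
    have "D = sphere_chart_domain \<inter> (\<lambda>p. std_point (fst p) (snd p)) -` A" by (auto simp: D_def)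
    then show ?thesis
      using measurable_sets_borel[OF sphere_point_measurable A] by auto
  qed
  have bnd: "{y \<in> ball 0 1. sgn y \<in> A} \<in> sets borel" if "A \<in> sets borel" for A :: "(real^3) set"
  proof -
    have "{y \<in> ball 0 1. sgn y \<in> A} = ball 0 1 \<inter> (sgn :: real^3 \<Rightarrow> _) -` A" by auto
    then show ?thesis using measurable_sets_borel[OF borel_measurable_sgn that] by simp
  qed
  have P: "P \<in> sets borel"
  proof -
    have m: "(\<lambda>x::real^3. (x $ 2, x $ 3)) \<in> borel_measurable borel"
      by (intro borel_measurable_continuous_onI continuous_intros)
    have "P = (\<lambda>x. x $ 1) -` {0<..<1} \<inter> (\<lambda>x. (x $ 2, x $ 3)) -` D" by (auto simp: P_def)
    moreover have "(\<lambda>x::real^3. x $ 1) -` {0<..<1} \<in> sets borel"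
      by (intro borel_open open_vimage continuous_intros)
    ultimately show ?thesis using measurable_sets_borel[OF m D] by auto
  qed
  have eP: "emeasure lborel P = emeasure lborel D"
  proof -
    have v: "(\<lambda>(a, b, c). vector [a, b, c] :: real ^ 3) -` P = {0<..<1} \<times> D"
      by (auto simp: P_def)
    have meas: "(\<lambda>(a, b, c). vector [a, b, c] :: real ^ 3) \<in> lborel \<rightarrow>\<^sub>M borel"
      using vec3_measurable by simp
    have "emeasure lborel P = emeasure (lborel \<Otimes>\<^sub>M lborel) ({0<..<1::real} \<times> D)"
      by (subst lborel_vec3, subst emeasure_distr[OF meas P]) (simp add: v lborel_prod)
    also have "\<dots> = emeasure lborel D"
      using D by (subst lborel.emeasure_pair_measure_Times) auto
    finally show ?thesis .
  qed
  have "bounded D"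
    by (rule bounded_subset[of "{-1..1} \<times> {0..2*pi}"]) (auto simp: D_def sphere_chart_domain_def intro!: bounded_Times)
  then have finD: "emeasure lborel D < \<infinity>" by (rule emeasure_bounded_finite)
  then have Pl: "P \<in> lmeasurable"
    using P eP by (auto simp: fmeasurable_def)
  have sub: "P \<subseteq> {x. x $ 1 \<in> {0<..<1} \<and> (x $ 2, x $ 3) \<in> sphere_chart_domain}"
    by (auto simp: P_def D_def)
  have ok: "0 < x $ 1" "\<bar>x $ 2\<bar> < 1" if "x \<in> P" for x
    using that by (auto simp: P_def D_def sphere_chart_domain_def)
  have "((\<lambda>x. \<bar>det (matrix (cone_map_deriv x))\<bar>) has_integral (1/3 * measure lebesgue P)) P"
  proof (rule has_integral_eq)
    show "1 / 3 = \<bar>det (matrix (cone_map_deriv x))\<bar>" if "x \<in> P" for x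
      using det_cone_map_deriv[OF ok[OF that]] by simp
    have "((\<lambda>x. 1) has_integral measure lebesgue P) P"
      using Pl by (simp add: lmeasure_integral lmeasurable_iff_integrable_on has_integral_iff)
    from has_integral_mult_right[OF this, of "1/3"] show "((\<lambda>x. 1/3) has_integral 1/3 * measure lebesgue P) P" by simp
  qed
  then have img: "cone_map ` P \<in> lmeasurable" "measure lebesgue (cone_map ` P) = 1/3 * measure lebesgue P"
    using has_measure_differentiable_image[of P cone_map cone_map_deriv "1/3 * measure lebesgue P"] Pl
      cone_map_has_derivative[OF ok] inj_on_subset[OF inj_on_cone_map sub]
    by (auto intro: has_derivative_at_withinI)
  define Y where "Y = {y \<in> ball 0 1. sgn y \<in> A}"
  have s1: "cone_map ` P \<subseteq> Y"
    using sgn_std_cone by (auto simp: P_def D_def Y_def)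
  have s2: "Y - cone_map ` P \<subseteq> {y. axis 3 1 \<bullet> y = 0}"
  proof
    fix y assume y: "y \<in> Y - cone_map ` P"
    show "y \<in> {y. axis 3 1 \<bullet> y = 0}"
    proof (rule ccontr)
      assume "y \<notin> {y. axis 3 1 \<bullet> y = 0}"
      then have "y $ 3 \<noteq> 0" by (simp add: inner_axis')
      from cone_map_surj[OF _ this] y obtain x where
        "x $ 1 \<in> {0<..<1}" "(x $ 2, x $ 3) \<in> sphere_chart_domain" "cone_map x = y" "std_point (x $ 2) (x $ 3) = sgn y"
        by (auto simp: Y_def)
      then have "x \<in> P" using y by (auto simp: P_def D_def Y_def)
      then show False using \<open>cone_map x = y\<close> y by auto
    qed
  qed
  have neg: "negligible (Y - cone_map ` P)"
    by (rule negligible_subset[OF negligible_hyperplane s2]) (simp add: axis_eq_0_iff)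
  have Yb: "Y \<in> sets borel" unfolding Y_def by (rule bnd[OF A])
  have Yl: "Y \<in> lmeasurable"
    by (rule bounded_set_imp_lmeasurable) (use Yb in \<open>auto simp: Y_def intro: bounded_subset[OF bounded_ball[of 0 1]]\<close>)
  have "measure lebesgue (cone_map ` P) = measure lebesgue Y"
    by (rule measure_negligible_symdiff) (use Yl img s1 neg in \<open>auto simp: Un_absorb1 Diff_eq_empty_iff[THEN iffD2]\<close>)
  then have "measure lebesgue Y = 1/3 * measure lebesgue P"
    using img(2) by linarith
  moreover have "emeasure lebesgue Y = ennreal (measure lebesgue Y)"
    using Yl by (rule emeasure_eq_measure2)
  ultimately have "emeasure lebesgue Y = ennreal (1/3 * measure lebesgue P)" by simp
  then have "emeasure lborel Y = ennreal (1/3) * ennreal (measure lborel P)"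
    using Yb P by (simp add: ennreal_mult[symmetric])
  also have "ennreal (measure lborel P) = emeasure lborel D"
    using finD by (simp add: emeasure_eq_ennreal_measure eP[symmetric] less_top)
  finally show ?thesis by (simp add: Y_def D_def)
qed

definition orthonormal3 :: "real ^ 3 \<Rightarrow> real ^ 3 \<Rightarrow> real ^ 3 \<Rightarrow> bool" where
  "orthonormal3 e0 e1 e2 \<longleftrightarrow> e0 \<bullet> e0 = 1 \<and> e1 \<bullet> e1 = 1 \<and> e2 \<bullet> e2 = 1 \<and>
    e0 \<bullet> e1 = 0 \<and> e0 \<bullet> e2 = 0 \<and> e1 \<bullet> e2 = 0"

lemma orthonormal3_exists:
  fixes e0 :: "real ^ 3"
  assumes "norm e0 = 1"
  shows "\<exists>e1 e2. orthonormal3 e0 e1 e2"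
proof -
  obtain x where x: "x \<noteq> 0" "orthogonal e0 x"
    using orthogonal_to_vector_exists[of e0] by auto
  define e1 where "e1 = x /\<^sub>R norm x"
  have "e1 \<bullet> e1 = 1" "e0 \<bullet> e1 = 0" "e0 \<bullet> e0 = 1"
    using x assms by (auto simp: e1_def orthogonal_def dot_square_norm power2_eq_square)
  moreover from this have "cross3 e0 e1 \<bullet> cross3 e0 e1 = 1"
    using norm_cross_dot[of e0 e1] by (simp add: dot_square_norm power_mult_distrib)
  ultimately have "orthonormal3 e0 e1 (cross3 e0 e1)"
    by (simp add: orthonormal3_def dot_cross_self)
  then show ?thesis by blast
qed

text \<open>An orthogonal map carries the standard chart into the chart for \<open>e0\<close>,
  \<open>e1\<close>, \<open>e2\<close>. It commutes with \<open>sgn\<close> and preserves volume, so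
  the standard case suffices.\<close>

lemma sphere_measure_eq:
  assumes e: "orthonormal3 e0 e1 e2"
  shows "sphere_measure = distr (density lborel (indicator sphere_chart_domain)) borel
    (\<lambda>p. sphere_point e0 e1 e2 (fst p) (snd p))"
    (is "_ = distr ?M borel ?f")
proof (rule measure_eqI)
  fix A assume "A \<in> sets sphere_measure"
  then have A: "A \<in> sets borel" by (simp add: sphere_measure_def)
  define Q :: "real ^ 3 \<Rightarrow> real ^ 3" where "Q x = x $ 1 *\<^sub>R e0 + x $ 2 *\<^sub>R e1 + x $ 3 *\<^sub>R e2" for x
  have Q: "orthogonal_transformation Q"
    unfolding orthogonal_transformation_def
  proof (intro conjI allI)
    show "linear Q" by (rule linearI) (simp_all add: Q_def algebra_simps)
    show "Q v \<bullet> Q w = v \<bullet> w" for v w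
      using e by (simp add: Q_def orthonormal3_def inner_add_left inner_add_right inner_commute inner_vec_def[of v w] sum_3)
  qed
  have sp: "sphere_point e0 e1 e2 c \<phi> = Q (std_point c \<phi>)" for c \<phi>
    by (simp add: Q_def std_point_components) (simp add: sphere_point_def algebra_simps)
  have nQ: "norm (Q x) = norm x" for x using orthogonal_transformation_norm[OF Q] .
  have lQ: "linear Q" using Q by (simp add: orthogonal_transformation_def)
  have sgnQ: "sgn (Q x) = Q (sgn x)" for x
    by (simp add: sgn_div_norm nQ linear_scale[OF lQ])
  have cQ: "continuous_on UNIV Q" using lQ by (rule linear_continuous_on[OF linear_conv_bounded_linear[THEN iffD1]])
  have QA: "Q -` A \<in> sets borel"
    using measurable_sets_borel[OF borel_measurable_continuous_onI[OF cQ] A] .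
  have set_borel: "{y \<in> ball 0 1. sgn y \<in> B} \<in> sets borel" if "B \<in> sets borel" for B :: "(real^3) set"
  proof -
    have "{y \<in> ball 0 1. sgn y \<in> B} = ball 0 1 \<inter> (sgn :: real^3 \<Rightarrow> _) -` B" by auto
    then show ?thesis using measurable_sets_borel[OF borel_measurable_sgn that] by simp
  qed
  have lm: "{y \<in> ball 0 1. sgn y \<in> B} \<in> lmeasurable" if "B \<in> sets borel" for B :: "(real^3) set"
    by (rule bounded_set_imp_lmeasurable) (use set_borel[OF that] in \<open>auto intro: bounded_subset[OF bounded_ball[of 0 1]]\<close>)
  have img: "{y \<in> ball 0 1. sgn y \<in> A} = Q ` {y \<in> ball 0 1. sgn y \<in> Q -` A}"
  proof (intro equalityI subsetI)
    fix y assume y: "y \<in> {y \<in> ball 0 1. sgn y \<in> A}"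
    obtain x where "y = Q x" using orthogonal_transformation_surj[OF Q] by (metis surjD)
    then show "y \<in> Q ` {y \<in> ball 0 1. sgn y \<in> Q -` A}"
      using y by (intro image_eqI[of _ _ x]) (auto simp: nQ sgnQ)
  qed (auto simp: nQ sgnQ)
  have "emeasure lebesgue {y \<in> ball 0 1. sgn y \<in> A} = emeasure lebesgue {y \<in> ball 0 1. sgn y \<in> Q -` A}"
    using measure_orthogonal_image[OF Q lm[OF QA], folded img] lm[OF A] lm[OF QA]
    by (simp add: emeasure_eq_measure2)
  then have vol: "emeasure lborel {y \<in> ball 0 1. sgn y \<in> A} = emeasure lborel {y \<in> ball 0 1. sgn y \<in> Q -` A}"
    using set_borel[OF A] set_borel[OF QA] by simp
  have "emeasure sphere_measure A = (\<integral>\<^sup>+x. 3 * indicator (ball 0 1) x * indicator (sgn -` A) x \<partial>lborel)"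
    unfolding sphere_measure_def
    using A measurable_sets_borel[OF borel_measurable_sgn A]
    by (subst emeasure_distr, simp_all, intro emeasure_density)
      (auto intro!: borel_measurable_times_ennreal borel_measurable_indicator)
  also have "\<dots> = (\<integral>\<^sup>+x. 3 * indicator {y \<in> ball 0 1. sgn y \<in> A} x \<partial>lborel)"
    by (intro nn_integral_cong) (auto split: split_indicator)
  also have "\<dots> = 3 * emeasure lborel {y \<in> ball 0 1. sgn y \<in> A}"
    using set_borel[OF A] by (subst nn_integral_cmult_indicator) auto
  also have "\<dots> = 3 * (ennreal (1 / 3) * emeasure lborel {p \<in> sphere_chart_domain. std_point (fst p) (snd p) \<in> Q -` A})"
    unfolding vol emeasure_std_cone[OF QA] ..
  also have "\<dots> = emeasure lborel {p \<in> sphere_chart_domain. std_point (fst p) (snd p) \<in> Q -` A}"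
    by (simp add: mult.assoc[symmetric] ennreal_mult[symmetric] flip: ennreal_numeral)
  also have "{p \<in> sphere_chart_domain. std_point (fst p) (snd p) \<in> Q -` A} = sphere_chart_domain \<inter> ?f -` A"
    by (auto simp: sp)
  also have "emeasure lborel (sphere_chart_domain \<inter> ?f -` A) = emeasure ?M (?f -` A)"
  proof -
    have "?f -` A \<in> sets borel" using measurable_sets_borel[OF sphere_point_measurable A] .
    then show ?thesis
      by (subst emeasure_density)
        (auto simp: nn_integral_indicator[symmetric] intro!: nn_integral_cong simp del: nn_integral_indicator split: split_indicator)
  qed
  also have "\<dots> = emeasure (distr ?M borel ?f) A"
    using A by (subst emeasure_distr) auto
  finally show "emeasure sphere_measure A = emeasure (distr ?M borel ?f) A" .
qed (simp add: sphere_measure_def)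

lemma
  fixes h :: "real ^ 3 \<Rightarrow> real"
  assumes e: "orthonormal3 e0 e1 e2" and h: "h \<in> borel_measurable borel"
  shows integrable_sphere_iff: "integrable sphere_measure h \<longleftrightarrow>
      integrable lborel (\<lambda>p. indicator sphere_chart_domain p * h (sphere_point e0 e1 e2 (fst p) (snd p)))"
    and integral_sphere_eq: "(LINT \<nu>|sphere_measure. h \<nu>) =
      (LINT p|lborel. indicator sphere_chart_domain p * h (sphere_point e0 e1 e2 (fst p) (snd p)))"
proof -
  have m: "(\<lambda>p. h (sphere_point e0 e1 e2 (fst p) (snd p))) \<in> borel_measurable borel"
    using measurable_compose[OF sphere_point_measurable h] .
  have d: "density lborel (indicator sphere_chart_domain) = density lborel (\<lambda>p. ennreal (indicator sphere_chart_domain p))"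
    by (simp add: ennreal_indicator)
  show "integrable sphere_measure h \<longleftrightarrow>
      integrable lborel (\<lambda>p. indicator sphere_chart_domain p * h (sphere_point e0 e1 e2 (fst p) (snd p)))"
    unfolding sphere_measure_eq[OF e] d using h m
    by (subst integrable_distr_eq) (auto simp: integrable_density)
  show "(LINT \<nu>|sphere_measure. h \<nu>) =
      (LINT p|lborel. indicator sphere_chart_domain p * h (sphere_point e0 e1 e2 (fst p) (snd p)))"
    unfolding sphere_measure_eq[OF e] d using h m
    by (subst integral_distr) (auto simp: integral_density)
qed

section \<open>Homogeneous potentials\<close>

definition power_law :: "real \<Rightarrow> real \<Rightarrow> real \<Rightarrow> real" where
  "power_law b s r = b * r powr - s"

lemma repulsive_power_law:
  assumes "0 \<le> b" "0 < s"
  shows "repulsive (power_law b s)"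
  unfolding repulsive_def
proof (intro conjI)
  show "continuous_on {0<..} (power_law b s)"
    unfolding power_law_def by (intro continuous_intros) auto
  show "antimono_on {0<..} (power_law b s)"
    using assms by (auto simp: monotone_on_def power_law_def intro!: mult_left_mono powr_mono2')
  have "((\<lambda>r. b * r powr - s) \<longlongrightarrow> b * 0) at_top"
    using assms by (intro tendsto_intros tendsto_neg_powr filterlim_ident) auto
  then show "(power_law b s \<longlongrightarrow> 0) at_top" by (simp add: power_law_def[abs_def])
qed

text \<open>For a power law all dependence on strength, apsis and impact parameter collapses into
  the single number \<open>m\<close>. Differentiating in \<open>m\<close> avoids differentiating the
  apsis under the integral.\<close>

definition power_half_angle_integrand :: "real \<Rightarrow> real \<Rightarrow> real \<Rightarrow> real" where
  "power_half_angle_integrand s m x = 1 / sqrt (1 - x\<^sup>2 + m * (1 - x powr s))"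

definition power_half_angle :: "real \<Rightarrow> real \<Rightarrow> real" where
  "power_half_angle s m = (LBINT x:{0<..<1}. power_half_angle_integrand s m x)"

section \<open>The half angle of a power law as a function of \<open>m\<close>\<close>

context
  fixes s :: real
  assumes s: "1 < s"
begin

lemma power_radicand:
  assumes "x \<in> {0<..<1}" "0 \<le> m"
  shows "0 < 1 - x\<^sup>2" "1 - x\<^sup>2 \<le> 1 - x\<^sup>2 + m * (1 - x powr s)" "0 < 1 - x\<^sup>2 + m * (1 - x powr s)"
    "1 - x\<^sup>2 + m * (1 - x powr s) \<le> (1 + s * m) * (1 - x\<^sup>2)"
proof -
  show 1: "0 < 1 - x\<^sup>2" using assms(1) by (simp add: power_less_one_iff abs_square_less_1)
  have "0 \<le> m * (1 - x powr s)" using one_minus_powr_bounds(1)[of s x] s assms by simp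
  then show "1 - x\<^sup>2 \<le> 1 - x\<^sup>2 + m * (1 - x powr s)" by simp
  with 1 show "0 < 1 - x\<^sup>2 + m * (1 - x powr s)" by linarith
  have "m * (1 - x powr s) \<le> m * (s * (1 - x\<^sup>2))"
    using one_minus_powr_bounds(3)[of s x] s assms by (intro mult_left_mono) auto
  then show "1 - x\<^sup>2 + m * (1 - x powr s) \<le> (1 + s * m) * (1 - x\<^sup>2)"
    by (simp add: algebra_simps)
qed

lemma power_integrand_measurable [measurable]: "power_half_angle_integrand s m \<in> borel_measurable borel"
  unfolding power_half_angle_integrand_def by measurable

lemma power_integrand_bounds:
  assumes "x \<in> {0<..<1}" "0 \<le> m"
  shows "0 \<le> power_half_angle_integrand s m x" "power_half_angle_integrand s m x \<le> 1 / sqrt (1 - x\<^sup>2)"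
  using power_radicand[OF assms] by (auto simp: power_half_angle_integrand_def intro!: frac_le)

lemma set_integrable_power_half_angle:
  assumes "0 \<le> m"
  shows "set_integrable lborel {0<..<1} (power_half_angle_integrand s m)"
  unfolding set_integrable_def
proof (rule Bochner_Integration.integrable_bound)
  show "integrable lborel (\<lambda>x::real. indicator {0<..<1} x *\<^sub>R (1 / sqrt (1 - x\<^sup>2)))"
    using set_integrable_arcsin by (simp add: set_integrable_def)
  show "AE x in lborel. norm (indicator {0<..<1} x *\<^sub>R power_half_angle_integrand s m x)
      \<le> norm (indicator {0<..<1} x *\<^sub>R (1 / sqrt (1 - x\<^sup>2)))"
    using order_trans[OF power_integrand_bounds] power_integrand_bounds assms
    by (intro AE_I2) (auto simp: indicator_def power_integrand_bounds)
qed simp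

lemma power_half_angle_ge:
  assumes "0 \<le> m"
  shows "pi / 2 / sqrt (1 + s * m) \<le> power_half_angle s m"
proof -
  have "1 / sqrt (1 + s * m) * (1 / sqrt (1 - x\<^sup>2)) \<le> power_half_angle_integrand s m x" if "x \<in> {0<..<1}" for x
    using power_radicand[OF that assms]
    by (simp add: power_half_angle_integrand_def real_sqrt_mult[symmetric] frac_le)
  then have "(LBINT x:{0<..<1}. 1 / sqrt (1 + s * m) * (1 / sqrt (1 - x\<^sup>2))) \<le> power_half_angle s m"
    unfolding power_half_angle_def
    by (intro set_integral_mono set_integrable_power_half_angle assms set_integrable_mult_right set_integrable_arcsin) auto
  then show ?thesis unfolding set_integral_mult_right set_integral_arcsin by simp
qed

text \<open>Dropping \<open>1 - x\<^sup>2\<close> and using \<open>1 - x \<le> 1 - x powr s\<close>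
  leaves an integrable inverse root, whose integral is the constant 2. With the lower bound before
  it, the half angles are seen to come close to 0 and to \<open>pi / 2\<close>.\<close>

lemma power_half_angle_le:
  assumes "0 < m"
  shows "power_half_angle s m \<le> 2 / sqrt m"
proof -
  have hi: "((\<lambda>x::real. 1 / sqrt (1 - x)) has_integral 2) {0<..<1}"
  proof -
    have "((\<lambda>x::real. 1 / sqrt (1 - x)) has_integral (- 2 * sqrt (1 - 1) - (- 2 * sqrt (1 - 0)))) {0..1}"
    proof (rule fundamental_theorem_of_calculus_interior)
      fix x :: real assume "x \<in> {0<..<1}"
      then have "((\<lambda>x. - 2 * sqrt (1 - x)) has_real_derivative 1 / sqrt (1 - x)) (at x)"
        by (auto intro!: derivative_eq_intros simp: field_simps)
      then show "((\<lambda>x. - 2 * sqrt (1 - x)) has_vector_derivative 1 / sqrt (1 - x)) (at x)"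
        by (simp add: has_real_derivative_iff_has_vector_derivative)
    qed (auto intro!: continuous_intros)
    then show ?thesis by (simp add: has_integral_Icc_iff_Ioo)
  qed
  then have "(\<lambda>x::real. 1 / sqrt (1 - x)) absolutely_integrable_on {0<..<1}"
    by (intro nonnegative_absolutely_integrable_1) (auto simp: has_integral_integrable)
  then have i: "set_integrable lborel {0<..<1} (\<lambda>x::real. 1 / sqrt (1 - x))"
    unfolding set_integrable_def by (subst (asm) integrable_completion) auto
  have v: "(LBINT x:{0<..<1::real}. 1 / sqrt (1 - x)) = 2"
    using set_borel_integral_eq_integral(2)[OF i] hi by (simp add: integral_unique)
  have "power_half_angle_integrand s m x \<le> 1 / sqrt m * (1 / sqrt (1 - x))" if "x \<in> {0<..<1}" for x
  proof -
    have "m * (1 - x) \<le> m * (1 - x powr s)"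
      using one_minus_powr_bounds(1)[of s x] s that assms by (intro mult_left_mono) auto
    also have "\<dots> \<le> 1 - x\<^sup>2 + m * (1 - x powr s)" using power_radicand[OF that, of m] assms by simp
    finally show ?thesis
      using that assms by (simp add: power_half_angle_integrand_def real_sqrt_mult[symmetric] frac_le)
  qed
  then have "power_half_angle s m \<le> (LBINT x:{0<..<1}. 1 / sqrt m * (1 / sqrt (1 - x)))"
    unfolding power_half_angle_def
    using assms by (intro set_integral_mono set_integrable_power_half_angle set_integrable_mult_right i) auto
  then show ?thesis unfolding set_integral_mult_right v by simp
qed

text \<open>Controls the difference quotients in \<open>m\<close>: the common lower bound
  \<open>c\<close> will be \<open>1 - x\<^sup>2\<close>, and the difference of the radicands
  contains this factor as well.\<close>

lemma inverse_sqrt_diff_le: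
  fixes A B c :: real
  assumes "0 < c" "c \<le> A" "c \<le> B"
  shows "\<bar>1 / sqrt A - 1 / sqrt B\<bar> \<le> \<bar>A - B\<bar> / (2 * (c * sqrt c))"
proof -
  have p: "0 < A" "0 < B" using assms by auto
  have "1 / sqrt A - 1 / sqrt B = (B - A) / (sqrt A * sqrt B * (sqrt A + sqrt B))"
  proof -
    have "(sqrt B - sqrt A) * (sqrt A + sqrt B) = B - A" using p by (simp add: algebra_simps)
    moreover have "sqrt A + sqrt B \<noteq> 0" using p by (metis add_pos_pos less_irrefl real_sqrt_gt_zero)
    ultimately have "(B - A) / (sqrt A * sqrt B * (sqrt A + sqrt B)) = (sqrt B - sqrt A) / (sqrt A * sqrt B)"
      by (metis mult_divide_mult_cancel_right)
    then show ?thesis using p by (simp add: diff_divide_distrib)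
  qed
  then have "\<bar>1 / sqrt A - 1 / sqrt B\<bar> = \<bar>A - B\<bar> / (sqrt A * sqrt B * (sqrt A + sqrt B))"
    using p by (simp add: abs_mult abs_minus_commute)
  also have "\<dots> \<le> \<bar>A - B\<bar> / (sqrt c * sqrt c * (sqrt c + sqrt c))"
    using assms p by (intro divide_left_mono mult_mono add_mono mult_pos_pos add_pos_pos) auto
  also have "sqrt c * sqrt c * (sqrt c + sqrt c) = 2 * (c * sqrt c)" using assms by simp
  finally show ?thesis .
qed

definition power_half_angle_deriv where
  "power_half_angle_deriv m = (LBINT x:{0<..<1}.
     - (1 - x powr s) / (2 * ((1 - x\<^sup>2 + m * (1 - x powr s)) * sqrt (1 - x\<^sup>2 + m * (1 - x powr s)))))"

text \<open>Differentiation under the integral. The difference quotients are dominated by a multiple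
  of the free integrand, since \<open>1 - x powr s \<le> s * (1 - x\<^sup>2)\<close> cancels one
  power of the vanishing radicand.\<close>

lemma power_half_angle_has_derivative:
  assumes m: "0 < m"
  shows "(power_half_angle s has_real_derivative power_half_angle_deriv m) (at m)"
    and "power_half_angle_deriv m < 0"
proof -
  let ?A = "\<lambda>m x. 1 - x\<^sup>2 + m * (1 - x powr s)"
  let ?d = "\<lambda>x. - (1 - x powr s) / (2 * (?A m x * sqrt (?A m x)))"
  let ?dom = "\<lambda>x::real. indicator {0<..<1} x *\<^sub>R (s / 2 * (1 / sqrt (1 - x\<^sup>2)))"
  have int_dom: "integrable lborel ?dom"
    using set_integrable_mult_right[OF set_integrable_arcsin, of "s/2"] by (simp add: set_integrable_def)
  have quot: "\<bar>(power_half_angle_integrand s y x - power_half_angle_integrand s m x) / (y - m)\<bar> \<le> s / 2 * (1 / sqrt (1 - x\<^sup>2))"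
    if x: "x \<in> {0<..<1}" and y: "0 < y" "y \<noteq> m" for x y
  proof -
    let ?c = "1 - x\<^sup>2"
    have c: "0 < ?c" "?c \<le> ?A m x" "?c \<le> ?A y x" using power_radicand[OF x] m y by auto
    have "\<bar>power_half_angle_integrand s y x - power_half_angle_integrand s m x\<bar> \<le> \<bar>?A y x - ?A m x\<bar> / (2 * (?c * sqrt ?c))"
      unfolding power_half_angle_integrand_def using inverse_sqrt_diff_le[OF c(1) c(3) c(2)] .
    also have "?A y x - ?A m x = (y - m) * (1 - x powr s)" by (simp add: algebra_simps)
    also have "\<bar>(y - m) * (1 - x powr s)\<bar> = \<bar>y - m\<bar> * (1 - x powr s)"
      using one_minus_powr_bounds(1)[of s x] s x by (simp add: abs_mult)
    also have "\<dots> / (2 * (?c * sqrt ?c)) \<le> \<bar>y - m\<bar> * (s * ?c) / (2 * (?c * sqrt ?c))"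
      using one_minus_powr_bounds(3)[of s x] s x c by (intro divide_right_mono mult_left_mono) auto
    also have "\<dots> = \<bar>y - m\<bar> * (s / 2 * (1 / sqrt ?c))" using c by simp
    finally show ?thesis using y by (simp add: abs_divide divide_le_eq mult.commute)
  qed
  have lim: "((\<lambda>y. (power_half_angle_integrand s y x - power_half_angle_integrand s m x) / (y - m)) \<longlongrightarrow> ?d x) (at m)"
    if x: "x \<in> {0<..<1}" for x
  proof -
    have "((\<lambda>z. 1 / sqrt z) has_real_derivative - 1 / (2 * (z * sqrt z))) (at z)" if "0 < z" for z :: real
      using that by (auto intro!: derivative_eq_intros simp: field_simps)
    from this[OF power_radicand(3)[OF x, of m]] m
    have "((\<lambda>z. 1 / sqrt z) has_real_derivative - 1 / (2 * (?A m x * sqrt (?A m x)))) (at (?A m x))" by auto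
    moreover have "((\<lambda>y. ?A y x) has_real_derivative (1 - x powr s)) (at m)"
      by (auto intro!: derivative_eq_intros)
    ultimately have "((\<lambda>y. 1 / sqrt (?A y x)) has_real_derivative - 1 / (2 * (?A m x * sqrt (?A m x))) * (1 - x powr s)) (at m)"
      by (rule DERIV_chain2)
    then have "((\<lambda>y. power_half_angle_integrand s y x) has_real_derivative ?d x) (at m)"
      unfolding power_half_angle_integrand_def times_divide_eq_left mult_minus_left mult_1_left .
    then show ?thesis by (simp add: has_field_derivative_iff)
  qed
  have meas_d: "?d \<in> borel_measurable borel" by measurable
  have der: "((\<lambda>y. (power_half_angle s y - power_half_angle s m) / (y - m)) \<longlongrightarrow> power_half_angle_deriv m) (at m within {0<..})"
    unfolding tendsto_at_iff_sequentially
  proof (intro allI impI)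
    fix Y :: "nat \<Rightarrow> real" assume Y: "\<forall>i. Y i \<in> {0<..} - {m}" "Y \<longlonglongrightarrow> m"
    have Ypos: "0 < Y i" "Y i \<noteq> m" for i using Y(1) by auto
    have "(\<lambda>i. LINT x|lborel. indicator {0<..<1} x *\<^sub>R ((power_half_angle_integrand s (Y i) x - power_half_angle_integrand s m x) / (Y i - m)))
      \<longlonglongrightarrow> (LINT x|lborel. indicator {0<..<1} x *\<^sub>R ?d x)"
    proof (rule integral_dominated_convergence[OF _ _ int_dom])
      show "AE x in lborel. (\<lambda>i. indicator {0<..<1} x *\<^sub>R ((power_half_angle_integrand s (Y i) x - power_half_angle_integrand s m x) / (Y i - m)))
        \<longlonglongrightarrow> indicator {0<..<1} x *\<^sub>R ?d x"
      proof (rule AE_I2)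
        fix x :: real
        have "(\<lambda>i. (power_half_angle_integrand s (Y i) x - power_half_angle_integrand s m x) / (Y i - m)) \<longlonglongrightarrow> ?d x"
          if "x \<in> {0<..<1}"
          using lim[OF that, unfolded tendsto_at_iff_sequentially] Y by (auto simp: comp_def)
        then show "(\<lambda>i. indicator {0<..<1} x *\<^sub>R ((power_half_angle_integrand s (Y i) x - power_half_angle_integrand s m x) / (Y i - m)))
          \<longlonglongrightarrow> indicator {0<..<1} x *\<^sub>R ?d x"
          by (cases "x \<in> {0<..<1}") auto
      qed
      show "AE x in lborel. norm (indicator {0<..<1} x *\<^sub>R ((power_half_angle_integrand s (Y i) x - power_half_angle_integrand s m x) / (Y i - m))) \<le> ?dom x" for i
        using quot[OF _ Ypos] by (intro AE_I2) (auto simp: indicator_def)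
    qed (use meas_d in measurable)
    moreover have "(LINT x|lborel. indicator {0<..<1} x *\<^sub>R ((power_half_angle_integrand s (Y i) x - power_half_angle_integrand s m x) / (Y i - m)))
      = (power_half_angle s (Y i) - power_half_angle s m) / (Y i - m)" for i
      unfolding power_half_angle_def set_integral_diff(2)[symmetric, OF set_integrable_power_half_angle[OF less_imp_le[OF Ypos(1)]] set_integrable_power_half_angle[OF less_imp_le[OF m]]]
      by (simp add: set_lebesgue_integral_def)
    ultimately have "(\<lambda>i. (power_half_angle s (Y i) - power_half_angle s m) / (Y i - m))
        \<longlonglongrightarrow> (LINT x|lborel. indicator {0<..<1} x *\<^sub>R ?d x)" by (simp only:)
    then show "((\<lambda>y. (power_half_angle s y - power_half_angle s m) / (y - m)) \<circ> Y) \<longlonglongrightarrow> power_half_angle_deriv m"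
      unfolding comp_def power_half_angle_deriv_def set_lebesgue_integral_def .
  qed
  then show "(power_half_angle s has_real_derivative power_half_angle_deriv m) (at m)"
    using m by (simp add: has_field_derivative_iff at_within_open[of m "{0<..}"])
  have nd: "0 \<le> - ?d x" "- ?d x \<le> s / 2 * (1 / sqrt (1 - x\<^sup>2))" if x: "x \<in> {0<..<1}" for x
  proof -
    have "0 \<le> (1 - x powr s) / (2 * (?A m x * sqrt (?A m x)))"
      using power_radicand(3)[OF x, of m] m one_minus_powr_bounds(1)[of s x] s x
      by (intro divide_nonneg_nonneg mult_nonneg_nonneg) auto
    then show "0 \<le> - ?d x" unfolding minus_divide_left[symmetric] minus_minus .
    have "\<forall>\<^sub>F y in at m. 0 < y \<and> y \<noteq> m"
      using eventually_at_in_open'[of "{0<..}" m] m eventually_neq_at_within[of m m UNIV] by (auto elim: eventually_elim2)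
    then have "\<forall>\<^sub>F y in at m. \<bar>(power_half_angle_integrand s y x - power_half_angle_integrand s m x) / (y - m)\<bar> \<le> s / 2 * (1 / sqrt (1 - x\<^sup>2))"
      by eventually_elim (use quot[OF x] in auto)
    then have "\<bar>?d x\<bar> \<le> s / 2 * (1 / sqrt (1 - x\<^sup>2))"
      by (rule tendsto_upperbound[OF tendsto_rabs[OF lim[OF x]]]) simp
    then show "- ?d x \<le> s / 2 * (1 / sqrt (1 - x\<^sup>2))" by linarith
  qed
  \<comment> \<open>For strictness the interval \<open>(0, 1/2)\<close> is enough: there
    \<open>1 - x powr s \<ge> 1 / 2\<close> and the radicand is at most
    \<open>1 + s * m\<close>.\<close>
  have "0 < (LINT x|lborel. indicator {0<..<1} x *\<^sub>R (- ?d x))"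
  proof -
    let ?c = "1 / (4 * ((1 + s * m) * sqrt (1 + s * m)))"
    have "(LINT x|lborel. indicator {0<..<1/2::real} x *\<^sub>R ?c) \<le> (LINT x|lborel. indicator {0<..<1} x *\<^sub>R (- ?d x))"
    proof (rule integral_mono)
      show "integrable lborel (\<lambda>x. indicator {0<..<1} x *\<^sub>R (- ?d x))"
      proof (rule Bochner_Integration.integrable_bound[OF int_dom])
        show "AE x in lborel. norm (indicator {0<..<1} x *\<^sub>R (- ?d x)) \<le> norm (?dom x)"
        proof (rule AE_I2)
          fix x :: real
          show "norm (indicator {0<..<1} x *\<^sub>R (- ?d x)) \<le> norm (?dom x)"
          proof (cases "x \<in> {0<..<1}")
            case True
            have "\<bar>- ?d x\<bar> \<le> \<bar>s / 2 * (1 / sqrt (1 - x\<^sup>2))\<bar>" using nd[OF True] by linarith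
            then show ?thesis using True by (simp only: indicator_simps real_norm_def scaleR_one)
          qed simp
        qed
      qed (use meas_d in measurable)
      show "indicator {0<..<1/2::real} x *\<^sub>R ?c \<le> indicator {0<..<1} x *\<^sub>R (- ?d x)" for x
      proof (cases "x \<in> {0<..<1/2}")
        case True
        then have x: "x \<in> {0<..<1}" by auto
        have A: "?A m x \<le> 1 + s * m" "0 < ?A m x"
          using power_radicand[OF x, of m] m s mult_left_mono[of "1 - x\<^sup>2" 1 "1 + s * m"] by auto
        have "1 / 2 \<le> 1 - x powr s" using one_minus_powr_bounds(1)[of s x] s True by auto
        then have "(1 / 2) / (2 * ((1 + s * m) * sqrt (1 + s * m))) \<le> (1 - x powr s) / (2 * (?A m x * sqrt (?A m x)))"
          using A by (intro frac_le mult_left_mono mult_mono) auto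
        then have "?c \<le> - ?d x" unfolding minus_divide_left[symmetric] minus_minus by simp
        then show ?thesis using True x by (simp only: indicator_simps scaleR_one)
      next
        case False
        then show ?thesis
          using False nd(1)[of x] by (cases "x \<in> {0<..<1}") (simp_all only: indicator_simps scaleR_one scaleR_zero_left order_refl)
      qed
      have "integrable lborel (indicator {0<..<1/2::real} :: real \<Rightarrow> real)"
        using emeasure_bounded_finite[of "{0<..<1/2::real}"] by (intro integrable_real_indicator) auto
      then show "integrable lborel (\<lambda>x. indicator {0<..<1/2::real} x *\<^sub>R ?c)"
        by (intro integrable_scaleR_left)
    qed
    moreover have "0 < (LINT x|lborel. indicator {0<..<1/2::real} x *\<^sub>R ?c)"
      using m s by (simp add: add_pos_pos)
    ultimately show ?thesis by linarith
  qed
  then show "power_half_angle_deriv m < 0"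
    unfolding power_half_angle_deriv_def set_lebesgue_integral_def scaleR_minus_right Bochner_Integration.integral_minus
    by linarith
qed

end

lemma DERIV_inverse_strong:
  fixes f g :: "real \<Rightarrow> real"
  assumes "open S" "x \<in> S" "continuous_on S f" "\<And>z. z \<in> S \<Longrightarrow> g (f z) = z"
    and "(f has_real_derivative D) (at x)" "D \<noteq> 0"
  shows "(g has_real_derivative 1 / D) (at (f x))"
  unfolding has_field_derivative_def
proof (rule has_derivative_inverse_strong[OF assms(1-3)])
  show "(f has_derivative (*) D) (at x)" using assms(5) by (simp add: has_field_derivative_def)
qed (use assms in auto)

\<comment> \<open>With \<open>r\<close> the apsis, \<open>m = (r / \<rho>)\<^sup>2 - 1 = b r powr - s * r\<^sup>2 / \<rho>\<^sup>2\<close> parametrizes the impact parameters; in it the half angle is \<open>power_half_angle s m\<close>.\<close>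
definition power_impact :: "real \<Rightarrow> real \<Rightarrow> real \<Rightarrow> real" where
  "power_impact b s m = (b * (1 + m) / m) powr (1 / s) / sqrt (1 + m)"

definition power_param :: "real \<Rightarrow> real \<Rightarrow> real \<Rightarrow> real" where
  "power_param b s \<rho> = (apsis (power_law b s) \<rho> / \<rho>)\<^sup>2 - 1"

section \<open>The deflection of a power law as a function of the impact parameter\<close>

context
  fixes b s :: real
  assumes b: "0 < b" and s: "1 < s"
begin

lemma power_law_repulsive: "repulsive (power_law b s)"
  using repulsive_power_law[of b s] b s by simp

lemma power_impact_pos: "0 < m \<Longrightarrow> 0 < power_impact b s m"
  using b by (auto simp: power_impact_def intro!: divide_pos_pos mult_pos_pos)

text \<open>In terms of \<open>m\<close> the apsis equation reads
  \<open>1 / (1 + m) + m / (1 + m) = 1\<close>, with the centrifugal term first and the potential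
  second.\<close>

lemma
  assumes m: "0 < m"
  shows apsis_power_impact: "apsis (power_law b s) (power_impact b s m) = (b * (1 + m) / m) powr (1 / s)"
    and half_angle_power_impact: "half_angle (power_law b s) (power_impact b s m) = power_half_angle s m"
proof -
  define r where "r = (b * (1 + m) / m) powr (1 / s)"
  have base: "0 < b * (1 + m) / m" using b m by simp
  then have r: "0 < r" using b m by (simp add: r_def)
  have rs: "b * r powr - s = m / (1 + m)"
  proof -
    have "r powr - s = (b * (1 + m) / m) powr - 1" using s by (simp add: r_def powr_powr)
    also have "\<dots> = m / (b * (1 + m))" using b m by (simp add: powr_minus)
    finally show ?thesis using b by simp
  qed
  have rho: "power_impact b s m = r / sqrt (1 + m)" by (simp add: power_impact_def r_def)
  have q: "(power_impact b s m)\<^sup>2 / r\<^sup>2 = 1 / (1 + m)"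
    using m r by (simp add: rho power_divide)
  show a: "apsis (power_law b s) (power_impact b s m) = (b * (1 + m) / m) powr (1 / s)"
    unfolding r_def[symmetric]
    by (rule apsis_eqI[OF power_law_repulsive power_impact_pos[OF m] r])
      (use m in \<open>simp add: q power_law_def rs add_divide_distrib[symmetric]\<close>)
  have "half_angle_integrand (power_law b s) (power_impact b s m) x = power_half_angle_integrand s m x"
    if x: "x \<in> {0<..<1}" for x
  proof -
    have q': "r\<^sup>2 / (power_impact b s m)\<^sup>2 = 1 + m" using q m r power_impact_pos[OF m] by (simp add: field_simps)
    have pl: "power_law b s (r / x) = b * r powr - s * x powr s"
      using x r by (simp add: power_law_def powr_divide powr_minus field_simps)
    have "(power_law b s r - power_law b s (r / x)) * r\<^sup>2 / (power_impact b s m)\<^sup>2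
        = (b * r powr - s) * (1 - x powr s) * (1 + m)"
      unfolding times_divide_eq_right[symmetric] q' pl by (simp add: power_law_def[of b s r] algebra_simps)
    also have "\<dots> = (m / (1 + m)) * (1 - x powr s) * (1 + m)" unfolding rs ..
    also have "\<dots> = m * (1 - x powr s)" using m by simp
    finally show ?thesis
      by (simp add: half_angle_integrand_def power_half_angle_integrand_def a r_def[symmetric])
  qed
  then show "half_angle (power_law b s) (power_impact b s m) = power_half_angle s m"
    unfolding half_angle_def power_half_angle_def by (intro set_lebesgue_integral_cong) auto
qed

lemma power_param_impact: "0 < m \<Longrightarrow> power_param b s (power_impact b s m) = m"
  using b by (simp add: power_param_def apsis_power_impact) (simp add: power_impact_def)

lemma
  assumes \<rho>: "0 < \<rho>"
  shows power_param_pos: "0 < power_param b s \<rho>"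
    and power_impact_param: "power_impact b s (power_param b s \<rho>) = \<rho>"
proof -
  define r where "r = apsis (power_law b s) \<rho>"
  define m where "m = power_param b s \<rho>"
  have r: "0 < r" using apsis_pos[OF power_law_repulsive \<rho>] by (simp add: r_def)
  have eq: "\<rho>\<^sup>2 / r\<^sup>2 + b * r powr - s = 1" using apsis_eq[OF power_law_repulsive \<rho>] by (simp add: r_def power_law_def)
  have m1: "1 + m = r\<^sup>2 / \<rho>\<^sup>2" by (simp add: m_def power_param_def r_def power_divide)
  have "0 < b * r powr - s" using b r by simp
  then have "\<rho>\<^sup>2 / r\<^sup>2 < 1" using eq by linarith
  then have "1 < r\<^sup>2 / \<rho>\<^sup>2" using r \<rho> by (simp add: field_simps)
  then show m: "0 < power_param b s \<rho>" using m1 by (simp add: m_def)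
  then have m': "0 < m" by (simp add: m_def)
  have "1 / (1 + m) = \<rho>\<^sup>2 / r\<^sup>2" by (simp add: m1)
  then have "b * r powr - s = 1 - 1 / (1 + m)" using eq by linarith
  then have "b * r powr - s = m / (1 + m)" using m' by (simp add: field_simps)
  then have "b * (1 + m) / m = r powr s" using m' r b by (simp add: powr_minus field_simps)
  then have "(b * (1 + m) / m) powr (1 / s) = r" using s r by (simp add: powr_powr)
  moreover have "sqrt (1 + m) = r / \<rho>" using r \<rho> by (simp add: m1 real_sqrt_divide)
  ultimately have "power_impact b s m = \<rho>" using r \<rho> by (simp add: power_impact_def)
  then show "power_impact b s (power_param b s \<rho>) = \<rho>" by (simp add: m_def)
qed

text \<open>Written as an exponential, the derivative is the logarithmic derivative times the
  function; both \<open>(1 + m) / m\<close> and \<open>1 / sqrt (1 + m)\<close> decrease in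
  \<open>m\<close>.\<close>

lemma power_impact_has_derivative:
  assumes m: "0 < m"
  shows "\<exists>D<0. (power_impact b s has_real_derivative D) (at m)"
proof -
  let ?g = "\<lambda>m. exp ((ln b + ln (1 + m) - ln m) / s - ln (1 + m) / 2)"
  let ?D = "?g m * ((1 / (1 + m) - 1 / m) / s - 1 / (1 + m) / 2)"
  have eq: "?g y = power_impact b s y" if "0 < y" for y
  proof -
    have "sqrt (1 + y) = exp (ln (1 + y) / 2)" using that by (simp add: powr_half_sqrt[symmetric] powr_def)
    moreover have "(b * (1 + y) / y) powr (1 / s) = exp ((ln b + ln (1 + y) - ln y) / s)"
      using that b by (simp add: powr_def ln_mult ln_div)
    ultimately show ?thesis by (simp add: power_impact_def exp_diff)
  qed
  have "(?g has_real_derivative ?D) (at m)"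
    using m s by (auto intro!: derivative_eq_intros simp: divide_simps) (simp add: algebra_simps)
  then have "(power_impact b s has_real_derivative ?D) (at m)"
    by (rule has_field_derivative_transform_within_open[of _ _ _ "{0<..}"]) (use m eq in auto)
  moreover have "1 / (1 + m) < 1 / m" using m by (intro divide_strict_left_mono) auto
  then have "(1 / (1 + m) - 1 / m) / s < 0" using s by (intro divide_neg_pos) auto
  then have "(1 / (1 + m) - 1 / m) / s - 1 / (1 + m) / 2 < 0" using m by (smt (verit) divide_pos_pos)
  then have "?D < 0" by (simp add: mult_pos_neg)
  ultimately show ?thesis by blast
qed

lemma deflection_power:
  assumes "0 < \<rho>"
  shows "deflection (power_law b s) \<rho> = pi - 2 * power_half_angle s (power_param b s \<rho>)"
  using half_angle_power_impact[OF power_param_pos[OF assms]]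
  by (simp add: deflection_def power_impact_param[OF assms])

text \<open>\<open>m\<close> decreases in \<open>\<rho>\<close> and the half angle decreases in
  \<open>m\<close>; so the half angle increases and the deflection decreases in
  \<open>\<rho>\<close>.\<close>

lemma deflection_power_has_derivative:
  assumes \<rho>: "0 < \<rho>"
  shows "\<exists>D<0. (deflection (power_law b s) has_real_derivative D) (at \<rho>)"
proof -
  let ?m = "power_param b s \<rho>"
  note m = power_param_pos[OF \<rho>]
  obtain R where R: "R < 0" "(power_impact b s has_real_derivative R) (at ?m)"
    using power_impact_has_derivative[OF m] by blast
  have c: "continuous_on {0<..} (power_impact b s)"
    by (rule continuous_at_imp_continuous_on) (meson DERIV_isCont greaterThan_iff power_impact_has_derivative)
  have "(power_param b s has_real_derivative 1 / R) (at (power_impact b s ?m))"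
    by (rule DERIV_inverse_strong[of "{0<..}"]) (use R m c power_param_impact in auto)
  then have "(power_param b s has_real_derivative 1 / R) (at \<rho>)" by (simp add: power_impact_param[OF \<rho>])
  from DERIV_chain2[OF power_half_angle_has_derivative(1)[OF s m] this]
  have "((\<lambda>\<rho>. pi - 2 * power_half_angle s (power_param b s \<rho>)) has_real_derivative
      - 2 * (power_half_angle_deriv s ?m * (1 / R))) (at \<rho>)"
    by (auto intro!: derivative_eq_intros)
  then have "(deflection (power_law b s) has_real_derivative - 2 * (power_half_angle_deriv s ?m * (1 / R))) (at \<rho>)"
    by (rule has_field_derivative_transform_within_open[of _ _ _ "{0<..}"]) (use \<rho> deflection_power in auto)
  moreover have "0 < power_half_angle_deriv s ?m * (1 / R)"
    using power_half_angle_has_derivative(2)[OF s m] R by (intro mult_neg_neg) auto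
  then have "- 2 * (power_half_angle_deriv s ?m * (1 / R)) < 0" by linarith
  ultimately show ?thesis by blast
qed

lemma continuous_on_deflection_power: "continuous_on {0<..} (deflection (power_law b s))"
  by (rule continuous_at_imp_continuous_on) (meson DERIV_isCont greaterThan_iff deflection_power_has_derivative)

lemma deflection_power_strict_antimono:
  assumes "0 < \<rho>" "\<rho> < \<rho>'"
  shows "deflection (power_law b s) \<rho>' < deflection (power_law b s) \<rho>"
proof (rule DERIV_neg_imp_decreasing[OF assms(2)])
  fix x assume "\<rho> \<le> x" "x \<le> \<rho>'"
  then show "\<exists>y. (deflection (power_law b s) has_real_derivative y) (at x) \<and> y < 0"
    using deflection_power_has_derivative[of x] assms by auto
qed

text \<open>Strictness comes from comparing with twice and with half the impact parameter.\<close>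

lemma deflection_power_bounds:
  assumes "0 < \<rho>"
  shows "0 < deflection (power_law b s) \<rho>" "deflection (power_law b s) \<rho> < pi"
  using deflection_power_strict_antimono[of \<rho> "2 * \<rho>"] deflection_power_strict_antimono[of "\<rho> / 2" \<rho>]
    deflection_bounds[OF power_law_repulsive, of "2 * \<rho>"] deflection_bounds[OF power_law_repulsive, of "\<rho> / 2"] assms by auto

lemma deflection_power_inj:
  "0 < \<rho> \<Longrightarrow> 0 < \<rho>' \<Longrightarrow> deflection (power_law b s) \<rho> = deflection (power_law b s) \<rho>' \<Longrightarrow> \<rho> = \<rho>'"
  using deflection_power_strict_antimono by (metis less_irrefl not_less_iff_gr_or_eq)

lemma deflection_power_surj:
  assumes "\<theta> \<in> {0<..<pi}"
  shows "\<exists>\<rho>>0. deflection (power_law b s) \<rho> = \<theta>"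
proof -
  define y where "y = (pi - \<theta>) / 2"
  have y: "0 < y" "y < pi / 2" using assms by (auto simp: y_def)
  \<comment> \<open>\<open>2 / sqrt m2\<close> is \<open>y / 2\<close>, so the upper bound of the
    half angle falls below \<open>y\<close>.\<close>
  define m2 where "m2 = (4 / y)\<^sup>2"
  have m2: "0 < m2" "power_half_angle s m2 < y"
  proof -
    show "0 < m2" using y by (simp add: m2_def)
    have "sqrt m2 = 4 / y" using y by (simp add: m2_def)
    then have "2 / sqrt m2 < y" using y by simp
    then show "power_half_angle s m2 < y"
      using power_half_angle_le[OF s \<open>0 < m2\<close>] by linarith
  qed
  \<comment> \<open>Chosen so that the lower bound \<open>pi / 2 / sqrt (1 + s * m1)\<close> equals
    \<open>y\<close>.\<close>
  define m1 where "m1 = ((pi / 2 / y)\<^sup>2 - 1) / s"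
  have m1: "0 < m1" "y \<le> power_half_angle s m1"
  proof -
    have 1: "1 < pi / 2 / y" using y by (simp add: field_simps)
    then have "1 < (pi / 2 / y)\<^sup>2" by (simp add: one_less_power)
    then show "0 < m1" using s by (simp add: m1_def)
    have "1 + s * m1 = (pi / 2 / y)\<^sup>2" using s by (simp add: m1_def)
    then have "sqrt (1 + s * m1) = pi / 2 / y" using 1 by (simp only: real_sqrt_abs)
    then have "pi / 2 / sqrt (1 + s * m1) = y" using y by simp
    then show "y \<le> power_half_angle s m1"
      using power_half_angle_ge[OF s, of m1] \<open>0 < m1\<close> by simp
  qed
  have dec: "power_half_angle s m' < power_half_angle s m" if "0 < m" "m < m'" for m m'
  proof (rule DERIV_neg_imp_decreasing[OF that(2)])
    fix x assume "m \<le> x" "x \<le> m'"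
    then show "\<exists>y. (power_half_angle s has_real_derivative y) (at x) \<and> y < 0"
      using power_half_angle_has_derivative[OF s, of x] that by auto
  qed
  have "m1 < m2"
    using dec[of m2 m1] m1 m2 by (cases m1 m2 rule: linorder_cases) auto
  have "\<exists>m\<ge>m1. m \<le> m2 \<and> power_half_angle s m = y"
  proof (rule IVT2')
    show "continuous_on {m1..m2} (power_half_angle s)"
    proof (rule continuous_at_imp_continuous_on, rule ballI)
      fix x assume "x \<in> {m1..m2}"
      then show "isCont (power_half_angle s) x"
        using power_half_angle_has_derivative(1)[OF s, of x] m1 by (intro DERIV_isCont) auto
    qed
  qed (use m1 m2 \<open>m1 < m2\<close> in auto)
  then obtain m where m: "0 < m" "power_half_angle s m = y" using m1(1) by (metis order_less_le_trans)
  then have "deflection (power_law b s) (power_impact b s m) = \<theta>"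
    using half_angle_power_impact[OF m(1)] by (simp add: deflection_def y_def)
  then show ?thesis using power_impact_pos[OF m(1)] by blast
qed

end

section \<open>Scattering angle, impact parameter and kernel of the potential
  \<open>1 / r powr s\<close>\<close>

context
  fixes s w :: real
  assumes s: "1 < s" and w: "0 < w"
begin

abbreviation (input) kernel_angle where "kernel_angle \<equiv> deflection (power_law (4 / w\<^sup>2) s)"

lemma kernel_strength_pos: "0 < 4 / w\<^sup>2"
  using w by simp

lemmas kernel_potential_repulsive = power_law_repulsive[OF kernel_strength_pos s]
lemmas kernel_angle_bounds = deflection_power_bounds[OF kernel_strength_pos s]
lemmas kernel_angle_strict_antimono = deflection_power_strict_antimono[OF kernel_strength_pos s]
lemmas kernel_angle_inj = deflection_power_inj[OF kernel_strength_pos s]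
lemmas kernel_angle_surj = deflection_power_surj[OF kernel_strength_pos s]
lemmas kernel_angle_deriv = deflection_power_has_derivative[OF kernel_strength_pos s]
lemmas kernel_angle_continuous = continuous_on_deflection_power[OF kernel_strength_pos s]

lemma radial_expr_eq: "0 < r \<Longrightarrow> radial_expr s w \<rho> r = 1 - (\<rho>\<^sup>2 / r\<^sup>2 + power_law (4 / w\<^sup>2) s r)"
  by (simp add: radial_expr_def power_law_def powr_minus divide_inverse)

lemma closest_distance_eq: "closest_distance s w \<rho> = apsis (power_law (4 / w\<^sup>2) s) \<rho>"
  unfolding closest_distance_def apsis_def
  by (rule arg_cong[where f=The]) (auto simp: fun_eq_iff radial_expr_eq)

text \<open>The substitution \<open>r = r0 / x\<close> maps the unit interval onto the ray beyond
  the apsis; subtracting the apsis equation from the radicand gives the form of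
  \<open>half_angle_integrand\<close>.\<close>

lemma scattering_angle_eq:
  assumes \<rho>: "0 < \<rho>"
  shows "scattering_angle s w \<rho> = kernel_angle \<rho>"
proof -
  let ?\<kappa> = "power_law (4 / w\<^sup>2) s"
  define r0 where "r0 = apsis ?\<kappa> \<rho>"
  have r0: "0 < r0" "\<rho>\<^sup>2 / r0\<^sup>2 + ?\<kappa> r0 = 1"
    using apsis_pos[OF kernel_potential_repulsive \<rho>] apsis_eq[OF kernel_potential_repulsive \<rho>] by (auto simp: r0_def)
  define f where "f r = \<rho> / (r\<^sup>2 * sqrt (radial_expr s w \<rho> r))" for r
  let ?S = "{0<..<1::real}" and ?I = "half_angle_integrand ?\<kappa> \<rho>"
  have eq: "\<bar>- r0 / x\<^sup>2\<bar> * f (r0 / x) = ?I x" if x: "x \<in> ?S" for x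
  proof -
    let ?A = "1 - x\<^sup>2 + (?\<kappa> r0 - ?\<kappa> (r0 / x)) * r0\<^sup>2 / \<rho>\<^sup>2"
    have A: "0 < ?A"
      using potential_drop_nonneg[OF kernel_potential_repulsive \<rho> x] x unfolding r0_def
      by (intro add_pos_nonneg) (simp add: power_less_one_iff abs_square_less_1)
    have "radial_expr s w \<rho> (r0 / x) = (\<rho>\<^sup>2 / r0\<^sup>2 + ?\<kappa> r0) - (\<rho>\<^sup>2 * x\<^sup>2 / r0\<^sup>2 + ?\<kappa> (r0 / x))"
      unfolding r0(2) using x r0 by (simp add: radial_expr_eq power_divide)
    also have "\<dots> = (\<rho> / r0)\<^sup>2 * ?A"
      using r0(1) \<rho> by (simp add: field_simps power2_eq_square)
    finally have "sqrt (radial_expr s w \<rho> (r0 / x)) = \<rho> / r0 * sqrt ?A"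
      using r0(1) \<rho> by (simp add: real_sqrt_mult)
    then have "\<bar>- r0 / x\<^sup>2\<bar> * f (r0 / x) = (r0 / x\<^sup>2) * (\<rho> / ((r0 / x)\<^sup>2 * (\<rho> / r0 * sqrt ?A)))"
      using r0(1) by (simp add: f_def abs_divide)
    also have "\<dots> = 1 / sqrt ?A"
      using r0(1) \<rho> x A by (simp add: field_simps power2_eq_square)
    finally show ?thesis by (simp add: half_angle_integrand_def r0_def)
  qed
  have si: "set_integrable lborel ?S ?I" by (rule set_integrable_half_angle[OF kernel_potential_repulsive \<rho>])
  have "?I absolutely_integrable_on ?S"
    using si unfolding set_integrable_def by (subst integrable_completion) auto
  then have 1: "(\<lambda>x. \<bar>- r0 / x\<^sup>2\<bar> * f (r0 / x)) absolutely_integrable_on ?S"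
    by (rule absolutely_integrable_spike[where S="{}"]) (use eq in auto)
  have 2: "integral ?S (\<lambda>x. \<bar>- r0 / x\<^sup>2\<bar> * f (r0 / x)) = half_angle ?\<kappa> \<rho>"
    unfolding half_angle_def set_borel_integral_eq_integral(2)[OF si]
    by (rule integral_cong) (use eq in auto)
  have der: "((\<lambda>x. r0 / x) has_field_derivative (- r0 / x\<^sup>2)) (at x within ?S)" if "x \<in> ?S" for x
    using that by (auto intro!: derivative_eq_intros simp: power2_eq_square)
  have inj: "inj_on (\<lambda>x. r0 / x) ?S" using r0 by (auto simp: inj_on_def field_simps)
  have img: "(\<lambda>x. r0 / x) ` ?S = {r0<..}"
  proof (intro equalityI subsetI)
    fix r assume "r \<in> {r0<..}"
    then show "r \<in> (\<lambda>x. r0 / x) ` ?S" using r0 by (intro image_eqI[of _ _ "r0 / r"]) auto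
  qed (use r0 in \<open>auto simp: field_simps\<close>)
  have "f absolutely_integrable_on {r0<..} \<and> integral {r0<..} f = half_angle ?\<kappa> \<rho>"
    using has_absolute_integral_change_of_variables_1'[of ?S "\<lambda>x. r0 / x" "\<lambda>x. - r0 / x\<^sup>2" f "half_angle ?\<kappa> \<rho>"]
      der inj 1 2 unfolding img by auto
  moreover have fm: "f \<in> borel_measurable borel" unfolding f_def radial_expr_def by measurable
  ultimately have i: "set_integrable lborel {r0<..} f" and v: "integral {r0<..} f = half_angle ?\<kappa> \<rho>"
    unfolding set_integrable_def by (auto simp: integrable_completion)
  \<comment> \<open>At the apsis the root is 0 and division by zero yields 0; so the closed ray of
    the definition and the open ray of the substitution give the same integral.\<close>
  have "f r0 = 0" using r0 by (simp add: f_def radial_expr_eq)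
  then have "indicator {r0..} r *\<^sub>R f r = indicator {r0<..} r *\<^sub>R f r" for r
    by (cases "r = r0") (auto simp: indicator_def)
  then have "(LBINT r:{r0..}. f r) = (LBINT r:{r0<..}. f r)"
    unfolding set_lebesgue_integral_def by (simp only:)
  also have "\<dots> = half_angle ?\<kappa> \<rho>" using set_borel_integral_eq_integral(2)[OF i] v by simp
  finally show ?thesis
    unfolding scattering_angle_def deflection_def closest_distance_eq r0_def[symmetric] f_def by simp
qed

lemma impact_parameter_kernel_angle:
  assumes "0 < \<rho>"
  shows "impact_parameter s w (kernel_angle \<rho>) = \<rho>"
  unfolding impact_parameter_def
  by (rule the_equality) (use assms kernel_angle_inj in \<open>auto simp: scattering_angle_eq\<close>)

lemma impact_parameter:
  assumes "t \<in> {0<..<pi}"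
  shows "0 < impact_parameter s w t" "kernel_angle (impact_parameter s w t) = t"
  using kernel_angle_surj[OF assms] impact_parameter_kernel_angle by auto

lemma impact_parameter_has_derivative:
  assumes "0 < \<rho>" "(kernel_angle has_real_derivative D) (at \<rho>)" "D \<noteq> 0"
  shows "(impact_parameter s w has_real_derivative 1 / D) (at (kernel_angle \<rho>))"
  by (rule DERIV_inverse_strong[of "{0<..}"]) (use assms kernel_angle_continuous impact_parameter_kernel_angle in auto)

lemma impact_parameter_differentiable:
  assumes "t \<in> {0<..<pi}"
  shows "(impact_parameter s w has_real_derivative deriv (impact_parameter s w) t) (at t)"
proof -
  obtain D where "D < 0" "(kernel_angle has_real_derivative D) (at (impact_parameter s w t))"
    using kernel_angle_deriv[OF impact_parameter(1)[OF assms]] by blast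
  from impact_parameter_has_derivative[OF impact_parameter(1)[OF assms] this(2)] this(1)
  show ?thesis using impact_parameter(2)[OF assms] by (simp add: DERIV_deriv_iff_real_differentiable real_differentiable_def) blast
qed

text \<open>The relation that determines the kernel, in the form needed for the substitution
  \<open>c = cos \<theta>\<close>: the first factor is the modulus of the derivative of
  \<open>cos \<theta>\<close> in \<open>\<rho>\<close>.\<close>

lemma collision_kernel_at_angle:
  assumes "0 < \<rho>" "(kernel_angle has_real_derivative D) (at \<rho>)" "D \<noteq> 0" "norm (z :: real^3) = w"
  shows "\<bar>- sin (kernel_angle \<rho>) * D\<bar> * collision_kernel s z (cos (kernel_angle \<rho>)) = w * \<rho>"
proof -
  have t: "0 < kernel_angle \<rho>" "kernel_angle \<rho> < pi" using kernel_angle_bounds[OF assms(1)] by auto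
  then have "0 < sin (kernel_angle \<rho>)" by (rule sin_gt_zero)
  moreover have "arccos (cos (kernel_angle \<rho>)) = kernel_angle \<rho>" using t by (intro arccos_cos) auto
  moreover have "deriv (impact_parameter s w) (kernel_angle \<rho>) = 1 / D"
    by (rule DERIV_imp_deriv[OF impact_parameter_has_derivative[OF assms(1-3)]])
  ultimately show ?thesis
    using assms impact_parameter_kernel_angle[OF assms(1)]
    by (simp add: collision_kernel_def Let_def abs_mult abs_divide)
qed

text \<open>The derivative of the impact parameter is a pointwise limit of difference quotients with
  steps \<open>1 / Suc n\<close>. \<open>P0\<close> is extended by 0; the shifted argument is inside
  the interval for large \<open>n\<close>.\<close>

lemma collision_kernel_measurable:
  assumes "norm (z :: real ^ 3) = w"
  shows "(\<lambda>c. indicator {-1<..<1} c * collision_kernel s z c) \<in> borel_measurable borel"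
proof -
  let ?P = "impact_parameter s w"
  define P0 where "P0 t = indicator {0<..<pi} t * ?P t" for t
  have cP: "continuous_on {0<..<pi} ?P"
    by (rule continuous_at_imp_continuous_on) (meson DERIV_isCont impact_parameter_differentiable)
  have P0: "P0 \<in> borel_measurable borel"
    using borel_measurable_continuous_on_indicator[OF _ cP] by (simp add: P0_def[abs_def])
  define P1 where "P1 t = indicator {0<..<pi} t * deriv ?P t" for t
  have "P1 \<in> borel_measurable borel"
  proof (rule borel_measurable_LIMSEQ_real)
    show "(\<lambda>n. indicator {0<..<pi} t * ((P0 (t + 1 / real (Suc n)) - P0 t) * real (Suc n))) \<longlonglongrightarrow> P1 t"
      if "t \<in> space borel" for t
    proof (cases "t \<in> {0<..<pi}")
      case True
      have "((\<lambda>h. (?P (t + h) - ?P t) / h) \<longlongrightarrow> deriv ?P t) (at 0)"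
        using impact_parameter_differentiable[OF True] by (simp add: DERIV_def)
      moreover have "filterlim (\<lambda>n. 1 / real (Suc n)) (at 0) sequentially"
        by (intro filterlim_atI tendsto_eq_intros LIMSEQ_Suc[OF lim_1_over_n] always_eventually) auto
      ultimately have l: "(\<lambda>n. (?P (t + 1 / real (Suc n)) - ?P t) / (1 / real (Suc n))) \<longlonglongrightarrow> deriv ?P t"
        by (rule filterlim_compose)
      have "(\<lambda>n. 1 / real (Suc n)) \<longlonglongrightarrow> 0" by (rule LIMSEQ_Suc[OF lim_1_over_n])
      then have "\<forall>\<^sub>F n in sequentially. 1 / real (Suc n) < pi - t"
        using True by (intro order_tendstoD(2)) auto
      then have "\<forall>\<^sub>F n in sequentially. (?P (t + 1 / real (Suc n)) - ?P t) / (1 / real (Suc n))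
          = indicator {0<..<pi} t * ((P0 (t + 1 / real (Suc n)) - P0 t) * real (Suc n))"
      proof eventually_elim
        case (elim n)
        then have "t + 1 / real (Suc n) \<in> {0<..<pi}" using True by (auto intro: add_pos_pos)
        then show ?case using True by (simp add: P0_def)
      qed
      from Lim_transform_eventually[OF l this] show ?thesis using True by (simp add: P1_def)
    qed (simp add: P1_def)
  qed (use P0 in measurable)
  note [measurable] = P0 this
  have ac: "(\<lambda>c. indicator {-1..1} c * arccos c) \<in> borel_measurable borel"
    using borel_measurable_continuous_on_indicator[OF _ continuous_on_arccos'] by simp
  define A where "A c = indicator {-1..1} c * arccos c" for c :: real
  have [measurable]: "A \<in> borel_measurable borel" using ac by (simp add: A_def[abs_def])
  have "(\<lambda>c. indicator {-1<..<1} c * (w * P0 (A c) * \<bar>P1 (A c)\<bar> / sin (A c))) \<in> borel_measurable borel"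
    by measurable
  moreover have "indicator {-1<..<1} c * (w * P0 (A c) * \<bar>P1 (A c)\<bar> / sin (A c)) = indicator {-1<..<1} c * collision_kernel s z c" for c
  proof (cases "c \<in> {-1<..<1}")
    case True
    then have "A c = arccos c" "arccos c \<in> {0<..<pi}"
      using arccos_lt_bounded[of c] by (auto simp: A_def)
    then show ?thesis by (simp add: collision_kernel_def Let_def assms P0_def P1_def)
  qed simp
  ultimately show ?thesis by (simp only:)
qed

text \<open>The substitution \<open>c = cos \<theta>\<close> with \<open>\<theta>\<close> the angle
  at \<open>\<rho>\<close>. Deviation angles of at least \<open>\<delta>\<close> are impact
  parameters up to \<open>impact_parameter s w \<delta>\<close>, a bounded range on which the
  integrand is bounded; the angle \<open>pi\<close> is not attained for positive
  \<open>\<rho>\<close>, hence the open end at -1.\<close>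

lemma collision_kernel_integral:
  fixes G :: "real \<Rightarrow> real" and z :: "real ^ 3"
  assumes z: "norm z = w" and \<delta>: "\<delta> \<in> {0<..<pi}"
    and G: "continuous_on {0..pi} G"
  shows "(\<lambda>c. G (arccos c) * collision_kernel s z c) absolutely_integrable_on {-1<..cos \<delta>}"
    and "integral {-1<..cos \<delta>} (\<lambda>c. G (arccos c) * collision_kernel s z c) =
      w * integral {0<..impact_parameter s w \<delta>} (\<lambda>\<rho>. \<rho> * G (kernel_angle \<rho>))"
proof -
  let ?P = "impact_parameter s w \<delta>"
  let ?S = "{0<..?P}"
  have P: "0 < ?P" "kernel_angle ?P = \<delta>" using impact_parameter[OF \<delta>] by auto
  obtain D where D: "\<And>\<rho>. 0 < \<rho> \<Longrightarrow> D \<rho> < 0 \<and> (kernel_angle has_real_derivative D \<rho>) (at \<rho>)"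
    using kernel_angle_deriv by metis
  let ?g = "\<lambda>\<rho>. cos (kernel_angle \<rho>)" and ?g' = "\<lambda>\<rho>. - sin (kernel_angle \<rho>) * D \<rho>"
  let ?f = "\<lambda>c. G (arccos c) * collision_kernel s z c"
  have b: "0 \<le> kernel_angle \<rho>" "kernel_angle \<rho> \<le> pi" if "0 < \<rho>" for \<rho> using kernel_angle_bounds[OF that] by auto
  have der: "(?g has_field_derivative ?g' \<rho>) (at \<rho> within ?S)" if "\<rho> \<in> ?S" for \<rho>
    using DERIV_chain2[OF DERIV_cos] D[of \<rho>] that has_field_derivative_at_within by fastforce
  have inj: "inj_on ?g ?S"
  proof (rule inj_onI)
    fix x y assume x: "x \<in> ?S" and y: "y \<in> ?S" and "?g x = ?g y"
    then have "kernel_angle x = kernel_angle y" using b[of x] b[of y] by (metis arccos_cos greaterThanAtMost_iff)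
    then show "x = y" using kernel_angle_inj[of x y] x y by auto
  qed
  have img: "?g ` ?S = {-1<..cos \<delta>}"
  proof (intro equalityI subsetI)
    fix c assume "c \<in> ?g ` ?S"
    then obtain \<rho> where \<rho>: "0 < \<rho>" "\<rho> \<le> ?P" "c = cos (kernel_angle \<rho>)" by auto
    have "\<delta> \<le> kernel_angle \<rho>" using kernel_angle_strict_antimono[OF \<rho>(1), of ?P] \<rho> P by (cases "\<rho> = ?P") auto
    then have "c \<le> cos \<delta>" using \<rho> \<delta> b[OF \<rho>(1)] by (auto intro: cos_monotone_0_pi_le)
    moreover have "- 1 < c" using kernel_angle_bounds[OF \<rho>(1)] cos_monotone_0_pi[of "kernel_angle \<rho>" pi] \<rho> by auto
    ultimately show "c \<in> {-1<..cos \<delta>}" by simp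
  next
    fix c assume c: "c \<in> {-1<..cos \<delta>}"
    have d1: "cos \<delta> < 1" using cos_monotone_0_pi[of 0 \<delta>] \<delta> by auto
    define t where "t = arccos c"
    have t: "0 < t" "t < pi" "cos t = c" using c d1 arccos_lt_bounded[of c] by (auto simp: t_def)
    obtain \<rho> where \<rho>: "0 < \<rho>" "kernel_angle \<rho> = t" using kernel_angle_surj[of t] t by auto
    have "\<rho> \<le> ?P"
    proof (rule ccontr)
      assume "\<not> \<rho> \<le> ?P"
      then have "t < \<delta>" using kernel_angle_strict_antimono[OF P(1), of \<rho>] P \<rho> by auto
      then have "cos \<delta> < cos t" using t \<delta> by (intro cos_monotone_0_pi) auto
      then show False using c t by auto
    qed
    then show "c \<in> ?g ` ?S" using \<rho> t by (intro image_eqI[of _ _ \<rho>]) auto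
  qed
  have eq: "\<bar>?g' \<rho>\<bar> * ?f (?g \<rho>) = w * (\<rho> * G (kernel_angle \<rho>))" if "\<rho> \<in> ?S" for \<rho>
  proof -
    have r: "0 < \<rho>" using that by auto
    have "\<bar>?g' \<rho>\<bar> * ?f (?g \<rho>) = G (arccos (cos (kernel_angle \<rho>))) * (\<bar>?g' \<rho>\<bar> * collision_kernel s z (cos (kernel_angle \<rho>)))"
      by (simp only: mult_ac)
    moreover have "\<bar>?g' \<rho>\<bar> * collision_kernel s z (cos (kernel_angle \<rho>)) = w * \<rho>"
      by (rule collision_kernel_at_angle[OF r _ _ z]) (use D[OF r] in auto)
    moreover have "arccos (cos (kernel_angle \<rho>)) = kernel_angle \<rho>" using b[OF r] by (intro arccos_cos) auto
    ultimately show ?thesis by (simp only: mult_ac)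
  qed
  have cG: "continuous_on {0<..} (\<lambda>\<rho>. G (kernel_angle \<rho>))"
    by (rule continuous_on_compose2[OF G kernel_angle_continuous]) (use b in auto)
  have "bounded (G ` {0..pi})"
    using compact_imp_bounded[OF compact_continuous_image[OF G]] by simp
  then obtain K where K: "\<And>t. t \<in> {0..pi} \<Longrightarrow> \<bar>G t\<bar> \<le> K"
    unfolding bounded_iff by (metis imageI real_norm_def)
  have "(\<lambda>\<rho>. w * (\<rho> * G (kernel_angle \<rho>))) absolutely_integrable_on ?S"
  proof (rule measurable_bounded_by_integrable_imp_absolutely_integrable)
    show "(\<lambda>\<rho>. w * (\<rho> * G (kernel_angle \<rho>))) \<in> borel_measurable (lebesgue_on ?S)"
      by (rule continuous_imp_measurable_on_sets_lebesgue)
        (auto intro!: continuous_intros continuous_on_subset[OF cG])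
    show "(\<lambda>\<rho>. w * (?P * K)) integrable_on ?S"
      by (rule integrable_on_const) (simp add: bounded_set_imp_lmeasurable)
    show "norm (w * (\<rho> * G (kernel_angle \<rho>))) \<le> w * (?P * K)" if "\<rho> \<in> ?S" for \<rho>
      using that w K[of "kernel_angle \<rho>"] b[of \<rho>] by (auto simp: abs_mult intro!: mult_left_mono mult_mono)
  qed simp
  then have 1: "(\<lambda>\<rho>. \<bar>?g' \<rho>\<bar> * ?f (?g \<rho>)) absolutely_integrable_on ?S"
    by (rule absolutely_integrable_spike[where S="{}"]) (use eq in auto)
  have 2: "integral ?S (\<lambda>\<rho>. \<bar>?g' \<rho>\<bar> * ?f (?g \<rho>)) = w * integral ?S (\<lambda>\<rho>. \<rho> * G (kernel_angle \<rho>))"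
    unfolding integral_mult_right[symmetric] by (rule integral_cong) (use eq in auto)
  have S: "?S \<in> sets lebesgue" by simp
  have "?f absolutely_integrable_on {-1<..cos \<delta>} \<and>
      integral {-1<..cos \<delta>} ?f = w * integral ?S (\<lambda>\<rho>. \<rho> * G (kernel_angle \<rho>))"
    using has_absolute_integral_change_of_variables_1'[OF S der inj, of ?f "w * integral ?S (\<lambda>\<rho>. \<rho> * G (kernel_angle \<rho>))"] 1 2
    unfolding img by auto
  then show "?f absolutely_integrable_on {-1<..cos \<delta>}"
    "integral {-1<..cos \<delta>} ?f = w * integral ?S (\<lambda>\<rho>. \<rho> * G (kernel_angle \<rho>))" by auto
qed

end

section \<open>The gain term\<close>

text \<open>The mean value inequality for \<open>\<psi>\<close> minus its linear part at
  \<open>x\<close>, whose derivative on the ball of radius \<open>norm h\<close> is at most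
  \<open>C * norm h\<close>. One constant for all bounds keeps the later estimates short.\<close>

lemma C3_bounded_taylor:
  assumes "C3_bounded \<psi>"
  shows "\<exists>(D :: real^3 \<Rightarrow> (real^3) \<Rightarrow>\<^sub>L real) C. 0 \<le> C \<and> continuous_on UNIV \<psi> \<and> (\<forall>x. \<bar>\<psi> x\<bar> \<le> C) \<and> (\<forall>x. norm (D x) \<le> C) \<and>
    (\<forall>x h. \<bar>\<psi> (x + h) - \<psi> x - blinfun_apply (D x) h\<bar> \<le> C * (norm h)\<^sup>2)"
proof -
  from assms obtain D1 :: "real ^ 3 \<Rightarrow> ((real ^ 3) \<Rightarrow>\<^sub>L real)"
    and D2 :: "real ^ 3 \<Rightarrow> ((real ^ 3) \<Rightarrow>\<^sub>L ((real ^ 3) \<Rightarrow>\<^sub>L real))"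
    where b: "bounded (range \<psi>)" "bounded (range D1)" "bounded (range D2)"
      and d1: "\<And>x. (\<psi> has_derivative blinfun_apply (D1 x)) (at x)"
      and d2: "\<And>x. (D1 has_derivative blinfun_apply (D2 x)) (at x)"
    unfolding C3_bounded_def by blast
  from b obtain B0 B1 B2 where B: "\<And>x. norm (\<psi> x) \<le> B0" "\<And>x. norm (D1 x) \<le> B1" "\<And>x. norm (D2 x) \<le> B2"
    unfolding bounded_iff by (metis rangeI)
  define C where "C = max B0 (max B1 B2)"
  have C: "\<bar>\<psi> x\<bar> \<le> C" "norm (D1 x) \<le> C" "norm (D2 x) \<le> C" for x
    using B(1)[of x] B(2)[of x] B(3)[of x] by (auto simp: C_def)
  have C0: "0 \<le> C" using C(2) norm_ge_zero order_trans by blast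
  have lip: "norm (D1 y - D1 x) \<le> C * norm (y - x)" for x y
    by (rule differentiable_bound[of UNIV D1 "\<lambda>x. blinfun_apply (D2 x)"])
      (use d2 C(3) in \<open>auto simp: norm_blinfun.rep_eq[symmetric]\<close>)
  have "\<bar>\<psi> (x + h) - \<psi> x - D1 x h\<bar> \<le> C * (norm h)\<^sup>2" for x h
  proof -
    define g where "g y = \<psi> y - D1 x y" for y
    have "norm (g (x + h) - g x) \<le> (C * norm h) * norm (x + h - x)"
    proof (rule differentiable_bound[of "cball x (norm h)" g "\<lambda>y. blinfun_apply (D1 y - D1 x)"])
      fix y assume y: "y \<in> cball x (norm h)"
      have "(g has_derivative (\<lambda>k. D1 y k - D1 x k)) (at y)"
        unfolding g_def by (intro has_derivative_diff d1 blinfun.bounded_linear_right[THEN bounded_linear_imp_has_derivative])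
      then show "(g has_derivative blinfun_apply (D1 y - D1 x)) (at y within cball x (norm h))"
        by (simp add: blinfun.diff_left[abs_def] has_derivative_at_withinI)
      have "norm (D1 y - D1 x) \<le> C * norm (y - x)" by (rule lip)
      also have "\<dots> \<le> C * norm h" using y C0 by (intro mult_left_mono) (auto simp: dist_norm norm_minus_commute)
      finally show "onorm (blinfun_apply (D1 y - D1 x)) \<le> C * norm h" by (simp add: norm_blinfun.rep_eq)
    qed (auto simp: dist_norm)
    then show ?thesis by (simp add: g_def blinfun.add_right power2_eq_square algebra_simps)
  qed
  moreover have "continuous_on UNIV \<psi>"
    using d1 by (auto intro!: has_derivative_continuous continuous_at_imp_continuous_on)
  ultimately show ?thesis using C C0 by blast
qed

definition collision_gain :: "(real ^ 3 \<Rightarrow> real) \<Rightarrow> real ^ 3 \<Rightarrow> real ^ 3 \<Rightarrow> real ^ 3 \<Rightarrow> real" where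
  "collision_gain \<psi> v1 v2 \<sigma> =
     \<psi> ((v1 + v2) /\<^sub>R 2 + (norm (v1 - v2) / 2) *\<^sub>R \<sigma>) + \<psi> ((v1 + v2) /\<^sub>R 2 - (norm (v1 - v2) / 2) *\<^sub>R \<sigma>)
       - \<psi> v1 - \<psi> v2"

definition scattered :: "real ^ 3 \<Rightarrow> real ^ 3 \<Rightarrow> real ^ 3 \<Rightarrow> real \<Rightarrow> real \<Rightarrow> real ^ 3" where
  "scattered e0 e1 e2 \<theta> \<phi> = cos \<theta> *\<^sub>R e0 + sin \<theta> *\<^sub>R (cos \<phi> *\<^sub>R e1 + sin \<phi> *\<^sub>R e2)"

definition azimuthal_gain ::
    "(real ^ 3 \<Rightarrow> real) \<Rightarrow> real ^ 3 \<Rightarrow> real ^ 3 \<Rightarrow> real ^ 3 \<Rightarrow> real ^ 3 \<Rightarrow> real ^ 3 \<Rightarrow> real \<Rightarrow> real" where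
  "azimuthal_gain \<psi> v1 v2 e0 e1 e2 \<theta> = integral {0..2 * pi} (\<lambda>\<phi>. collision_gain \<psi> v1 v2 (scattered e0 e1 e2 \<theta> \<phi>))"

lemma has_integral_cos_sin_period:
  "(cos has_integral 0) {0..2 * pi}" "(sin has_integral (0::real)) {0..2 * pi}"
proof -
  have "(cos has_integral (sin (2 * pi) - sin 0)) {0..2 * pi}"
    by (rule fundamental_theorem_of_calculus)
      (auto simp flip: has_real_derivative_iff_has_vector_derivative intro!: derivative_eq_intros)
  then show "(cos has_integral 0) {0..2 * pi}" by simp
  have "(sin has_integral (- cos (2 * pi) - (- cos 0))) {0..2 * pi}"
    by (rule fundamental_theorem_of_calculus)
      (auto simp flip: has_real_derivative_iff_has_vector_derivative intro!: derivative_eq_intros)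
  then show "(sin has_integral (0::real)) {0..2 * pi}" by simp
qed

lemma one_minus_cos_le: "1 - cos (t::real) \<le> t\<^sup>2 / 2"
proof -
  have "1 - cos t = 2 * (sin (t / 2))\<^sup>2"
    using cos_double_sin[of "t / 2"] by simp
  also have "(sin (t / 2))\<^sup>2 \<le> (t / 2)\<^sup>2"
    using abs_sin_x_le_abs_x[of "t / 2"] by (simp only: abs_le_square_iff)
  finally show ?thesis by (simp add: power_divide)
qed

lemma continuous_azimuthal_gain:
  assumes "continuous_on UNIV \<psi>"
  shows "continuous_on UNIV (azimuthal_gain \<psi> v1 v2 e0 e1 e2)"
proof -
  have "continuous_on (UNIV \<times> cbox 0 (2 * pi)) (\<lambda>(\<theta>, \<phi>). collision_gain \<psi> v1 v2 (scattered e0 e1 e2 \<theta> \<phi>))"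
    unfolding collision_gain_def scattered_def case_prod_unfold
    by (intro continuous_intros continuous_on_compose2[OF assms]) auto
  from integral_continuous_on_param[OF this] show ?thesis
    unfolding azimuthal_gain_def[abs_def] by simp
qed

\<comment> \<open>The terms of first order in \<open>sin \<theta>\<close> cancel in the average over the azimuth, which leaves the order \<open>\<theta>\<^sup>2\<close>.\<close>
lemma azimuthal_gain_bounds:
  assumes C: "0 \<le> C" "continuous_on UNIV \<psi>" "\<And>x. \<bar>\<psi> x\<bar> \<le> C" "\<And>x. norm (D x) \<le> C"
    "\<And>x h. \<bar>\<psi> (x + h) - \<psi> x - blinfun_apply (D x) h\<bar> \<le> C * (norm h)\<^sup>2"
    and e: "orthonormal3 e0 e1 e2" and e0: "v1 - v2 = norm (v1 - v2) *\<^sub>R e0"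
  shows "\<bar>azimuthal_gain \<psi> v1 v2 e0 e1 e2 \<theta>\<bar> \<le> 8 * pi * C"
    and "\<bar>azimuthal_gain \<psi> v1 v2 e0 e1 e2 \<theta>\<bar> \<le> pi * C * (norm (v1 - v2) + (norm (v1 - v2))\<^sup>2) * \<theta>\<^sup>2"
proof -
  let ?w = "norm (v1 - v2)"
  let ?g = "\<lambda>\<phi>. collision_gain \<psi> v1 v2 (scattered e0 e1 e2 \<theta> \<phi>)"
  define h where "h \<phi> = (?w / 2) *\<^sub>R (scattered e0 e1 e2 \<theta> \<phi> - e0)" for \<phi>
  define A where "A = D v1 - D v2"
  have cg: "continuous_on {0..2 * pi} ?g"
    unfolding collision_gain_def scattered_def by (intro continuous_intros continuous_on_compose2[OF C(2)]) auto
  have gi: "(?g has_integral azimuthal_gain \<psi> v1 v2 e0 e1 e2 \<theta>) {0..2 * pi}"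
    unfolding azimuthal_gain_def by (intro integrable_integral integrable_continuous_real cg)
  have g4: "\<bar>?g \<phi>\<bar> \<le> 4 * C" for \<phi>
    unfolding collision_gain_def
    using C(3)[of v1] C(3)[of v2] C(3)[of "(v1 + v2) /\<^sub>R 2 + (norm (v1 - v2) / 2) *\<^sub>R scattered e0 e1 e2 \<theta> \<phi>"]
      C(3)[of "(v1 + v2) /\<^sub>R 2 - (norm (v1 - v2) / 2) *\<^sub>R scattered e0 e1 e2 \<theta> \<phi>"] by linarith
  have "\<bar>azimuthal_gain \<psi> v1 v2 e0 e1 e2 \<theta>\<bar> \<le> 4 * C * (2 * pi - 0)"
    using has_integral_bound[OF _ gi[folded box_real(2)], of "4 * C"] g4 C(1) by simp
  then show "\<bar>azimuthal_gain \<psi> v1 v2 e0 e1 e2 \<theta>\<bar> \<le> 8 * pi * C" by (simp add: mult_ac)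
  \<comment> \<open>In the collision the first velocity gains the transfer \<open>h\<close> and the
    second loses it.\<close>
  have v: "(v1 + v2) /\<^sub>R 2 + (?w / 2) *\<^sub>R \<sigma> = v1 + (?w / 2) *\<^sub>R (\<sigma> - e0)"
    "(v1 + v2) /\<^sub>R 2 - (?w / 2) *\<^sub>R \<sigma> = v2 + - ((?w / 2) *\<^sub>R (\<sigma> - e0))" for \<sigma>
  proof -
    have "(?w / 2) *\<^sub>R e0 = (1 / 2) *\<^sub>R (v1 - v2)" by (subst e0) simp
    then have d: "(?w / 2) *\<^sub>R (\<sigma> - e0) = (?w / 2) *\<^sub>R \<sigma> - (1 / 2) *\<^sub>R (v1 - v2)"
      by (simp only: scaleR_diff_right)
    have aux: "(v1 + v2) /\<^sub>R 2 + u = v1 + (u - (1 / 2) *\<^sub>R (v1 - v2))"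
      "(v1 + v2) /\<^sub>R 2 - u = v2 + - (u - (1 / 2) *\<^sub>R (v1 - v2))" for u :: "real^3"
      by (simp_all add: vec_eq_iff field_simps)
    show "(v1 + v2) /\<^sub>R 2 + (?w / 2) *\<^sub>R \<sigma> = v1 + (?w / 2) *\<^sub>R (\<sigma> - e0)"
      "(v1 + v2) /\<^sub>R 2 - (?w / 2) *\<^sub>R \<sigma> = v2 + - ((?w / 2) *\<^sub>R (\<sigma> - e0))"
      by (simp_all only: aux d)
  qed
  \<comment> \<open>Two Taylor remainders, quadratic in the transfer, plus a linear term in which
    the derivatives at \<open>v1\<close> and \<open>v2\<close> enter with opposite signs.\<close>
  have g: "?g \<phi> = (\<psi> (v1 + h \<phi>) - \<psi> v1 - D v1 (h \<phi>)) + (\<psi> (v2 + - h \<phi>) - \<psi> v2 - D v2 (- h \<phi>)) + A (h \<phi>)" for \<phi>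
    unfolding collision_gain_def v h_def[symmetric] by (simp add: A_def blinfun.diff_left blinfun.minus_right)
  have e': "e0 \<bullet> e0 = 1" "e1 \<bullet> e1 = 1" "e2 \<bullet> e2 = 1" "e0 \<bullet> e1 = 0" "e0 \<bullet> e2 = 0" "e1 \<bullet> e2 = 0"
    "e1 \<bullet> e0 = 0" "e2 \<bullet> e0 = 0" "e2 \<bullet> e1 = 0"
    using e by (auto simp: orthonormal3_def inner_commute)
  have nh: "(norm (h \<phi>))\<^sup>2 \<le> ?w\<^sup>2 * \<theta>\<^sup>2 / 4" for \<phi>
  proof -
    define u where "u = cos \<phi> *\<^sub>R e1 + sin \<phi> *\<^sub>R e2"
    have u: "u \<bullet> u = 1" "e0 \<bullet> u = 0" "u \<bullet> e0 = 0"
      using sin_cos_squared_add3[of \<phi>] by (auto simp: u_def inner_add_left inner_add_right e')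
    have "scattered e0 e1 e2 \<theta> \<phi> - e0 = (cos \<theta> - 1) *\<^sub>R e0 + sin \<theta> *\<^sub>R u"
      by (simp add: scattered_def u_def scaleR_diff_left)
    then have "(scattered e0 e1 e2 \<theta> \<phi> - e0) \<bullet> (scattered e0 e1 e2 \<theta> \<phi> - e0)
        = (cos \<theta> - 1) * (cos \<theta> - 1) + sin \<theta> * sin \<theta>"
      by (simp add: inner_add_left inner_add_right u e')
    also have "\<dots> = 2 * (1 - cos \<theta>)" using sin_cos_squared_add3[of \<theta>] by (simp add: algebra_simps)
    also have "\<dots> \<le> \<theta>\<^sup>2" using one_minus_cos_le[of \<theta>] by simp
    finally have "(norm (scattered e0 e1 e2 \<theta> \<phi> - e0))\<^sup>2 \<le> \<theta>\<^sup>2" by (simp add: dot_square_norm)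
    then have "(?w / 2)\<^sup>2 * (norm (scattered e0 e1 e2 \<theta> \<phi> - e0))\<^sup>2 \<le> (?w / 2)\<^sup>2 * \<theta>\<^sup>2"
      by (intro mult_left_mono) auto
    then show ?thesis by (simp add: h_def power_mult_distrib power_divide)
  qed
  \<comment> \<open>The components along \<open>e1\<close> and \<open>e2\<close> carry
    \<open>cos \<phi>\<close> and \<open>sin \<phi>\<close> and vanish in the integral over a
    period; the one along \<open>e0\<close> carries \<open>cos \<theta> - 1\<close>, which is
    quadratic in the angle.\<close>
  have Ah: "A (h \<phi>) = (?w / 2) * (cos \<theta> - 1) * A e0 + (?w / 2) * sin \<theta> * (A e1 * cos \<phi> + A e2 * sin \<phi>)" for \<phi>
    by (simp add: h_def scattered_def blinfun.scaleR_right blinfun.add_right blinfun.diff_right algebra_simps) (simp add: field_simps)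
  have const: "((\<lambda>x::real. c) has_integral 2 * pi * c) {0..2 * pi}" for c :: real
    using has_integral_const_real[of c 0 "2 * pi"] by simp
  have Ai: "((\<lambda>\<phi>. A (h \<phi>)) has_integral (2 * pi * ((?w / 2) * (cos \<theta> - 1) * A e0) + (?w / 2) * sin \<theta> * (A e1 * 0 + A e2 * 0))) {0..2 * pi}"
    unfolding Ah
    by (rule has_integral_add[OF const has_integral_mult_right[OF has_integral_add[OF
          has_integral_mult_right[OF has_integral_cos_sin_period(1)] has_integral_mult_right[OF has_integral_cos_sin_period(2)]]]])
  have "((\<lambda>\<phi>. ?g \<phi> - A (h \<phi>)) has_integral (azimuthal_gain \<psi> v1 v2 e0 e1 e2 \<theta> - 2 * pi * ((?w / 2) * (cos \<theta> - 1) * A e0))) {0..2 * pi}"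
    using has_integral_diff[OF gi Ai] by simp
  moreover have "\<bar>?g \<phi> - A (h \<phi>)\<bar> \<le> 2 * C * (?w\<^sup>2 * \<theta>\<^sup>2 / 4)" for \<phi>
  proof -
    have "\<bar>?g \<phi> - A (h \<phi>)\<bar> \<le> C * (norm (h \<phi>))\<^sup>2 + C * (norm (- h \<phi>))\<^sup>2"
      unfolding g using C(5)[of v1 "h \<phi>"] C(5)[of v2 "- h \<phi>"] by linarith
    also have "\<dots> = 2 * C * (norm (h \<phi>))\<^sup>2" by simp
    also have "\<dots> \<le> 2 * C * (?w\<^sup>2 * \<theta>\<^sup>2 / 4)" using nh C(1) by (intro mult_left_mono) auto
    finally show ?thesis .
  qed
  ultimately have 1: "\<bar>azimuthal_gain \<psi> v1 v2 e0 e1 e2 \<theta> - 2 * pi * ((?w / 2) * (cos \<theta> - 1) * A e0)\<bar> \<le> 2 * C * (?w\<^sup>2 * \<theta>\<^sup>2 / 4) * (2 * pi)"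
    using has_integral_bound[of "2 * C * (?w\<^sup>2 * \<theta>\<^sup>2 / 4)" "\<lambda>\<phi>. ?g \<phi> - A (h \<phi>)" _ 0 "2 * pi"] C(1) by simp
  have "norm e0 = 1" using e'(1) by (simp add: norm_eq_sqrt_inner)
  then have "\<bar>A e0\<bar> \<le> 2 * C"
    using norm_blinfun[of A e0] norm_triangle_ineq4[of "D v1" "D v2"] C(4)[of v1] C(4)[of v2] by (simp add: A_def)
  then have 3: "\<bar>(?w / 2) * (cos \<theta> - 1) * A e0\<bar> \<le> (?w / 2) * (\<theta>\<^sup>2 / 2) * (2 * C)"
    using one_minus_cos_le[of \<theta>] C(1) unfolding abs_mult by (intro mult_mono) auto
  have 2: "\<bar>2 * pi * ((?w / 2) * (cos \<theta> - 1) * A e0)\<bar> \<le> 2 * pi * ((?w / 2) * (\<theta>\<^sup>2 / 2) * (2 * C))"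
    unfolding abs_mult[of "2 * pi"] by (rule mult_mono[OF _ 3]) auto
  have "\<bar>azimuthal_gain \<psi> v1 v2 e0 e1 e2 \<theta>\<bar> \<le> 2 * C * (?w\<^sup>2 * \<theta>\<^sup>2 / 4) * (2 * pi) + 2 * pi * ((?w / 2) * (\<theta>\<^sup>2 / 2) * (2 * C))"
    using 1 2 by linarith
  also have "\<dots> = pi * C * (?w + ?w\<^sup>2) * \<theta>\<^sup>2" by (simp add: algebra_simps)
  finally show "\<bar>azimuthal_gain \<psi> v1 v2 e0 e1 e2 \<theta>\<bar> \<le> pi * C * (?w + ?w\<^sup>2) * \<theta>\<^sup>2" .
qed

section \<open>Truncated singular potentials\<close>

lemma antimono_derivative_nonpos:
  fixes g :: "real \<Rightarrow> real"
  assumes "antimono_on {0<..} g" "0 < r" "(g has_real_derivative D) (at r)"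
  shows "D \<le> 0"
proof (rule ccontr)
  assume "\<not> D \<le> 0"
  then obtain d where d: "d > 0" "\<And>h. h > 0 \<Longrightarrow> h < d \<Longrightarrow> g r < g (r + h)"
    using DERIV_pos_inc_right[OF assms(3)] by auto
  have "g (r + d / 2) \<le> g r"
    using assms(1,2) d(1) by (auto simp: monotone_on_def)
  then show False using d(2)[of "d/2"] d(1) by auto
qed

text \<open>The force must be continuous up to the sphere although \<open>f\<close> is smooth only
  on the open interval: a bounded second derivative makes \<open>deriv f\<close> Lipschitz, hence
  continuously extendable to the end points. One \<open>d\<phi>\<close> serves for all
  strengths.\<close>

lemma singular_potential_scattering:
  assumes "singular_potential s \<Phi> \<phi> f"
  shows "\<exists>d\<phi>. \<forall>\<epsilon> w \<rho>. 0 < \<epsilon> \<longrightarrow> 0 < w \<longrightarrow> 0 < \<rho> \<longrightarrow> \<rho> < 1 \<longrightarrow>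
    scattering (\<lambda>r. \<epsilon> * \<phi> r) (\<lambda>r. \<epsilon> * d\<phi> r) w \<rho>"
    and "continuous_on {0<..} \<phi>"
proof -
  from assms have s: "0 \<le> s" and c\<Phi>: "continuous_on (- {0}) \<Phi>" and \<Phi>: "\<And>x. x \<noteq> 0 \<Longrightarrow> \<Phi> x = \<phi> (norm x)"
    and anti: "antimono_on {0<..} \<phi>" and \<phi>: "\<And>r. 0 < r \<Longrightarrow> r \<le> 1 \<Longrightarrow> \<phi> r = f r / r powr s"
    and \<phi>0: "\<And>r. 1 < r \<Longrightarrow> \<phi> r = 0" and sm: "smooth_bounded_01 f" and cf: "continuous_on {0..1} f"
    and f1: "f 1 = 0"
    by (auto simp: singular_potential_def)
  show c\<phi>: "continuous_on {0<..} \<phi>"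
  proof -
    have "continuous_on {0<..} (\<lambda>r. \<Phi> (r *\<^sub>R axis 1 1))"
      by (rule continuous_on_compose2[OF c\<Phi>]) (auto intro!: continuous_intros simp: axis_eq_0_iff)
    then show ?thesis
      by (rule continuous_on_eq) (auto simp: \<Phi> axis_eq_0_iff norm_axis_1)
  qed
  have sm': "(deriv ^^ k) f differentiable (at r)" "bounded ((deriv ^^ k) f ` {0<..<1})" if "r \<in> {0<..<1}" for k r
    using sm that by (auto simp: smooth_bounded_01_def)
  have df: "(f has_real_derivative deriv f r) (at r)" if "r \<in> {0<..<1}" for r
    using sm'(1)[OF that, of 0] by (simp add: DERIV_deriv_iff_real_differentiable)
  have ddf: "(deriv f has_real_derivative deriv (deriv f) r) (at r)" if "r \<in> {0<..<1}" for r
    using sm'(1)[OF that, of 1] by (simp add: DERIV_deriv_iff_real_differentiable)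
  have "bounded (deriv (deriv f) ` {0<..<1})"
    using sm'(2)[of "1/2" 2] by (simp add: numeral_2_eq_2)
  then obtain K where K: "\<And>r. r \<in> {0<..<1} \<Longrightarrow> \<bar>deriv (deriv f) r\<bar> \<le> K"
    unfolding bounded_iff by (metis imageI real_norm_def)
  have lip: "norm (deriv f y - deriv f x) \<le> K * norm (y - x)" if "x \<in> {0<..<1}" "y \<in> {0<..<1}" for x y
  proof (rule field_differentiable_bound[of "{0<..<1}" "deriv f" "\<lambda>x. deriv (deriv f) x"])
    show "(deriv f has_field_derivative deriv (deriv f) z) (at z within {0<..<1})" if "z \<in> {0<..<1}" for z
      using ddf[OF that] by (rule has_field_derivative_at_within)
  qed (use that K in auto)
  have "K-lipschitz_on {0<..<1} (deriv f)"
    by (rule lipschitz_onI) (use lip K[of "1/2"] in \<open>auto simp: dist_norm\<close>)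
  then have "uniformly_continuous_on {0<..<1} (deriv f)" by (rule lipschitz_on_uniformly_continuous)
  then obtain g where g: "uniformly_continuous_on (closure {0<..<1}) g" "\<And>r. r \<in> {0<..<1} \<Longrightarrow> deriv f r = g r"
    by (rule uniformly_continuous_on_extension_on_closure) blast
  have cg: "continuous_on {0..1} g" using uniformly_continuous_imp_continuous[OF g(1)] by simp
  define d\<phi> where "d\<phi> r = g r / r powr s - s * f r / r powr (s + 1)" for r
  have der: "(\<phi> has_real_derivative d\<phi> r) (at r)" if r: "0 < r" "r < 1" for r
  proof -
    have "((\<lambda>r. f r * r powr - s) has_real_derivative deriv f r * r powr - s + (- s * r powr (- s - 1)) * f r) (at r)"
      by (intro DERIV_mult df has_real_derivative_powr) (use r in auto)
    moreover have "deriv f r * r powr - s + (- s * r powr (- s - 1)) * f r = d\<phi> r"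
    proof -
      have "- s - 1 = - (s + 1)" by simp
      then have "r powr (- s - 1) = 1 / r powr (s + 1)" by (simp only: powr_minus_divide)
      then show ?thesis using g(2)[of r] r by (simp add: d\<phi>_def powr_minus_divide)
    qed
    ultimately have "((\<lambda>r. f r * r powr - s) has_real_derivative d\<phi> r) (at r)" by simp
    then show ?thesis
      by (rule has_field_derivative_transform_within_open[of _ _ _ "{0<..<1}"])
        (use r in \<open>auto simp: \<phi> powr_minus_divide\<close>)
  qed
  have cd: "continuous_on {0<..1} d\<phi>"
    unfolding d\<phi>_def by (intro continuous_intros continuous_on_subset[OF cg] continuous_on_subset[OF cf]) auto
  have nonpos: "d\<phi> r \<le> 0" if "0 < r" "r < 1" for r
    by (rule antimono_derivative_nonpos[OF anti that(1) der[OF that]])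
  \<comment> \<open>At \<open>r = 1\<close> the sign is inherited as a limit from inside, because
    the two-sided derivative of \<open>\<phi>\<close> may fail to exist there.\<close>
  have nonpos1: "d\<phi> r \<le> 0" if r: "0 < r" "r \<le> 1" for r
  proof (cases "r = 1")
    case True
    have "(d\<phi> \<longlongrightarrow> d\<phi> 1) (at 1 within {0<..1})"
      using cd by (auto simp: continuous_on_def)
    then have "(d\<phi> \<longlongrightarrow> d\<phi> 1) (at 1 within {0<..<1})"
      by (rule tendsto_within_subset) auto
    moreover have "\<forall>\<^sub>F x in at 1 within {0<..<1}. d\<phi> x \<le> 0"
      by (simp add: eventually_at_filter nonpos)
    moreover have "at (1::real) within {0<..<1} \<noteq> bot"
      by (simp add: at_within_eq_bot_iff)
    ultimately have "d\<phi> 1 \<le> 0" by (intro tendsto_upperbound)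
    then show ?thesis using True by simp
  next
    case False
    then show ?thesis using nonpos r by auto
  qed
  have van: "\<phi> r = 0" if "1 \<le> r" for r using \<phi>[of 1] \<phi>0[of r] f1 that by (cases "r = 1") auto
  show "\<exists>d\<phi>. \<forall>\<epsilon> w \<rho>. 0 < \<epsilon> \<longrightarrow> 0 < w \<longrightarrow> 0 < \<rho> \<longrightarrow> \<rho> < 1 \<longrightarrow>
    scattering (\<lambda>r. \<epsilon> * \<phi> r) (\<lambda>r. \<epsilon> * d\<phi> r) w \<rho>"
  proof (intro exI[of _ d\<phi>] allI impI)
    fix \<epsilon> w \<rho> :: real assume "0 < \<epsilon>" "0 < w" "0 < \<rho>" "\<rho> < 1"
    then show "scattering (\<lambda>r. \<epsilon> * \<phi> r) (\<lambda>r. \<epsilon> * d\<phi> r) w \<rho>"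
      using c\<phi> cd van anti nonpos1
      by unfold_locales (auto intro!: continuous_intros DERIV_cmult der mult_nonneg_nonpos mult_left_mono simp: monotone_on_def)
  qed
qed

text \<open>The constant is \<open>B = f 0 + K\<close> with \<open>K\<close> a bound for the
  derivative of \<open>f\<close>: the drop of \<open>f r / r powr s\<close> splits into the drop of
  the power, with a factor at most \<open>f 0\<close>, and the drop of \<open>f\<close>, which is at
  most \<open>K * (r' - r)\<close>.\<close>

lemma singular_potential_bounds:
  assumes sp: "singular_potential s \<Phi> \<phi> f" and s: "1 \<le> s"
  shows "\<exists>B>0. (\<forall>r>0. 0 \<le> \<phi> r \<and> \<phi> r \<le> B * r powr - s) \<and>
    (\<forall>r r'. 0 < r \<longrightarrow> r \<le> r' \<longrightarrow> \<phi> r - \<phi> r' \<le> B * (r powr - s - r' powr - s))"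
proof -
  from sp have \<phi>: "\<And>r. 0 < r \<Longrightarrow> r \<le> 1 \<Longrightarrow> \<phi> r = f r / r powr s"
    and \<phi>0: "\<And>r. 1 < r \<Longrightarrow> \<phi> r = 0" and sm: "smooth_bounded_01 f" and cf: "continuous_on {0..1} f"
    and fa: "antimono_on {0..1} f" and f1: "f 1 = 0" and f0: "0 < f 0"
    by (auto simp: singular_potential_def)
  have sm': "(deriv ^^ k) f differentiable (at r)" "bounded ((deriv ^^ k) f ` {0<..<1})" if "r \<in> {0<..<1}" for k r
    using sm that by (auto simp: smooth_bounded_01_def)
  have df: "(f has_real_derivative deriv f r) (at r)" if "r \<in> {0<..<1}" for r
    using sm'(1)[OF that, of 0] by (simp add: DERIV_deriv_iff_real_differentiable)
  have "bounded (deriv f ` {0<..<1})"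
    using sm'(2)[of "1/2" 1] by simp
  then obtain K where K: "\<And>r. r \<in> {0<..<1} \<Longrightarrow> \<bar>deriv f r\<bar> \<le> K"
    unfolding bounded_iff by (metis imageI real_norm_def)
  have K0: "0 \<le> K" using K[of "1/2"] by auto
  have lip: "f r - f r' \<le> K * (r' - r)" if "0 < r" "r \<le> r'" "r' \<le> 1" for r r'
  proof -
    have "(- K) * (r' - r) \<le> f r' - f r"
      by (rule increase_ge[of "{}" r r' f "deriv f"])
        (use that df K in \<open>auto intro!: continuous_on_subset[OF cf] simp: abs_le_iff minus_le_iff\<close>)
    then show ?thesis by (simp add: algebra_simps)
  qed
  have fb: "0 \<le> f r" "f r \<le> f 0" if "0 < r" "r \<le> 1" for r
    using monotone_onD[OF fa, of r 1] monotone_onD[OF fa, of 0 r] that f1 by auto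
  have van: "\<phi> r = 0" if "1 \<le> r" for r using \<phi>[of 1] \<phi>0[of r] f1 that by (cases "r = 1") auto
  define B where "B = f 0 + K"
  have B: "0 < B" using f0 K0 by (simp add: B_def)
  have p: "r' powr - s \<le> r powr - s" if "0 < r" "r \<le> r'" for r r'
    using that s by (intro powr_mono2') auto
  have drop1: "\<phi> r - \<phi> r' \<le> B * (r powr - s - r' powr - s)" if r: "0 < r" "r \<le> r'" "r' \<le> 1" for r r'
  proof -
    have "\<phi> r - \<phi> r' = f r' * (r powr - s - r' powr - s) + (f r - f r') * r powr - s"
      using r by (simp add: \<phi> powr_minus_divide algebra_simps diff_divide_distrib)
    also have "\<dots> \<le> f 0 * (r powr - s - r' powr - s) + (K * (r' - r)) * r powr - s"
      using fb[of r'] r p[of r r'] lip[of r r'] by (intro add_mono mult_right_mono) auto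
    \<comment> \<open>Uses \<open>r' \<le> 1\<close> in the form
      \<open>r' - r \<le> 1 - r / r'\<close>, and \<open>s \<ge> 1\<close> in the form
      \<open>(r / r') powr s \<le> r / r'\<close>.\<close>
    also have "(r' - r) * r powr - s \<le> r powr - s - r' powr - s"
    proof -
      have q: "0 < r / r'" "r / r' \<le> 1" using r by auto
      have "(r / r') powr s \<le> (r / r') powr 1" using q s by (intro powr_mono') auto
      also have "(r / r') powr 1 = r / r'" using r by simp
      finally have "(r / r') powr s \<le> r / r'" .
      moreover have "r' - r \<le> 1 - r / r'"
      proof -
        have "r' * (r' - r) \<le> 1 * (r' - r)" using r by (intro mult_right_mono) auto
        then show ?thesis using r by (simp add: field_simps)
      qed
      ultimately have "r' - r \<le> 1 - (r / r') powr s" by linarith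
      then have "(r' - r) * r powr - s \<le> (1 - (r / r') powr s) * r powr - s"
        by (intro mult_right_mono) auto
      also have "\<dots> = r powr - s - r' powr - s"
        using r by (simp add: powr_divide powr_minus_divide field_simps)
      finally show ?thesis .
    qed
    then have "f 0 * (r powr - s - r' powr - s) + (K * (r' - r)) * r powr - s
        \<le> f 0 * (r powr - s - r' powr - s) + K * (r powr - s - r' powr - s)"
      using K0 by (simp add: mult.assoc mult_left_mono)
    finally show ?thesis by (simp add: B_def algebra_simps)
  qed
  have drop: "\<phi> r - \<phi> r' \<le> B * (r powr - s - r' powr - s)" if r: "0 < r" "r \<le> r'" for r r'
  proof (cases "r' \<le> 1")
    case True then show ?thesis using drop1 r by auto
  next
    case False
    show ?thesis
    proof (cases "r \<le> 1")
      case True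
      have "\<phi> r - \<phi> 1 \<le> B * (r powr - s - 1 powr - s)" using drop1[of r 1] r True by auto
      also have "\<dots> \<le> B * (r powr - s - r' powr - s)"
        using p[of 1 r'] False B by (intro mult_left_mono) auto
      finally show ?thesis using van[of 1] van[of r'] False by simp
    next
      case False': False
      then show ?thesis using van[of r] van[of r'] r p[of r r'] B by simp
    qed
  qed
  have "0 \<le> \<phi> r \<and> \<phi> r \<le> B * r powr - s" if "0 < r" for r
  proof (cases "r \<le> 1")
    case True
    have "f r \<le> B" using fb(2)[OF that True] K0 by (simp add: B_def)
    then show ?thesis using fb[OF that True] True that by (simp add: \<phi> powr_minus_divide divide_right_mono)
  next
    case False then show ?thesis using van[of r] B by simp
  qed
  then show ?thesis using B drop by blast
qed

text \<open>The length scale \<open>\<epsilon> powr (1 / s)\<close> is the one for which the power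
  in the denominator produces a factor \<epsilon> that cancels the coupling; only the value of
  \<open>f\<close> at 0 survives.\<close>

lemma singular_potential_limit:
  assumes sp: "singular_potential s \<Phi> \<phi> f" and s: "1 \<le> s" and r: "0 < r"
  shows "((\<lambda>\<epsilon>. \<epsilon> * \<phi> (\<epsilon> powr (1 / s) * r)) \<longlongrightarrow> f 0 * r powr - s) (at_right 0)"
proof -
  from sp have \<phi>: "\<And>r. 0 < r \<Longrightarrow> r \<le> 1 \<Longrightarrow> \<phi> r = f r / r powr s" and cf: "continuous_on {0..1} f"
    by (auto simp: singular_potential_def)
  have l: "((\<lambda>\<epsilon>. \<epsilon> powr (1 / s) * r) \<longlongrightarrow> 0 powr (1 / s) * r) (at_right 0)"
    using s by (intro tendsto_intros tendsto_powr' ) (auto simp: eventually_at_filter)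
  then have l: "((\<lambda>\<epsilon>. \<epsilon> powr (1 / s) * r) \<longlongrightarrow> 0) (at_right 0)" by simp
  have pos: "\<forall>\<^sub>F \<epsilon> in at_right 0. (0::real) < \<epsilon>" by (rule eventually_at_right_less)
  have small: "\<forall>\<^sub>F \<epsilon> in at_right 0. \<epsilon> powr (1 / s) * r < 1" using order_tendstoD(2)[OF l] by simp
  have "\<forall>\<^sub>F \<epsilon> in at_right 0. \<epsilon> powr (1 / s) * r \<in> {0..1} - {0}"
    using pos small by eventually_elim (use r in auto)
  with l have "filterlim (\<lambda>\<epsilon>. \<epsilon> powr (1 / s) * r) (at 0 within {0..1}) (at_right 0)"
    by (rule filterlim_at_withinI)
  moreover have "(f \<longlongrightarrow> f 0) (at 0 within {0..1})" using cf by (auto simp: continuous_on_def)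
  ultimately have "((\<lambda>\<epsilon>. f (\<epsilon> powr (1 / s) * r)) \<longlongrightarrow> f 0) (at_right 0)"
    by (rule filterlim_compose[rotated])
  then have "((\<lambda>\<epsilon>. f (\<epsilon> powr (1 / s) * r) * r powr - s) \<longlongrightarrow> f 0 * r powr - s) (at_right 0)"
    by (intro tendsto_intros)
  moreover have "\<forall>\<^sub>F \<epsilon> in at_right 0. f (\<epsilon> powr (1 / s) * r) * r powr - s = \<epsilon> * \<phi> (\<epsilon> powr (1 / s) * r)"
    using pos small
  proof eventually_elim
    case (elim \<epsilon>)
    have "(\<epsilon> powr (1 / s) * r) powr s = \<epsilon> * r powr s"
      using elim r s by (simp add: powr_mult powr_powr)
    then show ?case using elim r by (simp add: \<phi> powr_minus_divide)
  qed
  ultimately show ?thesis by (rule Lim_transform_eventually)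
qed

section \<open>The collision integrals\<close>

lemma finite_sphere_measure: "finite_measure sphere_measure"
proof
  have "emeasure sphere_measure (space sphere_measure) = (\<integral>\<^sup>+x. 3 * indicator (ball 0 1) (x :: real ^ 3) \<partial>lborel)"
    unfolding sphere_measure_def
    by (subst emeasure_distr, simp_all, subst emeasure_density)
      (auto intro!: borel_measurable_times_ennreal borel_measurable_indicator nn_integral_cong)
  also have "\<dots> = 3 * emeasure lborel (ball 0 1 :: (real ^ 3) set)"
    by (subst nn_integral_cmult_indicator) auto
  also have "\<dots> < \<infinity>"
    using emeasure_bounded_finite[of "ball 0 1 :: (real ^ 3) set"] by (auto simp: ennreal_mult_less_top)
  finally show "emeasure sphere_measure (space sphere_measure) \<noteq> \<infinity>" by simp
qed

lemma sets_sphere_measure [simp, measurable_cong]: "sets sphere_measure = sets borel"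
  by (simp add: sphere_measure_def)

lemma space_sphere_measure [simp]: "space sphere_measure = UNIV"
  by (simp add: sphere_measure_def)

lemma sphere_integral_iterated:
  fixes h :: "real ^ 3 \<Rightarrow> real"
  assumes e: "orthonormal3 e0 e1 e2" and h: "h \<in> borel_measurable borel" and i: "integrable sphere_measure h"
  shows "(LINT \<nu>|sphere_measure. h \<nu>) =
    (LBINT c:{-1<..<1}. LBINT \<phi>:{0<..<2 * pi}. h (sphere_point e0 e1 e2 c \<phi>))"
proof -
  let ?F = "\<lambda>p. indicator sphere_chart_domain p * h (sphere_point e0 e1 e2 (fst p) (snd p))"
  have "integrable (lborel \<Otimes>\<^sub>M lborel) ?F"
    using i integrable_sphere_iff[OF e h] by (simp add: lborel_prod)
  from lborel_pair.integral_fst'[OF this]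
  have "(LINT p|lborel. ?F p) = (LINT c|lborel. LINT \<phi>|lborel. ?F (c, \<phi>))"
    by (simp add: lborel_prod)
  also have "\<dots> = (LINT c|lborel. LINT \<phi>|lborel. indicator {-1<..<1} c *\<^sub>R (indicator {0<..<2 * pi} \<phi> *\<^sub>R h (sphere_point e0 e1 e2 c \<phi>)))"
    by (intro Bochner_Integration.integral_cong refl) (auto simp: sphere_chart_domain_def indicator_def)
  also have "\<dots> = (LBINT c:{-1<..<1}. LBINT \<phi>:{0<..<2 * pi}. h (sphere_point e0 e1 e2 c \<phi>))"
    unfolding set_lebesgue_integral_def Bochner_Integration.integral_scaleR_right ..
  finally show ?thesis by (simp add: integral_sphere_eq[OF e h])
qed

text \<open>Removes the head-on direction, where the impact parameter is 0, and with the axis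
  reversed the direction of deviation angle \<open>pi\<close>, where the kernel is not
  controlled.\<close>

lemma sphere_null_pole:
  assumes "orthonormal3 e0 e1 e2"
  shows "AE \<nu> in sphere_measure. \<nu> \<noteq> e0"
proof (rule AE_I')
  have "(\<lambda>p. sphere_point e0 e1 e2 (fst p) (snd p)) -` {e0} \<inter> sphere_chart_domain = {}"
  proof (safe, goal_cases)
    case (1 c \<phi>)
    then have "sphere_point e0 e1 e2 c \<phi> \<bullet> e0 = e0 \<bullet> e0" by simp
    then have "c = 1" using assms
      by (simp add: sphere_point_def orthonormal3_def inner_add_left inner_add_right inner_commute)
    then show ?case using 1 by (auto simp: sphere_chart_domain_def)
  qed
  then have 0: "indicator sphere_chart_domain x * indicator ((\<lambda>p. sphere_point e0 e1 e2 (fst p) (snd p)) -` {e0}) x = (0::ennreal)" for x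
    by (auto simp: indicator_def)
  have m: "(\<lambda>p. sphere_point e0 e1 e2 (fst p) (snd p)) -` {e0} \<in> sets borel"
    using measurable_sets_borel[OF sphere_point_measurable, of "{e0}"] by simp
  have "emeasure sphere_measure {e0} = 0"
    unfolding sphere_measure_eq[OF assms]
    by (subst emeasure_distr, simp_all, subst emeasure_density) (use m in \<open>auto simp: 0\<close>)
  then show "{e0} \<in> null_sets sphere_measure" by (auto intro!: null_setsI)
qed auto

definition effective_potential :: "real \<Rightarrow> (real \<Rightarrow> real) \<Rightarrow> real \<Rightarrow> real \<Rightarrow> real" where
  "effective_potential \<epsilon> \<phi> w r = 4 * (\<epsilon> * \<phi> r) / w\<^sup>2"

text \<open>For unit vectors, \<open>\<eta>\<close> turned by the angle \<open>t\<close> in the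
  plane of \<open>\<eta>\<close> and \<open>\<nu>\<close>, away from \<open>\<nu>\<close>: the
  relative position starts at \<open>- \<nu>\<close> and is repelled outwards. The root is the
  impact parameter and the length of the component of \<open>\<nu>\<close> orthogonal to
  \<open>\<eta>\<close>.\<close>

definition impact_direction :: "real ^ 3 \<Rightarrow> real ^ 3 \<Rightarrow> real \<Rightarrow> real ^ 3" where
  "impact_direction \<eta> \<nu> t = cos t *\<^sub>R \<eta> - (sin t / sqrt (1 - (\<nu> \<bullet> \<eta>)\<^sup>2)) *\<^sub>R (\<nu> - (\<nu> \<bullet> \<eta>) *\<^sub>R \<eta>)"

section \<open>The collision integral with explicit outgoing velocities\<close>

context
  fixes s :: real and \<Phi> :: "real ^ 3 \<Rightarrow> real" and \<phi> f :: "real \<Rightarrow> real"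
  assumes s: "1 < s" and sp: "singular_potential s \<Phi> \<phi> f"
begin

lemma repulsive_effective:
  assumes "0 \<le> \<epsilon>" "w \<noteq> 0"
  shows "repulsive (effective_potential \<epsilon> \<phi> w)"
  unfolding repulsive_def
proof (intro conjI)
  show "continuous_on {0<..} (effective_potential \<epsilon> \<phi> w)"
    unfolding effective_potential_def using assms
    by (intro continuous_intros singular_potential_scattering(2)[OF sp]) auto
  show "antimono_on {0<..} (effective_potential \<epsilon> \<phi> w)"
    using sp assms by (auto simp: singular_potential_def monotone_on_def effective_potential_def
        intro!: divide_right_mono mult_left_mono)
  have "\<forall>\<^sub>F r in at_top. effective_potential \<epsilon> \<phi> w r = 0"
    using eventually_gt_at_top[of 1] by eventually_elim (use sp in \<open>simp add: singular_potential_def effective_potential_def\<close>)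
  then show "(effective_potential \<epsilon> \<phi> w \<longlongrightarrow> 0) at_top" by (rule tendsto_eventually)
qed

lemma outgoing_velocities_scattered:
  fixes v1 v2 \<nu> :: "real ^ 3"
  defines "w \<equiv> norm (v1 - v2)" and "\<eta> \<equiv> (v1 - v2) /\<^sub>R norm (v1 - v2)"
  assumes \<epsilon>: "0 < \<epsilon>" and v: "v1 \<noteq> v2" and \<nu>: "norm \<nu> = 1" "0 < \<nu> \<bullet> \<eta>" "\<nu> \<bullet> \<eta> < 1"
  shows "outgoing_velocities (\<lambda>x. \<epsilon> * \<Phi> x) v1 v2 \<nu> =
    (let \<sigma> = impact_direction \<eta> \<nu> (deflection (effective_potential \<epsilon> \<phi> w) (sqrt (1 - (\<nu> \<bullet> \<eta>)\<^sup>2)))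
     in ((v1 + v2) /\<^sub>R 2 + (w / 2) *\<^sub>R \<sigma>, (v1 + v2) /\<^sub>R 2 - (w / 2) *\<^sub>R \<sigma>))"
proof -
  define c where "c = \<nu> \<bullet> \<eta>"
  define \<rho> where "\<rho> = sqrt (1 - c\<^sup>2)"
  have w: "0 < w" using v by (simp add: w_def)
  have z: "v1 - v2 = w *\<^sub>R \<eta>" using v by (simp add: w_def \<eta>_def)
  have c: "0 < c" "c < 1" using \<nu> by (auto simp: c_def)
  then have c2: "0 < c\<^sup>2" "c\<^sup>2 < 1" by (auto simp: power_less_one_iff abs_square_less_1)
  then have \<rho>: "0 < \<rho>" "\<rho> < 1" by (auto simp: \<rho>_def)
  obtain d\<phi> where "scattering (\<lambda>r. \<epsilon> * \<phi> r) (\<lambda>r. \<epsilon> * d\<phi> r) w \<rho>"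
    using singular_potential_scattering(1)[OF sp] \<epsilon> w \<rho> by blast
  then interpret S: scattering "\<lambda>r. \<epsilon> * \<phi> r" "\<lambda>r. \<epsilon> * d\<phi> r" w \<rho> .
  have \<kappa>: "S.\<kappa> = effective_potential \<epsilon> \<phi> w" by (auto simp: S.\<kappa>_def effective_potential_def)
  have q: "S.qmax = c" unfolding S.qmax_def using c c2 by (simp add: \<rho>_def)
  have \<nu>z: "\<nu> \<bullet> (v1 - v2) = w * S.qmax" by (simp add: z q c_def)
  have \<Phi>: "\<epsilon> * \<Phi> x = \<epsilon> * \<phi> (norm x)" if "x \<noteq> 0" for x
    using sp that by (simp add: singular_potential_def)
  have nw: "norm (v1 - v2) = w" by (simp add: w_def)
  have ex: "S.exit_relative_velocity v1 v2 \<nu> = w *\<^sub>R impact_direction \<eta> \<nu> (deflection (effective_potential \<epsilon> \<phi> w) \<rho>)"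
    using S.exit_velocity_deflection[OF nw \<nu>(1) \<nu>z]
    unfolding \<kappa> q impact_direction_def c_def[symmetric] \<rho>_def[symmetric] by (simp add: \<eta>_def w_def)
  have "outgoing_velocities (\<lambda>x. \<epsilon> * \<Phi> x) v1 v2 \<nu> =
    ((v1 + v2) /\<^sub>R 2 + S.exit_relative_velocity v1 v2 \<nu> /\<^sub>R 2, (v1 + v2) /\<^sub>R 2 - S.exit_relative_velocity v1 v2 \<nu> /\<^sub>R 2)"
    by (rule S.outgoing_velocities_eq[OF \<Phi> nw \<nu>(1) \<nu>z])
  then show ?thesis
    unfolding ex c_def[symmetric] \<rho>_def[symmetric] Let_def by simp
qed

text \<open>Extended by 0 outside the open quadrant, so that joint continuity there gives a Borel
  function of speed and impact parameter.\<close>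

definition total_deflection :: "real \<Rightarrow> real \<times> real \<Rightarrow> real" where
  "total_deflection \<epsilon> p = indicator ({0<..} \<times> {0<..}) p * deflection (effective_potential \<epsilon> \<phi> (fst p)) (snd p)"

lemma total_deflection_measurable [measurable]:
  assumes "0 \<le> \<epsilon>"
  shows "total_deflection \<epsilon> \<in> borel_measurable borel"
proof -
  have "continuous_on ({0<..} \<times> {0<..}) (\<lambda>p. deflection (effective_potential \<epsilon> \<phi> (fst p)) (snd p))"
    unfolding continuous_on_sequentially comp_def
  proof safe
    fix x :: "nat \<Rightarrow> real \<times> real" and a b :: real
    assume ab: "0 < a" "0 < b" and x: "\<forall>n. x n \<in> {0<..} \<times> {0<..}" and lim: "x \<longlonglongrightarrow> (a, b)"
    have p: "0 < fst (x n)" "0 < snd (x n)" for n using x[rule_format, of n] by (auto simp: mem_Times_iff)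
    have l: "(\<lambda>n. fst (x n)) \<longlonglongrightarrow> a" "(\<lambda>n. snd (x n)) \<longlonglongrightarrow> b"
      using tendsto_fst[OF lim] tendsto_snd[OF lim] by auto
    have "(\<lambda>n. deflection (effective_potential \<epsilon> \<phi> (fst (x n))) (snd (x n))) \<longlonglongrightarrow> deflection (effective_potential \<epsilon> \<phi> a) b"
    proof (rule deflection_tendsto)
      show "(\<lambda>n. effective_potential \<epsilon> \<phi> (fst (x n)) r) \<longlonglongrightarrow> effective_potential \<epsilon> \<phi> a r" for r
        unfolding effective_potential_def using ab by (intro tendsto_intros l) auto
    qed (use p ab l repulsive_effective assms in \<open>auto simp: less_imp_neq[symmetric]\<close>)
    then show "(\<lambda>n. deflection (effective_potential \<epsilon> \<phi> (fst (x n))) (snd (x n)))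
        \<longlonglongrightarrow> deflection (effective_potential \<epsilon> \<phi> (fst (a, b))) (snd (a, b))" by simp
  qed
  from borel_measurable_continuous_on_indicator[OF _ this] show ?thesis
    by (simp add: total_deflection_def[abs_def] borel_open open_Times)
qed

lemma continuous_on_deflection_effective:
  assumes "0 \<le> \<epsilon>" "w \<noteq> 0"
  shows "continuous_on {0<..} (deflection (effective_potential \<epsilon> \<phi> w))"
  unfolding continuous_on_sequentially comp_def
  by (safe, rule deflection_tendsto) (use repulsive_effective assms in auto)

text \<open>A jointly measurable substitute for the integrand of
  \<open>linearized_boltzmann\<close>, whose outgoing velocities are given only by a definite
  description.\<close>

definition incoming_gain :: "real \<Rightarrow> (real ^ 3 \<Rightarrow> real) \<Rightarrow> real ^ 3 \<Rightarrow> real ^ 3 \<Rightarrow> real ^ 3 \<Rightarrow> real" where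
  "incoming_gain \<epsilon> \<psi> v1 v2 \<nu> =
     (let w = norm (v1 - v2); \<eta> = sgn (v1 - v2); c = \<nu> \<bullet> \<eta>
      in if norm \<nu> = 1 \<and> 0 < c \<and> c < 1
         then collision_gain \<psi> v1 v2 (impact_direction \<eta> \<nu> (total_deflection \<epsilon> (w, sqrt (1 - c\<^sup>2))))
           * maxwellian v2 * ((v1 - v2) \<bullet> \<nu>)
         else 0)"

lemma incoming_gain_measurable:
  assumes "0 \<le> \<epsilon>" "continuous_on UNIV \<psi>"
  shows "(\<lambda>p. incoming_gain \<epsilon> \<psi> v1 (fst p) (snd p)) \<in> borel_measurable (borel \<Otimes>\<^sub>M borel)"
proof -
  have [measurable]: "\<psi> \<in> borel_measurable borel" by (rule borel_measurable_continuous_onI[OF assms(2)])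
  have [measurable]: "total_deflection \<epsilon> \<in> borel_measurable (borel \<Otimes>\<^sub>M borel)"
    using total_deflection_measurable[OF assms(1)] by (simp add: borel_prod)
  have [measurable]: "(\<lambda>p. sgn (v1 - fst p)) \<in> borel_measurable (borel \<Otimes>\<^sub>M (borel :: (real^3) measure))"
    by (rule measurable_compose[OF _ borel_measurable_sgn]) measurable
  have [measurable]: "maxwellian \<in> borel_measurable borel"
    unfolding maxwellian_def by (intro borel_measurable_continuous_onI continuous_intros) auto
  show ?thesis
    unfolding incoming_gain_def Let_def impact_direction_def collision_gain_def by measurable
qed

text \<open>The two integrands agree except at the pole \<open>\<eta>\<close>. For receding
  directions both are 0, and for grazing ones the flux factor vanishes, whatever the outgoing
  velocities are.\<close>

lemma collision_integral_eq:
  fixes v1 v2 :: "real ^ 3"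
  assumes \<epsilon>: "0 < \<epsilon>" and v: "v1 \<noteq> v2" and \<psi>: "continuous_on UNIV \<psi>"
  shows "(LINT \<nu>:{\<nu> \<in> sphere 0 1. 0 \<le> \<nu> \<bullet> (v1 - v2)}|sphere_measure.
      (\<psi> (fst (outgoing_velocities (\<lambda>x. \<epsilon> * \<Phi> x) v1 v2 \<nu>)) + \<psi> (snd (outgoing_velocities (\<lambda>x. \<epsilon> * \<Phi> x) v1 v2 \<nu>))
         - \<psi> v1 - \<psi> v2) * maxwellian v2 * ((v1 - v2) \<bullet> \<nu>)) =
    (LINT \<nu>|sphere_measure. incoming_gain \<epsilon> \<psi> v1 v2 \<nu>)"
proof -
  define \<eta> where "\<eta> = (v1 - v2) /\<^sub>R norm (v1 - v2)"
  have w: "0 < norm (v1 - v2)" using v by simp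
  have sgn: "sgn (v1 - v2) = \<eta>" by (simp add: \<eta>_def sgn_div_norm)
  have n\<eta>: "norm \<eta> = 1" using w by (simp add: \<eta>_def)
  have z: "v1 - v2 = norm (v1 - v2) *\<^sub>R \<eta>" using w by (simp add: \<eta>_def)
  obtain e1 e2 where e: "orthonormal3 \<eta> e1 e2" using orthonormal3_exists[OF n\<eta>] by blast
  let ?g = "\<lambda>\<nu>. (\<psi> (fst (outgoing_velocities (\<lambda>x. \<epsilon> * \<Phi> x) v1 v2 \<nu>)) + \<psi> (snd (outgoing_velocities (\<lambda>x. \<epsilon> * \<Phi> x) v1 v2 \<nu>))
         - \<psi> v1 - \<psi> v2) * maxwellian v2 * ((v1 - v2) \<bullet> \<nu>)"
  let ?S = "{\<nu> \<in> sphere 0 1. 0 \<le> \<nu> \<bullet> (v1 - v2)}"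
  have eq: "indicator ?S \<nu> *\<^sub>R ?g \<nu> = incoming_gain \<epsilon> \<psi> v1 v2 \<nu>" if ne: "\<nu> \<noteq> \<eta>" for \<nu>
  proof (cases "norm \<nu> = 1")
    case n: True
    have dot: "\<nu> \<bullet> (v1 - v2) = norm (v1 - v2) * (\<nu> \<bullet> \<eta>)" by (subst z) simp
    have "\<nu> \<bullet> \<eta> \<noteq> 1"
    proof
      assume 1: "\<nu> \<bullet> \<eta> = 1"
      have "(\<nu> - \<eta>) \<bullet> (\<nu> - \<eta>) = \<nu> \<bullet> \<nu> - 2 * (\<nu> \<bullet> \<eta>) + \<eta> \<bullet> \<eta>"
        by (simp add: inner_diff_left inner_diff_right inner_commute)
      also have "\<dots> = 0" using n n\<eta> 1 by (simp add: dot_square_norm)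
      finally show False using ne by simp
    qed
    moreover have "\<nu> \<bullet> \<eta> \<le> 1" using norm_cauchy_schwarz[of \<nu> \<eta>] n n\<eta> by simp
    ultimately have c1: "\<nu> \<bullet> \<eta> < 1" by simp
    consider "\<nu> \<bullet> \<eta> < 0" | "\<nu> \<bullet> \<eta> = 0" | "0 < \<nu> \<bullet> \<eta>" by linarith
    then show ?thesis
    proof cases
      case 1
      then have "\<not> 0 \<le> \<nu> \<bullet> (v1 - v2)" using w by (simp add: dot mult_less_0_iff not_le)
      then show ?thesis using 1 by (simp add: incoming_gain_def sgn Let_def)
    next
      case 2
      then have "(v1 - v2) \<bullet> \<nu> = 0" using dot by (simp add: inner_commute)
      then show ?thesis using 2 by (simp add: incoming_gain_def sgn Let_def)
    next
      case 3
      then have "(\<nu> \<bullet> \<eta>)\<^sup>2 < 1" using c1 by (simp add: abs_square_less_1)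
      then have td: "total_deflection \<epsilon> (norm (v1 - v2), sqrt (1 - (\<nu> \<bullet> \<eta>)\<^sup>2)) =
          deflection (effective_potential \<epsilon> \<phi> (norm (v1 - v2))) (sqrt (1 - (\<nu> \<bullet> \<eta>)\<^sup>2))"
        using w by (simp add: total_deflection_def)
      have "0 \<le> \<nu> \<bullet> (v1 - v2)" using 3 w by (simp add: dot)
      then show ?thesis
        using n 3 c1 outgoing_velocities_scattered[OF \<epsilon> v n, folded \<eta>_def]
        by (simp add: incoming_gain_def sgn Let_def td collision_gain_def)
    qed
  qed (simp add: incoming_gain_def Let_def)
  have m: "incoming_gain \<epsilon> \<psi> v1 v2 \<in> borel_measurable borel"
    using measurable_compose[OF measurable_Pair1' incoming_gain_measurable[OF less_imp_le[OF \<epsilon>] \<psi>], of v2] by simp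
  \<comment> \<open>The original integrand differs from a measurable function at a single point, so
    nothing has to be known about its value there.\<close>
  have "(\<lambda>\<nu>. indicator ?S \<nu> *\<^sub>R ?g \<nu>) = (\<lambda>\<nu>. if \<nu> = \<eta> then indicator ?S \<eta> *\<^sub>R ?g \<eta> else incoming_gain \<epsilon> \<psi> v1 v2 \<nu>)"
    using eq by auto
  also have "\<dots> \<in> borel_measurable borel"
    using m by measurable
  finally have m': "(\<lambda>\<nu>. indicator ?S \<nu> *\<^sub>R ?g \<nu>) \<in> borel_measurable borel" .
  show ?thesis
    unfolding set_lebesgue_integral_def
  proof (rule integral_cong_AE)
    show "AE \<nu> in sphere_measure. indicator ?S \<nu> *\<^sub>R ?g \<nu> = incoming_gain \<epsilon> \<psi> v1 v2 \<nu>"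
      using sphere_null_pole[OF e] by eventually_elim (rule eq)
  qed (use m m' in \<open>simp_all only: measurable_cong_sets[OF sets_sphere_measure refl]\<close>)
qed

end

text \<open>Projection of the hemisphere onto the disc of impact parameters: with
  \<open>\<rho> = sqrt (1 - c\<^sup>2)\<close> the flux factor \<open>c\<close> is the Jacobian. As
  \<open>G\<close> vanishes beyond 1, the disc may be replaced by the half-line, which is what can
  be rescaled.\<close>

lemma disc_projection:
  fixes G :: "real \<Rightarrow> real"
  assumes G: "continuous_on {0<..} G" "\<And>\<rho>. 0 < \<rho> \<Longrightarrow> \<bar>G \<rho>\<bar> \<le> K" "\<And>\<rho>. 1 \<le> \<rho> \<Longrightarrow> G \<rho> = 0"
  shows "(LBINT c:{0<..<1}. c * G (sqrt (1 - c\<^sup>2))) = (LBINT \<rho>:{0<..}. \<rho> * G \<rho>)"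
proof -
  let ?S = "{0<..<1::real}" and ?f = "\<lambda>c. c * G (sqrt (1 - c\<^sup>2))"
  have sq: "0 < 1 - x\<^sup>2" if "x \<in> ?S" for x :: real using that by (simp add: power_less_one_iff abs_square_less_1)
  have K: "0 \<le> K" using G(2)[of 1] by auto
  have bi: "set_integrable lborel ?S h" if c: "continuous_on ?S h" and b: "\<And>x. x \<in> ?S \<Longrightarrow> \<bar>h x\<bar> \<le> K" for h :: "real \<Rightarrow> real"
    unfolding set_integrable_def
  proof (rule Bochner_Integration.integrable_bound)
    have "integrable lborel (indicator ?S :: real \<Rightarrow> real)"
      using emeasure_bounded_finite[of ?S] by (intro integrable_real_indicator) auto
    then show "integrable lborel (\<lambda>x. indicator ?S x *\<^sub>R K)" by (intro integrable_scaleR_left)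
    show "AE x in lborel. norm (indicator ?S x *\<^sub>R h x) \<le> norm (indicator ?S x *\<^sub>R K)"
      using b K by (intro AE_I2) (auto simp: indicator_def)
    show "(\<lambda>x. indicator ?S x *\<^sub>R h x) \<in> borel_measurable lborel"
      using borel_measurable_continuous_on_indicator[OF _ c] by simp
  qed
  have bnd: "\<bar>x * y\<bar> \<le> K" if "x \<in> ?S" "\<bar>y\<bar> \<le> K" for x y
    using mult_mono[of "\<bar>x\<bar>" 1 "\<bar>y\<bar>" K] that by (auto simp: abs_mult)
  have i1: "set_integrable lborel ?S ?f"
  proof (rule bi)
    show "continuous_on ?S ?f"
      by (intro continuous_intros continuous_on_compose2[OF G(1)]) (use sq in auto)
    show "\<bar>?f x\<bar> \<le> K" if "x \<in> ?S" for x by (rule bnd[OF that G(2)]) (use sq[OF that] in auto)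
  qed
  have i2: "set_integrable lborel ?S (\<lambda>\<rho>. \<rho> * G \<rho>)"
  proof (rule bi)
    show "continuous_on ?S (\<lambda>\<rho>. \<rho> * G \<rho>)"
      by (intro continuous_intros continuous_on_subset[OF G(1)]) auto
    show "\<bar>x * G x\<bar> \<le> K" if "x \<in> ?S" for x by (rule bnd[OF that G(2)]) (use that in auto)
  qed
  let ?g = "\<lambda>\<rho>::real. sqrt (1 - \<rho>\<^sup>2)" and ?g' = "\<lambda>\<rho>::real. - \<rho> / sqrt (1 - \<rho>\<^sup>2)"
  have der: "(?g has_field_derivative ?g' x) (at x within ?S)" if "x \<in> ?S" for x
    using sq[OF that] by (auto intro!: derivative_eq_intros simp: field_simps)
  have inj: "inj_on ?g ?S" by (rule inj_onI) (auto simp: power2_eq_iff)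
  have gS: "?g x \<in> ?S" if "x \<in> ?S" for x using sq[OF that] that by auto
  have gg: "?g (?g x) = x" if "x \<in> ?S" for x using sq[OF that] that by auto
  have img: "?g ` ?S = ?S"
  proof (intro equalityI subsetI)
    fix x assume "x \<in> ?S"
    then show "x \<in> ?g ` ?S" using gS gg by (intro image_eqI[of _ _ "?g x"]) auto
  qed (use gS in auto)
  have eq: "\<bar>?g' x\<bar> * ?f (?g x) = x * G x" if "x \<in> ?S" for x
    using sq[OF that] gg[OF that] that by (simp add: abs_divide)
  have "(\<lambda>\<rho>. \<rho> * G \<rho>) absolutely_integrable_on ?S"
    using i2 unfolding set_integrable_def by (subst integrable_completion) auto
  then have 1: "(\<lambda>x. \<bar>?g' x\<bar> * ?f (?g x)) absolutely_integrable_on ?S"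
    by (rule absolutely_integrable_spike[where S="{}"]) (use eq in auto)
  have 2: "integral ?S (\<lambda>x. \<bar>?g' x\<bar> * ?f (?g x)) = integral ?S (\<lambda>\<rho>. \<rho> * G \<rho>)"
    by (rule integral_cong) (use eq in auto)
  have S: "?S \<in> sets lebesgue" by simp
  have "integral ?S ?f = integral ?S (\<lambda>\<rho>. \<rho> * G \<rho>)"
    using has_absolute_integral_change_of_variables_1'[OF S der inj, of ?f "integral ?S (\<lambda>\<rho>. \<rho> * G \<rho>)"] 1 2
    unfolding img by auto
  then have "(LBINT c:?S. ?f c) = (LBINT \<rho>:?S. \<rho> * G \<rho>)"
    using set_borel_integral_eq_integral(2)[OF i1] set_borel_integral_eq_integral(2)[OF i2] by simp
  also have "\<dots> = (LBINT \<rho>:{0<..}. \<rho> * G \<rho>)"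
    unfolding set_lebesgue_integral_def
    by (intro Bochner_Integration.integral_cong refl) (use G(3) in \<open>auto simp: indicator_def\<close>)
  finally show ?thesis .
qed

lemma sphere_point_props:
  assumes "orthonormal3 e0 e1 e2" "\<bar>c\<bar> \<le> 1"
  shows "norm (sphere_point e0 e1 e2 c \<phi>) = 1" "sphere_point e0 e1 e2 c \<phi> \<bullet> e0 = c" "e0 \<bullet> sphere_point e0 e1 e2 c \<phi> = c"
proof -
  have e': "e0 \<bullet> e0 = 1" "e1 \<bullet> e1 = 1" "e2 \<bullet> e2 = 1" "e0 \<bullet> e1 = 0" "e0 \<bullet> e2 = 0" "e1 \<bullet> e2 = 0"
    "e1 \<bullet> e0 = 0" "e2 \<bullet> e0 = 0" "e2 \<bullet> e1 = 0"
    using assms(1) by (auto simp: orthonormal3_def inner_commute)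
  define u where "u = cos \<phi> *\<^sub>R e1 + sin \<phi> *\<^sub>R e2"
  have u: "u \<bullet> u = 1" "e0 \<bullet> u = 0" "u \<bullet> e0 = 0"
    using sin_cos_squared_add3[of \<phi>] by (auto simp: u_def inner_add_left inner_add_right e')
  have p: "sphere_point e0 e1 e2 c \<phi> = c *\<^sub>R e0 + sqrt (1 - c\<^sup>2) *\<^sub>R u" by (simp add: sphere_point_def u_def)
  have c2: "c\<^sup>2 \<le> 1" using assms(2) by (simp add: abs_square_le_1)
  have "sphere_point e0 e1 e2 c \<phi> \<bullet> sphere_point e0 e1 e2 c \<phi> = c * c + sqrt (1 - c\<^sup>2) * sqrt (1 - c\<^sup>2)"
    by (simp add: p inner_add_left inner_add_right u e')
  also have "\<dots> = 1" using c2 by (simp add: power2_eq_square)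
  finally show "norm (sphere_point e0 e1 e2 c \<phi>) = 1" by (simp add: norm_eq_sqrt_inner)
  show "sphere_point e0 e1 e2 c \<phi> \<bullet> e0 = c" "e0 \<bullet> sphere_point e0 e1 e2 c \<phi> = c"
    by (simp_all add: p inner_add_left inner_add_right u e')
qed

lemma set_integral_azimuthal_gain:
  assumes "continuous_on UNIV \<psi>"
  shows "(LBINT \<phi>:{0<..<2 * pi}. collision_gain \<psi> v1 v2 (scattered e0 e1 e2 t \<phi>)) = azimuthal_gain \<psi> v1 v2 e0 e1 e2 t"
proof -
  let ?g = "\<lambda>\<phi>. collision_gain \<psi> v1 v2 (scattered e0 e1 e2 t \<phi>)"
  have c: "continuous_on {0..2 * pi} ?g"
    unfolding collision_gain_def scattered_def by (intro continuous_intros continuous_on_compose2[OF assms]) auto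
  have "set_integrable lborel {0..2 * pi} ?g"
    unfolding set_integrable_def by (rule borel_integrable_compact[OF compact_Icc c])
  then have i: "set_integrable lborel {0<..<2 * pi} ?g" by (rule set_integrable_subset) auto
  have "(?g has_integral azimuthal_gain \<psi> v1 v2 e0 e1 e2 t) {0<..<2 * pi}"
    unfolding azimuthal_gain_def using integrable_integral[OF integrable_continuous_real[OF c]]
    by (simp add: has_integral_Icc_iff_Ioo)
  then show ?thesis using set_borel_integral_eq_integral(2)[OF i] by (simp add: integral_unique)
qed

lemma collision_gain_bound:
  assumes "\<And>x. \<bar>\<psi> x\<bar> \<le> C"
  shows "\<bar>collision_gain \<psi> v1 v2 \<sigma>\<bar> \<le> 4 * C"
  unfolding collision_gain_def
  using assms[of v1] assms[of v2] assms[of "(v1 + v2) /\<^sub>R 2 + (norm (v1 - v2) / 2) *\<^sub>R \<sigma>"]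
    assms[of "(v1 + v2) /\<^sub>R 2 - (norm (v1 - v2) / 2) *\<^sub>R \<sigma>"] by linarith

text \<open>Below 1 the factor \<open>\<rho>\<close> of the area element is at most 1 and the
  constant bound is used; beyond 1 the power \<open>1 - 2 * s\<close> is less than -1, and its
  integral is \<open>1 / (2 * s - 2)\<close>.\<close>

lemma radial_majorant:
  fixes s K1 K2 :: real
  assumes s: "1 < s" and K: "0 \<le> K1" "0 \<le> K2"
  defines "m \<equiv> \<lambda>\<rho>::real. if \<rho> < 1 then K1 else K2 * \<rho> powr (1 - 2 * s)"
  shows "set_integrable lborel {0<..} m" "(LBINT \<rho>:{0<..}. m \<rho>) = K1 + K2 / (2 * s - 2)"
proof -
  have "((\<lambda>x. x powr (1 - 2 * s)) has_integral (- (1 powr (1 - 2 * s + 1)) / (1 - 2 * s + 1))) {1..}"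
    by (rule has_integral_powr_to_inf) (use s in auto)
  then have h: "((\<lambda>x::real. x powr (1 - 2 * s)) has_integral (1 / (2 * s - 2))) {1..}"
    by (simp add: minus_divide_left[symmetric] minus_divide_right)
  then have "(\<lambda>x::real. x powr (1 - 2 * s)) absolutely_integrable_on {1..}"
    by (intro nonnegative_absolutely_integrable_1) (auto simp: has_integral_integrable)
  then have i: "set_integrable lborel {1..} (\<lambda>x::real. x powr (1 - 2 * s))"
    unfolding set_integrable_def by (subst (asm) integrable_completion) auto
  have v: "(LBINT x:{1..}. x powr (1 - 2 * s)) = 1 / (2 * s - 2)"
    using set_borel_integral_eq_integral(2)[OF i] h by (simp add: integral_unique)
  have i1: "integrable lborel (indicator {0<..<1::real} :: real \<Rightarrow> real)"
    using emeasure_bounded_finite[of "{0<..<1::real}"] by (intro integrable_real_indicator) auto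
  have eq: "indicator {0<..} x *\<^sub>R m x = indicator {0<..<1} x *\<^sub>R K1 + K2 * (indicator {1..} x *\<^sub>R x powr (1 - 2 * s))" for x
    by (auto simp: m_def indicator_def)
  have i2: "integrable lborel (\<lambda>x. indicator {0<..<1::real} x *\<^sub>R K1)" by (intro integrable_scaleR_left i1)
  have i3: "integrable lborel (\<lambda>x. K2 * (indicator {1..} x *\<^sub>R x powr (1 - 2 * s)))"
    using i unfolding set_integrable_def by (rule integrable_mult_right)
  show "set_integrable lborel {0<..} m"
    unfolding set_integrable_def eq by (rule Bochner_Integration.integrable_add[OF i2 i3])
  have "(LBINT \<rho>:{0<..}. m \<rho>) = (LINT x|lborel. indicator {0<..<1::real} x *\<^sub>R K1) + (LINT x|lborel. K2 * (indicator {1..} x *\<^sub>R x powr (1 - 2 * s)))"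
    unfolding set_lebesgue_integral_def eq by (rule Bochner_Integration.integral_add[OF i2 i3])
  also have "(LINT x|lborel. indicator {0<..<1::real} x *\<^sub>R K1) = K1" by simp
  also have "(LINT x|lborel. K2 * (indicator {1..} x *\<^sub>R x powr (1 - 2 * s))) = K2 / (2 * s - 2)"
    using v by (simp add: set_lebesgue_integral_def)
  finally show "(LBINT \<rho>:{0<..}. m \<rho>) = K1 + K2 / (2 * s - 2)" .
qed

text \<open>The sets \<open>S n\<close> make one statement serve both limits: for the non-cutoff
  operator they are the growing ranges of impact parameters left by the truncation, for the limit of
  small \<epsilon> they are \<open>UNIV\<close>.\<close>

lemma radial_integral_dominated:
  fixes G :: "nat \<Rightarrow> real \<Rightarrow> real"
  assumes s: "1 < s" and G: "\<And>n. continuous_on {0<..} (G n)" "continuous_on {0<..} G'"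
    and K: "0 \<le> K1" "0 \<le> K2"
    and bnd: "\<And>n \<rho>. 0 < \<rho> \<Longrightarrow> \<bar>G n \<rho>\<bar> \<le> K1" "\<And>n \<rho>. 0 < \<rho> \<Longrightarrow> \<bar>G n \<rho>\<bar> \<le> K2 * \<rho> powr (- 2 * s)"
    and S: "\<And>n. S n \<in> sets borel" "\<And>\<rho>. 0 < \<rho> \<Longrightarrow> \<forall>\<^sub>F n in sequentially. \<rho> \<in> S n"
    and lim: "\<And>\<rho>. 0 < \<rho> \<Longrightarrow> (\<lambda>n. G n \<rho>) \<longlonglongrightarrow> G' \<rho>"
  shows "(\<lambda>n. LBINT \<rho>:{0<..} \<inter> S n. \<rho> * G n \<rho>) \<longlonglongrightarrow> (LBINT \<rho>:{0<..}. \<rho> * G' \<rho>)"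
    and "\<bar>LBINT \<rho>:{0<..}. \<rho> * G n \<rho>\<bar> \<le> K1 + K2 / (2 * s - 2)"
proof -
  define m where "m = (\<lambda>\<rho>::real. if \<rho> < 1 then K1 else K2 * \<rho> powr (1 - 2 * s))"
  note maj = radial_majorant[OF s K, folded m_def]
  have m: "\<bar>\<rho> * G n \<rho>\<bar> \<le> m \<rho>" if "0 < \<rho>" for n \<rho>
  proof (cases "\<rho> < 1")
    case True
    then show ?thesis using mult_mono[of "\<bar>\<rho>\<bar>" 1 "\<bar>G n \<rho>\<bar>" K1] bnd(1)[OF that, of n] that K by (simp add: m_def abs_mult)
  next
    case False
    have "\<bar>\<rho> * G n \<rho>\<bar> \<le> \<rho> * (K2 * \<rho> powr (- 2 * s))"
      using bnd(2)[OF that, of n] that by (simp add: abs_mult mult_left_mono)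
    also have "\<dots> = m \<rho>" using False that powr_add[of \<rho> 1 "- 2 * s"] by (simp add: m_def)
    finally show ?thesis .
  qed
  have meas: "(\<lambda>\<rho>. indicator {0<..} \<rho> *\<^sub>R (\<rho> * H \<rho>)) \<in> borel_measurable borel" if "continuous_on {0<..} H" for H :: "real \<Rightarrow> real"
    by (rule borel_measurable_continuous_on_indicator) (auto intro!: continuous_intros that)
  have intm: "integrable lborel (\<lambda>\<rho>. indicator {0<..} \<rho> *\<^sub>R m \<rho>)" using maj(1) by (simp add: set_integrable_def)
  show "(\<lambda>n. LBINT \<rho>:{0<..} \<inter> S n. \<rho> * G n \<rho>) \<longlonglongrightarrow> (LBINT \<rho>:{0<..}. \<rho> * G' \<rho>)"
    unfolding set_lebesgue_integral_def
  proof (rule integral_dominated_convergence[OF _ _ intm])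
    show "(\<lambda>\<rho>. indicator {0<..} \<rho> *\<^sub>R (\<rho> * G' \<rho>)) \<in> borel_measurable lborel" using meas[OF G(2)] by simp
    show "(\<lambda>\<rho>. indicator ({0<..} \<inter> S n) \<rho> *\<^sub>R (\<rho> * G n \<rho>)) \<in> borel_measurable lborel" for n
    proof -
      have "(\<lambda>\<rho>. indicator (S n) \<rho> *\<^sub>R (indicator {0<..} \<rho> *\<^sub>R (\<rho> * G n \<rho>))) \<in> borel_measurable borel"
        using meas[OF G(1)[of n]] S(1)[of n] by measurable
      then show ?thesis by (simp add: indicator_inter_arith mult_ac)
    qed
    show "AE \<rho> in lborel. (\<lambda>n. indicator ({0<..} \<inter> S n) \<rho> *\<^sub>R (\<rho> * G n \<rho>)) \<longlonglongrightarrow> indicator {0<..} \<rho> *\<^sub>R (\<rho> * G' \<rho>)"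
    proof (rule AE_I2)
      fix \<rho> :: real
      show "(\<lambda>n. indicator ({0<..} \<inter> S n) \<rho> *\<^sub>R (\<rho> * G n \<rho>)) \<longlonglongrightarrow> indicator {0<..} \<rho> *\<^sub>R (\<rho> * G' \<rho>)"
      proof (cases "0 < \<rho>")
        case True
        have "(\<lambda>n. \<rho> * G n \<rho>) \<longlonglongrightarrow> \<rho> * G' \<rho>" by (intro tendsto_intros lim True)
        moreover have "\<forall>\<^sub>F n in sequentially. \<rho> * G n \<rho> = indicator ({0<..} \<inter> S n) \<rho> *\<^sub>R (\<rho> * G n \<rho>)"
          using S(2)[OF True] by eventually_elim (use True in auto)
        ultimately have "(\<lambda>n. indicator ({0<..} \<inter> S n) \<rho> *\<^sub>R (\<rho> * G n \<rho>)) \<longlonglongrightarrow> \<rho> * G' \<rho>"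
          by (rule Lim_transform_eventually)
        then show ?thesis using True by simp
      qed simp
    qed
    show "AE \<rho> in lborel. norm (indicator ({0<..} \<inter> S n) \<rho> *\<^sub>R (\<rho> * G n \<rho>)) \<le> indicator {0<..} \<rho> *\<^sub>R m \<rho>" for n
    proof (rule AE_I2)
      fix \<rho> :: real
      show "norm (indicator ({0<..} \<inter> S n) \<rho> *\<^sub>R (\<rho> * G n \<rho>)) \<le> indicator {0<..} \<rho> *\<^sub>R m \<rho>"
        using m[of \<rho> n] abs_ge_zero[of "\<rho> * G n \<rho>"] by (auto simp: indicator_def simp del: abs_ge_zero intro: order_trans)
    qed
  qed
  have "norm (LINT \<rho>|lborel. indicator {0<..} \<rho> *\<^sub>R (\<rho> * G n \<rho>)) \<le> (LINT \<rho>|lborel. indicator {0<..} \<rho> *\<^sub>R m \<rho>)"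
  proof (rule Bochner_Integration.integral_norm_bound_integral[OF _ intm])
    show "integrable lborel (\<lambda>\<rho>. indicator {0<..} \<rho> *\<^sub>R (\<rho> * G n \<rho>))"
    proof (rule Bochner_Integration.integrable_bound[OF intm])
      show "(\<lambda>\<rho>. indicator {0<..} \<rho> *\<^sub>R (\<rho> * G n \<rho>)) \<in> borel_measurable lborel" using meas[OF G(1)] by simp
      show "AE \<rho> in lborel. norm (indicator {0<..} \<rho> *\<^sub>R (\<rho> * G n \<rho>)) \<le> norm (indicator {0<..} \<rho> *\<^sub>R m \<rho>)"
      proof (rule AE_I2)
        fix \<rho> :: real
        show "norm (indicator {0<..} \<rho> *\<^sub>R (\<rho> * G n \<rho>)) \<le> norm (indicator {0<..} \<rho> *\<^sub>R m \<rho>)"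
          using m[of \<rho> n] by (cases "0 < \<rho>") auto
      qed
    qed
    show "norm (indicator {0<..} \<rho> *\<^sub>R (\<rho> * G n \<rho>)) \<le> indicator {0<..} \<rho> *\<^sub>R m \<rho>" for \<rho>
      using m[of \<rho> n] by (cases "0 < \<rho>") auto
  qed
  then show "\<bar>LBINT \<rho>:{0<..}. \<rho> * G n \<rho>\<bar> \<le> K1 + K2 / (2 * s - 2)"
    using maj(2) by (simp add: set_lebesgue_integral_def)
qed

lemma radial_integral_scale:
  fixes G :: "real \<Rightarrow> real"
  assumes "0 < l"
  shows "(LBINT \<rho>:{0<..}. \<rho> * G \<rho>) = l\<^sup>2 * (LBINT \<rho>:{0<..}. \<rho> * G (l * \<rho>))"
proof -
  have "(LBINT \<rho>:{0<..}. \<rho> * G \<rho>) = \<bar>l\<bar> *\<^sub>R (LINT \<rho>|lborel. indicator {0<..} (0 + l * \<rho>) *\<^sub>R ((0 + l * \<rho>) * G (0 + l * \<rho>)))"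
    unfolding set_lebesgue_integral_def using assms by (intro lborel_integral_real_affine) auto
  also have "(LINT \<rho>|lborel. indicator {0<..} (0 + l * \<rho>) *\<^sub>R ((0 + l * \<rho>) * G (0 + l * \<rho>)))
      = (LINT \<rho>|lborel. l * (indicator {0<..} \<rho> *\<^sub>R (\<rho> * G (l * \<rho>))))"
    using assms by (intro Bochner_Integration.integral_cong refl) (auto simp: indicator_def zero_less_mult_iff)
  finally show ?thesis using assms by (simp add: set_lebesgue_integral_def power2_eq_square)
qed

lemma maxwellian_nonneg: "0 \<le> maxwellian v"
  by (simp add: maxwellian_def)

context
  fixes s :: real and \<Phi> :: "real ^ 3 \<Rightarrow> real" and \<phi> f :: "real \<Rightarrow> real"
  assumes s: "1 < s" and sp: "singular_potential s \<Phi> \<phi> f"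
begin

text \<open>In coordinates around the relative velocity the deflection depends only on the polar
  coordinate, so the azimuth can be integrated separately; the flux then turns into the area element
  of the impact parameter.\<close>

lemma incoming_gain_integral:
  fixes v1 v2 e0 e1 e2 :: "real ^ 3" and \<psi> :: "real ^ 3 \<Rightarrow> real"
  assumes \<epsilon>: "0 < \<epsilon>" and v: "v1 \<noteq> v2" and c\<psi>: "continuous_on UNIV \<psi>" and C: "\<And>x. \<bar>\<psi> x\<bar> \<le> C"
    and e: "orthonormal3 e0 e1 e2" and e0: "v1 - v2 = norm (v1 - v2) *\<^sub>R e0"
  shows "(LINT \<nu>|sphere_measure. incoming_gain \<phi> \<epsilon> \<psi> v1 v2 \<nu>) = maxwellian v2 * norm (v1 - v2) *
    (LBINT \<rho>:{0<..}. \<rho> * azimuthal_gain \<psi> v1 v2 e0 e1 e2 (deflection (effective_potential \<epsilon> \<phi> (norm (v1 - v2))) \<rho>))"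
proof -
  let ?w = "norm (v1 - v2)" and ?M = "maxwellian v2"
  let ?\<theta> = "deflection (effective_potential \<epsilon> \<phi> ?w)"
  let ?Ga = "azimuthal_gain \<psi> v1 v2 e0 e1 e2"
  let ?h = "incoming_gain \<phi> \<epsilon> \<psi> v1 v2"
  have w: "0 < ?w" using v by simp
  have sgn: "sgn (v1 - v2) = e0"
  proof -
    have "sgn (v1 - v2) = inverse ?w *\<^sub>R (?w *\<^sub>R e0)" using e0 by (metis sgn_div_norm)
    then show ?thesis using w by simp
  qed
  have C0: "0 \<le> C" using C[of 0] by simp
  have m: "?h \<in> borel_measurable borel"
    using measurable_compose[OF measurable_Pair1' incoming_gain_measurable[OF s sp less_imp_le[OF \<epsilon>] c\<psi>], of v2] by simp
  have bnd: "\<bar>?h \<nu>\<bar> \<le> 4 * C * ?M * ?w" for \<nu>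
  proof (cases "norm \<nu> = 1 \<and> 0 < \<nu> \<bullet> e0 \<and> \<nu> \<bullet> e0 < 1")
    case True
    have "\<bar>(v1 - v2) \<bullet> \<nu>\<bar> \<le> ?w" using Cauchy_Schwarz_ineq2[of "v1 - v2" \<nu>] True by simp
    then show ?thesis
      using True collision_gain_bound[OF C] maxwellian_nonneg[of v2] C0
      unfolding incoming_gain_def[OF s sp] sgn Let_def by (auto simp: abs_mult intro!: mult_mono)
  next
    case False
    then have "?h \<nu> = 0" unfolding incoming_gain_def[OF s sp] sgn Let_def by (simp only: if_False)
    then show ?thesis using maxwellian_nonneg[of v2] C0 by simp
  qed
  interpret finite_measure sphere_measure by (rule finite_sphere_measure)
  have i: "integrable sphere_measure ?h"
    by (rule integrable_const_bound[where B="4 * C * ?M * ?w"])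
      (use bnd m in \<open>auto simp: measurable_cong_sets[OF sets_sphere_measure refl]\<close>)
  \<comment> \<open>The sphere is charted with \<open>- e1\<close> and \<open>- e2\<close>, because
    the deflection is away from \<open>\<nu>\<close>: the outgoing direction then has the azimuth of
    the chart with respect to \<open>e1\<close> and \<open>e2\<close>.\<close>
  have e': "orthonormal3 e0 (- e1) (- e2)" using e by (simp add: orthonormal3_def)
  have val: "?h (sphere_point e0 (- e1) (- e2) c \<phi>') = indicator {0<..<1} c *
      (?M * ?w * c * collision_gain \<psi> v1 v2 (scattered e0 e1 e2 (?\<theta> (sqrt (1 - c\<^sup>2))) \<phi>'))" if c: "c \<in> {-1<..<1}" for c \<phi>'
  proof -
    let ?p = "sphere_point e0 (- e1) (- e2) c \<phi>'"
    have p: "norm ?p = 1" "?p \<bullet> e0 = c" "e0 \<bullet> ?p = c" using sphere_point_props[OF e'] c by auto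
    show ?thesis
    proof (cases "0 < c")
      case True
      have c2: "c\<^sup>2 < 1" using c by (simp add: abs_square_less_1 abs_less_iff)
      have td: "total_deflection \<phi> \<epsilon> (?w, sqrt (1 - c\<^sup>2)) = ?\<theta> (sqrt (1 - c\<^sup>2))"
        using w c2 by (simp add: total_deflection_def[OF s sp])
      have "?p - c *\<^sub>R e0 = - sqrt (1 - c\<^sup>2) *\<^sub>R (cos \<phi>' *\<^sub>R e1 + sin \<phi>' *\<^sub>R e2)"
        by (simp add: sphere_point_def algebra_simps)
      then have dir: "impact_direction e0 ?p t = scattered e0 e1 e2 t \<phi>'" for t
        unfolding impact_direction_def p using c2 by (simp add: scattered_def)
      have "(v1 - v2) \<bullet> ?p = ?w * c" by (subst e0) (simp add: p)
      then show ?thesis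
        using c True by (simp add: incoming_gain_def[OF s sp] sgn Let_def p td dir)
    next
      case False
      then show ?thesis by (simp add: incoming_gain_def[OF s sp] sgn Let_def p)
    qed
  qed
  have "(LINT \<nu>|sphere_measure. ?h \<nu>) =
      (LBINT c:{-1<..<1}. LBINT \<phi>':{0<..<2 * pi}. ?h (sphere_point e0 (- e1) (- e2) c \<phi>'))"
    by (rule sphere_integral_iterated[OF e' m i])
  also have "\<dots> = (LBINT c:{-1<..<1}. indicator {0<..<1} c * (?M * ?w * c * ?Ga (?\<theta> (sqrt (1 - c\<^sup>2)))))"
  proof (intro set_lebesgue_integral_cong ballI allI impI)
    fix c :: real assume c: "c \<in> {-1<..<1}"
    have "(LBINT \<phi>':{0<..<2 * pi}. ?h (sphere_point e0 (- e1) (- e2) c \<phi>'))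
        = indicator {0<..<1} c * (?M * ?w * c) * (LBINT \<phi>':{0<..<2 * pi}. collision_gain \<psi> v1 v2 (scattered e0 e1 e2 (?\<theta> (sqrt (1 - c\<^sup>2))) \<phi>'))"
      unfolding val[OF c] mult.assoc[symmetric] set_integral_mult_right ..
    then show "(LBINT \<phi>':{0<..<2 * pi}. ?h (sphere_point e0 (- e1) (- e2) c \<phi>'))
        = indicator {0<..<1} c * (?M * ?w * c * ?Ga (?\<theta> (sqrt (1 - c\<^sup>2))))"
      unfolding set_integral_azimuthal_gain[OF c\<psi>] by (simp only: mult.assoc)
  qed auto
  also have "\<dots> = (LINT c|lborel. (?M * ?w) * (indicator {0<..<1} c *\<^sub>R (c * ?Ga (?\<theta> (sqrt (1 - c\<^sup>2))))))"
    unfolding set_lebesgue_integral_def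
    by (intro Bochner_Integration.integral_cong refl) (auto simp: indicator_def)
  also have "\<dots> = ?M * ?w * (LBINT c:{0<..<1}. c * ?Ga (?\<theta> (sqrt (1 - c\<^sup>2))))"
    by (simp add: set_lebesgue_integral_def)
  also have "(LBINT c:{0<..<1}. c * ?Ga (?\<theta> (sqrt (1 - c\<^sup>2)))) = (LBINT \<rho>:{0<..}. \<rho> * ?Ga (?\<theta> \<rho>))"
  proof (rule disc_projection)
    have rep: "repulsive (effective_potential \<epsilon> \<phi> ?w)"
      using repulsive_effective[OF s sp, of \<epsilon> ?w] \<epsilon> w by simp
    show "continuous_on {0<..} (\<lambda>\<rho>. ?Ga (?\<theta> \<rho>))"
      by (rule continuous_on_compose2[OF continuous_azimuthal_gain[OF c\<psi>]
            continuous_on_deflection_effective[OF s sp]]) (use \<epsilon> w in auto)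
    have gi: "\<bar>?Ga t\<bar> \<le> 4 * C * (2 * pi)" for t
    proof -
      have "continuous_on {0..2 * pi} (\<lambda>\<phi>'. collision_gain \<psi> v1 v2 (scattered e0 e1 e2 t \<phi>'))"
        unfolding collision_gain_def scattered_def by (intro continuous_intros continuous_on_compose2[OF c\<psi>]) auto
      then have "((\<lambda>\<phi>'. collision_gain \<psi> v1 v2 (scattered e0 e1 e2 t \<phi>')) has_integral ?Ga t) (cbox 0 (2 * pi))"
        unfolding azimuthal_gain_def by (simp add: integrable_integral integrable_continuous_real)
      from has_integral_bound[OF _ this, of "4 * C"] show ?thesis
        using collision_gain_bound[OF C] C0 by simp
    qed
    then show "\<bar>?Ga (?\<theta> \<rho>)\<bar> \<le> 4 * C * (2 * pi)" for \<rho> .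
    \<comment> \<open>Beyond the ball there is no deflection, and a collision without deflection
      gains nothing.\<close>
    show "?Ga (?\<theta> \<rho>) = 0" if "1 \<le> \<rho>" for \<rho>
    proof -
      have "\<phi> \<rho> = 0" using sp that by (cases "\<rho> = 1") (auto simp: singular_potential_def)
      then have "?\<theta> \<rho> = 0" using that by (intro deflection_eq_0[OF rep]) (auto simp: effective_potential_def)
      moreover have "collision_gain \<psi> v1 v2 e0 = 0"
      proof -
        have "(v1 + v2) /\<^sub>R 2 + (?w / 2) *\<^sub>R e0 = v1" "(v1 + v2) /\<^sub>R 2 - (?w / 2) *\<^sub>R e0 = v2"
        proof -
          have "(?w / 2) *\<^sub>R e0 = (1 / 2) *\<^sub>R (v1 - v2)" by (subst e0) simp
          then show "(v1 + v2) /\<^sub>R 2 + (?w / 2) *\<^sub>R e0 = v1" "(v1 + v2) /\<^sub>R 2 - (?w / 2) *\<^sub>R e0 = v2"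
            by (simp_all only:) (simp_all add: vec_eq_iff field_simps)
        qed
        then show ?thesis by (simp add: collision_gain_def)
      qed
      ultimately show ?thesis by (simp add: azimuthal_gain_def scattered_def)
    qed
  qed
  finally show ?thesis .
qed

end

text \<open>For positive \<open>\<delta>\<close> the kernel is integrable and the azimuth can be
  integrated first; this produces the decay \<open>\<rho> powr (- 2 * s)\<close>. As
  \<open>\<delta>\<close> tends to 0 the range of impact parameters grows to the half-line and the
  integral converges absolutely.\<close>

lemma noncutoff_inner_limit:
  fixes v1 v2 e0 e1 e2 :: "real ^ 3" and \<psi> :: "real ^ 3 \<Rightarrow> real"
  assumes s: "1 < s" and v: "v1 \<noteq> v2" and c\<psi>: "continuous_on UNIV \<psi>" and C: "\<And>x. \<bar>\<psi> x\<bar> \<le> C"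
    and e: "orthonormal3 e0 e1 e2"
    and K: "0 \<le> K1" "0 \<le> K2"
    and bnd: "\<And>\<rho>. 0 < \<rho> \<Longrightarrow> \<bar>azimuthal_gain \<psi> v1 v2 e0 e1 e2 (deflection (power_law (4 / (norm (v1 - v2))\<^sup>2) s) \<rho>)\<bar> \<le> K1"
      "\<And>\<rho>. 0 < \<rho> \<Longrightarrow> \<bar>azimuthal_gain \<psi> v1 v2 e0 e1 e2 (deflection (power_law (4 / (norm (v1 - v2))\<^sup>2) s) \<rho>)\<bar> \<le> K2 * \<rho> powr (- 2 * s)"
  shows "((\<lambda>\<delta>. LINT \<sigma>:{\<sigma> \<in> sphere 0 1. e0 \<bullet> \<sigma> \<le> cos \<delta>}|sphere_measure.
      collision_gain \<psi> v1 v2 \<sigma> * maxwellian v2 * collision_kernel s (v1 - v2) (e0 \<bullet> \<sigma>)) \<longlongrightarrow>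
    maxwellian v2 * norm (v1 - v2) *
      (LBINT \<rho>:{0<..}. \<rho> * azimuthal_gain \<psi> v1 v2 e0 e1 e2 (deflection (power_law (4 / (norm (v1 - v2))\<^sup>2) s) \<rho>))) (at_right 0)"
proof -
  define w where "w = norm (v1 - v2)"
  have w: "0 < w" using v by (simp add: w_def)
  let ?M = "maxwellian v2" and ?\<theta> = "deflection (power_law (4 / w\<^sup>2) s)"
  let ?Ga = "azimuthal_gain \<psi> v1 v2 e0 e1 e2" and ?K = "collision_kernel s (v1 - v2)"
  let ?P = "impact_parameter s w"
  define I where "I \<delta> = (LINT \<sigma>:{\<sigma> \<in> sphere 0 1. e0 \<bullet> \<sigma> \<le> cos \<delta>}|sphere_measure.
      collision_gain \<psi> v1 v2 \<sigma> * ?M * ?K (e0 \<bullet> \<sigma>))" for \<delta>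
  have C0: "0 \<le> C" using C[of 0] by simp
  have cG: "continuous_on UNIV ?Ga" by (rule continuous_azimuthal_gain[OF c\<psi>])
  have Kb: "(\<lambda>c. indicator {-1<..<1} c * ?K c) \<in> borel_measurable borel"
    by (rule collision_kernel_measurable[OF s w]) (simp add: w_def)
  have I: "I \<delta> = ?M * w * (LBINT \<rho>:{0<..} \<inter> {..?P \<delta>}. \<rho> * ?Ga (?\<theta> \<rho>))" if \<delta>: "\<delta> \<in> {0<..<pi}" for \<delta>
  proof -
    have cd: "cos \<delta> < 1" "-1 < cos \<delta>"
      using \<delta> cos_monotone_0_pi[of 0 \<delta>] cos_monotone_0_pi[of \<delta> pi] by auto
    let ?S = "{\<sigma> \<in> sphere 0 1. e0 \<bullet> \<sigma> \<le> cos \<delta>}"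
    \<comment> \<open>The value \<open>c = -1\<close> is left out, because nothing is known of the
      kernel at angle \<open>pi\<close>; on the sphere this is the pole \<open>- e0\<close>.\<close>
    define k where "k c = indicator {-1<..cos \<delta>} c * ?K c" for c
    have k: "k = (\<lambda>c. indicator {..cos \<delta>} c * (indicator {-1<..<1} c * ?K c))"
      using cd by (auto simp: k_def indicator_def fun_eq_iff)
    have [measurable]: "k \<in> borel_measurable borel" unfolding k using Kb by measurable
    have [measurable]: "\<psi> \<in> borel_measurable borel" by (rule borel_measurable_continuous_onI[OF c\<psi>])
    define h where "h \<sigma> = indicator (sphere 0 1) \<sigma> * (collision_gain \<psi> v1 v2 \<sigma> * ?M * k (e0 \<bullet> \<sigma>))" for \<sigma>
    have hm: "h \<in> borel_measurable borel"
    proof -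
      have [measurable]: "sphere 0 1 \<in> sets (borel :: (real ^ 3) measure)" by (rule borel_closed) simp
      show ?thesis unfolding h_def collision_gain_def by measurable
    qed
    have e'': "orthonormal3 (- e0) e1 e2" using e by (simp add: orthonormal3_def)
    have eq: "indicator ?S \<sigma> *\<^sub>R (collision_gain \<psi> v1 v2 \<sigma> * ?M * ?K (e0 \<bullet> \<sigma>)) = h \<sigma>" if ne: "\<sigma> \<noteq> - e0" for \<sigma>
    proof (cases "norm \<sigma> = 1")
      case n: True
      have e0n: "norm e0 = 1" using e by (simp add: orthonormal3_def norm_eq_sqrt_inner)
      have "e0 \<bullet> \<sigma> \<noteq> -1"
      proof
        assume 1: "e0 \<bullet> \<sigma> = -1"
        have "(\<sigma> + e0) \<bullet> (\<sigma> + e0) = \<sigma> \<bullet> \<sigma> + 2 * (e0 \<bullet> \<sigma>) + e0 \<bullet> e0"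
          by (simp add: inner_add_left inner_add_right inner_commute)
        also have "\<dots> = 0" using n e0n 1 by (simp add: dot_square_norm)
        finally have "\<sigma> + e0 = 0" by simp
        then show False using ne by (simp add: eq_neg_iff_add_eq_0)
      qed
      moreover have "- 1 \<le> e0 \<bullet> \<sigma>" using Cauchy_Schwarz_ineq2[of e0 \<sigma>] n e0n by simp
      ultimately have "-1 < e0 \<bullet> \<sigma>" by simp
      then show ?thesis using n by (auto simp: h_def k_def indicator_def)
    qed (auto simp: h_def indicator_def)
    have m: "(\<lambda>\<sigma>. indicator ?S \<sigma> *\<^sub>R (collision_gain \<psi> v1 v2 \<sigma> * ?M * ?K (e0 \<bullet> \<sigma>))) \<in> borel_measurable borel"
    proof -
      have "(\<lambda>\<sigma>. indicator ?S \<sigma> *\<^sub>R (collision_gain \<psi> v1 v2 \<sigma> * ?M * ?K (e0 \<bullet> \<sigma>)))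
        = (\<lambda>\<sigma>. if \<sigma> = - e0 then indicator ?S (- e0) *\<^sub>R (collision_gain \<psi> v1 v2 (- e0) * ?M * ?K (e0 \<bullet> - e0)) else h \<sigma>)"
        using eq by auto
      also have "\<dots> \<in> borel_measurable borel" using hm by measurable
      finally show ?thesis .
    qed
    have Ih: "I \<delta> = (LINT \<sigma>|sphere_measure. h \<sigma>)"
      unfolding I_def set_lebesgue_integral_def
    proof (rule integral_cong_AE)
      show "AE \<sigma> in sphere_measure. indicator ?S \<sigma> *\<^sub>R (collision_gain \<psi> v1 v2 \<sigma> * ?M * ?K (e0 \<bullet> \<sigma>)) = h \<sigma>"
        using sphere_null_pole[OF e''] by eventually_elim (rule eq)
    qed (use m hm in \<open>simp_all only: measurable_cong_sets[OF sets_sphere_measure refl]\<close>)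
    have absK: "?K absolutely_integrable_on {-1<..cos \<delta>}"
      using collision_kernel_integral(1)[OF s w w_def[symmetric] \<delta>, of "\<lambda>_. 1"] by simp
    have ki: "integrable lborel k"
    proof -
      have "integrable lebesgue k" using absK by (simp add: set_integrable_def k_def[abs_def])
      then show ?thesis by (subst (asm) integrable_completion) auto
    qed
    have hval: "h (sphere_point e0 e1 e2 c \<phi>') = collision_gain \<psi> v1 v2 (scattered e0 e1 e2 (arccos c) \<phi>') * ?M * k c"
      if c: "c \<in> {-1<..<1}" for c \<phi>'
    proof -
      have "sphere_point e0 e1 e2 c \<phi>' = scattered e0 e1 e2 (arccos c) \<phi>'"
        using c by (simp add: sphere_point_def scattered_def sin_arccos)
      moreover have "\<bar>c\<bar> \<le> 1" using c by auto
      ultimately show ?thesis using sphere_point_props[OF e, of c \<phi>'] by (simp add: h_def)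
    qed
    \<comment> \<open>The gain is bounded, so the truncated kernel times the indicator of the
      azimuth range is a majorant, and it is integrable as a product.\<close>
    have hi: "integrable sphere_measure h"
      unfolding integrable_sphere_iff[OF e hm]
    proof (rule Bochner_Integration.integrable_bound)
      have "integrable (lborel \<Otimes>\<^sub>M lborel) (\<lambda>p. k (fst p) * indicator {0<..<2 * pi} (snd p) :: real)"
      proof (rule lborel_pair.Fubini_integrable)
        show "integrable lborel (\<lambda>x. LINT y|lborel. norm (k (fst (x, y)) * indicator {0<..<2 * pi} (snd (x, y)) :: real))"
          using integrable_norm[OF ki] by (simp add: abs_mult)
        have "integrable lborel (indicator {0<..<2 * pi} :: real \<Rightarrow> real)"
          using emeasure_bounded_finite[of "{0<..<2 * pi}"] by (intro integrable_real_indicator) auto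
        then show "AE x in lborel. integrable lborel (\<lambda>y. k (fst (x, y)) * indicator {0<..<2 * pi} (snd (x, y)) :: real)"
          by (intro AE_I2) simp
      qed measurable
      then show "integrable lborel (\<lambda>p. (4 * C * ?M) * (k (fst p) * indicator {0<..<2 * pi} (snd p)))"
        by (intro integrable_mult_right) (simp add: lborel_prod)
      show "(\<lambda>p. indicator sphere_chart_domain p * h (sphere_point e0 e1 e2 (fst p) (snd p))) \<in> borel_measurable lborel"
        using measurable_compose[OF sphere_point_measurable hm] by measurable
      show "AE p in lborel. norm (indicator sphere_chart_domain p * h (sphere_point e0 e1 e2 (fst p) (snd p)))
          \<le> norm ((4 * C * ?M) * (k (fst p) * indicator {0<..<2 * pi} (snd p)))"
      proof (rule AE_I2)
        fix p :: "real \<times> real"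
        show "norm (indicator sphere_chart_domain p * h (sphere_point e0 e1 e2 (fst p) (snd p)))
          \<le> norm ((4 * C * ?M) * (k (fst p) * indicator {0<..<2 * pi} (snd p)))"
        proof (cases "p \<in> sphere_chart_domain")
          case True
          then have c: "fst p \<in> {-1<..<1}" "snd p \<in> {0<..<2 * pi}" by (auto simp: sphere_chart_domain_def)
          have "\<bar>collision_gain \<psi> v1 v2 (scattered e0 e1 e2 (arccos (fst p)) (snd p)) * ?M * k (fst p)\<bar> \<le> 4 * C * ?M * \<bar>k (fst p)\<bar>"
            unfolding abs_mult using collision_gain_bound[OF C] maxwellian_nonneg[of v2] C0
            by (intro mult_mono) auto
          then show ?thesis using True c hval[OF c(1)] maxwellian_nonneg[of v2] C0 by (simp add: abs_mult)
        qed simp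
      qed
    qed
    have "I \<delta> = (LBINT c:{-1<..<1}. LBINT \<phi>':{0<..<2 * pi}. h (sphere_point e0 e1 e2 c \<phi>'))"
      unfolding Ih by (rule sphere_integral_iterated[OF e hm hi])
    also have "\<dots> = (LBINT c:{-1<..<1}. ?Ga (arccos c) * (?M * k c))"
    proof (intro set_lebesgue_integral_cong ballI allI impI)
      fix c :: real assume c: "c \<in> {-1<..<1}"
      have "(LBINT \<phi>':{0<..<2 * pi}. h (sphere_point e0 e1 e2 c \<phi>'))
          = (LBINT \<phi>':{0<..<2 * pi}. collision_gain \<psi> v1 v2 (scattered e0 e1 e2 (arccos c) \<phi>')) * (?M * k c)"
        unfolding hval[OF c] mult.assoc set_integral_mult_left ..
      then show "(LBINT \<phi>':{0<..<2 * pi}. h (sphere_point e0 e1 e2 c \<phi>')) = ?Ga (arccos c) * (?M * k c)"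
        unfolding set_integral_azimuthal_gain[OF c\<psi>] .
    qed auto
    also have "\<dots> = (LINT c|lborel. ?M * (indicator {-1<..cos \<delta>} c *\<^sub>R (?Ga (arccos c) * ?K c)))"
      unfolding set_lebesgue_integral_def
      by (intro Bochner_Integration.integral_cong refl) (use cd in \<open>auto simp: indicator_def k_def\<close>)
    also have "\<dots> = ?M * (LBINT c:{-1<..cos \<delta>}. ?Ga (arccos c) * ?K c)"
      by (simp add: set_lebesgue_integral_def)
    also have "(LBINT c:{-1<..cos \<delta>}. ?Ga (arccos c) * ?K c) = integral {-1<..cos \<delta>} (\<lambda>c. ?Ga (arccos c) * ?K c)"
    proof (rule set_borel_integral_eq_integral(2))
      have cg': "continuous_on {-1..1} (\<lambda>c. ?Ga (arccos c))"
        by (rule continuous_on_compose2[OF cG continuous_on_arccos']) auto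
      have "(\<lambda>c. (indicator {-1..1} c *\<^sub>R ?Ga (arccos c)) * k c) \<in> borel_measurable borel"
        using borel_measurable_continuous_on_indicator[OF _ cg'] by measurable
      moreover have "(indicator {-1..1} c *\<^sub>R ?Ga (arccos c)) * k c = indicator {-1<..cos \<delta>} c *\<^sub>R (?Ga (arccos c) * ?K c)" for c
        using cd by (auto simp: k_def indicator_def)
      ultimately have "(\<lambda>c. indicator {-1<..cos \<delta>} c *\<^sub>R (?Ga (arccos c) * ?K c)) \<in> borel_measurable borel"
        by (simp only:)
      then show "set_integrable lborel {-1<..cos \<delta>} (\<lambda>c. ?Ga (arccos c) * ?K c)"
        using collision_kernel_integral(1)[OF s w w_def[symmetric] \<delta> continuous_on_subset[OF cG subset_UNIV]]
        unfolding set_integrable_def by (subst (asm) integrable_completion) auto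
    qed
    also have "\<dots> = w * integral {0<..?P \<delta>} (\<lambda>\<rho>. \<rho> * ?Ga (?\<theta> \<rho>))"
      by (rule collision_kernel_integral(2)[OF s w w_def[symmetric] \<delta> continuous_on_subset[OF cG subset_UNIV]])
    also have "integral {0<..?P \<delta>} (\<lambda>\<rho>. \<rho> * ?Ga (?\<theta> \<rho>)) = (LBINT \<rho>:{0<..} \<inter> {..?P \<delta>}. \<rho> * ?Ga (?\<theta> \<rho>))"
    proof -
      have st: "{0<..} \<inter> {..?P \<delta>} = {0<..?P \<delta>}" by auto
      have cc: "continuous_on {0<..} (\<lambda>\<rho>. \<rho> * ?Ga (?\<theta> \<rho>))"
        by (intro continuous_intros continuous_on_compose2[OF cG kernel_angle_continuous[OF s w]]) auto
      have P0: "0 < ?P \<delta>" by (rule impact_parameter(1)[OF s w \<delta>])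
      have "set_integrable lborel {0<..?P \<delta>} (\<lambda>\<rho>. \<rho> * ?Ga (?\<theta> \<rho>))"
        unfolding set_integrable_def
      proof (rule Bochner_Integration.integrable_bound)
        have "integrable lborel (indicator {0<..?P \<delta>} :: real \<Rightarrow> real)"
          using emeasure_bounded_finite[of "{0<..?P \<delta>}"] by (intro integrable_real_indicator) auto
        then show "integrable lborel (\<lambda>\<rho>. indicator {0<..?P \<delta>} \<rho> *\<^sub>R (?P \<delta> * K1))" by (intro integrable_scaleR_left)
        show "(\<lambda>\<rho>. indicator {0<..?P \<delta>} \<rho> *\<^sub>R (\<rho> * ?Ga (?\<theta> \<rho>))) \<in> borel_measurable lborel"
        proof -
          have "{0<..?P \<delta>} \<subseteq> {0<..}" by auto
          from borel_measurable_continuous_on_indicator[OF _ continuous_on_subset[OF cc this]] show ?thesis by simp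
        qed
        show "AE \<rho> in lborel. norm (indicator {0<..?P \<delta>} \<rho> *\<^sub>R (\<rho> * ?Ga (?\<theta> \<rho>))) \<le> norm (indicator {0<..?P \<delta>} \<rho> *\<^sub>R (?P \<delta> * K1))"
          using bnd(1) K P0 by (intro AE_I2) (auto simp: indicator_def abs_mult w_def intro!: mult_mono)
      qed
      then show ?thesis unfolding st by (rule set_borel_integral_eq_integral(2)[symmetric])
    qed
    finally show ?thesis by (simp only: mult.assoc)
  qed
  have "(I \<longlongrightarrow> ?M * w * (LBINT \<rho>:{0<..}. \<rho> * ?Ga (?\<theta> \<rho>))) (at_right 0)"
    unfolding tendsto_at_iff_sequentially
  proof (intro allI impI)
    fix X :: "nat \<Rightarrow> real" assume X: "\<forall>i. X i \<in> {0<..} - {0}" "X \<longlonglongrightarrow> 0"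
    have Xpos: "0 < X n" for n using X(1) by auto
    have Xpi: "\<forall>\<^sub>F n in sequentially. X n < pi" using order_tendstoD(2)[OF X(2), of pi] by simp
    have "(\<lambda>n. LBINT \<rho>:{0<..} \<inter> {..?P (X n)}. \<rho> * ?Ga (?\<theta> \<rho>)) \<longlonglongrightarrow> (LBINT \<rho>:{0<..}. \<rho> * ?Ga (?\<theta> \<rho>))"
    proof (rule radial_integral_dominated(1)[OF s _ _ K])
      show "continuous_on {0<..} (\<lambda>\<rho>. ?Ga (?\<theta> \<rho>))" "continuous_on {0<..} (\<lambda>\<rho>. ?Ga (?\<theta> \<rho>))"
        by (rule continuous_on_compose2[OF cG kernel_angle_continuous[OF s w]], simp)+
      fix \<rho> :: real assume \<rho>: "0 < \<rho>"
      show "\<bar>?Ga (?\<theta> \<rho>)\<bar> \<le> K1" "\<bar>?Ga (?\<theta> \<rho>)\<bar> \<le> K2 * \<rho> powr (- 2 * s)" using bnd[OF \<rho>] by (simp_all add: w_def)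
      have "0 < ?\<theta> \<rho>" by (rule kernel_angle_bounds(1)[OF s w \<rho>])
      then have "\<forall>\<^sub>F n in sequentially. X n < ?\<theta> \<rho>" using order_tendstoD(2)[OF X(2)] by simp
      \<comment> \<open>Every fixed \<open>\<rho>\<close> is eventually in range, because its
        deflection is positive and the deflection decreases in the impact parameter.\<close>
      with Xpi show "\<forall>\<^sub>F n in sequentially. \<rho> \<in> {..?P (X n)}"
      proof eventually_elim
        case (elim n)
        then have d: "X n \<in> {0<..<pi}" using Xpos by auto
        have "\<not> ?P (X n) < \<rho>"
          using kernel_angle_strict_antimono[OF s w impact_parameter(1)[OF s w d], of \<rho>] impact_parameter(2)[OF s w d] elim by auto
        then show ?case by simp
      qed
    qed auto
    then have "(\<lambda>n. ?M * w * (LBINT \<rho>:{0<..} \<inter> {..?P (X n)}. \<rho> * ?Ga (?\<theta> \<rho>))) \<longlonglongrightarrow> ?M * w * (LBINT \<rho>:{0<..}. \<rho> * ?Ga (?\<theta> \<rho>))"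
      by (rule tendsto_mult_left)
    moreover have "\<forall>\<^sub>F n in sequentially. ?M * w * (LBINT \<rho>:{0<..} \<inter> {..?P (X n)}. \<rho> * ?Ga (?\<theta> \<rho>)) = (I \<circ> X) n"
      using Xpi by eventually_elim (use I Xpos in auto)
    ultimately show "(I \<circ> X) \<longlonglongrightarrow> ?M * w * (LBINT \<rho>:{0<..}. \<rho> * ?Ga (?\<theta> \<rho>))"
      by (rule Lim_transform_eventually)
  qed
  then show ?thesis unfolding I_def w_def .
qed

section \<open>The limit\<close>

text \<open>In dimension 3 the exponent 2 is integrable at the origin and the exponent 4 at
  infinity. At \<open>r = 0\<close> the value is 0 by division by zero.\<close>

definition radial_weight :: "real \<Rightarrow> real" where
  "radial_weight r = (if r < 1 then 1 / r\<^sup>2 else 1 / r ^ 4)"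

lemma dyadic_small:
  fixes r :: real
  assumes "0 < r" "r < 1"
  shows "\<exists>k. r < (1 / 2) ^ k \<and> (1 / 2) ^ Suc k \<le> r"
proof -
  obtain n0 where "(1 / 2 :: real) ^ n0 < r" using real_arch_pow_inv[of r "1 / 2"] assms by auto
  then have ex: "\<exists>n. (1 / 2 :: real) ^ n \<le> r" by (auto intro: less_imp_le)
  define n where "n = (LEAST n. (1 / 2 :: real) ^ n \<le> r)"
  have n: "(1 / 2 :: real) ^ n \<le> r" unfolding n_def by (rule LeastI_ex[OF ex])
  then have "n \<noteq> 0" using assms by (cases n) auto
  then obtain k where k: "n = Suc k" by (cases n) auto
  then have "\<not> (1 / 2 :: real) ^ k \<le> r" using not_less_Least[of k "\<lambda>n. (1 / 2 :: real) ^ n \<le> r"] by (simp add: n_def)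
  then show ?thesis using n k by (intro exI[of _ k]) auto
qed

lemma dyadic_large:
  fixes r :: real
  assumes "1 \<le> r"
  shows "\<exists>k. 2 ^ k \<le> r \<and> r < 2 ^ Suc k"
proof -
  have ex: "\<exists>n. r < 2 ^ n" using real_arch_pow[of 2 r] by auto
  define n where "n = (LEAST n. r < 2 ^ n)"
  have n: "r < 2 ^ n" unfolding n_def by (rule LeastI_ex[OF ex])
  then have "n \<noteq> 0" using assms by (cases n) auto
  then obtain k where k: "n = Suc k" by (cases n) auto
  then have "\<not> r < 2 ^ k" using not_less_Least[of k "\<lambda>n. r < 2 ^ n"] by (simp add: n_def)
  then show ?thesis using n k by (intro exI[of _ k]) auto
qed

text \<open>On each dyadic shell the weight is at most a constant, so indicators of balls with known
  volume replace polar coordinates.\<close>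

lemma integrable_radial_weight:
  fixes a :: "real ^ 3"
  shows "integrable lborel (\<lambda>x. radial_weight (norm (a - x)))"
proof -
  define c where "c = 4 / 3 * pi"
  \<comment> \<open>The two terms bound the weight on the shell from \<open>(1/2) ^ Suc k\<close> to
    \<open>(1/2) ^ k\<close> and on the shell from \<open>2 ^ k\<close> to \<open>2 ^ Suc k\<close>.
    Their integrals are \<open>4 * c * (1/2) ^ k\<close> and \<open>8 * c * (1/2) ^ k\<close>, a
    geometric series.\<close>
  define u where "u k x = ennreal (4 ^ Suc k) * indicator (ball a ((1/2) ^ k)) x +
      ennreal ((1/16) ^ k) * indicator (ball a (2 ^ Suc k)) x" for k and x :: "real ^ 3"
  have vol: "emeasure lborel (ball a r) = ennreal (c * r ^ 3)" if "0 \<le> r" for r :: real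
    using emeasure_ball[OF that, of a] by (simp add: unit_ball_vol_3 c_def)
  have um: "u k \<in> borel_measurable lborel" for k
    unfolding u_def
    by (intro borel_measurable_add borel_measurable_times_ennreal borel_measurable_indicator) auto
  have ui: "(\<integral>\<^sup>+x. u k x \<partial>lborel) = ennreal (24 * c * (1/2) ^ Suc k)" for k
  proof -
    have "(\<integral>\<^sup>+x. u k x \<partial>lborel) = ennreal (4 ^ Suc k) * emeasure lborel (ball a ((1/2) ^ k)) +
        ennreal ((1/16) ^ k) * emeasure lborel (ball a (2 ^ Suc k))"
      unfolding u_def
      by (subst nn_integral_add)
        (auto simp: nn_integral_cmult_indicator intro!: borel_measurable_times_ennreal borel_measurable_indicator)
    also have "\<dots> = ennreal (4 ^ Suc k * (c * ((1/2) ^ k) ^ 3) + (1/16) ^ k * (c * (2 ^ Suc k) ^ 3))"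
      by (simp add: vol ennreal_mult[symmetric] ennreal_plus[symmetric] c_def del: ennreal_plus)
    also have "4 ^ Suc k * (c * ((1/2) ^ k) ^ 3) + (1/16) ^ k * (c * (2 ^ Suc k) ^ 3) = 24 * c * (1/2) ^ Suc k"
    proof -
      have "((1/2::real) ^ k) ^ 3 = ((1/2) ^ 3) ^ k" by (simp only: power_mult[symmetric] mult.commute)
      also have "(1/2::real) ^ 3 = 1/8" by (simp add: power3_eq_cube)
      finally have "(4::real) ^ k * ((1/2) ^ k) ^ 3 = (4 * (1/8)) ^ k" by (simp only: power_mult_distrib)
      then have 1: "(4::real) ^ k * ((1/2) ^ k) ^ 3 = (1/2) ^ k" by simp
      have 2: "(1/16::real) ^ k * (2 ^ k) ^ 3 = (1/2) ^ k"
        by (simp add: power_mult_distrib[symmetric] power_mult[symmetric] mult.commute[of k 3] power_mult)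
      have "4 ^ Suc k * (c * ((1/2) ^ k) ^ 3) + (1/16) ^ k * (c * (2 ^ Suc k) ^ 3)
          = 4 * c * (4 ^ k * ((1/2) ^ k) ^ 3) + 8 * c * ((1/16) ^ k * (2 ^ k) ^ 3)"
        by (simp add: power_mult_distrib algebra_simps)
      then show ?thesis unfolding 1 2 by simp
    qed
    finally show ?thesis .
  qed
  have "(\<integral>\<^sup>+x. (\<Sum>k. u k x) \<partial>lborel) = (\<Sum>k. ennreal (24 * c * (1/2) ^ Suc k))"
    by (subst nn_integral_suminf[OF um]) (simp only: ui)
  also have "\<dots> = ennreal (24 * c * 1)"
    by (rule suminf_ennreal_eq[OF _ sums_mult[OF power_half_series]]) (simp add: c_def)
  finally have fin: "(\<integral>\<^sup>+x. (\<Sum>k. u k x) \<partial>lborel) < \<infinity>" by simp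
  have le: "ennreal (radial_weight (norm (a - x))) \<le> (\<Sum>k. u k x)" for x
  proof (cases "x = a")
    case True
    then show ?thesis by (simp add: radial_weight_def)
  next
    case False
    define r where "r = norm (a - x)"
    have r: "0 < r" using False by (simp add: r_def)
    have "\<exists>k. ennreal (radial_weight r) \<le> u k x"
    proof (cases "r < 1")
      case True
      obtain k where k: "r < (1 / 2) ^ k" "(1 / 2) ^ Suc k \<le> r" using dyadic_small[OF r True] by blast
      have "((1 / 2) ^ Suc k)\<^sup>2 \<le> r\<^sup>2" using k by (intro power_mono) auto
      then have "1 / r\<^sup>2 \<le> 1 / ((1 / 2) ^ Suc k)\<^sup>2" by (intro divide_left_mono) (use r in auto)
      also have "((1/2::real) ^ Suc k)\<^sup>2 = ((1/2)\<^sup>2) ^ Suc k" by (simp only: power_mult[symmetric] mult.commute)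
      also have "(1/2::real)\<^sup>2 = 1/4" by (simp add: power2_eq_square)
      also have "1 / (1/4::real) ^ Suc k = 4 ^ Suc k" by (simp add: power_divide)
      finally have "ennreal (radial_weight r) \<le> ennreal (4 ^ Suc k)"
        using True by (intro ennreal_leI) (simp add: radial_weight_def)
      moreover have "x \<in> ball a ((1/2) ^ k)" using k by (simp add: r_def dist_norm)
      ultimately show ?thesis by (intro exI[of _ k]) (simp add: u_def add_increasing2)
    next
      case False
      obtain k where k: "2 ^ k \<le> r" "r < 2 ^ Suc k" using dyadic_large[of r] False by auto
      have "(2 ^ k) ^ 4 \<le> r ^ 4" using k by (intro power_mono) auto
      then have "1 / r ^ 4 \<le> 1 / (2 ^ k) ^ 4" by (intro divide_left_mono) (use r in auto)
      also have "(2 ^ k) ^ 4 = (2 ^ 4 :: real) ^ k" by (simp only: power_mult[symmetric] mult.commute)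
      also have "1 / (2 ^ 4 :: real) ^ k = (1/16) ^ k" by (simp add: power_divide)
      finally have "ennreal (radial_weight r) \<le> ennreal ((1/16) ^ k)"
        using False by (intro ennreal_leI) (simp add: radial_weight_def)
      moreover have "x \<in> ball a (2 ^ Suc k)" using k by (simp add: r_def dist_norm)
      ultimately show ?thesis by (intro exI[of _ k]) (simp add: u_def add_increasing)
    qed
    then obtain k where "ennreal (radial_weight r) \<le> u k x" by blast
    also have "u k x = (\<Sum>j\<in>{k}. u j x)" by simp
    also have "\<dots> \<le> (\<Sum>k. u k x)" by (rule sum_le_suminf) auto
    finally show ?thesis by (simp add: r_def)
  qed
  show ?thesis
  proof (rule integrableI_bounded)
    show "(\<lambda>x. radial_weight (norm (a - x))) \<in> borel_measurable lborel"
      unfolding radial_weight_def by measurable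
    have "(\<integral>\<^sup>+x. ennreal (norm (radial_weight (norm (a - x)))) \<partial>lborel) \<le> (\<integral>\<^sup>+x. (\<Sum>k. u k x) \<partial>lborel)"
      by (intro nn_integral_mono) (use le in \<open>simp add: radial_weight_def\<close>)
    then show "(\<integral>\<^sup>+x. ennreal (norm (radial_weight (norm (a - x)))) \<partial>lborel) < \<infinity>"
      using fin by (rule le_less_trans)
  qed
qed

text \<open>The three terms are those of the collision integral,
  \<open>w * (1 + 1 / w ^ 3 + 1 / w\<^sup>2)\<close>. Near \<open>v1\<close> the worst is
  \<open>1 / w\<^sup>2\<close>; far away the Gaussian beats the linear growth.\<close>

lemma maxwellian_weight_bound:
  fixes v1 :: "real ^ 3"
  shows "\<exists>A\<ge>0. \<forall>v2. v2 \<noteq> v1 \<longrightarrow> maxwellian v2 * (norm (v1 - v2) + 1 / (norm (v1 - v2))\<^sup>2 + 1 / norm (v1 - v2))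
    \<le> A * radial_weight (norm (v1 - v2))"
proof -
  \<comment> \<open>3 counts the terms; the exponential comes from
    \<open>(norm v2)\<^sup>2 / 2 \<ge> norm v2 - 1 / 2\<close> and the triangle inequality;
    \<open>3125 = 5 ^ 5\<close> comes from the fifth power of
    \<open>w / 5 \<le> exp (w / 5)\<close>.\<close>
  define A where "A = 3 * 3125 * exp (1 / 2 + norm v1)"
  have A: "3 \<le> A"
  proof -
    have "1 \<le> exp (1 / 2 + norm v1)" by simp
    then show ?thesis unfolding A_def by linarith
  qed
  have pre: "(2 * pi) powr (- 3 / 2) \<le> (1::real)"
  proof -
    have "1 \<le> 2 * pi" using pi_ge_two by simp
    then have "(2 * pi) powr (- 3 / 2) \<le> (2 * pi) powr 0" by (intro powr_mono) auto
    then show ?thesis using pi_gt_zero by simp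
  qed
  have "maxwellian v2 * (norm (v1 - v2) + 1 / (norm (v1 - v2))\<^sup>2 + 1 / norm (v1 - v2)) \<le> A * radial_weight (norm (v1 - v2))"
    if ne: "v2 \<noteq> v1" for v2
  proof -
    define w where "w = norm (v1 - v2)"
    have w: "0 < w" using ne by (simp add: w_def)
    have M: "maxwellian v2 \<le> exp (- (norm v2)\<^sup>2 / 2)" "0 \<le> maxwellian v2"
      using mult_right_mono[OF pre, of "exp (- (norm v2)\<^sup>2 / 2)"] by (auto simp: maxwellian_def)
    show ?thesis
    proof (cases "w < 1")
      case True
      have w2: "w\<^sup>2 \<le> w" "w\<^sup>2 \<le> 1" using w True by (auto simp: power2_eq_square mult_le_one)
      have "w \<le> 1 / w\<^sup>2" "1 / w \<le> 1 / w\<^sup>2"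
      proof -
        have "w \<le> 1" using True by simp
        also have "1 \<le> 1 / w\<^sup>2" using w w2 by (simp add: le_divide_eq)
        finally show "w \<le> 1 / w\<^sup>2" .
        show "1 / w \<le> 1 / w\<^sup>2" using w w2 by (intro divide_left_mono) auto
      qed
      then have "w + 1 / w\<^sup>2 + 1 / w \<le> 3 * (1 / w\<^sup>2)" by linarith
      moreover have "maxwellian v2 \<le> 1" using M(1) by (meson exp_le_one_iff order_trans divide_nonpos_pos neg_le_0_iff_le zero_le_power2 zero_less_numeral)
      ultimately have "maxwellian v2 * (w + 1 / w\<^sup>2 + 1 / w) \<le> 1 * (3 * (1 / w\<^sup>2))"
        using w M(2) by (intro mult_mono) auto
      also have "\<dots> \<le> A * (1 / w\<^sup>2)" using mult_right_mono[OF A, of "1 / w\<^sup>2"] by simp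
      finally show ?thesis using True by (simp add: radial_weight_def w_def)
    next
      case False
      have "w \<le> norm v1 + norm v2" unfolding w_def by (rule norm_triangle_ineq4)
      moreover have "norm v2 - 1 / 2 \<le> (norm v2)\<^sup>2 / 2"
        using zero_le_power2[of "norm v2 - 1"] by (simp add: power2_diff)
      ultimately have "- (norm v2)\<^sup>2 / 2 \<le> (1 / 2 + norm v1) + - w" by linarith
      then have "exp (- (norm v2)\<^sup>2 / 2) \<le> exp ((1 / 2 + norm v1) + - w)" by simp
      also have "\<dots> = exp (1 / 2 + norm v1) * exp (- w)" by (rule exp_add)
      also have "exp (- w) \<le> 3125 / w ^ 5"
      proof -
        have "w / 5 \<le> exp (w / 5)" using exp_ge_add_one_self[of "w / 5"] by linarith
        then have "(w / 5) ^ 5 \<le> exp (w / 5) ^ 5" using w by (intro power_mono) auto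
        also have "exp (w / 5) ^ 5 = exp w" by (simp add: exp_of_nat_mult[symmetric])
        finally have "w ^ 5 / 3125 \<le> exp w" by (simp add: power_divide)
        then show ?thesis using w by (simp add: exp_minus field_simps)
      qed
      finally have "maxwellian v2 \<le> exp (1 / 2 + norm v1) * (3125 / w ^ 5)" using M(1) by simp
      moreover have "w + 1 / w\<^sup>2 + 1 / w \<le> 3 * w"
      proof -
        have "1 \<le> w\<^sup>2" "1 \<le> w" using False by (auto simp: one_le_power)
        then have "1 / w\<^sup>2 \<le> 1" "1 / w \<le> 1" using w by (auto simp: divide_le_eq)
        then show ?thesis using \<open>1 \<le> w\<close> by linarith
      qed
      ultimately have "maxwellian v2 * (w + 1 / w\<^sup>2 + 1 / w) \<le> exp (1 / 2 + norm v1) * (3125 / w ^ 5) * (3 * w)"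
        using w M(2) by (intro mult_mono) auto
      also have "\<dots> = A * (1 / w ^ 4)"
        using w by (simp add: A_def power_def numeral_eq_Suc)
      finally show ?thesis using False by (simp add: radial_weight_def w_def)
    qed
  qed
  then show ?thesis using A by (intro exI[of _ A]) auto
qed

lemma repulsive_scale:
  assumes "repulsive \<kappa>" "0 < l"
  shows "repulsive (\<lambda>r. \<kappa> (l * r))"
  unfolding repulsive_def
proof (intro conjI)
  show "continuous_on {0<..} (\<lambda>r. \<kappa> (l * r))"
    by (rule continuous_on_compose2[of "{0<..}" \<kappa>])
      (use assms in \<open>auto simp: repulsive_def intro!: continuous_intros\<close>)
  show "antimono_on {0<..} (\<lambda>r. \<kappa> (l * r))"
    using repulsive_antimono[OF assms(1)] assms(2) by (auto simp: monotone_on_def)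
  have "filterlim (\<lambda>r. l * r) at_top at_top"
    using assms(2) by (intro filterlim_tendsto_pos_mult_at_top[OF tendsto_const] filterlim_ident)
  then show "((\<lambda>r. \<kappa> (l * r)) \<longlongrightarrow> 0) at_top"
    using assms(1) by (auto simp: repulsive_def intro: filterlim_compose)
qed

text \<open>Only positive radii enter, and the scaling of a power law is an identity there
  only.\<close>

lemma deflection_cong:
  assumes "repulsive \<kappa>" "0 < \<rho>" "\<And>r. 0 < r \<Longrightarrow> \<kappa> r = \<kappa>' r"
  shows "deflection \<kappa> \<rho> = deflection \<kappa>' \<rho>"
proof -
  have a: "apsis \<kappa> \<rho> = apsis \<kappa>' \<rho>"
    unfolding apsis_def by (rule arg_cong[where f=The]) (use assms(3) in \<open>auto simp: fun_eq_iff\<close>)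
  have "half_angle \<kappa> \<rho> = half_angle \<kappa>' \<rho>"
    unfolding half_angle_def half_angle_integrand_def a[symmetric]
    by (intro set_lebesgue_integral_cong) (use assms(3) apsis_pos[OF assms(1,2)] in auto)
  then show ?thesis by (simp add: deflection_def)
qed

lemma azimuthal_gain_deflection_bound:
  assumes C: "0 \<le> C" "continuous_on UNIV \<psi>" "\<And>x. \<bar>\<psi> x\<bar> \<le> C" "\<And>x. norm (D x) \<le> C"
    "\<And>x h. \<bar>\<psi> (x + h) - \<psi> x - blinfun_apply (D x) h\<bar> \<le> C * (norm h)\<^sup>2"
    and e: "orthonormal3 e0 e1 e2" and e0: "v1 - v2 = norm (v1 - v2) *\<^sub>R e0"
    and t: "0 \<le> t" "t \<le> c * \<rho> powr - s"
  shows "\<bar>azimuthal_gain \<psi> v1 v2 e0 e1 e2 t\<bar>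
    \<le> (pi * C * (norm (v1 - v2) + (norm (v1 - v2))\<^sup>2) * c\<^sup>2) * \<rho> powr (- 2 * s)"
proof -
  have "\<bar>azimuthal_gain \<psi> v1 v2 e0 e1 e2 t\<bar> \<le> pi * C * (norm (v1 - v2) + (norm (v1 - v2))\<^sup>2) * t\<^sup>2"
    by (rule azimuthal_gain_bounds(2)[OF C e e0])
  also have "\<dots> \<le> pi * C * (norm (v1 - v2) + (norm (v1 - v2))\<^sup>2) * (c * \<rho> powr - s)\<^sup>2"
    using t C(1) by (intro mult_left_mono power_mono) auto
  also have "(c * \<rho> powr - s)\<^sup>2 = c\<^sup>2 * \<rho> powr (- 2 * s)"
    by (simp add: power_mult_distrib power2_eq_square powr_add[symmetric])
  finally show ?thesis by (simp only: mult.assoc)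
qed

section \<open>The two collision integrals at fixed velocities\<close>

context
  fixes s :: real and \<Phi> \<psi> :: "real ^ 3 \<Rightarrow> real" and \<phi> f :: "real \<Rightarrow> real" and v1 :: "real ^ 3"
  assumes s: "1 < s" and sp: "singular_potential s \<Phi> \<phi> f" and C3: "C3_bounded \<psi>"
begin

definition collision_integral :: "real \<Rightarrow> real ^ 3 \<Rightarrow> real" where
  "collision_integral \<epsilon> v2 = (LINT \<nu>:{\<nu> \<in> sphere 0 1. 0 \<le> \<nu> \<bullet> (v1 - v2)}|sphere_measure.
      (\<psi> (fst (outgoing_velocities (\<lambda>x. \<epsilon> * \<Phi> x) v1 v2 \<nu>)) + \<psi> (snd (outgoing_velocities (\<lambda>x. \<epsilon> * \<Phi> x) v1 v2 \<nu>))
         - \<psi> v1 - \<psi> v2) * maxwellian v2 * ((v1 - v2) \<bullet> \<nu>))"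

definition noncutoff_integral :: "real ^ 3 \<Rightarrow> real" where
  "noncutoff_integral v2 =
      (let \<eta> = (v1 - v2) /\<^sub>R norm (v1 - v2);
             v1' = (\<lambda>\<sigma>. (v1 + v2) /\<^sub>R 2 + (norm (v1 - v2) / 2) *\<^sub>R \<sigma>);
             v2' = (\<lambda>\<sigma>. (v1 + v2) /\<^sub>R 2 - (norm (v1 - v2) / 2) *\<^sub>R \<sigma>)
         in Lim (at_right 0) (\<lambda>\<delta>. LINT \<sigma>:{\<sigma> \<in> sphere 0 1. \<eta> \<bullet> \<sigma> \<le> cos \<delta>}|sphere_measure.
              (\<psi> (v1' \<sigma>) + \<psi> (v2' \<sigma>) - \<psi> v1 - \<psi> v2) * maxwellian v2
                * collision_kernel s (v1 - v2) (\<eta> \<bullet> \<sigma>)))"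

text \<open>Off the point \<open>v1\<close> the integral is the one of \<open>incoming_gain\<close>,
  which is measurable in \<open>v2\<close> by Fubini; the single point \<open>v1\<close> does not
  affect measurability.\<close>

lemma collision_integral_measurable:
  assumes "0 < \<epsilon>"
  shows "collision_integral \<epsilon> \<in> borel_measurable borel"
proof -
  have c\<psi>: "continuous_on UNIV \<psi>" using C3_bounded_taylor[OF C3] by blast
  interpret finite_measure sphere_measure by (rule finite_sphere_measure)
  have "(\<lambda>p. incoming_gain \<phi> \<epsilon> \<psi> v1 (fst p) (snd p)) \<in> borel_measurable (borel \<Otimes>\<^sub>M sphere_measure)"
    using incoming_gain_measurable[OF s sp less_imp_le[OF assms] c\<psi>]
    by (simp add: measurable_cong_sets[OF sets_pair_measure_cong[OF refl sets_sphere_measure] refl])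
  then have m: "(\<lambda>v2. LINT \<nu>|sphere_measure. incoming_gain \<phi> \<epsilon> \<psi> v1 v2 \<nu>) \<in> borel_measurable borel"
    by (intro borel_measurable_lebesgue_integral) (simp add: case_prod_unfold)
  have "collision_integral \<epsilon> = (\<lambda>v2. if v2 = v1 then collision_integral \<epsilon> v1
      else LINT \<nu>|sphere_measure. incoming_gain \<phi> \<epsilon> \<psi> v1 v2 \<nu>)"
    using collision_integral_eq[OF s sp assms _ c\<psi>, of v1] by (auto simp: fun_eq_iff collision_integral_def)
  also have "\<dots> \<in> borel_measurable borel" using m by measurable
  finally show ?thesis .
qed

text \<open>After the rescaling both integrals are of one type, the radial integral of the azimuthal
  gain at a deflection angle. The constant \<open>A\<close> does not depend on \<open>v2\<close> or
  \<open>\<epsilon>\<close>; the dependence on the relative speed is kept explicit, to be integrated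
  in \<open>v2\<close>.\<close>

lemma collision_integral_limit:
  "\<exists>A\<ge>0. \<forall>v2. v2 \<noteq> v1 \<longrightarrow>
    (\<forall>\<epsilon>>0. \<bar>1 / \<epsilon> powr (2 / s) * collision_integral \<epsilon> v2\<bar>
        \<le> A * (maxwellian v2 * (norm (v1 - v2) + 1 / (norm (v1 - v2))\<^sup>2 + 1 / norm (v1 - v2)))) \<and>
    (\<forall>X. (\<forall>n. 0 < X n) \<longrightarrow> X \<longlonglongrightarrow> 0 \<longrightarrow>
        (\<lambda>n. 1 / X n powr (2 / s) * collision_integral (X n) v2) \<longlonglongrightarrow> f 0 powr (2 / s) * noncutoff_integral v2)"
proof -
  obtain D C where C: "0 \<le> C" "continuous_on UNIV \<psi>" "\<And>x. \<bar>\<psi> x\<bar> \<le> C" "\<And>x. norm (D x) \<le> C"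
    "\<And>x h. \<bar>\<psi> (x + h) - \<psi> x - blinfun_apply (D x) h\<bar> \<le> C * (norm h)\<^sup>2"
    using C3_bounded_taylor[OF C3] by metis
  obtain B where B: "0 < B" "\<And>r. 0 < r \<Longrightarrow> \<phi> r \<le> B * r powr - s"
    "\<And>r r'. 0 < r \<Longrightarrow> r \<le> r' \<Longrightarrow> \<phi> r - \<phi> r' \<le> B * (r powr - s - r' powr - s)"
    using singular_potential_bounds[OF sp] s by fastforce
  have f0: "0 < f 0" using sp by (simp add: singular_potential_def)
  \<comment> \<open>Collects what remains of \<open>K2 (4 * B / w\<^sup>2) / (2 * s - 2)\<close>
    when the powers of \<open>w\<close> are split off: \<open>(w + w\<^sup>2) / w ^ 4\<close> is
    \<open>1 / w ^ 3 + 1 / w\<^sup>2\<close>.\<close>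
  define c0 where "c0 = pi * C * (2 * pi * s * (4 * B))\<^sup>2 / (2 * s - 2)"
  define A where "A = 8 * pi * C + c0"
  have c0: "0 \<le> c0" using C(1) s by (simp add: c0_def)
  have "(\<forall>\<epsilon>>0. \<bar>1 / \<epsilon> powr (2 / s) * collision_integral \<epsilon> v2\<bar>
        \<le> A * (maxwellian v2 * (norm (v1 - v2) + 1 / (norm (v1 - v2))\<^sup>2 + 1 / norm (v1 - v2)))) \<and>
    (\<forall>X. (\<forall>n. 0 < X n) \<longrightarrow> X \<longlonglongrightarrow> 0 \<longrightarrow>
        (\<lambda>n. 1 / X n powr (2 / s) * collision_integral (X n) v2) \<longlonglongrightarrow> f 0 powr (2 / s) * noncutoff_integral v2)"
    if ne: "v2 \<noteq> v1" for v2
  proof -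
    define w where "w = norm (v1 - v2)"
    define e0 where "e0 = (v1 - v2) /\<^sub>R w"
    let ?M = "maxwellian v2"
    have w: "0 < w" using ne by (simp add: w_def)
    have e0: "v1 - v2 = norm (v1 - v2) *\<^sub>R e0" using w by (simp add: e0_def w_def)
    have ne': "v1 \<noteq> v2" using ne by simp
    have "norm e0 = 1" using w by (simp add: e0_def w_def)
    then obtain e1 e2 where e: "orthonormal3 e0 e1 e2" using orthonormal3_exists by blast
    let ?Ga = "azimuthal_gain \<psi> v1 v2 e0 e1 e2"
    have cG: "continuous_on UNIV ?Ga" by (rule continuous_azimuthal_gain[OF C(2)])
    \<comment> \<open>The effective potential in lengths of size
      \<open>\<epsilon> powr (1 / s)\<close>; its bounds no longer contain
      \<open>\<epsilon>\<close>.\<close>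
    define \<kappa> where "\<kappa> \<epsilon> r = effective_potential \<epsilon> \<phi> w (\<epsilon> powr (1 / s) * r)" for \<epsilon> r
    define \<theta> where "\<theta> \<epsilon> = deflection (\<kappa> \<epsilon>)" for \<epsilon>
    define K1 where "K1 = 8 * pi * C"
    define K2 where "K2 b = pi * C * (w + w\<^sup>2) * (2 * pi * s * b)\<^sup>2" for b
    have K: "0 \<le> K1" "0 \<le> K2 b" for b using C(1) w by (auto simp: K1_def K2_def)
    have b1: "\<bar>?Ga t\<bar> \<le> K1" for t unfolding K1_def by (rule azimuthal_gain_bounds(1)[OF C e e0])
    have b2: "\<bar>?Ga (deflection \<mu> \<rho>)\<bar> \<le> K2 b * \<rho> powr (- 2 * s)"
      if "repulsive \<mu>" "0 < \<rho>" "\<And>r. 0 < r \<Longrightarrow> \<mu> r \<le> b * r powr - s"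
        "\<And>r r'. 0 < r \<Longrightarrow> r \<le> r' \<Longrightarrow> \<mu> r - \<mu> r' \<le> b * (r powr - s - r' powr - s)" for \<mu> \<rho> b
      unfolding K2_def w_def
    proof (rule azimuthal_gain_deflection_bound[OF C e e0])
      show "0 \<le> deflection \<mu> \<rho>" by (rule deflection_bounds(1)[OF that(1,2)])
      show "deflection \<mu> \<rho> \<le> 2 * pi * s * b * \<rho> powr - s"
        by (rule deflection_le[OF that(1,2)]) (use s that(3,4) in auto)
    qed
    have rep_eff: "repulsive (effective_potential \<epsilon> \<phi> w)" if "0 < \<epsilon>" for \<epsilon>
      using repulsive_effective[OF s sp, of \<epsilon> w] that w by simp
    have rep\<kappa>: "repulsive (\<kappa> \<epsilon>)" if "0 < \<epsilon>" for \<epsilon>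
      unfolding \<kappa>_def[abs_def] using rep_eff[OF that] that by (intro repulsive_scale) auto
    have scale: "\<epsilon> * (\<epsilon> powr (1 / s) * r) powr - s = r powr - s" if "0 < \<epsilon>" "0 < r" for \<epsilon> r
    proof -
      have "(\<epsilon> powr (1 / s) * r) powr - s = \<epsilon> powr - 1 * r powr - s"
        using that s by (simp add: powr_mult powr_powr)
      then show ?thesis using that by (simp add: powr_minus)
    qed
    have \<kappa>_bound: "\<kappa> \<epsilon> r \<le> 4 * B / w\<^sup>2 * r powr - s" if "0 < \<epsilon>" "0 < r" for \<epsilon> r
    proof -
      have "\<kappa> \<epsilon> r \<le> 4 * (\<epsilon> * (B * (\<epsilon> powr (1 / s) * r) powr - s)) / w\<^sup>2"
        unfolding \<kappa>_def effective_potential_def using B(2)[of "\<epsilon> powr (1 / s) * r"] that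
        by (intro divide_right_mono mult_left_mono) auto
      also have "\<epsilon> * (B * (\<epsilon> powr (1 / s) * r) powr - s) = B * r powr - s"
        using scale[OF that] by (simp only: mult.left_commute[of \<epsilon> B])
      finally show ?thesis by simp
    qed
    have \<kappa>_drop: "\<kappa> \<epsilon> r - \<kappa> \<epsilon> r' \<le> 4 * B / w\<^sup>2 * (r powr - s - r' powr - s)" if "0 < \<epsilon>" "0 < r" "r \<le> r'" for \<epsilon> r r'
    proof -
      let ?l = "\<epsilon> powr (1 / s)"
      have "\<kappa> \<epsilon> r - \<kappa> \<epsilon> r' = 4 * (\<epsilon> * (\<phi> (?l * r) - \<phi> (?l * r'))) / w\<^sup>2"
        by (simp add: \<kappa>_def effective_potential_def diff_divide_distrib[symmetric] right_diff_distrib)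
      also have "\<dots> \<le> 4 * (\<epsilon> * (B * ((?l * r) powr - s - (?l * r') powr - s))) / w\<^sup>2"
        using B(3)[of "?l * r" "?l * r'"] that by (intro divide_right_mono mult_left_mono) auto
      also have "\<epsilon> * (B * ((?l * r) powr - s - (?l * r') powr - s))
          = B * (\<epsilon> * (?l * r) powr - s - \<epsilon> * (?l * r') powr - s)" by (simp add: algebra_simps)
      also have "\<dots> = B * (r powr - s - r' powr - s)" using scale[of \<epsilon>] that by simp
      finally show ?thesis by simp
    qed
    have \<theta>b2: "\<bar>?Ga (\<theta> \<epsilon> \<rho>)\<bar> \<le> K2 (4 * B / w\<^sup>2) * \<rho> powr (- 2 * s)" if "0 < \<epsilon>" "0 < \<rho>" for \<epsilon> \<rho>
      unfolding \<theta>_def by (rule b2[OF rep\<kappa>[OF that(1)] that(2) \<kappa>_bound[OF that(1)] \<kappa>_drop[OF that(1)]])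
    have \<theta>c: "continuous_on {0<..} (\<lambda>\<rho>. ?Ga (\<theta> \<epsilon> \<rho>))" if "0 < \<epsilon>" for \<epsilon>
    proof -
      have "continuous_on {0<..} (\<theta> \<epsilon>)"
        unfolding \<theta>_def continuous_on_sequentially comp_def
        by (safe, rule deflection_tendsto) (use rep\<kappa>[OF that] in auto)
      then show ?thesis by (rule continuous_on_compose2[OF cG]) auto
    qed
    have CI: "1 / \<epsilon> powr (2 / s) * collision_integral \<epsilon> v2 = ?M * w * (LBINT \<rho>:{0<..}. \<rho> * ?Ga (\<theta> \<epsilon> \<rho>))"
      if \<epsilon>: "0 < \<epsilon>" for \<epsilon>
    proof -
      let ?l = "\<epsilon> powr (1 / s)"
      have l: "0 < ?l" using \<epsilon> by simp
      have "collision_integral \<epsilon> v2 = ?M * w * (LBINT \<rho>:{0<..}. \<rho> * ?Ga (deflection (effective_potential \<epsilon> \<phi> w) \<rho>))"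
        unfolding collision_integral_def collision_integral_eq[OF s sp \<epsilon> ne' C(2)] w_def
        by (rule incoming_gain_integral[OF s sp \<epsilon> ne' C(2,3) e e0])
      also have "(LBINT \<rho>:{0<..}. \<rho> * ?Ga (deflection (effective_potential \<epsilon> \<phi> w) \<rho>))
          = ?l\<^sup>2 * (LBINT \<rho>:{0<..}. \<rho> * ?Ga (deflection (effective_potential \<epsilon> \<phi> w) (?l * \<rho>)))"
        by (rule radial_integral_scale[OF l])
      also have "(LBINT \<rho>:{0<..}. \<rho> * ?Ga (deflection (effective_potential \<epsilon> \<phi> w) (?l * \<rho>)))
          = (LBINT \<rho>:{0<..}. \<rho> * ?Ga (\<theta> \<epsilon> \<rho>))"
      proof (intro set_lebesgue_integral_cong ballI allI impI)
        fix \<rho> :: real assume "\<rho> \<in> {0<..}"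
        then show "\<rho> * ?Ga (deflection (effective_potential \<epsilon> \<phi> w) (?l * \<rho>)) = \<rho> * ?Ga (\<theta> \<epsilon> \<rho>)"
          using deflection_scale[OF rep_eff[OF \<epsilon>] _ l, of \<rho>] rep\<kappa>[OF \<epsilon>] by (simp add: \<theta>_def \<kappa>_def[abs_def])
      qed auto
      also have "?l\<^sup>2 = \<epsilon> powr (2 / s)"
        using \<epsilon> by (simp add: power2_eq_square powr_add[symmetric])
      finally show ?thesis using \<epsilon> by simp
    qed
    have 1: "\<bar>1 / \<epsilon> powr (2 / s) * collision_integral \<epsilon> v2\<bar> \<le> A * (?M * (w + 1 / w\<^sup>2 + 1 / w))" if \<epsilon>: "0 < \<epsilon>" for \<epsilon>
    proof -
      have "\<bar>LBINT \<rho>:{0<..}. \<rho> * ?Ga (\<theta> \<epsilon> \<rho>)\<bar> \<le> K1 + K2 (4 * B / w\<^sup>2) / (2 * s - 2)"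
        by (rule radial_integral_dominated(2)[OF s \<theta>c[OF \<epsilon>] \<theta>c[OF \<epsilon>] K, where S="\<lambda>_. UNIV"])
          (use b1 \<theta>b2[OF \<epsilon>] in auto)
      also have "K2 (4 * B / w\<^sup>2) / (2 * s - 2) = c0 * (1 / w ^ 3 + 1 / w\<^sup>2)"
        using w s by (simp add: K2_def c0_def field_simps power2_eq_square power3_eq_cube)
      finally have i: "\<bar>LBINT \<rho>:{0<..}. \<rho> * ?Ga (\<theta> \<epsilon> \<rho>)\<bar> \<le> K1 + c0 * (1 / w ^ 3 + 1 / w\<^sup>2)" .
      have "\<bar>1 / \<epsilon> powr (2 / s) * collision_integral \<epsilon> v2\<bar> = ?M * w * \<bar>LBINT \<rho>:{0<..}. \<rho> * ?Ga (\<theta> \<epsilon> \<rho>)\<bar>"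
        unfolding CI[OF \<epsilon>] using w maxwellian_nonneg[of v2] by (simp add: abs_mult)
      also have "\<dots> \<le> ?M * w * (K1 + c0 * (1 / w ^ 3 + 1 / w\<^sup>2))"
        using i w maxwellian_nonneg[of v2] by (intro mult_left_mono) auto
      also have "\<dots> = ?M * (K1 * w + c0 * (1 / w\<^sup>2 + 1 / w))"
        using w by (simp add: field_simps power2_eq_square power3_eq_cube)
      also have "\<dots> \<le> ?M * (A * (w + 1 / w\<^sup>2 + 1 / w))"
      proof (intro mult_left_mono maxwellian_nonneg)
        have "0 \<le> K1 * (1 / w\<^sup>2 + 1 / w)" "0 \<le> c0 * w" using K(1) c0 w by simp_all
        moreover have "(K1 + c0) * (w + p + q) = K1 * w + c0 * (p + q) + (K1 * (p + q) + c0 * w)" for p q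
          by (simp add: algebra_simps)
        ultimately show "K1 * w + c0 * (1 / w\<^sup>2 + 1 / w) \<le> A * (w + 1 / w\<^sup>2 + 1 / w)"
          unfolding A_def K1_def[symmetric] by (simp only:)
      qed
      finally show ?thesis by (simp only: mult.left_commute)
    qed
    define I0 where "I0 = (LBINT \<rho>:{0<..}. \<rho> * ?Ga (deflection (power_law (4 * f 0 / w\<^sup>2) s) \<rho>))"
    define J where "J = (LBINT \<rho>:{0<..}. \<rho> * ?Ga (deflection (power_law (4 / w\<^sup>2) s) \<rho>))"
    have rep0: "repulsive (power_law (4 * f 0 / w\<^sup>2) s)" "repulsive (power_law (4 / w\<^sup>2) s)"
      using f0 w s by (auto intro!: repulsive_power_law)
    have lim: "(\<lambda>n. 1 / X n powr (2 / s) * collision_integral (X n) v2) \<longlonglongrightarrow> ?M * w * I0"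
      if X: "\<And>n. 0 < X n" "X \<longlonglongrightarrow> 0" for X :: "nat \<Rightarrow> real"
    proof -
      have c0': "continuous_on {0<..} (\<lambda>\<rho>. ?Ga (deflection (power_law (4 * f 0 / w\<^sup>2) s) \<rho>))"
      proof -
        have "continuous_on {0<..} (deflection (power_law (4 * f 0 / w\<^sup>2) s))"
          unfolding continuous_on_sequentially comp_def
          by (safe, rule deflection_tendsto) (use rep0 in auto)
        then show ?thesis by (rule continuous_on_compose2[OF cG]) auto
      qed
      have "(\<lambda>n. LBINT \<rho>:{0<..} \<inter> UNIV. \<rho> * ?Ga (\<theta> (X n) \<rho>)) \<longlonglongrightarrow> I0"
        unfolding I0_def
      proof (rule radial_integral_dominated(1)[OF s \<theta>c[OF X(1)] c0' K])
        fix \<rho> :: real assume \<rho>: "0 < \<rho>"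
        show "\<bar>?Ga (\<theta> (X n) \<rho>)\<bar> \<le> K1" "\<bar>?Ga (\<theta> (X n) \<rho>)\<bar> \<le> K2 (4 * B / w\<^sup>2) * \<rho> powr (- 2 * s)" for n
          using b1 \<theta>b2[OF X(1) \<rho>] by auto
        have "(\<lambda>n. \<theta> (X n) \<rho>) \<longlonglongrightarrow> deflection (power_law (4 * f 0 / w\<^sup>2) s) \<rho>"
          unfolding \<theta>_def
        proof (rule deflection_tendsto)
          fix r :: real assume r: "0 < r"
          have h: "(\<lambda>n. X n * \<phi> (X n powr (1 / s) * r)) \<longlonglongrightarrow> f 0 * r powr - s"
            using singular_potential_limit[OF sp _ r] s X
            unfolding tendsto_at_iff_sequentially comp_def by (auto simp: less_imp_neq[symmetric])
          have "(\<lambda>n. 4 * (X n * \<phi> (X n powr (1 / s) * r)) / w\<^sup>2) \<longlonglongrightarrow> 4 * (f 0 * r powr - s) / w\<^sup>2"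
            by (rule tendsto_divide[OF tendsto_mult_left[OF h] tendsto_const]) (use w in simp)
          then show "(\<lambda>n. \<kappa> (X n) r) \<longlonglongrightarrow> power_law (4 * f 0 / w\<^sup>2) s r"
            by (simp add: \<kappa>_def effective_potential_def power_law_def mult.assoc)
        qed (use rep\<kappa>[OF X(1)] rep0 \<rho> in auto)
        then show "(\<lambda>n. ?Ga (\<theta> (X n) \<rho>)) \<longlonglongrightarrow> ?Ga (deflection (power_law (4 * f 0 / w\<^sup>2) s) \<rho>)"
          using cG by (auto simp: continuous_on_eq_continuous_at intro: isCont_tendsto_compose)
      qed auto
      then have "(\<lambda>n. ?M * w * (LBINT \<rho>:{0<..}. \<rho> * ?Ga (\<theta> (X n) \<rho>))) \<longlonglongrightarrow> ?M * w * I0"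
        by (intro tendsto_mult_left) simp
      then show ?thesis unfolding CI[OF X(1)] .
    qed
    \<comment> \<open>A dilation by \<open>f 0 powr (1 / s)\<close> turns the power law of strength
      \<open>4 * f 0 / w\<^sup>2\<close> into that of strength \<open>4 / w\<^sup>2\<close>, and the
      area element contributes the square of this factor.\<close>
    have IJ: "I0 = f 0 powr (2 / s) * J"
    proof -
      let ?l = "f 0 powr (1 / s)"
      have l: "0 < ?l" using f0 by simp
      have "I0 = ?l\<^sup>2 * (LBINT \<rho>:{0<..}. \<rho> * ?Ga (deflection (power_law (4 * f 0 / w\<^sup>2) s) (?l * \<rho>)))"
        unfolding I0_def by (rule radial_integral_scale[OF l])
      also have "(LBINT \<rho>:{0<..}. \<rho> * ?Ga (deflection (power_law (4 * f 0 / w\<^sup>2) s) (?l * \<rho>))) = J"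
        unfolding J_def
      proof (intro set_lebesgue_integral_cong ballI allI impI)
        fix \<rho> :: real assume "\<rho> \<in> {0<..}"
        then have \<rho>: "0 < \<rho>" by simp
        have rs: "repulsive (\<lambda>r. power_law (4 * f 0 / w\<^sup>2) s (?l * r))" by (rule repulsive_scale[OF rep0(1) l])
        have "deflection (power_law (4 * f 0 / w\<^sup>2) s) (?l * \<rho>) = deflection (\<lambda>r. power_law (4 * f 0 / w\<^sup>2) s (?l * r)) \<rho>"
          by (rule deflection_scale[OF rep0(1) \<rho> l rs])
        also have "\<dots> = deflection (power_law (4 / w\<^sup>2) s) \<rho>"
        proof (rule deflection_cong[OF rs \<rho>])
          fix r :: real assume "0 < r"
          then show "power_law (4 * f 0 / w\<^sup>2) s (?l * r) = power_law (4 / w\<^sup>2) s r"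
            using scale[OF f0, of r] by (simp add: power_law_def)
        qed
        finally show "\<rho> * ?Ga (deflection (power_law (4 * f 0 / w\<^sup>2) s) (?l * \<rho>)) = \<rho> * ?Ga (deflection (power_law (4 / w\<^sup>2) s) \<rho>)"
          by simp
      qed auto
      also have "?l\<^sup>2 = f 0 powr (2 / s)" using f0 by (simp add: power2_eq_square powr_add[symmetric])
      finally show ?thesis .
    qed
    have "noncutoff_integral v2 = ?M * w * J"
      unfolding noncutoff_integral_def Let_def J_def w_def[symmetric] e0_def[symmetric]
    proof (rule tendsto_Lim[OF _ noncutoff_inner_limit[OF s ne' C(2,3) e K, unfolded collision_gain_def, folded w_def]])
      fix \<rho> :: real assume \<rho>: "0 < \<rho>"
      show "\<bar>?Ga (deflection (power_law (4 / w\<^sup>2) s) \<rho>)\<bar> \<le> K1" by (rule b1)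
      show "\<bar>?Ga (deflection (power_law (4 / w\<^sup>2) s) \<rho>)\<bar> \<le> K2 (4 / w\<^sup>2) * \<rho> powr (- 2 * s)"
        by (rule b2[OF rep0(2) \<rho>]) (auto simp: power_law_def right_diff_distrib)
    qed auto
    then have "?M * w * I0 = f 0 powr (2 / s) * noncutoff_integral v2" by (simp add: IJ)
    then show ?thesis using 1 lim unfolding w_def by auto
  qed
  moreover have "0 \<le> A" using C(1) c0 by (simp add: A_def)
  ultimately show ?thesis by blast
qed

end

text \<open>Near the origin \<open>\<Phi>\<close> behaves like \<open>f 0\<close> times the
  homogeneous potential. Impact parameters scale with the power \<open>1 / s\<close> of the strength
  and areas with \<open>2 / s\<close>; this is the origin of the factor
  \<open>f 0 powr (2 / s)\<close>, which is 1 for \<open>f 0 = 1\<close>.\<close>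

theorem theorem2p4:
  fixes s :: real and \<Phi> \<psi> :: "real ^ 3 \<Rightarrow> real" and \<phi> f :: "real \<Rightarrow> real" and v1 :: "real ^ 3"
  assumes "s > 1"
    and "singular_potential s \<Phi> \<phi> f"
    and "C3_bounded \<psi>"
  shows "((\<lambda>\<epsilon>. 1 / \<epsilon> powr (2 / s) * linearized_boltzmann (\<lambda>x. \<epsilon> * \<Phi> x) \<psi> v1)
            \<longlongrightarrow> f 0 powr (2 / s) * noncutoff_boltzmann s \<psi> v1) (at_right 0)"
proof -
  let ?CI = "collision_integral \<Phi> \<psi> v1" and ?NI = "noncutoff_integral s \<psi> v1"
  define g where "g v2 = f 0 powr (2 / s) * ?NI v2" for v2
  obtain A where A0: "0 \<le> A" and A12: "\<forall>v2. v2 \<noteq> v1 \<longrightarrow>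
    (\<forall>\<epsilon>>0. \<bar>1 / \<epsilon> powr (2 / s) * ?CI \<epsilon> v2\<bar>
        \<le> A * (maxwellian v2 * (norm (v1 - v2) + 1 / (norm (v1 - v2))\<^sup>2 + 1 / norm (v1 - v2)))) \<and>
    (\<forall>X. (\<forall>n. 0 < X n) \<longrightarrow> X \<longlonglongrightarrow> 0 \<longrightarrow>
        (\<lambda>n. 1 / X n powr (2 / s) * ?CI (X n) v2) \<longlonglongrightarrow> g v2)"
    using collision_integral_limit[OF assms, of v1] unfolding g_def[symmetric] by (elim exE conjE)
  have A: "\<bar>1 / \<epsilon> powr (2 / s) * ?CI \<epsilon> v2\<bar>
        \<le> A * (maxwellian v2 * (norm (v1 - v2) + 1 / (norm (v1 - v2))\<^sup>2 + 1 / norm (v1 - v2)))"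
    if "v2 \<noteq> v1" "0 < \<epsilon>" for v2 \<epsilon>
    using A12 that by blast
  have lim: "(\<lambda>n. 1 / X n powr (2 / s) * ?CI (X n) v2) \<longlonglongrightarrow> g v2"
    if "v2 \<noteq> v1" "\<And>n. 0 < X n" "X \<longlonglongrightarrow> 0" for v2 X
    using A12 that by blast
  obtain A' where A': "0 \<le> A'" "\<And>v2. v2 \<noteq> v1 \<Longrightarrow>
      maxwellian v2 * (norm (v1 - v2) + 1 / (norm (v1 - v2))\<^sup>2 + 1 / norm (v1 - v2)) \<le> A' * radial_weight (norm (v1 - v2))"
    using maxwellian_weight_bound[of v1] by blast
  \<comment> \<open>At \<open>v2 = v1\<close> there is no relative velocity and no scattering
    problem of the treated kind; the point is a null set.\<close>
  have ne: "AE v2 in lborel. v2 \<noteq> v1" by (rule AE_lborel_singleton)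
  have meas: "(\<lambda>v2. 1 / \<epsilon> powr (2 / s) * ?CI \<epsilon> v2) \<in> borel_measurable borel" if "0 < \<epsilon>" for \<epsilon>
    using collision_integral_measurable[OF assms that, of v1] by measurable
  \<comment> \<open>The limit integrand is itself defined through a limit in
    \<open>\<delta>\<close>; its measurability is inherited from the collision integrals along
    \<open>\<epsilon> = 1 / Suc n\<close>, with the point \<open>v1\<close> set aside.\<close>
  have gm: "g \<in> borel_measurable borel"
  proof -
    define X where "X = (\<lambda>n. 1 / real (Suc n))"
    have X: "0 < X n" "X \<longlonglongrightarrow> 0" for n
      using LIMSEQ_Suc[OF lim_1_over_n[where 'a=real]] by (simp_all add: X_def)
    have "(\<lambda>v2. indicator (- {v1}) v2 * g v2) \<in> borel_measurable borel"
    proof (rule borel_measurable_LIMSEQ_real)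
      show "(\<lambda>n. indicator (- {v1}) v2 * (1 / X n powr (2 / s) * ?CI (X n) v2)) \<longlonglongrightarrow> indicator (- {v1}) v2 * g v2" for v2
        using lim[OF _ X] by (cases "v2 = v1") auto
      show "(\<lambda>v2. indicator (- {v1}) v2 * (1 / X n powr (2 / s) * ?CI (X n) v2)) \<in> borel_measurable borel" for n
        using meas[OF X(1)] by measurable
    qed
    then have "(\<lambda>v2. if v2 = v1 then g v1 else indicator (- {v1}) v2 * g v2) \<in> borel_measurable borel"
      by measurable
    also have "(\<lambda>v2. if v2 = v1 then g v1 else indicator (- {v1}) v2 * g v2) = g" by auto
    finally show ?thesis .
  qed
  have LB: "1 / \<epsilon> powr (2 / s) * linearized_boltzmann (\<lambda>x. \<epsilon> * \<Phi> x) \<psi> v1 = (LINT v2|lborel. 1 / \<epsilon> powr (2 / s) * ?CI \<epsilon> v2)" for \<epsilon>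
    unfolding linearized_boltzmann_def collision_integral_def[OF assms] by simp
  have NB: "f 0 powr (2 / s) * noncutoff_boltzmann s \<psi> v1 = (LINT v2|lborel. g v2)"
    unfolding noncutoff_boltzmann_def g_def noncutoff_integral_def[OF assms] by simp
  show ?thesis
    unfolding LB NB tendsto_at_iff_sequentially comp_def
  proof (intro allI impI)
    fix X :: "nat \<Rightarrow> real" assume X: "\<forall>i. X i \<in> {0<..} - {0}" "X \<longlonglongrightarrow> 0"
    have Xpos: "0 < X n" for n using X(1) by auto
    show "(\<lambda>n. LINT v2|lborel. 1 / X n powr (2 / s) * ?CI (X n) v2) \<longlonglongrightarrow> (LINT v2|lborel. g v2)"
    proof (rule integral_dominated_convergence)
      show "integrable lborel (\<lambda>v2. A * (A' * radial_weight (norm (v1 - v2))))"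
        by (intro integrable_mult_right integrable_radial_weight)
      show "AE v2 in lborel. (\<lambda>n. 1 / X n powr (2 / s) * ?CI (X n) v2) \<longlonglongrightarrow> g v2"
        using ne by eventually_elim (rule lim[OF _ Xpos X(2)])
      show "AE v2 in lborel. norm (1 / X n powr (2 / s) * ?CI (X n) v2) \<le> A * (A' * radial_weight (norm (v1 - v2)))" for n
        using ne
      proof eventually_elim
        case (elim v2)
        then show ?case
          using A[OF elim Xpos[of n]] mult_left_mono[OF A'(2)[OF elim] A0] by simp
      qed
    qed (use gm meas Xpos in auto)
  qed
qed

end
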